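(* Let $\mathcal{Z}$ be a $\Bbbk$-linear abelian category and let $(Z_1,\ldots,Z_n)$ be an ordered simple collection of objects of $\mathcal{Z}$, i.e. $\dim_{\Bbbk}\operatorname{Hom}_{\mathcal{Z}}(Z_i,Z_j)=\delta_{ij}$ for all $i,j$. If $\dim_{\Bbbk}\operatorname{Ext}^1_{\mathcal{Z}}\big(\bigoplus_i Z_i,\bigoplus_i Z_i\big)$ is finite, then $\mathcal{F}(\{Z_i\})$ (with the structure functor $\operatorname{mod-}\Bbbk^{n}\to\mathcal{F}(\{Z_i\})$ sending the $i$-th simple module to $Z_i$) is an object of $\widetilde{\mathrm{Df}}_n$, and it ind-represents the non-commutative deformation functor $\mathrm{ncDef}_{(Z_1,\ldots,Z_n)}\colon \mathrm{Df}_n^{\mathrm{op}}\to\mathrm{Sets}$.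
   Context: $\Bbbk$ is an algebraically closed field; functors between $\Bbbk$-linear categories are $\Bbbk$-linear. $\operatorname{mod-}A$ is the category of finitely presented right $A$-modules. $\Bbbk^n$ is the product algebra; its $i$-th simple module is the $i$-th copy of $\Bbbk$. $\mathcal{F}(\{Z_i\})\subset\mathcal{Z}$ is the smallest (strictly) full subcategory closed under extensions and containing $Z_1,\ldots,Z_n$ (and the zero object), i.e. the full subcategory of objects admitting a finite filtration with all graded factors isomorphic to objects among the $Z_i$. A $\Bbbk$-linear abelian category is of finite length if all its $\operatorname{Hom}$ and $\operatorname{Ext}^1$ spaces are finite dimensional, it has finitely many isomorphism classes of simple objects, and every object has a finite filtration with semi-simple graded factors (semi-simple = finite direct sum of simple objects). It is Deligne finite if moreover it has a projective generator. $\mathcal{S}(\mathcal{A})$ denotes the full subcategory of semi-simple objects of $\mathcal{A}$. Category $\widetilde{\mathrm{Df}}_n$: objects are pairs $(\mathcal{A},Q_{\mathcal{A}})$ with $\mathcal{A}$ a $\Bbbk$-linear abelian category of finite length and $Q_{\mathcal{A}}\colon\operatorname{mod-}\Bbbk^{n}\to\mathcal{A}$ a fully faithful functor with essential image $\mathcal{S}(\mathcal{A})$. Morphisms $(\mathcal{A},Q_{\mathcal{A}})\to(\mathcal{B},Q_{\mathcal{B}})$ are classes of pairs $(F,\varphi)$ with $F\colon\mathcal{A}\to\mathcal{B}$ exact and $\varphi\colon F\circ Q_{\mathcal{A}}\xrightarrow{\simeq}Q_{\mathcal{B}}$, where $(F,\varphi)\sim(F',\varphi')$ if there is $\psi\colon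 F\to F'$ with $\varphi'\circ(\psi Q_{\mathcal{A}})=\varphi$. $\mathrm{Df}_n\subset\widetilde{\mathrm{Df}}_n$ is the full subcategory of pairs with $\mathcal{A}$ Deligne finite. Let $\zeta\colon\operatorname{mod-}\Bbbk^n\to\mathcal{Z}$ be the (exact) additive functor sending the $i$-th simple module to $Z_i$. The functor $\mathrm{ncDef}_{(Z_1,\ldots,Z_n)}=\mathrm{ncDef}_\zeta\colon\mathrm{Df}_n^{\mathrm{op}}\to\mathrm{Sets}$ assigns to $(\mathcal{A},Q_{\mathcal{A}})$ the set of pairs $(T,\tau)$ with $T\colon\mathcal{A}\to\mathcal{Z}$ exact and $\tau\colon T\circ Q_{\mathcal{A}}\xrightarrow{\simeq}\zeta$, modulo $(T,\tau)\sim(T',\tau')$ if there is an isomorphism $\psi\colon T\xrightarrow{\simeq}T'$ with $\tau'\circ(\psi Q_{\mathcal{A}})=\tau$. To a morphism $(F,\varphi)\colon\mathcal{A}\to\mathcal{B}$ it assigns $(T,\tau)\mapsto(T\circ F,\ \tau\circ T\varphi)$. An object $(\mathcal{C},Q_{\mathcal{C}})\in\widetilde{\mathrm{Df}}_n$ ind-represents $G\colon\mathrm{Df}_n^{\mathrm{op}}\to\mathrm{Sets}$ if $G$ is isomorphic to the restriction of $\operatorname{Hom}_{\widetilde{\mathrm{Df}}_n}(-,(\mathcal{C},Q_{\mathcal{C}}))$ to $\mathrm{Df}_n^{\mathrm{op}}$. *)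

theory Defs
  imports "HOL-Algebra.Algebraic_Closure_Type"
begin

no_notation var (\<open>X\<index>\<close>)

section \<open>Vector spaces\<close>

text \<open>
  A vector space over the field type \<open>'k\<close> is a \<^const>\<open>module\<close> over
  \<^const>\<open>ring_of_type_algebra\<close>. The fields \<^const>\<open>monoid.mult\<close> and \<^const>\<open>monoid.one\<close>
  that the record type inherits from rings carry no information.
\<close>

definition finite_dim :: "('k::field, 'v) module \<Rightarrow> bool" where
  "finite_dim V \<longleftrightarrow> (\<exists>d b. b \<in> {..<d::nat} \<rightarrow> carrier V \<and>
     (\<forall>v\<in>carrier V. \<exists>c. v = (\<Oplus>\<^bsub>V\<^esub>i\<in>{..<d}. c i \<odot>\<^bsub>V\<^esub> b i)))"

definition has_dim :: "('k::field, 'v) module \<Rightarrow> nat \<Rightarrow> bool" where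
  "has_dim V d \<longleftrightarrow> (\<exists>b. b \<in> {..<d} \<rightarrow> carrier V \<and>
     (\<forall>v\<in>carrier V. \<exists>!c. c \<in> {..<d} \<rightarrow>\<^sub>E UNIV \<and> v = (\<Oplus>\<^bsub>V\<^esub>i\<in>{..<d}. c i \<odot>\<^bsub>V\<^esub> b i)))"


section \<open>Linear and abelian categories\<close>

record ('k, 'o, 'm) lin_cat =
  Ob :: "'o set"
  Arr :: "'m set"
  Dom :: "'m \<Rightarrow> 'o"
  Cod :: "'m \<Rightarrow> 'o"
  Ide :: "'o \<Rightarrow> 'm"
  Comp :: "'m \<Rightarrow> 'm \<Rightarrow> 'm"  (infixl \<open>\<cdot>\<index>\<close> 70)
  Zer :: "'o \<Rightarrow> 'o \<Rightarrow> 'm"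
  Plus :: "'m \<Rightarrow> 'm \<Rightarrow> 'm"
  Scal :: "'k \<Rightarrow> 'm \<Rightarrow> 'm"

definition Hom :: "('k, 'o, 'm) lin_cat \<Rightarrow> 'o \<Rightarrow> 'o \<Rightarrow> 'm set" where
  "Hom C X Y = {f \<in> Arr C. Dom C f = X \<and> Cod C f = Y}"

definition hom_space :: "('k, 'o, 'm) lin_cat \<Rightarrow> 'o \<Rightarrow> 'o \<Rightarrow> ('k, 'm) module" where
  "hom_space C X Y = \<lparr>carrier = Hom C X Y, monoid.mult = undefined, monoid.one = undefined,
     ring.zero = Zer C X Y, ring.add = Plus C, module.smult = Scal C\<rparr>"

locale linear_category =
  fixes C :: "('k::field, 'o, 'm) lin_cat" (structure)
  assumes dom_cod: "f \<in> Arr C \<Longrightarrow> Dom C f \<in> Ob C \<and> Cod C f \<in> Ob C"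
    and ide_hom: "X \<in> Ob C \<Longrightarrow> Ide C X \<in> Hom C X X"
    and comp_hom: "\<lbrakk>f \<in> Hom C X Y; g \<in> Hom C Y Z\<rbrakk> \<Longrightarrow> g \<cdot> f \<in> Hom C X Z"
    and comp_assoc: "\<lbrakk>f \<in> Hom C X Y; g \<in> Hom C Y Z; h \<in> Hom C Z W\<rbrakk> \<Longrightarrow> h \<cdot> (g \<cdot> f) = (h \<cdot> g) \<cdot> f"
    and comp_ide_right: "f \<in> Hom C X Y \<Longrightarrow> f \<cdot> Ide C X = f"
    and comp_ide_left: "f \<in> Hom C X Y \<Longrightarrow> Ide C Y \<cdot> f = f"
    and hom_vector_space:
      "\<lbrakk>X \<in> Ob C; Y \<in> Ob C\<rbrakk> \<Longrightarrow> module (ring_of_type_algebra :: 'k ring) (hom_space C X Y)"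
    and comp_plus_right: "\<lbrakk>f \<in> Hom C X Y; f' \<in> Hom C X Y; g \<in> Hom C Y Z\<rbrakk> \<Longrightarrow>
      g \<cdot> Plus C f f' = Plus C (g \<cdot> f) (g \<cdot> f')"
    and comp_plus_left: "\<lbrakk>f \<in> Hom C X Y; g \<in> Hom C Y Z; g' \<in> Hom C Y Z\<rbrakk> \<Longrightarrow>
      Plus C g g' \<cdot> f = Plus C (g \<cdot> f) (g' \<cdot> f)"
    and comp_scal_right: "\<lbrakk>f \<in> Hom C X Y; g \<in> Hom C Y Z\<rbrakk> \<Longrightarrow> g \<cdot> Scal C c f = Scal C c (g \<cdot> f)"
    and comp_scal_left: "\<lbrakk>f \<in> Hom C X Y; g \<in> Hom C Y Z\<rbrakk> \<Longrightarrow> Scal C c g \<cdot> f = Scal C c (g \<cdot> f)"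

definition is_iso :: "('k, 'o, 'm) lin_cat \<Rightarrow> 'm \<Rightarrow> bool" where
  "is_iso C f \<longleftrightarrow> f \<in> Arr C \<and> (\<exists>g \<in> Hom C (Cod C f) (Dom C f).
     g \<cdot>\<^bsub>C\<^esub> f = Ide C (Dom C f) \<and> f \<cdot>\<^bsub>C\<^esub> g = Ide C (Cod C f))"

definition isomorphic :: "('k, 'o, 'm) lin_cat \<Rightarrow> 'o \<Rightarrow> 'o \<Rightarrow> bool" where
  "isomorphic C X Y \<longleftrightarrow> (\<exists>f \<in> Hom C X Y. is_iso C f)"

definition is_mono :: "('k, 'o, 'm) lin_cat \<Rightarrow> 'm \<Rightarrow> bool" where
  "is_mono C f \<longleftrightarrow> f \<in> Arr C \<and> (\<forall>W\<in>Ob C. \<forall>g \<in> Hom C W (Dom C f). \<forall>h \<in> Hom C W (Dom C f).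
     f \<cdot>\<^bsub>C\<^esub> g = f \<cdot>\<^bsub>C\<^esub> h \<longrightarrow> g = h)"

definition is_epi :: "('k, 'o, 'm) lin_cat \<Rightarrow> 'm \<Rightarrow> bool" where
  "is_epi C f \<longleftrightarrow> f \<in> Arr C \<and> (\<forall>W\<in>Ob C. \<forall>g \<in> Hom C (Cod C f) W. \<forall>h \<in> Hom C (Cod C f) W.
     g \<cdot>\<^bsub>C\<^esub> f = h \<cdot>\<^bsub>C\<^esub> f \<longrightarrow> g = h)"

definition is_zero_ob :: "('k, 'o, 'm) lin_cat \<Rightarrow> 'o \<Rightarrow> bool" where
  "is_zero_ob C X \<longleftrightarrow> X \<in> Ob C \<and>
     (\<forall>Y\<in>Ob C. (\<exists>!f. f \<in> Hom C X Y) \<and> (\<exists>!f. f \<in> Hom C Y X))"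

definition is_kernel :: "('k, 'o, 'm) lin_cat \<Rightarrow> 'm \<Rightarrow> 'm \<Rightarrow> bool" where
  "is_kernel C f k \<longleftrightarrow> f \<in> Arr C \<and> k \<in> Arr C \<and> Cod C k = Dom C f \<and>
     f \<cdot>\<^bsub>C\<^esub> k = Zer C (Dom C k) (Cod C f) \<and>
     (\<forall>W\<in>Ob C. \<forall>g \<in> Hom C W (Dom C f). f \<cdot>\<^bsub>C\<^esub> g = Zer C W (Cod C f) \<longrightarrow>
       (\<exists>!h. h \<in> Hom C W (Dom C k) \<and> k \<cdot>\<^bsub>C\<^esub> h = g))"

definition is_cokernel :: "('k, 'o, 'm) lin_cat \<Rightarrow> 'm \<Rightarrow> 'm \<Rightarrow> bool" where
  "is_cokernel C f q \<longleftrightarrow> f \<in> Arr C \<and> q \<in> Arr C \<and> Dom C q = Cod C f \<and>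
     q \<cdot>\<^bsub>C\<^esub> f = Zer C (Dom C f) (Cod C q) \<and>
     (\<forall>W\<in>Ob C. \<forall>g \<in> Hom C (Cod C f) W. g \<cdot>\<^bsub>C\<^esub> f = Zer C (Dom C f) W \<longrightarrow>
       (\<exists>!h. h \<in> Hom C (Cod C q) W \<and> h \<cdot>\<^bsub>C\<^esub> q = g))"

text \<open>\<open>S\<close> is the biproduct of \<open>A\<close> and \<open>B\<close> with inclusions \<open>i\<close>, \<open>j\<close> and projections \<open>p\<close>, \<open>q\<close>.\<close>

definition is_biproduct ::
  "('k, 'o, 'm) lin_cat \<Rightarrow> 'o \<Rightarrow> 'o \<Rightarrow> 'o \<Rightarrow> 'm \<Rightarrow> 'm \<Rightarrow> 'm \<Rightarrow> 'm \<Rightarrow> bool" where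
  "is_biproduct C A B S i j p q \<longleftrightarrow> S \<in> Ob C \<and>
     i \<in> Hom C A S \<and> j \<in> Hom C B S \<and> p \<in> Hom C S A \<and> q \<in> Hom C S B \<and>
     p \<cdot>\<^bsub>C\<^esub> i = Ide C A \<and> q \<cdot>\<^bsub>C\<^esub> j = Ide C B \<and> p \<cdot>\<^bsub>C\<^esub> j = Zer C B A \<and> q \<cdot>\<^bsub>C\<^esub> i = Zer C A B \<and>
     Plus C (i \<cdot>\<^bsub>C\<^esub> p) (j \<cdot>\<^bsub>C\<^esub> q) = Ide C S"

definition is_direct_sum :: "('k, 'o, 'm) lin_cat \<Rightarrow> nat \<Rightarrow> (nat \<Rightarrow> 'o) \<Rightarrow> 'o \<Rightarrow> bool" where
  "is_direct_sum C d X S \<longleftrightarrow> S \<in> Ob C \<and> (\<forall>i<d. X i \<in> Ob C) \<and>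
     (\<exists>\<iota> \<pi>. (\<forall>i<d. \<iota> i \<in> Hom C (X i) S \<and> \<pi> i \<in> Hom C S (X i)) \<and>
       (\<forall>i<d. \<forall>j<d. \<pi> i \<cdot>\<^bsub>C\<^esub> \<iota> j = (if i = j then Ide C (X i) else Zer C (X j) (X i))) \<and>
       (\<Oplus>\<^bsub>hom_space C S S\<^esub>i\<in>{..<d}. \<iota> i \<cdot>\<^bsub>C\<^esub> \<pi> i) = Ide C S)"

locale abelian_category = linear_category C for C :: "('k::field, 'o, 'm) lin_cat" (structure) +
  assumes zero_ob: "\<exists>X. is_zero_ob C X"
    and biproducts: "\<lbrakk>A \<in> Ob C; B \<in> Ob C\<rbrakk> \<Longrightarrow> \<exists>S i j p q. is_biproduct C A B S i j p q"
    and kernels: "f \<in> Arr C \<Longrightarrow> \<exists>k. is_kernel C f k"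
    and cokernels: "f \<in> Arr C \<Longrightarrow> \<exists>q. is_cokernel C f q"
    and mono_normal: "is_mono C m \<Longrightarrow> \<exists>f. is_kernel C f m"
    and epi_normal: "is_epi C e \<Longrightarrow> \<exists>f. is_cokernel C f e"

text \<open>The sequence \<open>0 \<rightarrow> Dom i \<rightarrow> Cod i = Dom p \<rightarrow> Cod p \<rightarrow> 0\<close> is exact.\<close>

definition short_exact :: "('k, 'o, 'm) lin_cat \<Rightarrow> 'm \<Rightarrow> 'm \<Rightarrow> bool" where
  "short_exact C i p \<longleftrightarrow> is_kernel C p i \<and> is_cokernel C i p"


section \<open>The first Yoneda Ext group\<close>

text \<open>An extension \<open>0 \<rightarrow> Y \<rightarrow> E \<rightarrow> X \<rightarrow> 0\<close> is stored as its pair of arrows.\<close>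

definition extensions :: "('k, 'o, 'm) lin_cat \<Rightarrow> 'o \<Rightarrow> 'o \<Rightarrow> ('m \<times> 'm) set" where
  "extensions C X Y = {(i, p). short_exact C i p \<and> Dom C i = Y \<and> Cod C p = X}"

definition ext_morphism ::
  "('k, 'o, 'm) lin_cat \<Rightarrow> 'm \<times> 'm \<Rightarrow> 'm \<times> 'm \<Rightarrow> 'm \<Rightarrow> 'm \<Rightarrow> bool" where
  "ext_morphism C = (\<lambda>(i, p) (i', p') a b.
     a \<in> Hom C (Dom C i) (Dom C i') \<and> b \<in> Hom C (Cod C p) (Cod C p') \<and>
     (\<exists>m \<in> Hom C (Cod C i) (Cod C i'). m \<cdot>\<^bsub>C\<^esub> i = i' \<cdot>\<^bsub>C\<^esub> a \<and> p' \<cdot>\<^bsub>C\<^esub> m = b \<cdot>\<^bsub>C\<^esub> p))"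

definition ext_equiv ::
  "('k, 'o, 'm) lin_cat \<Rightarrow> 'o \<Rightarrow> 'o \<Rightarrow> (('m \<times> 'm) \<times> ('m \<times> 'm)) set" where
  "ext_equiv C X Y = {(e, e'). e \<in> extensions C X Y \<and> e' \<in> extensions C X Y \<and>
     ext_morphism C e e' (Ide C Y) (Ide C X)}"

text \<open>
  \<open>e\<close> is a Baer sum of \<open>e\<^sub>1\<close> and \<open>e\<^sub>2\<close>: the direct sum extension of \<open>X \<oplus> X\<close> by \<open>Y \<oplus> Y\<close> is
  pushed out along the codiagonal of \<open>Y\<close> to \<open>e'\<close>, which is pulled back along the diagonal of \<open>X\<close>.
  A pushout (pullback) is recognised by a morphism of extensions which is the identity on the
  other end.
\<close>

definition baer_sum ::
  "('k, 'o, 'm) lin_cat \<Rightarrow> 'o \<Rightarrow> 'o \<Rightarrow> 'm \<times> 'm \<Rightarrow> 'm \<times> 'm \<Rightarrow> 'm \<times> 'm \<Rightarrow> bool" where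
  "baer_sum C X Y = (\<lambda>(i\<^sub>1, p\<^sub>1) (i\<^sub>2, p\<^sub>2) e. e \<in> extensions C X Y \<and>
     (\<exists>YY s\<^sub>1 s\<^sub>2 r\<^sub>1 r\<^sub>2 XX t\<^sub>1 t\<^sub>2 q\<^sub>1 q\<^sub>2 EE u\<^sub>1 u\<^sub>2 v\<^sub>1 v\<^sub>2.
        is_biproduct C Y Y YY s\<^sub>1 s\<^sub>2 r\<^sub>1 r\<^sub>2 \<and>
        is_biproduct C X X XX t\<^sub>1 t\<^sub>2 q\<^sub>1 q\<^sub>2 \<and>
        is_biproduct C (Cod C i\<^sub>1) (Cod C i\<^sub>2) EE u\<^sub>1 u\<^sub>2 v\<^sub>1 v\<^sub>2 \<and>
        (\<exists>e' \<in> extensions C XX Y.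
           ext_morphism C
             (Plus C (u\<^sub>1 \<cdot>\<^bsub>C\<^esub> i\<^sub>1 \<cdot>\<^bsub>C\<^esub> r\<^sub>1) (u\<^sub>2 \<cdot>\<^bsub>C\<^esub> i\<^sub>2 \<cdot>\<^bsub>C\<^esub> r\<^sub>2), Plus C (t\<^sub>1 \<cdot>\<^bsub>C\<^esub> p\<^sub>1 \<cdot>\<^bsub>C\<^esub> v\<^sub>1) (t\<^sub>2 \<cdot>\<^bsub>C\<^esub> p\<^sub>2 \<cdot>\<^bsub>C\<^esub> v\<^sub>2))
             e' (Plus C r\<^sub>1 r\<^sub>2) (Ide C XX) \<and>
           ext_morphism C e e' (Ide C Y) (Plus C t\<^sub>1 t\<^sub>2))))"

definition Ext1 :: "('k, 'o, 'm) lin_cat \<Rightarrow> 'o \<Rightarrow> 'o \<Rightarrow> ('k, ('m \<times> 'm) set) module" where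
  "Ext1 C X Y = \<lparr>carrier = extensions C X Y // ext_equiv C X Y,
     monoid.mult = undefined, monoid.one = undefined,
     ring.zero = {(i, p). (i, p) \<in> extensions C X Y \<and> (\<exists>s \<in> Hom C X (Dom C p). p \<cdot>\<^bsub>C\<^esub> s = Ide C X)},
     ring.add = (\<lambda>A B. {e. \<exists>a\<in>A. \<exists>b\<in>B. baer_sum C X Y a b e}),
     module.smult = (\<lambda>c A. {e \<in> extensions C X Y. \<exists>a\<in>A. ext_morphism C a e (Scal C c (Ide C Y)) (Ide C X)})\<rparr>"


section \<open>Finite length and Deligne finite categories\<close>

definition is_simple :: "('k, 'o, 'm) lin_cat \<Rightarrow> 'o \<Rightarrow> bool" where
  "is_simple C X \<longleftrightarrow> X \<in> Ob C \<and> \<not> is_zero_ob C X \<and>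
     (\<forall>m. is_mono C m \<and> Cod C m = X \<longrightarrow> is_zero_ob C (Dom C m) \<or> is_iso C m)"

definition is_semisimple :: "('k, 'o, 'm) lin_cat \<Rightarrow> 'o \<Rightarrow> bool" where
  "is_semisimple C X \<longleftrightarrow> (\<exists>d S. (\<forall>i<d. is_simple C (S i)) \<and> is_direct_sum C d S X)"

text \<open>The filtration is \<open>0 = F 0 \<subseteq> \<dots> \<subseteq> F d = X\<close> with inclusions \<open>j i\<close> and quotient maps \<open>p i\<close>.\<close>

definition has_semisimple_filtration :: "('k, 'o, 'm) lin_cat \<Rightarrow> 'o \<Rightarrow> bool" where
  "has_semisimple_filtration C X \<longleftrightarrow> (\<exists>(d::nat) F j p.
     is_zero_ob C (F 0) \<and> F d = X \<and>
     (\<forall>i<d. j i \<in> Hom C (F i) (F (Suc i)) \<and> short_exact C (j i) (p i) \<and>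
       is_semisimple C (Cod C (p i))))"

locale finite_length_category = abelian_category C
  for C :: "('k::field, 'o, 'm) lin_cat" (structure) +
  assumes hom_finite: "\<lbrakk>X \<in> Ob C; Y \<in> Ob C\<rbrakk> \<Longrightarrow> finite_dim (hom_space C X Y)"
    and ext_finite: "\<lbrakk>X \<in> Ob C; Y \<in> Ob C\<rbrakk> \<Longrightarrow> finite_dim (Ext1 C X Y)"
    and finitely_many_simples:
      "finite ({X. is_simple C X} // {(X, Y). is_simple C X \<and> is_simple C Y \<and> isomorphic C X Y})"
    and semisimple_filtration: "X \<in> Ob C \<Longrightarrow> has_semisimple_filtration C X"

definition is_projective :: "('k, 'o, 'm) lin_cat \<Rightarrow> 'o \<Rightarrow> bool" where
  "is_projective C P \<longleftrightarrow> P \<in> Ob C \<and>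
     (\<forall>e. is_epi C e \<longrightarrow> (\<forall>f \<in> Hom C P (Cod C e). \<exists>g \<in> Hom C P (Dom C e). e \<cdot>\<^bsub>C\<^esub> g = f))"

definition is_generator :: "('k, 'o, 'm) lin_cat \<Rightarrow> 'o \<Rightarrow> bool" where
  "is_generator C P \<longleftrightarrow> P \<in> Ob C \<and>
     (\<forall>X\<in>Ob C. \<forall>Y\<in>Ob C. \<forall>f \<in> Hom C X Y. \<forall>g \<in> Hom C X Y.
        (\<forall>h \<in> Hom C P X. f \<cdot>\<^bsub>C\<^esub> h = g \<cdot>\<^bsub>C\<^esub> h) \<longrightarrow> f = g)"

locale deligne_finite_category = finite_length_category C
  for C :: "('k::field, 'o, 'm) lin_cat" (structure) +
  assumes projective_generator: "\<exists>P. is_projective C P \<and> is_generator C P"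


section \<open>Functors and natural transformations\<close>

record ('o, 'm, 'p, 'q) functr =
  on_ob :: "'o \<Rightarrow> 'p"
  on_arr :: "'m \<Rightarrow> 'q"

locale linear_functor = A: linear_category A + B: linear_category B
  for A :: "('k::field, 'o, 'm) lin_cat" and B :: "('k, 'p, 'q) lin_cat"
    and F :: "('o, 'm, 'p, 'q) functr" +
  assumes on_ob: "X \<in> Ob A \<Longrightarrow> on_ob F X \<in> Ob B"
    and on_arr: "f \<in> Hom A X Y \<Longrightarrow> on_arr F f \<in> Hom B (on_ob F X) (on_ob F Y)"
    and on_ide: "X \<in> Ob A \<Longrightarrow> on_arr F (Ide A X) = Ide B (on_ob F X)"
    and on_comp: "\<lbrakk>f \<in> Hom A X Y; g \<in> Hom A Y Z\<rbrakk> \<Longrightarrow>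
      on_arr F (g \<cdot>\<^bsub>A\<^esub> f) = on_arr F g \<cdot>\<^bsub>B\<^esub> on_arr F f"
    and on_plus: "\<lbrakk>f \<in> Hom A X Y; g \<in> Hom A X Y\<rbrakk> \<Longrightarrow>
      on_arr F (Plus A f g) = Plus B (on_arr F f) (on_arr F g)"
    and on_scal: "f \<in> Hom A X Y \<Longrightarrow> on_arr F (Scal A c f) = Scal B c (on_arr F f)"

locale exact_functor = linear_functor A B F
  for A :: "('k::field, 'o, 'm) lin_cat" and B :: "('k, 'p, 'q) lin_cat"
    and F :: "('o, 'm, 'p, 'q) functr" +
  assumes exact: "short_exact A i p \<Longrightarrow> short_exact B (on_arr F i) (on_arr F p)"

definition fully_faithful ::
  "('k, 'o, 'm) lin_cat \<Rightarrow> ('k, 'p, 'q) lin_cat \<Rightarrow> ('o, 'm, 'p, 'q) functr \<Rightarrow> bool" where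
  "fully_faithful A B F \<longleftrightarrow> (\<forall>X\<in>Ob A. \<forall>Y\<in>Ob A.
     bij_betw (on_arr F) (Hom A X Y) (Hom B (on_ob F X) (on_ob F Y)))"

definition functor_comp ::
  "('p, 'q, 'r, 's) functr \<Rightarrow> ('o, 'm, 'p, 'q) functr \<Rightarrow> ('o, 'm, 'r, 's) functr" where
  "functor_comp G F = \<lparr>on_ob = on_ob G \<circ> on_ob F, on_arr = on_arr G \<circ> on_arr F\<rparr>"

definition nat_trans ::
  "('k, 'o, 'm) lin_cat \<Rightarrow> ('k, 'p, 'q) lin_cat \<Rightarrow> ('o, 'm, 'p, 'q) functr \<Rightarrow>
   ('o, 'm, 'p, 'q) functr \<Rightarrow> ('o \<Rightarrow> 'q) \<Rightarrow> bool" where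
  "nat_trans A B F G \<psi> \<longleftrightarrow>
     (\<forall>X\<in>Ob A. \<psi> X \<in> Hom B (on_ob F X) (on_ob G X)) \<and>
     (\<forall>X\<in>Ob A. \<forall>Y\<in>Ob A. \<forall>f \<in> Hom A X Y. on_arr G f \<cdot>\<^bsub>B\<^esub> \<psi> X = \<psi> Y \<cdot>\<^bsub>B\<^esub> on_arr F f)"

definition nat_iso ::
  "('k, 'o, 'm) lin_cat \<Rightarrow> ('k, 'p, 'q) lin_cat \<Rightarrow> ('o, 'm, 'p, 'q) functr \<Rightarrow>
   ('o, 'm, 'p, 'q) functr \<Rightarrow> ('o \<Rightarrow> 'q) \<Rightarrow> bool" where
  "nat_iso A B F G \<psi> \<longleftrightarrow> nat_trans A B F G \<psi> \<and> (\<forall>X\<in>Ob A. is_iso B (\<psi> X))"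


section \<open>Finitely presented modules over the product algebra\<close>

definition prod_alg :: "nat \<Rightarrow> (nat \<Rightarrow> 'k::field) ring" where
  "prod_alg n = \<lparr>carrier = {..<n} \<rightarrow>\<^sub>E UNIV,
     monoid.mult = (\<lambda>f g. \<lambda>i\<in>{..<n}. f i * g i), monoid.one = (\<lambda>i\<in>{..<n}. 1),
     ring.zero = (\<lambda>i\<in>{..<n}. 0), ring.add = (\<lambda>f g. \<lambda>i\<in>{..<n}. f i + g i)\<rparr>"

text \<open>Generators \<open>g j\<close> for \<open>j < q\<close> whose module of relations is generated by \<open>r i\<close> for \<open>i < p\<close>.\<close>

definition finitely_presented :: "('r, 'x) ring_scheme \<Rightarrow> ('r, 'v) module \<Rightarrow> bool" where
  "finitely_presented R M \<longleftrightarrow> (\<exists>(q::nat) g (p::nat) r.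
     g \<in> {..<q} \<rightarrow> carrier M \<and>
     (\<forall>m\<in>carrier M. \<exists>a \<in> {..<q} \<rightarrow> carrier R. m = (\<Oplus>\<^bsub>M\<^esub>j\<in>{..<q}. a j \<odot>\<^bsub>M\<^esub> g j)) \<and>
     (\<forall>i<p. r i \<in> {..<q} \<rightarrow> carrier R \<and> (\<Oplus>\<^bsub>M\<^esub>j\<in>{..<q}. r i j \<odot>\<^bsub>M\<^esub> g j) = \<zero>\<^bsub>M\<^esub>) \<and>
     (\<forall>a \<in> {..<q} \<rightarrow> carrier R. (\<Oplus>\<^bsub>M\<^esub>j\<in>{..<q}. a j \<odot>\<^bsub>M\<^esub> g j) = \<zero>\<^bsub>M\<^esub> \<longrightarrow>
        (\<exists>b \<in> {..<p} \<rightarrow> carrier R. \<forall>j<q. a j = (\<Oplus>\<^bsub>R\<^esub>i\<in>{..<p}. b i \<otimes>\<^bsub>R\<^esub> r i j))))"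

text \<open>
  The algebra is commutative, so that right modules are modules in the sense of
  \<^locale>\<open>module\<close>. Their carriers are subsets of \<open>nat \<Rightarrow> 'k\<close>, which has room for a copy of every
  finitely presented module. An arrow is a triple of source, underlying map (extensional on the
  carrier of the source) and target.
\<close>

type_synonym 'k pmod = "(nat \<Rightarrow> 'k, nat \<Rightarrow> 'k) module"
type_synonym 'k parr = "'k pmod \<times> ((nat \<Rightarrow> 'k) \<Rightarrow> (nat \<Rightarrow> 'k)) \<times> 'k pmod"

definition module_maps :: "('r, 'x) ring_scheme \<Rightarrow> ('r, 'v) module \<Rightarrow> ('r, 'w) module \<Rightarrow> ('v \<Rightarrow> 'w) set" where
  "module_maps R M N = {f \<in> carrier M \<rightarrow>\<^sub>E carrier N.
     (\<forall>x\<in>carrier M. \<forall>y\<in>carrier M. f (x \<oplus>\<^bsub>M\<^esub> y) = f x \<oplus>\<^bsub>N\<^esub> f y) \<and>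
     (\<forall>a\<in>carrier R. \<forall>x\<in>carrier M. f (a \<odot>\<^bsub>M\<^esub> x) = a \<odot>\<^bsub>N\<^esub> f x)}"

definition fp_modules :: "nat \<Rightarrow> 'k::field pmod set" where
  "fp_modules n = {M. module (prod_alg n) M \<and> finitely_presented (prod_alg n) M}"

definition mod_prod :: "nat \<Rightarrow> ('k::field, 'k pmod, 'k parr) lin_cat" where
  "mod_prod n = \<lparr>
     Ob = fp_modules n,
     Arr = {(M, f, N). M \<in> fp_modules n \<and> N \<in> fp_modules n \<and> f \<in> module_maps (prod_alg n) M N},
     Dom = (\<lambda>(M, f, N). M),
     Cod = (\<lambda>(M, f, N). N),
     Ide = (\<lambda>M. (M, \<lambda>x\<in>carrier M. x, M)),
     Comp = (\<lambda>(M', g, N') (M, f, N). (M, \<lambda>x\<in>carrier M. g (f x), N')),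
     Zer = (\<lambda>M N. (M, \<lambda>x\<in>carrier M. \<zero>\<^bsub>N\<^esub>, N)),
     Plus = (\<lambda>(M, f, N) (M', g, N'). (M, \<lambda>x\<in>carrier M. f x \<oplus>\<^bsub>N\<^esub> g x, N)),
     Scal = (\<lambda>c (M, f, N). (M, \<lambda>x\<in>carrier M. (\<lambda>i\<in>{..<n}. c) \<odot>\<^bsub>N\<^esub> f x, N))\<rparr>"

text \<open>The \<open>i\<close>-th copy of the field inside the regular module.\<close>

definition simple_mod :: "nat \<Rightarrow> nat \<Rightarrow> 'k::field pmod" where
  "simple_mod n i = \<lparr>carrier = {v \<in> carrier (prod_alg n). \<forall>j<n. j \<noteq> i \<longrightarrow> v j = 0},
     monoid.mult = monoid.mult (prod_alg n), monoid.one = monoid.one (prod_alg n),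
     ring.zero = ring.zero (prod_alg n), ring.add = ring.add (prod_alg n), module.smult = monoid.mult (prod_alg n)\<rparr>"


section \<open>The categories of pairs\<close>

type_synonym ('k, 'o, 'm) df = "('k, 'o, 'm) lin_cat \<times> ('k pmod, 'k parr, 'o, 'm) functr"

definition df_tilde :: "nat \<Rightarrow> ('k::field, 'o, 'm) df set" where
  "df_tilde n = {(A, Q). finite_length_category A \<and> linear_functor (mod_prod n) A Q \<and>
     fully_faithful (mod_prod n) A Q \<and>
     (\<forall>X\<in>Ob A. is_semisimple A X \<longleftrightarrow> (\<exists>M \<in> Ob (mod_prod n). isomorphic A (on_ob Q M) X))}"

definition df :: "nat \<Rightarrow> ('k::field, 'o, 'm) df set" where
  "df n = {(A, Q) \<in> df_tilde n. deligne_finite_category A}"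

text \<open>Exact functors \<open>T\<close> from \<open>A\<close> to \<open>B\<close> with an isomorphism from \<open>T Q\<close> to a given functor \<open>\<xi>\<close>.\<close>

definition framed_functors ::
  "nat \<Rightarrow> ('k::field, 'o, 'm) df \<Rightarrow> ('k, 'p, 'q) lin_cat \<Rightarrow> ('k pmod, 'k parr, 'p, 'q) functr \<Rightarrow>
   (('o, 'm, 'p, 'q) functr \<times> ('k pmod \<Rightarrow> 'q)) set" where
  "framed_functors n = (\<lambda>(A, Q) B \<xi>.
     {(T, \<tau>). exact_functor A B T \<and> nat_iso (mod_prod n) B (functor_comp T Q) \<xi> \<tau>})"

text \<open>In this relation \<open>\<psi>\<close> is only required to be a natural transformation.\<close>

definition df_equiv ::
  "nat \<Rightarrow> ('k::field, 'o, 'm) df \<Rightarrow> ('k, 'p, 'q) df \<Rightarrow>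
   ((('o, 'm, 'p, 'q) functr \<times> ('k pmod \<Rightarrow> 'q)) \<times> (('o, 'm, 'p, 'q) functr \<times> ('k pmod \<Rightarrow> 'q))) set" where
  "df_equiv n = (\<lambda>(A, Q) (B, Q').
     {((F, \<phi>), (F', \<phi>')). (F, \<phi>) \<in> framed_functors n (A, Q) B Q' \<and>
        (F', \<phi>') \<in> framed_functors n (A, Q) B Q' \<and>
        (\<exists>\<psi>. nat_trans A B F F' \<psi> \<and>
           (\<forall>M \<in> Ob (mod_prod n). \<phi>' M \<cdot>\<^bsub>B\<^esub> \<psi> (on_ob Q M) = \<phi> M))})"

definition df_hom ::
  "nat \<Rightarrow> ('k::field, 'o, 'm) df \<Rightarrow> ('k, 'p, 'q) df \<Rightarrow>
   (('o, 'm, 'p, 'q) functr \<times> ('k pmod \<Rightarrow> 'q)) set set" where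
  "df_hom n X Y = framed_functors n X (fst Y) (snd Y) // df_equiv n X Y"

text \<open>
  The composite of \<open>(F, \<phi>)\<close> followed by \<open>(T, \<tau>)\<close>; the latter lives over a category with
  composition \<open>C\<close>.
\<close>

definition framed_comp ::
  "('k, 'r, 's) lin_cat \<Rightarrow> ('p, 'q, 'r, 's) functr \<times> ('k pmod \<Rightarrow> 's) \<Rightarrow>
   ('o, 'm, 'p, 'q) functr \<times> ('k pmod \<Rightarrow> 'q) \<Rightarrow> ('o, 'm, 'r, 's) functr \<times> ('k pmod \<Rightarrow> 's)" where
  "framed_comp C = (\<lambda>(T, \<tau>) (F, \<phi>). (functor_comp T F, \<lambda>M. \<tau> M \<cdot>\<^bsub>C\<^esub> on_arr T (\<phi> M)))"

text \<open>The composite of classes is the class of the composites of representatives.\<close>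

definition df_comp ::
  "nat \<Rightarrow> ('k::field, 'o, 'm) df \<Rightarrow> ('k, 'r, 's) df \<Rightarrow>
   (('p, 'q, 'r, 's) functr \<times> ('k pmod \<Rightarrow> 's)) set \<Rightarrow>
   (('o, 'm, 'p, 'q) functr \<times> ('k pmod \<Rightarrow> 'q)) set \<Rightarrow>
   (('o, 'm, 'r, 's) functr \<times> ('k pmod \<Rightarrow> 's)) set" where
  "df_comp n X Z h f = df_equiv n X Z `` {framed_comp (fst Z) t u |t u. t \<in> h \<and> u \<in> f}"


section \<open>Set-valued functors and ind-representability\<close>

text \<open>
  A contravariant set-valued functor on \<^const>\<open>df\<close>, given by its values and by the maps
  \<open>restrict_along X Y f\<close> from the value at \<open>Y\<close> to the value at \<open>X\<close> for \<open>f\<close> in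
  \<open>df_hom n X Y\<close>. The type variables \<open>'o\<close> and \<open>'m\<close> play the role of the universe in which
  the objects of \<^const>\<open>df\<close> live.
\<close>

record ('k, 'o, 'm, 'v) df_presheaf =
  value_at :: "('k, 'o, 'm) df \<Rightarrow> 'v set"
  restrict_along :: "('k, 'o, 'm) df \<Rightarrow> ('k, 'o, 'm) df \<Rightarrow>
     (('o, 'm, 'o, 'm) functr \<times> ('k pmod \<Rightarrow> 'm)) set \<Rightarrow> 'v \<Rightarrow> 'v"

definition presheaf_iso ::
  "nat \<Rightarrow> ('k::field, 'o, 'm, 'v) df_presheaf \<Rightarrow> ('k, 'o, 'm, 'w) df_presheaf \<Rightarrow>
   (('k, 'o, 'm) df \<Rightarrow> 'v \<Rightarrow> 'w) \<Rightarrow> bool" where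
  "presheaf_iso n P G \<eta> \<longleftrightarrow>
     (\<forall>X \<in> df n. bij_betw (\<eta> X) (value_at P X) (value_at G X)) \<and>
     (\<forall>X \<in> df n. \<forall>Y \<in> df n. \<forall>f \<in> df_hom n X Y. \<forall>h \<in> value_at P Y.
        \<eta> X (restrict_along P X Y f h) = restrict_along G X Y f (\<eta> Y h))"

definition hom_presheaf ::
  "nat \<Rightarrow> ('k::field, 'p, 'q) df \<Rightarrow>
   ('k, 'o, 'm, (('o, 'm, 'p, 'q) functr \<times> ('k pmod \<Rightarrow> 'q)) set) df_presheaf" where
  "hom_presheaf n C = \<lparr>value_at = (\<lambda>X. df_hom n X C),
     restrict_along = (\<lambda>X Y f h. df_comp n X C h f)\<rparr>"

definition ind_represents ::
  "nat \<Rightarrow> ('k::field, 'p, 'q) df \<Rightarrow> ('k, 'o, 'm, 'v) df_presheaf \<Rightarrow> bool" where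
  "ind_represents n C G \<longleftrightarrow> C \<in> df_tilde n \<and> (\<exists>\<eta>. presheaf_iso n (hom_presheaf n C) G \<eta>)"


section \<open>Non-commutative deformations\<close>

definition ncdef_equiv ::
  "nat \<Rightarrow> ('k::field, 'p, 'q) lin_cat \<Rightarrow> ('k pmod, 'k parr, 'p, 'q) functr \<Rightarrow> ('k, 'o, 'm) df \<Rightarrow>
   ((('o, 'm, 'p, 'q) functr \<times> ('k pmod \<Rightarrow> 'q)) \<times> (('o, 'm, 'p, 'q) functr \<times> ('k pmod \<Rightarrow> 'q))) set" where
  "ncdef_equiv n Z \<zeta> = (\<lambda>(A, Q).
     {((T, \<tau>), (T', \<tau>')). (T, \<tau>) \<in> framed_functors n (A, Q) Z \<zeta> \<and>
        (T', \<tau>') \<in> framed_functors n (A, Q) Z \<zeta> \<and>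
        (\<exists>\<psi>. nat_iso A Z T T' \<psi> \<and>
           (\<forall>M \<in> Ob (mod_prod n). \<tau>' M \<cdot>\<^bsub>Z\<^esub> \<psi> (on_ob Q M) = \<tau> M))})"

definition ncDef ::
  "nat \<Rightarrow> ('k::field, 'p, 'q) lin_cat \<Rightarrow> ('k pmod, 'k parr, 'p, 'q) functr \<Rightarrow>
   ('k, 'o, 'm, (('o, 'm, 'p, 'q) functr \<times> ('k pmod \<Rightarrow> 'q)) set) df_presheaf" where
  "ncDef n Z \<zeta> = \<lparr>
     value_at = (\<lambda>X. framed_functors n X Z \<zeta> // ncdef_equiv n Z \<zeta> X),
     restrict_along = (\<lambda>X Y f h. ncdef_equiv n Z \<zeta> X `` {framed_comp Z t u |t u. t \<in> h \<and> u \<in> f})\<rparr>"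

text \<open>
  The modules over the product algebra are semisimple, so that two functors satisfying the
  following predicate are always isomorphic.
\<close>

definition sends_simples_to ::
  "nat \<Rightarrow> ('k::field, 'p, 'q) lin_cat \<Rightarrow> (nat \<Rightarrow> 'p) \<Rightarrow> ('k pmod, 'k parr, 'p, 'q) functr \<Rightarrow> bool" where
  "sends_simples_to n Z Zs \<zeta> \<longleftrightarrow> linear_functor (mod_prod n) Z \<zeta> \<and>
     (\<forall>i<n. on_ob \<zeta> (simple_mod n i) = Zs i)"

definition simple_collection :: "nat \<Rightarrow> ('k::field, 'p, 'q) lin_cat \<Rightarrow> (nat \<Rightarrow> 'p) \<Rightarrow> bool" where
  "simple_collection n Z Zs \<longleftrightarrow> (\<forall>i<n. Zs i \<in> Ob Z) \<and>
     (\<forall>i<n. \<forall>j<n. has_dim (hom_space Z (Zs i) (Zs j)) (if i = j then 1 else 0))"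

inductive_set ext_closure :: "('k, 'p, 'q) lin_cat \<Rightarrow> 'p set \<Rightarrow> 'p set"
  for Z :: "('k, 'p, 'q) lin_cat" and S :: "'p set" where
  zero: "is_zero_ob Z X \<Longrightarrow> X \<in> ext_closure Z S"
| base: "X \<in> S \<Longrightarrow> X \<in> ext_closure Z S"
| iso: "\<lbrakk>X \<in> ext_closure Z S; isomorphic Z X Y\<rbrakk> \<Longrightarrow> Y \<in> ext_closure Z S"
| ext: "\<lbrakk>X \<in> ext_closure Z S; Y \<in> ext_closure Z S; short_exact Z i p; Dom Z i = Y; Cod Z i = E;
    Cod Z p = X\<rbrakk> \<Longrightarrow> E \<in> ext_closure Z S"

definition full_subcat :: "('k, 'p, 'q) lin_cat \<Rightarrow> 'p set \<Rightarrow> ('k, 'p, 'q) lin_cat" where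
  "full_subcat Z S = Z\<lparr>Ob := S, Arr := {f \<in> Arr Z. Dom Z f \<in> S \<and> Cod Z f \<in> S}\<rparr>"

definition filt_cat :: "nat \<Rightarrow> ('k, 'p, 'q) lin_cat \<Rightarrow> (nat \<Rightarrow> 'p) \<Rightarrow> ('k, 'p, 'q) lin_cat" where
  "filt_cat n Z Zs = full_subcat Z (ext_closure Z (Zs ` {..<n}))"

end

theory Submission
  imports Defs
begin

text \<open>
  Write \<open>F\<close> for the extension closure of the objects \<open>Zs i\<close>. The theorem has three ingredients.

  \<^emph>\<open>\<open>F\<close> is an abelian subcategory whose simple objects are the \<open>Zs i\<close>.\<close> Nonzero arrows between the
  \<open>Zs i\<close> are invertible, because the arrow spaces have dimension one or zero. Hence a nonzero arrow
  from some \<open>Zs i\<close> to an object \<open>Y\<close> of \<open>F\<close> is a monomorphism with cokernel in \<open>F\<close> (\<open>brick_map\<close>).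
  For an arrow \<open>f\<close> from \<open>X\<close> to \<open>Y\<close> in \<open>F\<close> look at a bottom step \<open>Zs i\<close> of \<open>X\<close>: it is killed by \<open>f\<close>
  or it is embedded into \<open>Y\<close>, and it can be divided out of \<open>X\<close> or of both \<open>X\<close> and \<open>Y\<close>. Induction
  shows that kernels and cokernels taken in the ambient category stay in \<open>F\<close> (\<open>F_ker_coker\<close>). So
  \<open>F\<close> is abelian, its exact sequences are those of the ambient category with terms in \<open>F\<close>, and
  a bottom step of a simple object is the whole object.

  \<^emph>\<open>Finiteness.\<close> The spaces of arrows and of extensions are exact in the middle in both variables, so
  finite dimension spreads from the \<open>Zs i\<close> to all of \<open>F\<close> along filtrations, and the extension
  spaces of the \<open>Zs i\<close> are images of the one of their direct sum. The work lies in showing that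
  Baer sums make classes of extensions a vector space. For an extension \<open>u\<close> of \<open>X\<close> by \<open>T\<close> and an
  arrow \<open>f\<close> from \<open>T\<close> to \<open>Y\<close> there is the class \<open>f\<^sub>* u\<close>. Finitely many classes always have the
  form \<open>f\<^sub>* u\<close>, \<open>g\<^sub>* u\<close>, \<open>\<dots>\<close> for one common \<open>u\<close>, and the Baer sum of \<open>f\<^sub>* u\<close> and \<open>g\<^sub>* u\<close> is
  \<open>(f + g)\<^sub>* u\<close>. Every axiom then follows from the same axiom for arrows (\<open>vect_Ext1\<close>).

  \<^emph>\<open>Representability.\<close> If \<open>A\<close> has finite length and \<open>T\<close> is an exact functor from \<open>A\<close> to the ambient
  category that sends semisimple objects into \<open>F\<close>, then \<open>T\<close> sends all objects into \<open>F\<close>, by a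
  filtration. A deformation is therefore the same thing as a framed exact functor to \<open>F\<close>. The two
  equivalence relations agree as well: a transformation compatible with the framings is invertible
  on semisimple objects, hence everywhere by the five lemma. The representing isomorphism is the
  identity.

  The structure functor exists because modules over the product algebra are direct sums of simple
  modules, so that their arrows are block matrices of scalars; the same matrices act between direct
  sums of the \<open>Zs i\<close>. This description also shows that any such functor is fully faithful with the
  semisimple objects of \<open>F\<close> as essential image.

  Diagram chases are carried out with arrows \<open>x\<close> into an object in place of its elements. A preimage
  of \<open>x\<close> under an epimorphism exists after composing \<open>x\<close> with another epimorphism (\<open>epi_cover\<close>),
  and a factorisation through a monomorphism may be tested after such a composition
  (\<open>mono_lift_along_epi\<close>).
\<close>

section \<open>Calculus in linear categories\<close>

lemma Hom_iff: "f \<in> Hom C X Y \<longleftrightarrow> f \<in> Arr C \<and> Dom C f = X \<and> Cod C f = Y"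
  by (simp add: Hom_def)

lemma carrier_hom_space [simp]: "carrier (hom_space C X Y) = Hom C X Y"
  and zero_hom_space [simp]: "\<zero>\<^bsub>hom_space C X Y\<^esub> = Zer C X Y"
  and add_hom_space [simp]: "f \<oplus>\<^bsub>hom_space C X Y\<^esub> g = Plus C f g"
  and smult_hom_space [simp]: "c \<odot>\<^bsub>hom_space C X Y\<^esub> f = Scal C c f"
  by (simp_all add: hom_space_def)

lemma carrier_rta [simp]: "carrier (ring_of_type_algebra :: 'k::field ring) = UNIV"
  and zero_rta [simp]: "\<zero>\<^bsub>(ring_of_type_algebra :: 'k::field ring)\<^esub> = 0"
  and one_rta [simp]: "\<one>\<^bsub>(ring_of_type_algebra :: 'k::field ring)\<^esub> = 1"
  and add_rta [simp]: "(a::'k::field) \<oplus>\<^bsub>ring_of_type_algebra\<^esub> b = a + b"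
  and mult_rta [simp]: "(a::'k::field) \<otimes>\<^bsub>ring_of_type_algebra\<^esub> b = a * b"
  by (simp_all add: ring_of_type_algebra_def)

lemma dom_hom: "f \<in> Hom C X Y \<Longrightarrow> Dom C f = X" and cod_hom: "f \<in> Hom C X Y \<Longrightarrow> Cod C f = Y"
  by (simp_all add: Hom_iff)

context linear_category
begin

lemma hom_ob: "f \<in> Hom C X Y \<Longrightarrow> X \<in> Ob C \<and> Y \<in> Ob C"
  using dom_cod by (auto simp: Hom_iff)

lemma dom_ob: "f \<in> Arr C \<Longrightarrow> Dom C f \<in> Ob C"
  and cod_ob: "f \<in> Arr C \<Longrightarrow> Cod C f \<in> Ob C"
  using dom_cod by auto

lemma comp_typed:
  assumes "f \<in> Arr C" "g \<in> Arr C" "Dom C g = Cod C f"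
  shows comp_arr: "g \<cdot> f \<in> Arr C" and dom_comp: "Dom C (g \<cdot> f) = Dom C f"
    and cod_comp: "Cod C (g \<cdot> f) = Cod C g"
  using comp_hom[of f "Dom C f" "Cod C f" g "Cod C g"] assms by (auto simp: Hom_iff)

lemma comp_assoc_arr:
  "\<lbrakk>f \<in> Arr C; g \<in> Arr C; h \<in> Arr C; Dom C g = Cod C f; Dom C h = Cod C g\<rbrakk> \<Longrightarrow>
     (h \<cdot> g) \<cdot> f = h \<cdot> (g \<cdot> f)"
  using comp_assoc[of f "Dom C f" "Cod C f" g "Cod C g" h "Cod C h"] by (simp add: Hom_iff)

lemma ide_typed:
  assumes "X \<in> Ob C"
  shows ide_arr: "Ide C X \<in> Arr C" and dom_ide: "Dom C (Ide C X) = X" and cod_ide: "Cod C (Ide C X) = X"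
  using ide_hom[OF assms] by (auto simp: Hom_iff)

lemma comp_ide_arr:
  assumes "f \<in> Arr C"
  shows "Dom C f = X \<Longrightarrow> f \<cdot> Ide C X = f" and "Cod C f = Y \<Longrightarrow> Ide C Y \<cdot> f = f"
  using comp_ide_right comp_ide_left assms by (auto simp: Hom_iff)

text \<open>Compositions are normalised by bracketing to the right; this turns an equation between
  composites into a rewrite rule that also applies inside a longer composite.\<close>

lemma reassoc:
  assumes "g \<cdot> f = k" "f \<in> Arr C" "g \<in> Arr C" "Dom C g = Cod C f" "x \<in> Arr C" "Cod C x = Dom C f"
  shows "g \<cdot> (f \<cdot> x) = k \<cdot> x"
  using comp_assoc_arr[of x f g] assms by auto

lemma hom_abelian_group:
  assumes "X \<in> Ob C" "Y \<in> Ob C"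
  shows "abelian_group (hom_space C X Y)"
  using hom_vector_space[OF assms] by (rule module.axioms)

lemma zer_hom: "\<lbrakk>X \<in> Ob C; Y \<in> Ob C\<rbrakk> \<Longrightarrow> Zer C X Y \<in> Hom C X Y"
  using abelian_monoid.zero_closed[OF abelian_group.axioms(1)[OF hom_abelian_group]] by simp

lemma plus_hom:
  assumes "f \<in> Hom C X Y" "g \<in> Hom C X Y"
  shows "Plus C f g \<in> Hom C X Y"
  using abelian_monoid.a_closed[OF abelian_group.axioms(1)[OF hom_abelian_group[of X Y]], of f g]
    hom_ob[OF assms(1)] assms by simp

lemma scal_hom: "f \<in> Hom C X Y \<Longrightarrow> Scal C c f \<in> Hom C X Y"
  using module.smult_closed[OF hom_vector_space[of X Y], of c f] hom_ob[of f X Y] by simp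

lemma zer_typed:
  assumes "X \<in> Ob C" "Y \<in> Ob C"
  shows zer_arr: "Zer C X Y \<in> Arr C" and dom_zer: "Dom C (Zer C X Y) = X" and cod_zer: "Cod C (Zer C X Y) = Y"
  using zer_hom[OF assms] by (auto simp: Hom_iff)

lemma plus_typed:
  assumes "f \<in> Arr C" "g \<in> Arr C" "Dom C g = Dom C f" "Cod C g = Cod C f"
  shows plus_arr: "Plus C f g \<in> Arr C" and dom_plus: "Dom C (Plus C f g) = Dom C f"
    and cod_plus: "Cod C (Plus C f g) = Cod C f"
  using plus_hom[of f "Dom C f" "Cod C f" g] assms by (auto simp: Hom_iff)

lemma scal_typed:
  assumes "f \<in> Arr C"
  shows scal_arr: "Scal C c f \<in> Arr C" and dom_scal: "Dom C (Scal C c f) = Dom C f"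
    and cod_scal: "Cod C (Scal C c f) = Cod C f"
  using scal_hom[of f "Dom C f" "Cod C f" c] assms by (auto simp: Hom_iff)

lemma plus_assoc:
  assumes "f \<in> Arr C" "g \<in> Arr C" "h \<in> Arr C" "Dom C g = Dom C f" "Cod C g = Cod C f"
    "Dom C h = Dom C f" "Cod C h = Cod C f"
  shows "Plus C (Plus C f g) h = Plus C f (Plus C g h)"
  using abelian_monoid.a_assoc[OF abelian_group.axioms(1)[OF hom_abelian_group[of "Dom C f" "Cod C f"]], of f g h]
    assms by (simp add: Hom_iff dom_ob cod_ob)

lemma plus_comm:
  assumes "f \<in> Arr C" "g \<in> Arr C" "Dom C g = Dom C f" "Cod C g = Cod C f"
  shows "Plus C f g = Plus C g f"
  using abelian_monoid.a_comm[OF abelian_group.axioms(1)[OF hom_abelian_group[of "Dom C f" "Cod C f"]], of f g]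
    assms by (simp add: Hom_iff dom_ob cod_ob)

lemma plus_zer:
  assumes "f \<in> Arr C" "Dom C f = X" "Cod C f = Y"
  shows "Plus C f (Zer C X Y) = f" and "Plus C (Zer C X Y) f = f"
  using abelian_monoid.r_zero[OF abelian_group.axioms(1)[OF hom_abelian_group[of X Y]], of f]
   abelian_monoid.l_zero[OF abelian_group.axioms(1)[OF hom_abelian_group[of X Y]], of f]
    assms dom_cod[of f] by (auto simp: Hom_iff)

lemma scal_one: "f \<in> Arr C \<Longrightarrow> Scal C 1 f = f"
  using module.smult_one[OF hom_vector_space[of "Dom C f" "Cod C f"], of f]
  by (simp add: Hom_iff dom_ob cod_ob)

lemma scal_scal: "f \<in> Arr C \<Longrightarrow> Scal C a (Scal C b f) = Scal C (a * b) f"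
  using module.smult_assoc1[OF hom_vector_space[of "Dom C f" "Cod C f"], of a b f]
  by (simp add: Hom_iff dom_ob cod_ob)

lemma scal_plus_left: "f \<in> Arr C \<Longrightarrow> Plus C (Scal C a f) (Scal C b f) = Scal C (a + b) f"
  using module.smult_l_distr[OF hom_vector_space[of "Dom C f" "Cod C f"], of a b f]
  by (simp add: Hom_iff dom_ob cod_ob)

lemma scal_plus_right:
  "\<lbrakk>f \<in> Arr C; g \<in> Arr C; Dom C g = Dom C f; Cod C g = Cod C f\<rbrakk> \<Longrightarrow>
     Scal C a (Plus C f g) = Plus C (Scal C a f) (Scal C a g)"
  using module.smult_r_distr[OF hom_vector_space[of "Dom C f" "Cod C f"], of a f g]
  by (simp add: Hom_iff dom_ob cod_ob)

lemma scal_zero: "\<lbrakk>f \<in> Arr C; Dom C f = X; Cod C f = Y\<rbrakk> \<Longrightarrow> Scal C 0 f = Zer C X Y"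
  using module.smult_l_null[OF hom_vector_space[of "Dom C f" "Cod C f"], of f]
  by (auto simp: Hom_iff dom_ob cod_ob)

lemma scal_zer: "\<lbrakk>X \<in> Ob C; Y \<in> Ob C\<rbrakk> \<Longrightarrow> Scal C c (Zer C X Y) = Zer C X Y"
  using module.smult_r_null[OF hom_vector_space[of X Y], of c] by simp

lemma plus_neg:
  assumes "f \<in> Arr C"
  shows "Plus C f (Scal C (- 1) f) = Zer C (Dom C f) (Cod C f)"
    and "Plus C (Scal C (- 1) f) f = Zer C (Dom C f) (Cod C f)"
  using scal_plus_left[OF assms, of 1 "-1"] scal_plus_left[OF assms, of "-1" 1] scal_one[OF assms]
    scal_zero[OF assms] by auto

lemma comp_plus:
  assumes "f \<in> Arr C" "g \<in> Arr C" "Dom C g = Dom C f" "Cod C g = Cod C f" "h \<in> Arr C"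
  shows comp_plus_r: "Dom C h = Cod C f \<Longrightarrow> h \<cdot> Plus C f g = Plus C (h \<cdot> f) (h \<cdot> g)"
    and comp_plus_l: "Cod C h = Dom C f \<Longrightarrow> Plus C f g \<cdot> h = Plus C (f \<cdot> h) (g \<cdot> h)"
  using comp_plus_right[of f "Dom C f" "Cod C f" g h "Cod C h"]
    comp_plus_left[of h "Dom C h" "Cod C h" f "Cod C f" g] assms by (auto simp: Hom_iff)

lemma comp_scal:
  assumes "f \<in> Arr C" "h \<in> Arr C" "Dom C h = Cod C f"
  shows comp_scal_r: "h \<cdot> Scal C c f = Scal C c (h \<cdot> f)"
    and comp_scal_l: "Scal C c h \<cdot> f = Scal C c (h \<cdot> f)"
  using comp_scal_right[of f "Dom C f" "Cod C f" h "Cod C h"]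
    comp_scal_left[of f "Dom C f" "Cod C f" h "Cod C h"] assms by (auto simp: Hom_iff)

lemma comp_zer_r:
  assumes "h \<in> Arr C" "Dom C h = Y" "X \<in> Ob C"
  shows "h \<cdot> Zer C X Y = Zer C X (Cod C h)"
proof -
  have Y: "Y \<in> Ob C" using assms dom_ob by auto
  have "h \<cdot> Scal C 0 (Zer C X Y) = Scal C 0 (h \<cdot> Zer C X Y)"
    using assms Y by (intro comp_scal_r) (auto simp: zer_typed)
  then show ?thesis using assms Y
    by (simp add: scal_zer scal_zero comp_typed zer_typed)
qed

lemma comp_zer_l:
  assumes "h \<in> Arr C" "Cod C h = X" "Y \<in> Ob C"
  shows "Zer C X Y \<cdot> h = Zer C (Dom C h) Y"
proof -
  have X: "X \<in> Ob C" using assms cod_ob by auto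
  have "Scal C 0 (Zer C X Y) \<cdot> h = Scal C 0 (Zer C X Y \<cdot> h)"
    using assms X by (intro comp_scal_l) (auto simp: zer_typed)
  then show ?thesis using assms X
    by (simp add: scal_zer scal_zero comp_typed zer_typed)
qed

lemmas typed = dom_ob cod_ob comp_typed ide_typed zer_typed plus_typed scal_typed

lemmas cat_simps = Hom_iff typed comp_assoc_arr comp_ide_arr plus_zer scal_one scal_scal scal_zer
  scal_zero comp_plus_r comp_plus_l comp_scal_r comp_scal_l comp_zer_r comp_zer_l scal_plus_right plus_neg

lemma diff_eq_zer:
  assumes "f \<in> Hom C X Y" "g \<in> Hom C X Y" "Plus C f (Scal C (- 1) g) = Zer C X Y"
  shows "f = g"
proof -
  have "f = Plus C f (Plus C (Scal C (- 1) g) g)"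
    using assms(1,2) by (auto simp: cat_simps)
  also have "\<dots> = Plus C (Plus C f (Scal C (- 1) g)) g"
    using assms(1,2) by (auto simp: typed Hom_iff intro!: plus_assoc[symmetric])
  finally show ?thesis using assms by (auto simp: cat_simps)
qed

lemma scal_cancel:
  assumes "f \<in> Hom C X Y" "f \<noteq> Zer C X Y" "Scal C a f = Scal C b f"
  shows "a = b"
proof (rule ccontr)
  assume ne: "a \<noteq> b"
  have f: "f \<in> Arr C" "Dom C f = X" "Cod C f = Y" using assms(1) by (simp_all add: Hom_iff)
  have "Scal C (a - b) f = Plus C (Scal C a f) (Scal C (- b) f)" unfolding scal_plus_left[OF f(1)] by simp
  also have "\<dots> = Scal C 0 f" unfolding assms(3) scal_plus_left[OF f(1)] by simp
  finally have z: "Scal C (a - b) f = Zer C X Y" using scal_zero[OF f] by simp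
  have "f = Scal C (1 / (a - b)) (Scal C (a - b) f)" using ne f by (simp add: scal_scal scal_one)
  also have "\<dots> = Zer C X Y" unfolding z using scal_zer hom_ob[OF assms(1)] by blast
  finally show False using assms(2) by blast
qed

lemma is_monoI:
  assumes "f \<in> Hom C X Y" "\<And>W x. \<lbrakk>x \<in> Hom C W X; f \<cdot> x = Zer C W Y\<rbrakk> \<Longrightarrow> x = Zer C W X"
  shows "is_mono C f"
  unfolding is_mono_def
proof (intro conjI ballI impI)
  show "f \<in> Arr C" using assms by (simp add: Hom_iff)
  fix W g h assume *: "W \<in> Ob C" "g \<in> Hom C W (Dom C f)" "h \<in> Hom C W (Dom C f)" "f \<cdot> g = f \<cdot> h"
  have X: "Dom C f = X" "f \<in> Arr C" "Cod C f = Y" using assms by (auto simp: Hom_iff)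
  show "g = h"
  proof (rule diff_eq_zer)
    show "Plus C g (Scal C (- 1) h) = Zer C W X"
      using * X by (intro assms(2)) (auto simp: cat_simps)
  qed (use * X in auto)
qed

lemma is_epiI:
  assumes "f \<in> Hom C X Y" "\<And>W x. \<lbrakk>x \<in> Hom C Y W; x \<cdot> f = Zer C X W\<rbrakk> \<Longrightarrow> x = Zer C Y W"
  shows "is_epi C f"
  unfolding is_epi_def
proof (intro conjI ballI impI)
  show "f \<in> Arr C" using assms by (simp add: Hom_iff)
  fix W g h assume *: "W \<in> Ob C" "g \<in> Hom C (Cod C f) W" "h \<in> Hom C (Cod C f) W" "g \<cdot> f = h \<cdot> f"
  have X: "Dom C f = X" "f \<in> Arr C" "Cod C f = Y" using assms by (auto simp: Hom_iff)
  show "g = h"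
  proof (rule diff_eq_zer)
    show "Plus C g (Scal C (- 1) h) = Zer C Y W"
      using * X by (intro assms(2)) (auto simp: cat_simps)
  qed (use * X in auto)
qed

lemma mono_cancel:
  "\<lbrakk>is_mono C f; f \<in> Hom C X Y; x \<in> Hom C W X; y \<in> Hom C W X; f \<cdot> x = f \<cdot> y\<rbrakk> \<Longrightarrow> x = y"
  using hom_ob unfolding is_mono_def by (metis Hom_iff)

lemma mono_zer:
  assumes "is_mono C f" "f \<in> Hom C X Y" "x \<in> Hom C W X" "f \<cdot> x = Zer C W Y"
  shows "x = Zer C W X"
  using mono_cancel[OF assms(1-3), of "Zer C W X"] assms hom_ob[OF assms(2)] hom_ob[OF assms(3)]
  by (auto simp: cat_simps)

lemma epi_cancel:
  "\<lbrakk>is_epi C f; f \<in> Hom C X Y; x \<in> Hom C Y W; y \<in> Hom C Y W; x \<cdot> f = y \<cdot> f\<rbrakk> \<Longrightarrow> x = y"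
  using hom_ob unfolding is_epi_def by (metis Hom_iff)

lemma epi_zer:
  assumes "is_epi C f" "f \<in> Hom C X Y" "x \<in> Hom C Y W" "x \<cdot> f = Zer C X W"
  shows "x = Zer C Y W"
  using epi_cancel[OF assms(1-3), of "Zer C Y W"] assms hom_ob[OF assms(2)] hom_ob[OF assms(3)]
  by (auto simp: cat_simps)

lemma is_zero_ob_iff: "is_zero_ob C X \<longleftrightarrow> X \<in> Ob C \<and> Ide C X = Zer C X X"
proof
  assume "is_zero_ob C X"
  then show "X \<in> Ob C \<and> Ide C X = Zer C X X"
    unfolding is_zero_ob_def using ide_hom zer_hom by blast
next
  assume *: "X \<in> Ob C \<and> Ide C X = Zer C X X"
  have "f = Zer C X Y" if "f \<in> Hom C X Y" for f Y
    using that * comp_ide_right[OF that] hom_ob[OF that] by (metis Hom_iff comp_zer_r)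
  moreover have "f = Zer C Y X" if "f \<in> Hom C Y X" for f Y
    using that * comp_ide_left[OF that] hom_ob[OF that] by (metis Hom_iff comp_zer_l)
  ultimately show "is_zero_ob C X"
    unfolding is_zero_ob_def using * zer_hom by blast
qed

lemma zero_ob_hom:
  assumes "is_zero_ob C X"
  shows zero_ob_from: "f \<in> Hom C X Y \<Longrightarrow> f = Zer C X Y" and zero_ob_to: "f \<in> Hom C Y X \<Longrightarrow> f = Zer C Y X"
  using assms hom_ob zer_hom unfolding is_zero_ob_def by blast+

lemma is_isoI:
  assumes "f \<in> Hom C X Y" "g \<in> Hom C Y X" "g \<cdot> f = Ide C X" "f \<cdot> g = Ide C Y"
  shows "is_iso C f"
  using assms unfolding is_iso_def by (auto simp: Hom_iff)

lemma is_isoE: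
  assumes "is_iso C f" "f \<in> Hom C X Y"
  obtains g where "g \<in> Hom C Y X" "g \<cdot> f = Ide C X" "f \<cdot> g = Ide C Y" "is_iso C g"
proof -
  have "Dom C f = X" "Cod C f = Y" using assms by (simp_all add: Hom_iff)
  then obtain g where g: "g \<in> Hom C Y X" "g \<cdot> f = Ide C X" "f \<cdot> g = Ide C Y"
    using assms unfolding is_iso_def by blast
  then show ?thesis using that is_isoI[OF g(1) assms(2) g(3,2)] by blast
qed

lemma iso_mono: "is_iso C f \<Longrightarrow> f \<in> Hom C X Y \<Longrightarrow> is_mono C f"
  and iso_epi: "is_iso C f \<Longrightarrow> f \<in> Hom C X Y \<Longrightarrow> is_epi C f"
proof -
  assume f: "is_iso C f" "f \<in> Hom C X Y"
  then obtain g where g: "g \<in> Hom C Y X" "g \<cdot> f = Ide C X" "f \<cdot> g = Ide C Y" by (rule is_isoE)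
  show "is_mono C f"
  proof (rule is_monoI[OF f(2)])
    fix W x assume x: "x \<in> Hom C W X" "f \<cdot> x = Zer C W Y"
    have "x = g \<cdot> (f \<cdot> x)" using f(2) g x(1) by (simp add: cat_simps reassoc[OF g(2)])
    then show "x = Zer C W X" using x g(1) hom_ob[OF x(1)] by (simp add: cat_simps)
  qed
  show "is_epi C f"
  proof (rule is_epiI[OF f(2)])
    fix W x assume x: "x \<in> Hom C Y W" "x \<cdot> f = Zer C X W"
    have "x = (x \<cdot> f) \<cdot> g" using f(2) g x(1) by (simp add: cat_simps)
    then show "x = Zer C Y W" using x g(1) hom_ob[OF x(1)] by (simp add: cat_simps)
  qed
qed

lemma iso_comp:
  assumes "is_iso C f" "f \<in> Hom C X Y" "is_iso C g" "g \<in> Hom C Y W"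
  shows "is_iso C (g \<cdot> f)"
proof -
  obtain f' where f': "f' \<in> Hom C Y X" "f' \<cdot> f = Ide C X" "f \<cdot> f' = Ide C Y" using assms by (auto elim: is_isoE)
  obtain g' where g': "g' \<in> Hom C W Y" "g' \<cdot> g = Ide C Y" "g \<cdot> g' = Ide C W" using assms by (auto elim: is_isoE)
  show ?thesis using assms(2,4) f' g'
    by (intro is_isoI[of _ X W "f' \<cdot> g'"]) (auto simp: cat_simps reassoc[OF g'(2)] reassoc[OF f'(3)])
qed

lemma ide_iso: "X \<in> Ob C \<Longrightarrow> is_iso C (Ide C X)"
  by (rule is_isoI[of _ X X "Ide C X"]) (auto simp: cat_simps)

lemma isomorphic_sym: "isomorphic C X Y \<Longrightarrow> isomorphic C Y X"
  unfolding isomorphic_def by (meson is_isoE)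

lemma isomorphic_trans: "isomorphic C X Y \<Longrightarrow> isomorphic C Y W \<Longrightarrow> isomorphic C X W"
  unfolding isomorphic_def using iso_comp comp_hom by meson

lemma isomorphic_zero: "isomorphic C X Y \<Longrightarrow> is_zero_ob C X \<Longrightarrow> is_zero_ob C Y"
proof -
  assume "isomorphic C X Y" "is_zero_ob C X"
  then obtain f g where f: "f \<in> Hom C X Y" "g \<in> Hom C Y X" "f \<cdot> g = Ide C Y" "f = Zer C X Y"
    unfolding isomorphic_def using zero_ob_from by (meson is_isoE)
  then have "Ide C Y = Zer C Y Y" "Y \<in> Ob C" using hom_ob[OF f(1)] by (auto simp: cat_simps)
  then show ?thesis by (simp add: is_zero_ob_iff)
qed

lemma is_kernelI:
  assumes "f \<in> Hom C X Y" "k \<in> Hom C K X" "f \<cdot> k = Zer C K Y" "is_mono C k"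
    "\<And>W x. \<lbrakk>x \<in> Hom C W X; f \<cdot> x = Zer C W Y\<rbrakk> \<Longrightarrow> \<exists>h \<in> Hom C W K. k \<cdot> h = x"
  shows "is_kernel C f k"
  unfolding is_kernel_def
proof (intro conjI ballI impI)
  fix W g assume g: "W \<in> Ob C" "g \<in> Hom C W (Dom C f)" "f \<cdot> g = Zer C W (Cod C f)"
  then obtain h where "h \<in> Hom C W K" "k \<cdot> h = g" using assms(1) assms(5)[of g W] by (auto simp: Hom_iff)
  then show "\<exists>!h. h \<in> Hom C W (Dom C k) \<and> k \<cdot> h = g"
    using mono_cancel[OF assms(4,2)] assms(2) by (intro ex1I[of _ h]) (auto simp: Hom_iff)
qed (use assms in \<open>auto simp: Hom_iff\<close>)

lemma is_kernelD:
  assumes "is_kernel C f k" "f \<in> Hom C X Y"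
  shows kernel_hom: "k \<in> Hom C (Dom C k) X" and kernel_comp: "f \<cdot> k = Zer C (Dom C k) Y"
    and kernel_mono: "is_mono C k"
    and kernel_lift: "\<And>W x. \<lbrakk>x \<in> Hom C W X; f \<cdot> x = Zer C W Y\<rbrakk> \<Longrightarrow> \<exists>h \<in> Hom C W (Dom C k). k \<cdot> h = x"
proof -
  show k: "k \<in> Hom C (Dom C k) X" and fk: "f \<cdot> k = Zer C (Dom C k) Y"
    using assms by (auto simp: is_kernel_def Hom_iff)
  show "\<exists>h \<in> Hom C W (Dom C k). k \<cdot> h = x" if "x \<in> Hom C W X" "f \<cdot> x = Zer C W Y" for W x
  proof -
    have "Dom C f = X" "Cod C f = Y" "W \<in> Ob C" using assms(2) hom_ob[OF that(1)] by (simp_all add: Hom_iff)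
    then show ?thesis using assms(1) that unfolding is_kernel_def by blast
  qed
  show "is_mono C k"
    unfolding is_mono_def
  proof (intro conjI ballI impI)
    fix W g h assume *: "W \<in> Ob C" "g \<in> Hom C W (Dom C k)" "h \<in> Hom C W (Dom C k)" "k \<cdot> g = k \<cdot> h"
    have "f \<cdot> (k \<cdot> g) = Zer C W Y" using * assms(2) k dom_cod
      by (auto simp: cat_simps reassoc[OF fk])
    then have "\<exists>!h. h \<in> Hom C W (Dom C k) \<and> k \<cdot> h = k \<cdot> g"
      using assms * k unfolding is_kernel_def by (simp add: Hom_iff comp_typed)
    with * show "g = h" by auto
  qed (use assms in \<open>simp add: is_kernel_def\<close>)
qed

end

section \<open>Duality\<close>

text \<open>Reversing arrows exchanges kernels with cokernels and pullbacks with pushouts, so that one half of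
  the statements about abelian categories is deduced from the other half.\<close>

definition op_cat :: "('k, 'o, 'm) lin_cat \<Rightarrow> ('k, 'o, 'm) lin_cat" where
  "op_cat C = \<lparr>Ob = Ob C, Arr = Arr C, Dom = Cod C, Cod = Dom C, Ide = Ide C,
     Comp = (\<lambda>g f. Comp C f g), Zer = (\<lambda>X Y. Zer C Y X), Plus = Plus C, Scal = Scal C\<rparr>"

lemma op_cat_sel [simp]:
  "Ob (op_cat C) = Ob C" "Arr (op_cat C) = Arr C" "Dom (op_cat C) = Cod C" "Cod (op_cat C) = Dom C"
  "Ide (op_cat C) = Ide C" "Comp (op_cat C) g f = Comp C f g" "Zer (op_cat C) X Y = Zer C Y X"
  "Plus (op_cat C) = Plus C" "Scal (op_cat C) = Scal C"
  by (simp_all add: op_cat_def)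

lemma op_hom [simp]: "Hom (op_cat C) X Y = Hom C Y X"
  by (auto simp: Hom_iff)

lemma op_hom_space [simp]: "hom_space (op_cat C) X Y = hom_space C Y X"
  by (simp add: hom_space_def)

lemma op_mono [simp]: "is_mono (op_cat C) f \<longleftrightarrow> is_epi C f"
  and op_epi [simp]: "is_epi (op_cat C) f \<longleftrightarrow> is_mono C f"
  and op_kernel [simp]: "is_kernel (op_cat C) f g \<longleftrightarrow> is_cokernel C f g"
  and op_cokernel [simp]: "is_cokernel (op_cat C) f g \<longleftrightarrow> is_kernel C f g"
  and op_iso [simp]: "is_iso (op_cat C) f \<longleftrightarrow> is_iso C f"
  and op_zero_ob [simp]: "is_zero_ob (op_cat C) X \<longleftrightarrow> is_zero_ob C X"
  by (auto simp: is_mono_def is_epi_def is_kernel_def is_cokernel_def is_iso_def is_zero_ob_def)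

lemma op_short_exact [simp]: "short_exact (op_cat C) i p \<longleftrightarrow> short_exact C p i"
  by (auto simp: short_exact_def)

lemma op_biproduct: "is_biproduct C A B S i j p q \<Longrightarrow> is_biproduct (op_cat C) A B S p q i j"
  by (auto simp: is_biproduct_def)

lemma (in linear_category) op_linear: "linear_category (op_cat C)"
proof (rule linear_category.intro, unfold op_cat_sel op_hom op_hom_space)
  fix f g h X Y Z W assume "f \<in> Hom C Y X" "g \<in> Hom C Z Y" "h \<in> Hom C W Z"
  then show "(f \<cdot> g) \<cdot> h = f \<cdot> (g \<cdot> h)"
    using comp_assoc[of h W Z g Y f X] by simp
qed (use comp_hom comp_plus_left comp_plus_right comp_scal_left comp_scal_right in
  \<open>simp_all add: dom_ob cod_ob ide_hom comp_ide_left comp_ide_right hom_vector_space\<close>)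

lemma (in abelian_category) op_abelian: "abelian_category (op_cat C)"
proof -
  interpret op: linear_category "op_cat C" by (rule op_linear)
  show ?thesis
    by (rule abelian_category.intro[OF op_linear], rule abelian_category_axioms.intro)
      (simp_all add: zero_ob kernels cokernels mono_normal epi_normal, meson biproducts op_biproduct)
qed

context linear_category
begin

lemma is_cokernelI:
  assumes "f \<in> Hom C X Y" "q \<in> Hom C Y Q" "q \<cdot> f = Zer C X Q" "is_epi C q"
    "\<And>W x. \<lbrakk>x \<in> Hom C Y W; x \<cdot> f = Zer C X W\<rbrakk> \<Longrightarrow> \<exists>h \<in> Hom C Q W. h \<cdot> q = x"
  shows "is_cokernel C f q"
  using linear_category.is_kernelI[OF op_linear, of f Y X q Q] assms by simp

lemma is_cokernelD:
  assumes "is_cokernel C f q" "f \<in> Hom C X Y"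
  shows cokernel_hom: "q \<in> Hom C Y (Cod C q)" and cokernel_comp: "q \<cdot> f = Zer C X (Cod C q)"
    and cokernel_epi: "is_epi C q"
    and cokernel_desc: "\<And>W x. \<lbrakk>x \<in> Hom C Y W; x \<cdot> f = Zer C X W\<rbrakk> \<Longrightarrow> \<exists>h \<in> Hom C (Cod C q) W. h \<cdot> q = x"
  using linear_category.is_kernelD[OF op_linear, of f q Y X] assms by auto

end

section \<open>Diagram chasing in abelian categories\<close>

context abelian_category
begin

text \<open>The monomorphism is the kernel of some arrow, and that arrow factors through the cokernel.\<close>

lemma mono_kernel_of_cokernel:
  assumes "is_mono C m" "m \<in> Hom C X Y" "is_cokernel C m q"
  shows "is_kernel C q m"
proof -
  obtain f where f: "is_kernel C f m" using mono_normal[OF assms(1)] by blast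
  have F: "f \<in> Hom C Y (Cod C f)" using f assms(2) by (auto simp: is_kernel_def Hom_iff)
  have fm: "f \<cdot> m = Zer C X (Cod C f)" using kernel_comp[OF f F] assms(2) by (auto simp: Hom_iff)
  note q = is_cokernelD[OF assms(3,2)]
  obtain f' where f': "f' \<in> Hom C (Cod C q) (Cod C f)" "f' \<cdot> q = f" using q(4)[OF F fm] by blast
  show ?thesis
  proof (rule is_kernelI[OF q(1) assms(2) q(2) assms(1)])
    fix W x assume x: "x \<in> Hom C W Y" "q \<cdot> x = Zer C W (Cod C q)"
    have "f \<cdot> x = f' \<cdot> (q \<cdot> x)" using f' q(1) x(1) by (auto simp: cat_simps)
    then have "f \<cdot> x = Zer C W (Cod C f)" using x f' hom_ob[OF x(1)] by (auto simp: cat_simps)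
    then show "\<exists>h\<in>Hom C W X. m \<cdot> h = x" using kernel_lift[OF f F x(1)] assms(2) by (auto simp: Hom_iff)
  qed
qed

lemma mono_short_exact:
  assumes "is_mono C m"
  obtains p where "short_exact C m p"
proof -
  have m: "m \<in> Arr C" using assms by (simp add: is_mono_def)
  obtain q where "is_cokernel C m q" using cokernels[OF m] by blast
  then show ?thesis using mono_kernel_of_cokernel[OF assms, of "Dom C m" "Cod C m"] m that
    by (auto simp: short_exact_def Hom_iff)
qed

lemma cokernel_mono_short_exact:
  assumes "is_mono C m" "is_cokernel C m q"
  shows "short_exact C m q"
  using assms mono_kernel_of_cokernel[OF assms(1), of "Dom C m" "Cod C m"]
  by (auto simp: short_exact_def Hom_iff is_mono_def)

text \<open>An arrow into the target of \<open>f\<close> is regarded as a generalised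
  element; it has a preimage under an epimorphism after passing to a cover of its domain of
  definition. This replaces elements in all later chases. The cover is the pullback, obtained as
  the kernel of the difference of \<open>f\<close> and \<open>y\<close> on the direct sum; it maps onto the domain of \<open>y\<close>
  because an arrow that kills it extends along the cokernel of that kernel.\<close>

lemma epi_cover:
  assumes "is_epi C f" "f \<in> Hom C X Y" "y \<in> Hom C W Y"
  obtains V r x where "is_epi C r" "r \<in> Hom C V W" "x \<in> Hom C V X" "f \<cdot> x = y \<cdot> r"
proof -
  have obs: "X \<in> Ob C" "W \<in> Ob C" "Y \<in> Ob C" using assms hom_ob by blast+
  obtain S i j p q where bi: "is_biproduct C X W S i j p q" using biproducts[OF obs(1,2)] by blast
  have h: "i \<in> Hom C X S" "j \<in> Hom C W S" "p \<in> Hom C S X" "q \<in> Hom C S W"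
    and e: "p \<cdot> i = Ide C X" "q \<cdot> j = Ide C W" "p \<cdot> j = Zer C W X" "q \<cdot> i = Zer C X W"
    using bi by (auto simp: is_biproduct_def)
  define d where "d = Plus C (f \<cdot> p) (Scal C (- 1) (y \<cdot> q))"
  have d: "d \<in> Hom C S Y" using assms h by (simp add: d_def cat_simps)
  have di: "d \<cdot> i = f" using assms h e obs by (simp add: d_def cat_simps)
  have depi: "is_epi C d"
  proof (rule is_epiI[OF d])
    fix T x assume x: "x \<in> Hom C Y T" "x \<cdot> d = Zer C S T"
    have "x \<cdot> f = (x \<cdot> d) \<cdot> i" using x(1) d h by (simp add: cat_simps di)
    then have "x \<cdot> f = Zer C X T" using x h hom_ob[OF x(1)] by (auto simp: cat_simps)
    then show "x = Zer C Y T" using epi_zer[OF assms(1,2) x(1)] by simp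
  qed
  obtain k where k: "is_kernel C d k" using kernels d by (auto simp: Hom_iff)
  define V where "V = Dom C k"
  have kh: "k \<in> Hom C V S" and kc: "d \<cdot> k = Zer C V Y" using is_kernelD[OF k d] by (auto simp: V_def)
  have coker: "is_cokernel C k d"
    using abelian_category.mono_kernel_of_cokernel[OF op_abelian, of d Y S k] depi d k by simp
  have eq: "f \<cdot> (p \<cdot> k) = y \<cdot> (q \<cdot> k)"
    by (rule diff_eq_zer[of _ V Y]) (use kc kh assms h in \<open>simp_all add: cat_simps d_def\<close>)
  have "is_epi C (q \<cdot> k)"
  proof (rule is_epiI[of _ V W])
    show "q \<cdot> k \<in> Hom C V W" using h kh by (simp add: cat_simps)
    fix T u assume u: "u \<in> Hom C W T" "u \<cdot> (q \<cdot> k) = Zer C V T"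
    have "(u \<cdot> q) \<cdot> k = Zer C V T" "u \<cdot> q \<in> Hom C S T" using u h kh by (simp_all add: cat_simps)
    then obtain v where v: "v \<in> Hom C Y T" "v \<cdot> d = u \<cdot> q"
      using cokernel_desc[OF coker kh, of "u \<cdot> q" T] unfolding cod_hom[OF d] by blast
    have "v \<cdot> f = (v \<cdot> d) \<cdot> i" using v(1) d h by (simp add: cat_simps di)
    also have "\<dots> = Zer C X T" using v(2) h u(1) e hom_ob[OF u(1)] by (auto simp: cat_simps)
    finally have "v = Zer C Y T" using epi_zer[OF assms(1,2) v(1)] by simp
    then have "u \<cdot> q = Zer C S T" using v d hom_ob[OF v(1)] by (auto simp: cat_simps)
    moreover have "u = (u \<cdot> q) \<cdot> j" using h u(1) e by (auto simp: cat_simps)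
    ultimately show "u = Zer C W T" using h hom_ob[OF u(1)] by (auto simp: cat_simps)
  qed
  then show ?thesis using that[of "q \<cdot> k" V "p \<cdot> k"] eq h kh by (auto simp: cat_simps)
qed

text \<open>Factoring through a monomorphism means being killed by its cokernel, which can be tested after
  composing with an epimorphism. This is how an arrow constructed on a cover becomes an arrow on
  the object itself.\<close>

lemma mono_lift_along_epi:
  assumes "is_mono C m" "m \<in> Hom C X Y" "is_epi C r" "r \<in> Hom C V W" "y \<in> Hom C W Y"
    "t \<in> Hom C V X" "m \<cdot> t = y \<cdot> r"
  shows "\<exists>h \<in> Hom C W X. m \<cdot> h = y"
proof -
  obtain q where q: "is_cokernel C m q" using cokernels assms(2) by (auto simp: Hom_iff)
  note qD = is_cokernelD[OF q assms(2)]
  have "(q \<cdot> y) \<cdot> r = (q \<cdot> m) \<cdot> t" using assms qD(1) by (simp add: cat_simps)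
  also have "\<dots> = Zer C V (Cod C q)" unfolding qD(2) using assms hom_ob[OF qD(1)] by (auto simp: cat_simps)
  finally have "q \<cdot> y = Zer C W (Cod C q)"
    using epi_zer[OF assms(3,4), of "q \<cdot> y"] assms qD(1) by (simp add: comp_hom)
  then show ?thesis
    using kernel_lift[OF mono_kernel_of_cokernel[OF assms(1,2) q] qD(1) assms(5)] assms(2) by (auto simp: Hom_iff)
qed

lemma mono_epi_iso:
  assumes "is_mono C f" "is_epi C f" "f \<in> Hom C X Y"
  shows "is_iso C f"
proof -
  have obs: "X \<in> Ob C" "Y \<in> Ob C" using hom_ob[OF assms(3)] by auto
  obtain h where h: "h \<in> Hom C Y X" "f \<cdot> h = Ide C Y"
    using mono_lift_along_epi[OF assms(1,3,2,3), of "Ide C Y" "Ide C X"] assms(3) obs by (auto simp: cat_simps)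
  have "f \<cdot> (h \<cdot> f) = f \<cdot> Ide C X" using h assms(3) by (auto simp: cat_simps reassoc[OF h(2)])
  then have "h \<cdot> f = Ide C X"
    using mono_cancel[OF assms(1,3), of "h \<cdot> f" X "Ide C X"] obs h assms(3) by (auto simp: cat_simps)
  then show ?thesis using is_isoI h assms(3) by blast
qed

lemma short_exactD:
  assumes "short_exact C i p" "i \<in> Hom C Y E"
  shows short_exact_hom: "p \<in> Hom C E (Cod C p)" and short_exact_comp: "p \<cdot> i = Zer C Y (Cod C p)"
    and short_exact_mono: "is_mono C i" and short_exact_epi: "is_epi C p"
    and short_exact_lift: "\<And>W x. \<lbrakk>x \<in> Hom C W E; p \<cdot> x = Zer C W (Cod C p)\<rbrakk> \<Longrightarrow> \<exists>h \<in> Hom C W Y. i \<cdot> h = x"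
    and short_exact_desc: "\<And>W x. \<lbrakk>x \<in> Hom C E W; x \<cdot> i = Zer C Y W\<rbrakk> \<Longrightarrow> \<exists>h \<in> Hom C (Cod C p) W. h \<cdot> p = x"
proof -
  have k: "is_kernel C p i" and c: "is_cokernel C i p" using assms by (auto simp: short_exact_def)
  show p: "p \<in> Hom C E (Cod C p)" using cokernel_hom[OF c assms(2)] .
  have "Dom C i = Y" using assms by (simp add: Hom_iff)
  then show "p \<cdot> i = Zer C Y (Cod C p)" "is_mono C i" "is_epi C p"
    "\<And>W x. \<lbrakk>x \<in> Hom C W E; p \<cdot> x = Zer C W (Cod C p)\<rbrakk> \<Longrightarrow> \<exists>h \<in> Hom C W Y. i \<cdot> h = x"
    "\<And>W x. \<lbrakk>x \<in> Hom C E W; x \<cdot> i = Zer C Y W\<rbrakk> \<Longrightarrow> \<exists>h \<in> Hom C (Cod C p) W. h \<cdot> p = x"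
    using is_kernelD[OF k p] is_cokernelD[OF c assms(2)] by auto
qed

lemma short_exactI_kernel:
  assumes "is_kernel C p i" "is_epi C p"
  shows "short_exact C i p"
  using abelian_category.cokernel_mono_short_exact[OF op_abelian, of p i] assms by simp

lemma short_exactI:
  assumes "i \<in> Hom C Y E" "p \<in> Hom C E X" "p \<cdot> i = Zer C Y X" "is_mono C i" "is_epi C p"
    "\<And>W x. \<lbrakk>x \<in> Hom C W E; p \<cdot> x = Zer C W X\<rbrakk> \<Longrightarrow> \<exists>h \<in> Hom C W Y. i \<cdot> h = x"
  shows "short_exact C i p"
  using short_exactI_kernel[OF is_kernelI[OF assms(2,1,3,4,6)] assms(5)] .

lemma short_five_mono:
  assumes "short_exact C i p" "i \<in> Hom C Y E" "p \<in> Hom C E X"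
    and "short_exact C i' p'" "i' \<in> Hom C Y' E'" "p' \<in> Hom C E' X'"
    and "a \<in> Hom C Y Y'" "m \<in> Hom C E E'" "b \<in> Hom C X X'" "m \<cdot> i = i' \<cdot> a" "p' \<cdot> m = b \<cdot> p"
    and "is_mono C a" "is_mono C b"
  shows "is_mono C m"
proof (rule is_monoI[OF assms(8)])
  fix W x assume x: "x \<in> Hom C W E" "m \<cdot> x = Zer C W E'"
  note s = short_exactD[OF assms(1,2)] and s' = short_exactD[OF assms(4,5)]
  have cod: "Cod C p = X" "Cod C p' = X'" and obs: "W \<in> Ob C" "X' \<in> Ob C" "Y' \<in> Ob C" "E \<in> Ob C"
    using assms x hom_ob by (auto simp: Hom_iff)
  have "b \<cdot> (p \<cdot> x) = p' \<cdot> (m \<cdot> x)"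
    using assms(3,6,8,9) x(1) by (auto simp: cat_simps reassoc[OF assms(11)])
  then have "b \<cdot> (p \<cdot> x) = Zer C W X'" using x(2) assms(6) obs by (auto simp: cat_simps)
  then have "p \<cdot> x = Zer C W X"
    using mono_zer[OF assms(13,9)] comp_hom[OF x(1) assms(3)] by blast
  then obtain y where y: "y \<in> Hom C W Y" "i \<cdot> y = x" using s(5)[OF x(1)] cod by auto
  have "i' \<cdot> (a \<cdot> y) = m \<cdot> x"
    using assms(2,5,7,8) y by (auto simp: cat_simps reassoc[OF assms(10)[symmetric]])
  then have "a \<cdot> y = Zer C W Y'"
    using mono_zer[OF s'(3) assms(5), of "a \<cdot> y"] x comp_hom[OF y(1) assms(7)] by auto
  then have "y = Zer C W Y" using mono_zer[OF assms(12,7) y(1)] by simp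
  then show "x = Zer C W E" using y assms(2) obs by (auto simp: cat_simps)
qed

lemma short_five:
  assumes "short_exact C i p" "i \<in> Hom C Y E" "p \<in> Hom C E X"
    and "short_exact C i' p'" "i' \<in> Hom C Y' E'" "p' \<in> Hom C E' X'"
    and "a \<in> Hom C Y Y'" "m \<in> Hom C E E'" "b \<in> Hom C X X'" "m \<cdot> i = i' \<cdot> a" "p' \<cdot> m = b \<cdot> p"
    and "is_iso C a" "is_iso C b"
  shows "is_iso C m"
proof -
  have "is_mono C m" using short_five_mono[OF assms(1-11)] iso_mono assms by blast
  moreover have "is_epi C m"
    using abelian_category.short_five_mono[OF op_abelian, of p' i' X' E' Y' p i X E Y b m a] assms iso_epi
    by simp
  ultimately show ?thesis using mono_epi_iso assms(8) by blast
qed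

end

section \<open>Morphisms of extensions\<close>

context linear_category
begin

lemma plus_diff_cancel:
  assumes "f \<in> Hom C X Y" "g \<in> Hom C X Y"
  shows "Plus C f (Plus C g (Scal C (- 1) f)) = g"
proof -
  have "Plus C f (Plus C g (Scal C (- 1) f)) = Plus C (Plus C g (Scal C (- 1) f)) f"
    using assms by (intro plus_comm) (simp_all add: Hom_iff typed)
  also have "\<dots> = Plus C g (Plus C (Scal C (- 1) f) f)"
    using assms by (intro plus_assoc) (simp_all add: Hom_iff typed)
  finally show ?thesis using assms by (simp add: cat_simps)
qed

lemma diff_zer_iff:
  assumes "f \<in> Hom C X Y" "g \<in> Hom C X Y"
  shows "Plus C f (Scal C (- 1) g) = Zer C X Y \<longleftrightarrow> f = g"
  using diff_eq_zer[OF assms] assms by (auto simp: cat_simps)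

lemma biproductD:
  assumes "is_biproduct C A B S i j p q"
  shows "S \<in> Ob C" "A \<in> Ob C" "B \<in> Ob C" "i \<in> Hom C A S" "j \<in> Hom C B S" "p \<in> Hom C S A" "q \<in> Hom C S B"
    "p \<cdot> i = Ide C A" "q \<cdot> j = Ide C B" "p \<cdot> j = Zer C B A" "q \<cdot> i = Zer C A B"
    "Plus C (i \<cdot> p) (j \<cdot> q) = Ide C S"
  using assms hom_ob unfolding is_biproduct_def by blast+

lemma biproduct_expand:
  assumes "is_biproduct C A B S i j p q" "x \<in> Hom C W S"
  shows "Plus C (i \<cdot> (p \<cdot> x)) (j \<cdot> (q \<cdot> x)) = x"
proof -
  note b = biproductD[OF assms(1)]
  have "Plus C (i \<cdot> (p \<cdot> x)) (j \<cdot> (q \<cdot> x)) = Plus C (i \<cdot> p) (j \<cdot> q) \<cdot> x"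
    using b(4-7) assms(2) by (simp add: cat_simps)
  then show ?thesis using b(12) assms(2) by (simp add: cat_simps)
qed

lemma biproduct_coexpand:
  assumes "is_biproduct C A B S i j p q" "x \<in> Hom C S W"
  shows "Plus C (x \<cdot> (i \<cdot> p)) (x \<cdot> (j \<cdot> q)) = x"
proof -
  note b = biproductD[OF assms(1)]
  have "Plus C (x \<cdot> (i \<cdot> p)) (x \<cdot> (j \<cdot> q)) = x \<cdot> Plus C (i \<cdot> p) (j \<cdot> q)"
    using b(4-7) assms(2) by (simp add: cat_simps)
  then show ?thesis using b(12) assms(2) by (simp add: cat_simps)
qed

lemma epi_of_comp:
  assumes "is_epi C (g \<cdot> f)" "f \<in> Hom C X Y" "g \<in> Hom C Y W"
  shows "is_epi C g"
proof (rule is_epiI[OF assms(3)])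
  fix T x assume x: "x \<in> Hom C W T" "x \<cdot> g = Zer C Y T"
  have "x \<cdot> (g \<cdot> f) = Zer C X T"
    using x assms(2,3) hom_ob[OF x(1)] by (simp add: cat_simps reassoc[OF x(2)])
  then show "x = Zer C W T" using epi_zer[OF assms(1) comp_hom[OF assms(2,3)] x(1)] by simp
qed

lemma mono_of_comp:
  assumes "is_mono C (g \<cdot> f)" "f \<in> Hom C X Y" "g \<in> Hom C Y W"
  shows "is_mono C f"
  using linear_category.epi_of_comp[OF op_linear, of f g W Y X] assms by simp

lemma mono_comp:
  assumes "is_mono C f" "f \<in> Hom C X Y" "is_mono C g" "g \<in> Hom C Y W"
  shows "is_mono C (g \<cdot> f)"
proof (rule is_monoI[OF comp_hom[OF assms(2,4)]])
  fix T x assume x: "x \<in> Hom C T X" "(g \<cdot> f) \<cdot> x = Zer C T W"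
  then have "g \<cdot> (f \<cdot> x) = Zer C T W" using assms by (simp add: cat_simps)
  then have "f \<cdot> x = Zer C T Y" using mono_zer[OF assms(3,4)] comp_hom[OF x(1) assms(2)] by blast
  then show "x = Zer C T X" using mono_zer[OF assms(1,2) x(1)] by simp
qed

lemma epi_comp:
  assumes "is_epi C f" "f \<in> Hom C X Y" "is_epi C g" "g \<in> Hom C Y W"
  shows "is_epi C (g \<cdot> f)"
  using linear_category.mono_comp[OF op_linear, of g W Y f X] assms by simp

lemma extensionE:
  assumes "e \<in> extensions C X Y"
  obtains i p E where "e = (i, p)" "short_exact C i p" "i \<in> Hom C Y E" "p \<in> Hom C E X"
proof -
  obtain i p where e: "e = (i, p)" by (cases e)
  then have "short_exact C i p" "Dom C i = Y" "Cod C p = X" using assms by (auto simp: extensions_def)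
  then show ?thesis using that[OF e, of "Cod C i"]
    by (auto simp: short_exact_def is_cokernel_def Hom_iff)
qed

lemma extension_iff:
  "\<lbrakk>i \<in> Hom C Y E; p \<in> Hom C E X\<rbrakk> \<Longrightarrow> (i, p) \<in> extensions C X Y \<longleftrightarrow> short_exact C i p"
  by (auto simp: extensions_def Hom_iff)

lemma extension_ob: "e \<in> extensions C X Y \<Longrightarrow> X \<in> Ob C \<and> Y \<in> Ob C"
  by (elim extensionE) (auto dest: hom_ob)

lemma ext_morphism_iff:
  assumes "i \<in> Hom C Y E" "p \<in> Hom C E X" "i' \<in> Hom C Y' E'" "p' \<in> Hom C E' X'"
  shows "ext_morphism C (i, p) (i', p') a b \<longleftrightarrow> a \<in> Hom C Y Y' \<and> b \<in> Hom C X X' \<and>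
    (\<exists>m \<in> Hom C E E'. m \<cdot> i = i' \<cdot> a \<and> p' \<cdot> m = b \<cdot> p)"
  using assms by (simp add: ext_morphism_def Hom_iff)

lemma ext_morphism_hom:
  assumes "e \<in> extensions C X Y" "e' \<in> extensions C X' Y'" "ext_morphism C e e' a b"
  shows "a \<in> Hom C Y Y'" "b \<in> Hom C X X'"
  using assms by (auto elim!: extensionE simp: ext_morphism_iff)

lemma ext_morphism_ide:
  assumes "e \<in> extensions C X Y"
  shows "ext_morphism C e e (Ide C Y) (Ide C X)"
proof -
  obtain i p E where e: "e = (i, p)" "i \<in> Hom C Y E" "p \<in> Hom C E X" using assms by (auto elim: extensionE)
  have "Ide C E \<in> Hom C E E" "Ide C E \<cdot> i = i \<cdot> Ide C Y" "p \<cdot> Ide C E = Ide C X \<cdot> p"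
    using e hom_ob[OF e(2)] by (simp_all add: cat_simps)
  then show ?thesis unfolding e(1) ext_morphism_iff[OF e(2,3) e(2,3)]
    using ide_hom hom_ob[OF e(2)] hom_ob[OF e(3)] by blast
qed

lemma ext_morphism_comp:
  assumes "e \<in> extensions C X Y" "e' \<in> extensions C X' Y'" "e'' \<in> extensions C X'' Y''"
    and "ext_morphism C e e' a b" "ext_morphism C e' e'' a' b'"
  shows "ext_morphism C e e'' (a' \<cdot> a) (b' \<cdot> b)"
proof -
  obtain i p E where e: "e = (i, p)" "i \<in> Hom C Y E" "p \<in> Hom C E X" using assms(1) by (auto elim: extensionE)
  obtain i' p' E' where e': "e' = (i', p')" "i' \<in> Hom C Y' E'" "p' \<in> Hom C E' X'"
    using assms(2) by (auto elim: extensionE)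
  obtain i'' p'' E'' where e'': "e'' = (i'', p'')" "i'' \<in> Hom C Y'' E''" "p'' \<in> Hom C E'' X''"
    using assms(3) by (auto elim: extensionE)
  obtain m where m: "a \<in> Hom C Y Y'" "b \<in> Hom C X X'" "m \<in> Hom C E E'" "m \<cdot> i = i' \<cdot> a" "p' \<cdot> m = b \<cdot> p"
    using assms(4) ext_morphism_iff[OF e(2,3) e'(2,3)] unfolding e(1) e'(1) by blast
  obtain m' where m': "a' \<in> Hom C Y' Y''" "b' \<in> Hom C X' X''" "m' \<in> Hom C E' E''"
    "m' \<cdot> i' = i'' \<cdot> a'" "p'' \<cdot> m' = b' \<cdot> p'"
    using assms(5) ext_morphism_iff[OF e'(2,3) e''(2,3)] unfolding e''(1) e'(1) by blast
  have "m' \<cdot> m \<in> Hom C E E''" "a' \<cdot> a \<in> Hom C Y Y''" "b' \<cdot> b \<in> Hom C X X''"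
    using m(1-3) m'(1-3) by (simp_all add: cat_simps)
  moreover have "(m' \<cdot> m) \<cdot> i = i'' \<cdot> (a' \<cdot> a)" "p'' \<cdot> (m' \<cdot> m) = (b' \<cdot> b) \<cdot> p"
    using m m' e(2,3) e'(2,3) e''(2,3)
    by (simp_all add: cat_simps reassoc[OF m'(4)] reassoc[OF m'(5)])
  ultimately show ?thesis
    unfolding e(1) e''(1) ext_morphism_iff[OF e(2,3) e''(2,3)] by blast
qed

lemma op_extension [simp]: "prod.swap e \<in> extensions (op_cat C) Y X \<longleftrightarrow> e \<in> extensions C X Y"
  by (cases e) (auto simp: extensions_def)

lemma op_ext_morphism:
  assumes "e \<in> extensions C X Y" "e' \<in> extensions C X' Y'"
  shows "ext_morphism (op_cat C) (prod.swap e') (prod.swap e) b a \<longleftrightarrow> ext_morphism C e e' a b"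
proof -
  obtain i p E where e: "e = (i, p)" "i \<in> Hom C Y E" "p \<in> Hom C E X" using assms(1) by (auto elim: extensionE)
  obtain i' p' E' where e': "e' = (i', p')" "i' \<in> Hom C Y' E'" "p' \<in> Hom C E' X'"
    using assms(2) by (auto elim: extensionE)
  show ?thesis using e(2,3) e'(2,3) unfolding e(1) e'(1)
    by (auto simp: ext_morphism_def Hom_iff)
qed

end

context abelian_category
begin

lemma epi_desc:
  assumes "is_epi C r" "r \<in> Hom C V W" "z \<in> Hom C V T"
    and "\<And>U k. \<lbrakk>k \<in> Hom C U V; r \<cdot> k = Zer C U W\<rbrakk> \<Longrightarrow> z \<cdot> k = Zer C U T"
  shows "\<exists>h \<in> Hom C W T. h \<cdot> r = z"
proof -
  obtain k where k: "is_kernel C r k" using kernels assms(2) by (auto simp: Hom_iff)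
  note kD = is_kernelD[OF k assms(2)]
  have "is_cokernel C k r"
    using abelian_category.mono_kernel_of_cokernel[OF op_abelian, of r W V k] assms(1,2) k by simp
  from cokernel_desc[OF this kD(1) assms(3) assms(4)[OF kD(1,2)]] show ?thesis
    unfolding cod_hom[OF assms(2)] .
qed

text \<open>A morphism of extensions that is the identity on the subobject is a pullback square on the
  right; this is what lets extensions be pulled back and compared without elements.\<close>

context
  fixes i\<^sub>1 p\<^sub>1 i p m b Y E\<^sub>1 X\<^sub>1 E X
  assumes s1: "short_exact C i\<^sub>1 p\<^sub>1" "i\<^sub>1 \<in> Hom C Y E\<^sub>1" "p\<^sub>1 \<in> Hom C E\<^sub>1 X\<^sub>1"
    and s: "short_exact C i p" "i \<in> Hom C Y E" "p \<in> Hom C E X"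
    and m: "m \<in> Hom C E\<^sub>1 E" "b \<in> Hom C X\<^sub>1 X" "m \<cdot> i\<^sub>1 = i" "p \<cdot> m = b \<cdot> p\<^sub>1"
begin

lemma ext_pullback_zer:
  assumes x: "x \<in> Hom C W E\<^sub>1" "m \<cdot> x = Zer C W E" "p\<^sub>1 \<cdot> x = Zer C W X\<^sub>1"
  shows "x = Zer C W E\<^sub>1"
proof -
  obtain y where y: "y \<in> Hom C W Y" "i\<^sub>1 \<cdot> y = x"
    using short_exact_lift[OF s1(1,2) x(1)] x(3) cod_hom[OF s1(3)] by auto
  have "i \<cdot> y = m \<cdot> x" using y(1) s1(2) m unfolding y(2)[symmetric] by (simp add: cat_simps reassoc[OF m(3)])
  then have "y = Zer C W Y" using mono_zer[OF short_exact_mono[OF s(1,2)] s(2) y(1)] x by simp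
  then show ?thesis using y(2) s1(2) hom_ob[OF x(1)] by (simp add: cat_simps)
qed

lemma ext_pullback_unique:
  assumes x: "x \<in> Hom C W E\<^sub>1" "x' \<in> Hom C W E\<^sub>1" "m \<cdot> x = m \<cdot> x'" "p\<^sub>1 \<cdot> x = p\<^sub>1 \<cdot> x'"
  shows "x = x'"
proof (rule diff_eq_zer[OF x(1,2)], rule ext_pullback_zer)
  show "Plus C x (Scal C (- 1) x') \<in> Hom C W E\<^sub>1" using x by (simp add: cat_simps)
  show "m \<cdot> Plus C x (Scal C (- 1) x') = Zer C W E" "p\<^sub>1 \<cdot> Plus C x (Scal C (- 1) x') = Zer C W X\<^sub>1"
    using x m(1) s1(3) by (simp_all add: cat_simps)
qed

text \<open>A preimage of \<open>y\<close> exists on a cover. Its image in \<open>E\<close> differs from \<open>x\<close> by something in the common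
  subobject \<open>Y\<close>; after correcting by it, both components are right. Arrows with prescribed
  components are unique, so that the result descends from the cover.\<close>

lemma ext_pullback_lift:
  assumes x: "x \<in> Hom C T E" "y \<in> Hom C T X\<^sub>1" "p \<cdot> x = b \<cdot> y"
  shows "\<exists>h \<in> Hom C T E\<^sub>1. m \<cdot> h = x \<and> p\<^sub>1 \<cdot> h = y"
proof -
  note d1 = short_exactD[OF s1(1,2), unfolded cod_hom[OF s1(3)]] and d = short_exactD[OF s(1,2), unfolded cod_hom[OF s(3)]]
  obtain V r z where r: "is_epi C r" "r \<in> Hom C V T" and z: "z \<in> Hom C V E\<^sub>1" "p\<^sub>1 \<cdot> z = y \<cdot> r"
    using epi_cover[OF d1(4) s1(3) x(2)] by blast
  have obs: "V \<in> Ob C" "X\<^sub>1 \<in> Ob C" "X \<in> Ob C" "E \<in> Ob C" "Y \<in> Ob C"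
    using hom_ob r(2) s1(3) s(2,3) by blast+
  have eq: "p \<cdot> (m \<cdot> z) = p \<cdot> (x \<cdot> r)"
    using x r(2) z m(1,2) s(3) s1(3) by (simp add: cat_simps reassoc[OF x(3)] reassoc[OF m(4)])
  have "\<exists>w \<in> Hom C V Y. i \<cdot> w = Plus C (x \<cdot> r) (Scal C (- 1) (m \<cdot> z))"
    using x(1) r(2) z(1) m(1) s(3) obs by (intro d(5)) (simp_all add: cat_simps eq)
  then obtain w where w: "w \<in> Hom C V Y" "i \<cdot> w = Plus C (x \<cdot> r) (Scal C (- 1) (m \<cdot> z))" by blast
  define z' where "z' = Plus C z (i\<^sub>1 \<cdot> w)"
  have z': "z' \<in> Hom C V E\<^sub>1" using z w(1) s1(2) by (simp add: z'_def cat_simps)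
  have pz': "p\<^sub>1 \<cdot> z' = y \<cdot> r"
    using z w(1) s1(2,3) x(2) r(2) obs by (simp add: z'_def cat_simps reassoc[OF d1(2)])
  have "m \<cdot> z' = Plus C (m \<cdot> z) (i \<cdot> w)"
    using z(1) w(1) m(1) s1(2) by (simp add: z'_def cat_simps reassoc[OF m(3)])
  then have mz': "m \<cdot> z' = x \<cdot> r" unfolding w(2)
    using plus_diff_cancel[of "m \<cdot> z" V E "x \<cdot> r"] z(1) m(1) x(1) r(2) by (simp add: comp_hom)
  have "\<exists>h \<in> Hom C T E\<^sub>1. h \<cdot> r = z'"
  proof (rule epi_desc[OF r z'])
    fix U k assume k: "k \<in> Hom C U V" "r \<cdot> k = Zer C U T"
    have ob: "T \<in> Ob C" "U \<in> Ob C" using hom_ob[OF x(1)] hom_ob[OF k(1)] by auto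
    show "z' \<cdot> k = Zer C U E\<^sub>1"
      by (rule ext_pullback_zer)
        (use k x(1,2) r(2) z' m(1) s1(3) ob in \<open>simp_all add: cat_simps reassoc[OF mz'] reassoc[OF pz']\<close>)
  qed
  then obtain h where h: "h \<in> Hom C T E\<^sub>1" "h \<cdot> r = z'" by blast
  have "(m \<cdot> h) \<cdot> r = x \<cdot> r" "(p\<^sub>1 \<cdot> h) \<cdot> r = y \<cdot> r"
    using h m(1) r(2) s1(3) mz' pz' by (simp_all add: cat_simps)
  then have "m \<cdot> h = x" "p\<^sub>1 \<cdot> h = y"
    using epi_cancel[OF r, of "m \<cdot> h" E x] epi_cancel[OF r, of "p\<^sub>1 \<cdot> h" X\<^sub>1 y] x(1,2) h(1) m(1) s1(3)
    by (simp_all add: comp_hom)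
  then show ?thesis using h by blast
qed

end

text \<open>The universal property of the pullback and, dually, of the pushout in terms of morphisms of
  extensions. All later comparisons of extensions are applications of these two rules.\<close>

lemma cancel_pull:
  assumes "e\<^sub>1 \<in> extensions C X\<^sub>1 Y" "e \<in> extensions C X Y" "e' \<in> extensions C X' Y'"
    and "ext_morphism C e\<^sub>1 e (Ide C Y) b" "ext_morphism C e' e a (b \<cdot> c)" "c \<in> Hom C X' X\<^sub>1"
  shows "ext_morphism C e' e\<^sub>1 a c"
proof -
  obtain i p E where e: "e = (i, p)" "short_exact C i p" "i \<in> Hom C Y E" "p \<in> Hom C E X"
    using assms(2) by (auto elim: extensionE)
  obtain i\<^sub>1 p\<^sub>1 E\<^sub>1 where e1: "e\<^sub>1 = (i\<^sub>1, p\<^sub>1)" "short_exact C i\<^sub>1 p\<^sub>1" "i\<^sub>1 \<in> Hom C Y E\<^sub>1" "p\<^sub>1 \<in> Hom C E\<^sub>1 X\<^sub>1"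
    using assms(1) by (auto elim: extensionE)
  obtain i' p' E' where e': "e' = (i', p')" "short_exact C i' p'" "i' \<in> Hom C Y' E'" "p' \<in> Hom C E' X'"
    using assms(3) by (auto elim: extensionE)
  obtain m where m: "b \<in> Hom C X\<^sub>1 X" "m \<in> Hom C E\<^sub>1 E" "m \<cdot> i\<^sub>1 = i" "p \<cdot> m = b \<cdot> p\<^sub>1"
    using assms(4) ext_morphism_iff[OF e1(3,4) e(3,4)] comp_ide_right[OF e(3)] unfolding e(1) e1(1) by auto
  obtain n where n: "a \<in> Hom C Y' Y" "n \<in> Hom C E' E" "n \<cdot> i' = i \<cdot> a" "p \<cdot> n = (b \<cdot> c) \<cdot> p'"
    using assms(5) ext_morphism_iff[OF e'(3,4) e(3,4)] unfolding e(1) e'(1) by auto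
  note ctx = e1(2-4) e(2-4) m(2,1,3,4)
  have "p \<cdot> n = b \<cdot> (c \<cdot> p')" using n(4) m(1) assms(6) e'(4) by (simp add: cat_simps)
  then obtain h where h: "h \<in> Hom C E' E\<^sub>1" "m \<cdot> h = n" "p\<^sub>1 \<cdot> h = c \<cdot> p'"
    using ext_pullback_lift[OF ctx n(2) comp_hom[OF e'(4) assms(6)]] by blast
  have "h \<cdot> i' = i\<^sub>1 \<cdot> a"
  proof (rule ext_pullback_unique[OF ctx, of _ Y'])
    have obs: "X' \<in> Ob C" "Y \<in> Ob C" "X\<^sub>1 \<in> Ob C" "Y' \<in> Ob C" using hom_ob e' e1 by blast+
    note z = short_exact_comp[OF e1(2,3)] short_exact_comp[OF e'(2,3)]
    show "m \<cdot> (h \<cdot> i') = m \<cdot> (i\<^sub>1 \<cdot> a)"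
      using h(1) e'(3) m(2) n(1) e1(3) by (simp add: cat_simps reassoc[OF h(2)] n(3) reassoc[OF m(3)])
    show "p\<^sub>1 \<cdot> (h \<cdot> i') = p\<^sub>1 \<cdot> (i\<^sub>1 \<cdot> a)"
      using h(1) e'(3,4) e1(3,4) n(1) assms(6) obs
      by (simp add: cat_simps reassoc[OF h(3)] z reassoc[OF z(1)])
  qed (use h(1) e'(3) n(1) e1(3) in \<open>simp_all add: comp_hom\<close>)
  then show ?thesis using h n(1) assms(6)
    unfolding e1(1) e'(1) ext_morphism_iff[OF e'(3,4) e1(3,4)] by blast
qed

lemma cancel_push:
  assumes "e \<in> extensions C X Y" "e\<^sub>1 \<in> extensions C X Y\<^sub>1" "e' \<in> extensions C X' Y'"
    and "ext_morphism C e e\<^sub>1 a (Ide C X)" "ext_morphism C e e' (c \<cdot> a) b" "c \<in> Hom C Y\<^sub>1 Y'"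
  shows "ext_morphism C e\<^sub>1 e' c b"
proof -
  interpret op: abelian_category "op_cat C" by (rule op_abelian)
  show ?thesis
    using op.cancel_pull[of "prod.swap e\<^sub>1" Y\<^sub>1 X "prod.swap e" Y "prod.swap e'" Y' X' a b c] assms
      op_ext_morphism[OF assms(1,2)] op_ext_morphism[OF assms(1,3)] op_ext_morphism[OF assms(2,3)]
    by simp
qed

text \<open>The middle term is the kernel of the difference of \<open>p\<close> and \<open>b\<close> on the direct sum of \<open>E\<close> and
  \<open>X\<^sub>1\<close>.\<close>

lemma pull_exists:
  assumes "e \<in> extensions C X Y" "b \<in> Hom C X\<^sub>1 X"
  obtains e\<^sub>1 where "e\<^sub>1 \<in> extensions C X\<^sub>1 Y" "ext_morphism C e\<^sub>1 e (Ide C Y) b"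
proof -
  obtain i p E where e: "e = (i, p)" "short_exact C i p" "i \<in> Hom C Y E" "p \<in> Hom C E X"
    using assms(1) by (auto elim: extensionE)
  note d = short_exactD[OF e(2,3), unfolded cod_hom[OF e(4)]]
  have obs: "X \<in> Ob C" "Y \<in> Ob C" "E \<in> Ob C" "X\<^sub>1 \<in> Ob C" using hom_ob e assms(2) by blast+
  obtain S \<iota> \<kappa> q\<^sub>1 q\<^sub>2 where bi: "is_biproduct C E X\<^sub>1 S \<iota> \<kappa> q\<^sub>1 q\<^sub>2" using biproducts[OF obs(3,4)] by blast
  note b = biproductD[OF bi]
  define g where "g = Plus C (p \<cdot> q\<^sub>1) (Scal C (- 1) (b \<cdot> q\<^sub>2))"
  have g: "g \<in> Hom C S X" using b e assms(2) by (simp add: g_def cat_simps)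
  have g_iff: "g \<cdot> x = Zer C W X \<longleftrightarrow> p \<cdot> (q\<^sub>1 \<cdot> x) = b \<cdot> (q\<^sub>2 \<cdot> x)" if "x \<in> Hom C W S" for x W
    using diff_zer_iff[of "p \<cdot> (q\<^sub>1 \<cdot> x)" W X "b \<cdot> (q\<^sub>2 \<cdot> x)"] b(4-7) e(3,4) assms(2) that
    by (simp add: g_def cat_simps)
  obtain k where k: "is_kernel C g k" using kernels g by (auto simp: Hom_iff)
  define E\<^sub>1 where "E\<^sub>1 = Dom C k"
  note kD = is_kernelD[OF k g, folded E\<^sub>1_def]
  have sq: "p \<cdot> (q\<^sub>1 \<cdot> k) = b \<cdot> (q\<^sub>2 \<cdot> k)" using g_iff[OF kD(1)] kD(2) by simp
  have "\<exists>h \<in> Hom C Y E\<^sub>1. k \<cdot> h = \<iota> \<cdot> i"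
    by (rule kD(4), use b e in \<open>simp add: comp_hom\<close>, subst g_iff)
      (use b e assms(2) d(2) obs in \<open>simp_all add: cat_simps reassoc[OF b(8)] reassoc[OF b(11)]\<close>)
  then obtain i\<^sub>1 where i1: "i\<^sub>1 \<in> Hom C Y E\<^sub>1" "k \<cdot> i\<^sub>1 = \<iota> \<cdot> i" by blast
  define p\<^sub>1 where "p\<^sub>1 = q\<^sub>2 \<cdot> k"
  have p1: "p\<^sub>1 \<in> Hom C E\<^sub>1 X\<^sub>1" using b kD by (simp add: p\<^sub>1_def comp_hom)
  have q1ki: "(q\<^sub>1 \<cdot> k) \<cdot> i\<^sub>1 = i"
    using b kD(1) i1 e by (simp add: cat_simps reassoc[OF b(8)])
  have "short_exact C i\<^sub>1 p\<^sub>1"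
  proof (rule short_exactI[OF i1(1) p1])
    show "p\<^sub>1 \<cdot> i\<^sub>1 = Zer C Y X\<^sub>1"
      using b kD(1) i1 e obs by (simp add: p\<^sub>1_def cat_simps reassoc[OF b(11)])
    have "is_mono C ((q\<^sub>1 \<cdot> k) \<cdot> i\<^sub>1)" using q1ki d(3) by simp
    then show "is_mono C i\<^sub>1" using mono_of_comp[OF _ i1(1) comp_hom[OF kD(1) b(6)]] by simp
    obtain V r z where r: "is_epi C r" "r \<in> Hom C V X\<^sub>1" and z: "z \<in> Hom C V E" "p \<cdot> z = b \<cdot> r"
      using epi_cover[OF d(4) e(4) assms(2)] by blast
    have "\<exists>t \<in> Hom C V E\<^sub>1. k \<cdot> t = Plus C (\<iota> \<cdot> z) (\<kappa> \<cdot> r)"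
      by (rule kD(4), use b z r in \<open>simp add: cat_simps\<close>, subst g_iff)
        (use b(1-7) z r e assms(2) obs in \<open>simp_all add: cat_simps reassoc[OF b(8)] reassoc[OF b(9)] reassoc[OF b(10)] reassoc[OF b(11)]\<close>)
    then obtain t where t: "t \<in> Hom C V E\<^sub>1" "k \<cdot> t = Plus C (\<iota> \<cdot> z) (\<kappa> \<cdot> r)" by blast
    have "p\<^sub>1 \<cdot> t = r"
      using t b(1-7) kD(1) r(2) z(1) obs by (simp add: p\<^sub>1_def cat_simps reassoc[OF b(9)] reassoc[OF b(11)])
    then show "is_epi C p\<^sub>1" using epi_of_comp[OF _ t(1) p1] r by simp
  next
    fix W x assume x: "x \<in> Hom C W E\<^sub>1" "p\<^sub>1 \<cdot> x = Zer C W X\<^sub>1"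
    have W: "W \<in> Ob C" using hom_ob[OF x(1)] by simp
    have q2: "q\<^sub>2 \<cdot> (k \<cdot> x) = Zer C W X\<^sub>1" using x kD(1) b by (simp add: p\<^sub>1_def cat_simps)
    have "p \<cdot> (q\<^sub>1 \<cdot> (k \<cdot> x)) = Zer C W X"
      using g_iff[OF comp_hom[OF x(1) kD(1)]] q2 kD(1) x(1) assms(2) W g obs
      by (simp add: cat_simps reassoc[OF kD(2)])
    then obtain y where y: "y \<in> Hom C W Y" "i \<cdot> y = q\<^sub>1 \<cdot> (k \<cdot> x)"
      using d(5)[OF comp_hom[OF comp_hom[OF x(1) kD(1)] b(6)]] by blast
    have "k \<cdot> x = Plus C (\<iota> \<cdot> (q\<^sub>1 \<cdot> (k \<cdot> x))) (\<kappa> \<cdot> (q\<^sub>2 \<cdot> (k \<cdot> x)))"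
      using biproduct_expand[OF bi comp_hom[OF x(1) kD(1)]] by simp
    also have "\<dots> = k \<cdot> (i\<^sub>1 \<cdot> y)"
      unfolding q2 y(2)[symmetric] using b y(1) i1 e kD(1) W by (simp add: cat_simps reassoc[OF i1(2)])
    finally have "x = i\<^sub>1 \<cdot> y" using mono_cancel[OF kD(3,1) x(1)] comp_hom[OF y(1) i1(1)] by simp
    then show "\<exists>h\<in>Hom C W Y. i\<^sub>1 \<cdot> h = x" using y by blast
  qed
  then have ext: "(i\<^sub>1, p\<^sub>1) \<in> extensions C X\<^sub>1 Y" using extension_iff[OF i1(1) p1] by simp
  have "q\<^sub>1 \<cdot> k \<in> Hom C E\<^sub>1 E" "(q\<^sub>1 \<cdot> k) \<cdot> i\<^sub>1 = i \<cdot> Ide C Y" "p \<cdot> (q\<^sub>1 \<cdot> k) = b \<cdot> p\<^sub>1"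
    using b kD q1ki e sq by (simp_all add: comp_hom comp_ide_right p\<^sub>1_def)
  then have "ext_morphism C (i\<^sub>1, p\<^sub>1) e (Ide C Y) b"
    unfolding e(1) ext_morphism_iff[OF i1(1) p1 e(3,4)] using ide_hom[OF obs(2)] assms(2) by blast
  then show ?thesis using that ext by blast
qed

lemma push_exists:
  assumes "e \<in> extensions C X Y" "a \<in> Hom C Y Y\<^sub>1"
  obtains e\<^sub>1 where "e\<^sub>1 \<in> extensions C X Y\<^sub>1" "ext_morphism C e e\<^sub>1 a (Ide C X)"
proof -
  interpret op: abelian_category "op_cat C" by (rule op_abelian)
  obtain e' where e': "e' \<in> extensions (op_cat C) Y\<^sub>1 X" "ext_morphism (op_cat C) e' (prod.swap e) (Ide C X) a"
    using op.pull_exists[of "prod.swap e" Y X a Y\<^sub>1] assms by auto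
  then have "prod.swap e' \<in> extensions C X Y\<^sub>1" using op_extension[of "prod.swap e'" Y\<^sub>1 X] by simp
  then show ?thesis using that[of "prod.swap e'"] op_ext_morphism[OF assms(1), of "prod.swap e'" X Y\<^sub>1] e' by simp
qed

end

section \<open>Finite-dimensional vector spaces\<close>

locale vect = module ring_of_type_algebra V for V :: "('k::field, 'v) module" (structure)
begin

lemma vsmult [simp, intro]: "x \<in> carrier V \<Longrightarrow> c \<odot> x \<in> carrier V"
  using smult_closed by simp

lemma vsmult_ldistr: "x \<in> carrier V \<Longrightarrow> (a + b) \<odot> x = a \<odot> x \<oplus> b \<odot> x"
  using smult_l_distr[of a b x] by simp

lemma vsmult_rdistr: "\<lbrakk>x \<in> carrier V; y \<in> carrier V\<rbrakk> \<Longrightarrow> a \<odot> (x \<oplus> y) = a \<odot> x \<oplus> a \<odot> y"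
  using smult_r_distr[of a x y] by simp

lemma vsmult_assoc: "x \<in> carrier V \<Longrightarrow> a \<odot> (b \<odot> x) = (a * b) \<odot> x"
  using smult_assoc1[of a b x] by simp

lemma vsmult_one [simp]: "x \<in> carrier V \<Longrightarrow> 1 \<odot> x = x"
  using smult_one[of x] by simp

lemma vsmult_zero [simp]: "x \<in> carrier V \<Longrightarrow> 0 \<odot> x = \<zero>"
  using smult_l_null[of x] by simp

lemma vsmult_null [simp]: "c \<odot> \<zero> = \<zero>"
  using smult_r_null[of c] by simp

lemma vneg: "x \<in> carrier V \<Longrightarrow> x \<oplus> (- 1) \<odot> x = \<zero>"
  using vsmult_ldistr[of x 1 "-1"] by simp

lemma add_swap:
  "\<lbrakk>a \<in> carrier V; b \<in> carrier V; c \<in> carrier V; d \<in> carrier V\<rbrakk> \<Longrightarrow>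
     (a \<oplus> b) \<oplus> (c \<oplus> d) = (a \<oplus> c) \<oplus> (b \<oplus> d)"
  by (simp add: M.a_assoc M.a_lcomm)

lemma vneg_cancel: "\<lbrakk>x \<in> carrier V; y \<in> carrier V\<rbrakk> \<Longrightarrow> y \<oplus> (x \<oplus> (- 1) \<odot> y) = x"
  using vneg[of y] by (simp add: M.a_lcomm)

end

text \<open>Spans are defined by recursion on lists, because vectors are added and eliminated one at a time.\<close>

primrec lspan :: "('k::field, 'v) module \<Rightarrow> 'v list \<Rightarrow> 'v set" where
  "lspan V [] = {\<zero>\<^bsub>V\<^esub>}"
| "lspan V (b # bs) = {c \<odot>\<^bsub>V\<^esub> b \<oplus>\<^bsub>V\<^esub> v |c v. v \<in> lspan V bs}"

context vect
begin

lemma lspan_closed: "set bs \<subseteq> carrier V \<Longrightarrow> lspan V bs \<subseteq> carrier V"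
  by (induction bs) auto

lemma lspan_append:
  assumes "set xs \<subseteq> carrier V" "set ys \<subseteq> carrier V" "x \<in> lspan V xs" "y \<in> lspan V ys"
  shows "x \<oplus> y \<in> lspan V (xs @ ys)"
  using assms
proof (induction xs arbitrary: x)
  case Nil
  then show ?case using lspan_closed[of ys] by auto
next
  case (Cons b xs)
  then obtain c v where v: "x = c \<odot> b \<oplus> v" "v \<in> lspan V xs" by auto
  have "x \<oplus> y = c \<odot> b \<oplus> (v \<oplus> y)"
    using v Cons.prems lspan_closed[of xs] lspan_closed[of ys] by (auto simp: M.a_assoc subset_iff)
  then show ?case using Cons v by auto
qed

lemma lspan_add:
  assumes "set bs \<subseteq> carrier V" "x \<in> lspan V bs" "y \<in> lspan V bs"
  shows "x \<oplus> y \<in> lspan V bs"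
  using assms
proof (induction bs arbitrary: x y)
  case (Cons b bs)
  then obtain c v d w where v: "x = c \<odot> b \<oplus> v" "v \<in> lspan V bs" "y = d \<odot> b \<oplus> w" "w \<in> lspan V bs" by auto
  then have "v \<in> carrier V" "w \<in> carrier V" "b \<in> carrier V" using lspan_closed[of bs] Cons.prems by auto
  then have "x \<oplus> y = (c + d) \<odot> b \<oplus> (v \<oplus> w)"
    unfolding v(1,3) by (simp add: vsmult_ldistr add_swap)
  then show ?case using Cons v by auto
qed auto

lemma lspan_smult:
  assumes "set bs \<subseteq> carrier V" "x \<in> lspan V bs"
  shows "a \<odot> x \<in> lspan V bs"
  using assms
proof (induction bs arbitrary: x)
  case (Cons b bs)
  then obtain c v where v: "x = c \<odot> b \<oplus> v" "v \<in> lspan V bs" by auto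
  then have "v \<in> carrier V" "b \<in> carrier V" using lspan_closed[of bs] Cons.prems by auto
  then have "a \<odot> x = (a * c) \<odot> b \<oplus> a \<odot> v"
    using v by (simp add: vsmult_rdistr vsmult_assoc)
  then show ?case using Cons v by auto
qed auto

lemma lspan_upt:
  assumes "b \<in> {..<d::nat} \<rightarrow> carrier V"
  shows "lspan V (map b (rev [0..<d])) = {\<Oplus>i\<in>{..<d}. c i \<odot> b i |c. True}"
  using assms
proof (induction d)
  case (Suc d)
  have sum: "(\<Oplus>i\<in>{..<Suc d}. c i \<odot> b i) = c d \<odot> b d \<oplus> (\<Oplus>i\<in>{..<d}. c i \<odot> b i)" for c
    using Suc.prems by (subst lessThan_Suc, subst M.finsum_insert) auto
  have "b \<in> {..<d} \<rightarrow> carrier V" using Suc.prems by auto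
  from Suc.IH[OF this]
  have "lspan V (map b (rev [0..<Suc d])) = {x \<odot> b d \<oplus> (\<Oplus>i\<in>{..<d}. c i \<odot> b i) |x c. True}"
    by auto
  also have "\<dots> = {c d \<odot> b d \<oplus> (\<Oplus>i\<in>{..<d}. c i \<odot> b i) |c. True}"
  proof (intro equalityI subsetI)
    fix y assume "y \<in> {x \<odot> b d \<oplus> (\<Oplus>i\<in>{..<d}. c i \<odot> b i) |x c. True}"
    then obtain x c where y: "y = x \<odot> b d \<oplus> (\<Oplus>i\<in>{..<d}. c i \<odot> b i)" by blast
    have "(\<Oplus>i\<in>{..<d}. (c(d := x)) i \<odot> b i) = (\<Oplus>i\<in>{..<d}. c i \<odot> b i)"
      using Suc.prems by (intro M.finsum_cong') auto
    then have "y = (c(d := x)) d \<odot> b d \<oplus> (\<Oplus>i\<in>{..<d}. (c(d := x)) i \<odot> b i)" using y by simp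
    then show "y \<in> {c d \<odot> b d \<oplus> (\<Oplus>i\<in>{..<d}. c i \<odot> b i) |c. True}" by blast
  qed blast
  finally show ?case unfolding sum .
qed simp

lemma finite_dim_iff: "finite_dim V \<longleftrightarrow> (\<exists>bs. set bs \<subseteq> carrier V \<and> carrier V \<subseteq> lspan V bs)"
proof
  assume "finite_dim V"
  then obtain d b where b: "b \<in> {..<d::nat} \<rightarrow> carrier V"
    "\<forall>v\<in>carrier V. \<exists>c. v = (\<Oplus>i\<in>{..<d}. c i \<odot> b i)" unfolding finite_dim_def by blast
  then have "set (map b (rev [0..<d])) \<subseteq> carrier V" "carrier V \<subseteq> lspan V (map b (rev [0..<d]))"
    unfolding lspan_upt[OF b(1)] by auto
  then show "\<exists>bs. set bs \<subseteq> carrier V \<and> carrier V \<subseteq> lspan V bs" by blast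
next
  assume "\<exists>bs. set bs \<subseteq> carrier V \<and> carrier V \<subseteq> lspan V bs"
  then obtain bs where bs: "set bs \<subseteq> carrier V" "carrier V \<subseteq> lspan V bs" by blast
  define b where "b = (!) (rev bs)"
  have b: "b \<in> {..<length bs} \<rightarrow> carrier V" using bs(1) nth_mem[of _ "rev bs"] by (auto simp: b_def)
  have "map b (rev [0..<length bs]) = bs"
    using map_nth[of "rev bs"] unfolding b_def rev_map[symmetric] by simp
  then show "finite_dim V" unfolding finite_dim_def
    using bs b lspan_upt[OF b] by (intro exI[of _ "length bs"] exI[of _ b]) auto
qed

text \<open>Elimination of one vector: if some \<open>h\<close> in \<open>H\<close> involves the first vector of the list, a multiple of
  \<open>h\<close> can be subtracted from every other element of \<open>H\<close> to remove that vector from it.\<close>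

lemma subspace_lspan:
  assumes "set bs \<subseteq> carrier V" "H \<subseteq> lspan V bs"
    and "\<And>x y. \<lbrakk>x \<in> H; y \<in> H\<rbrakk> \<Longrightarrow> x \<oplus> y \<in> H" and "\<And>a x. x \<in> H \<Longrightarrow> a \<odot> x \<in> H"
  shows "\<exists>hs. set hs \<subseteq> H \<and> H \<subseteq> lspan V hs"
  using assms
proof (induction bs arbitrary: H)
  case Nil
  then have "set [] \<subseteq> H \<and> H \<subseteq> lspan V []" by auto
  then show ?case by blast
next
  case (Cons b bs)
  have sub: "set bs \<subseteq> carrier V" "b \<in> carrier V" "H \<subseteq> carrier V"
    using Cons.prems lspan_closed[of "b # bs"] by auto
  obtain hs where hs: "set hs \<subseteq> H \<inter> lspan V bs" "H \<inter> lspan V bs \<subseteq> lspan V hs"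
    using Cons.IH[of "H \<inter> lspan V bs"] Cons.prems sub lspan_add[OF sub(1)] lspan_smult[OF sub(1)] by blast
  show ?case
  proof (cases "H \<subseteq> lspan V bs")
    case True
    then show ?thesis using hs by blast
  next
    case False
    then obtain h where h: "h \<in> H" "h \<notin> lspan V bs" by blast
    then obtain c v where v: "h = c \<odot> b \<oplus> v" "v \<in> lspan V bs" using Cons.prems(2) by auto
    have vc: "v \<in> carrier V" "h \<in> carrier V" using v(2) lspan_closed[OF sub(1)] h(1) sub by auto
    have c: "c \<noteq> 0" using h(2) v vc sub by auto
    have "H \<subseteq> lspan V (h # hs)"
    proof
      fix x assume x: "x \<in> H"
      then obtain d w where w: "x = d \<odot> b \<oplus> w" "w \<in> lspan V bs" using Cons.prems(2) by auto
      have wc: "w \<in> carrier V" "x \<in> carrier V" using w(2) lspan_closed[OF sub(1)] x sub by auto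
      define y where "y = x \<oplus> (- 1) \<odot> ((d / c) \<odot> h)"
      have "(- 1) \<odot> ((d / c) \<odot> h) = (- d) \<odot> b \<oplus> (- (d / c)) \<odot> v"
        using vc sub c unfolding v(1) by (simp add: vsmult_rdistr vsmult_assoc)
      then have "y = (d \<odot> b \<oplus> w) \<oplus> ((- d) \<odot> b \<oplus> (- (d / c)) \<odot> v)"
        unfolding y_def w(1) by simp
      also have "\<dots> = (d \<odot> b \<oplus> (- d) \<odot> b) \<oplus> (w \<oplus> (- (d / c)) \<odot> v)"
        using wc vc sub by (intro add_swap) auto
      also have "d \<odot> b \<oplus> (- d) \<odot> b = \<zero>" using vsmult_ldistr[of b d "-d"] sub by simp
      finally have y: "y = w \<oplus> (- (d / c)) \<odot> v" using wc vc by simp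
      have "y \<in> lspan V bs" unfolding y by (rule lspan_add[OF sub(1) w(2) lspan_smult[OF sub(1) v(2)]])
      moreover have "y \<in> H" unfolding y_def by (intro Cons.prems(3) x Cons.prems(4) h(1))
      ultimately have "y \<in> lspan V hs" using hs by blast
      moreover have "x = (d / c) \<odot> h \<oplus> y"
        unfolding y_def using vneg_cancel[of x "(d / c) \<odot> h"] wc vc by simp
      ultimately show "x \<in> lspan V (h # hs)" by auto
    qed
    then show ?thesis using h hs by (intro exI[of _ "h # hs"]) auto
  qed
qed

end

definition lin_map :: "('k::field, 'v) module \<Rightarrow> ('k, 'w) module \<Rightarrow> ('v \<Rightarrow> 'w) \<Rightarrow> bool" where
  "lin_map V W f \<longleftrightarrow> f \<in> carrier V \<rightarrow> carrier W \<and>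
     (\<forall>x\<in>carrier V. \<forall>y\<in>carrier V. f (x \<oplus>\<^bsub>V\<^esub> y) = f x \<oplus>\<^bsub>W\<^esub> f y) \<and>
     (\<forall>c. \<forall>x\<in>carrier V. f (c \<odot>\<^bsub>V\<^esub> x) = c \<odot>\<^bsub>W\<^esub> f x)"

lemma lin_map_zero:
  assumes "vect V" "vect W" "lin_map V W f"
  shows "f \<zero>\<^bsub>V\<^esub> = \<zero>\<^bsub>W\<^esub>"
proof -
  interpret V: vect V by fact
  interpret W: vect W by fact
  have "\<forall>c. f (c \<odot>\<^bsub>V\<^esub> \<zero>\<^bsub>V\<^esub>) = c \<odot>\<^bsub>W\<^esub> f \<zero>\<^bsub>V\<^esub>" "f \<zero>\<^bsub>V\<^esub> \<in> carrier W"
    using assms(3) by (auto simp only: lin_map_def V.M.zero_closed Pi_iff)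
  then have "f (0 \<odot>\<^bsub>V\<^esub> \<zero>\<^bsub>V\<^esub>) = 0 \<odot>\<^bsub>W\<^esub> f \<zero>\<^bsub>V\<^esub>" "f \<zero>\<^bsub>V\<^esub> \<in> carrier W" by blast+
  then show ?thesis by (simp only: V.vsmult_null W.vsmult_zero)
qed

lemma lspan_map:
  assumes "vect V" "vect W" "lin_map V W f" "set bs \<subseteq> carrier V"
  shows "lspan W (map f bs) = f ` lspan V bs"
  using assms(4)
proof (induction bs)
  case Nil
  then show ?case using lin_map_zero[OF assms(1-3)] by simp
next
  case (Cons b bs)
  interpret V: vect V by fact
  have "f (c \<odot>\<^bsub>V\<^esub> b \<oplus>\<^bsub>V\<^esub> v) = c \<odot>\<^bsub>W\<^esub> f b \<oplus>\<^bsub>W\<^esub> f v" if "v \<in> lspan V bs" for c v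
    using assms(3) Cons.prems V.lspan_closed[of bs] that by (auto simp: lin_map_def subset_iff)
  then have eq: "f (c \<odot>\<^bsub>V\<^esub> b \<oplus>\<^bsub>V\<^esub> v) = c \<odot>\<^bsub>W\<^esub> f b \<oplus>\<^bsub>W\<^esub> f v" if "v \<in> lspan V bs" for c v
    using that by blast
  have "f ` lspan V (b # bs) = {f (c \<odot>\<^bsub>V\<^esub> b \<oplus>\<^bsub>V\<^esub> v) |c v. v \<in> lspan V bs}" by auto
  also have "\<dots> = {c \<odot>\<^bsub>W\<^esub> f b \<oplus>\<^bsub>W\<^esub> f v |c v. v \<in> lspan V bs}"
    using eq by (intro Collect_cong) metis
  also have "\<dots> = {c \<odot>\<^bsub>W\<^esub> f b \<oplus>\<^bsub>W\<^esub> w |c w. w \<in> f ` lspan V bs}" by blast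
  finally show ?case using Cons by simp
qed

lemma finite_dim_surj:
  assumes "vect V" "vect W" "lin_map V W f" "finite_dim V" "carrier W \<subseteq> f ` carrier V"
  shows "finite_dim W"
proof -
  obtain bs where bs: "set bs \<subseteq> carrier V" "carrier V \<subseteq> lspan V bs"
    using assms(4) vect.finite_dim_iff[OF assms(1)] by blast
  have "set (map f bs) \<subseteq> carrier W" using bs assms(3) by (auto simp: lin_map_def)
  moreover have "carrier W \<subseteq> lspan W (map f bs)"
    unfolding lspan_map[OF assms(1-3) bs(1)] using bs assms(5) by blast
  ultimately show ?thesis using vect.finite_dim_iff[OF assms(2)] by blast
qed

text \<open>Lifts of a spanning list of the image of \<open>g\<close> span together with the images of a spanning list of
  \<open>U\<close>.\<close>

lemma finite_dim_exact:
  assumes "vect U" "vect V" "vect W" "lin_map U V f" "lin_map V W g" "finite_dim U" "finite_dim W"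
    and exact: "\<And>v. \<lbrakk>v \<in> carrier V; g v = \<zero>\<^bsub>W\<^esub>\<rbrakk> \<Longrightarrow> v \<in> f ` carrier U"
  shows "finite_dim V"
proof -
  interpret U: vect U by fact
  interpret V: vect V by fact
  interpret W: vect W by fact
  have g: "g v \<in> carrier W" "g (v \<oplus>\<^bsub>V\<^esub> w) = g v \<oplus>\<^bsub>W\<^esub> g w" "g (c \<odot>\<^bsub>V\<^esub> v) = c \<odot>\<^bsub>W\<^esub> g v"
    if "v \<in> carrier V" "w \<in> carrier V" for v w c
    using assms(5) that by (auto simp: lin_map_def)
  obtain us where us: "set us \<subseteq> carrier U" "carrier U \<subseteq> lspan U us"
    using assms(6) U.finite_dim_iff by blast
  obtain ws where ws: "set ws \<subseteq> carrier W" "carrier W \<subseteq> lspan W ws"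
    using assms(7) W.finite_dim_iff by blast
  have "\<exists>hs. set hs \<subseteq> g ` carrier V \<and> g ` carrier V \<subseteq> lspan W hs"
  proof (rule W.subspace_lspan[OF ws(1)])
    show "g ` carrier V \<subseteq> lspan W ws" using g(1) ws(2) by auto
    show "x \<oplus>\<^bsub>W\<^esub> y \<in> g ` carrier V" if "x \<in> g ` carrier V" "y \<in> g ` carrier V" for x y
      using that g(2)[symmetric] by auto
    show "a \<odot>\<^bsub>W\<^esub> x \<in> g ` carrier V" if "x \<in> g ` carrier V" for a x
      using that g(3)[symmetric] by auto
  qed
  then obtain hs where hs: "set hs \<subseteq> g ` carrier V" "g ` carrier V \<subseteq> lspan W hs" by blast
  obtain vs where vs: "set vs \<subseteq> carrier V" "map g vs = hs"
  proof -
    define s where "s h = (SOME v. v \<in> carrier V \<and> g v = h)" for h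
    have s: "s h \<in> carrier V \<and> g (s h) = h" if "h \<in> set hs" for h
    proof -
      have "\<exists>v. v \<in> carrier V \<and> g v = h" using that hs by auto
      then show ?thesis unfolding s_def by (rule someI_ex)
    qed
    have "map g (map s hs) = hs" using s by (auto intro: map_idI)
    then show ?thesis using that[of "map s hs"] s by auto
  qed
  have fus: "set (map f us) \<subseteq> carrier V" using us assms(4) by (auto simp: lin_map_def)
  have "carrier V \<subseteq> lspan V (vs @ map f us)"
  proof
    fix v assume v: "v \<in> carrier V"
    then have "g v \<in> g ` lspan V vs"
      using hs lspan_map[OF assms(2,3,5) vs(1)] vs(2) by auto
    then obtain w where w: "w \<in> lspan V vs" "g v = g w" by blast
    have wc: "w \<in> carrier V" using w V.lspan_closed[OF vs(1)] by blast
    define x where "x = v \<oplus>\<^bsub>V\<^esub> (- 1) \<odot>\<^bsub>V\<^esub> w"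
    have x: "x \<in> carrier V" using v wc by (simp add: x_def)
    have "g x = g v \<oplus>\<^bsub>W\<^esub> (- 1) \<odot>\<^bsub>W\<^esub> g w" using v wc by (simp add: x_def g)
    then have "g x = \<zero>\<^bsub>W\<^esub>" using W.vneg[OF g(1)[OF v v]] w by simp
    then obtain u where "u \<in> carrier U" "x = f u" using exact[OF x] by blast
    then have "x \<in> lspan V (map f us)" unfolding lspan_map[OF assms(1,2,4) us(1)] using us by blast
    then have "w \<oplus>\<^bsub>V\<^esub> x \<in> lspan V (vs @ map f us)" using V.lspan_append[OF vs(1) fus w(1)] by blast
    then show "v \<in> lspan V (vs @ map f us)" using V.vneg_cancel[OF v wc] by (simp add: x_def)
  qed
  then show ?thesis using V.finite_dim_iff vs fus by (metis le_sup_iff set_append)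
qed

section \<open>The vector space of extensions\<close>

text \<open>For an extension \<open>u\<close> of \<open>X\<close> by \<open>T\<close> and an arrow \<open>f\<close> from \<open>T\<close> to \<open>Y\<close> this is the class \<open>f\<^sub>* u\<close> of
  the pushouts of \<open>u\<close> along \<open>f\<close>.\<close>

definition ext_push :: "('k, 'o, 'm) lin_cat \<Rightarrow> 'o \<Rightarrow> 'o \<Rightarrow> 'm \<times> 'm \<Rightarrow> 'm \<Rightarrow> ('m \<times> 'm) set" where
  "ext_push C X Y u f = {e \<in> extensions C X Y. ext_morphism C u e f (Ide C X)}"

lemma carrier_Ext1 [simp]: "carrier (Ext1 C X Y) = extensions C X Y // ext_equiv C X Y"
  by (simp add: Ext1_def)

context abelian_category
begin

abbreviation EP where "EP \<equiv> ext_push C"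

lemma push_comp:
  assumes "u \<in> extensions C X T" "e \<in> extensions C X Y" "e' \<in> extensions C X Y'"
    "ext_morphism C u e f (Ide C X)" "ext_morphism C e e' g (Ide C X)"
  shows "ext_morphism C u e' (g \<cdot> f) (Ide C X)"
  using ext_morphism_comp[OF assms] ide_hom[of X] extension_ob[OF assms(1)] comp_ide_left[of "Ide C X" X X] by simp

lemma push_equiv:
  assumes "u \<in> extensions C X T" "e \<in> extensions C X Y" "e' \<in> extensions C X Y"
    "ext_morphism C u e f (Ide C X)" "ext_morphism C u e' f (Ide C X)"
  shows "ext_morphism C e e' (Ide C Y) (Ide C X)"
  using cancel_push[OF assms(1,2,3,4), of "Ide C Y" "Ide C X"] assms(5) extension_ob[OF assms(2)]
    ext_morphism_hom[OF assms(1,2,4)] by (simp add: comp_ide_left ide_hom)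

lemma ext_pushI: "\<lbrakk>e \<in> extensions C X Y; ext_morphism C u e f (Ide C X)\<rbrakk> \<Longrightarrow> e \<in> EP X Y u f"
  by (simp add: ext_push_def)

lemma ext_pushD:
  assumes "e \<in> EP X Y u f"
  shows "e \<in> extensions C X Y" "ext_morphism C u e f (Ide C X)"
  using assms by (auto simp: ext_push_def)

lemma ext_push_nonempty:
  assumes "u \<in> extensions C X T" "f \<in> Hom C T Y"
  obtains e where "e \<in> EP X Y u f"
proof -
  obtain e where "e \<in> extensions C X Y" "ext_morphism C u e f (Ide C X)" using push_exists[OF assms] .
  then show ?thesis using that[OF ext_pushI] by blast
qed

lemma ext_push_class:
  assumes "u \<in> extensions C X T" "e \<in> EP X Y u f"
  shows "EP X Y u f = ext_equiv C X Y `` {e}"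
proof -
  note e = ext_pushD[OF assms(2)]
  have a: "ext_morphism C u e' f (Ide C X)" if "(e, e') \<in> ext_equiv C X Y" for e'
    using push_comp[OF assms(1) e(1) _ e(2), of e' Y "Ide C Y"] that
      comp_ide_left[OF ext_morphism_hom(1)[OF assms(1) e]] by (auto simp: ext_equiv_def)
  have b: "(e, e') \<in> ext_equiv C X Y" if "e' \<in> EP X Y u f" for e'
    using push_equiv[OF assms(1) e(1) ext_pushD(1)[OF that] e(2) ext_pushD(2)[OF that]] e(1) ext_pushD(1)[OF that]
    by (simp add: ext_equiv_def)
  show ?thesis
  proof (intro equalityI subsetI)
    fix x assume "x \<in> ext_equiv C X Y `` {e}"
    then have x: "(e, x) \<in> ext_equiv C X Y" by simp
    then have "x \<in> extensions C X Y" unfolding ext_equiv_def by simp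
    then show "x \<in> EP X Y u f" using a[OF x] by (rule ext_pushI)
  qed (simp add: b)
qed

lemma ext_push_carrier:
  assumes "u \<in> extensions C X T" "f \<in> Hom C T Y"
  shows "EP X Y u f \<in> carrier (Ext1 C X Y)"
proof -
  obtain e where e: "e \<in> EP X Y u f" using ext_push_nonempty[OF assms] .
  then show ?thesis using ext_push_class[OF assms(1) e] ext_pushD(1)[OF e] by (simp add: quotientI)
qed

lemma Ext1_carrierE:
  assumes "A \<in> carrier (Ext1 C X Y)"
  obtains e where "e \<in> extensions C X Y" "A = EP X Y e (Ide C Y)"
proof -
  obtain e where e: "e \<in> extensions C X Y" "A = ext_equiv C X Y `` {e}" using assms by (auto elim: quotientE)
  then have "e \<in> EP X Y e (Ide C Y)" using ext_morphism_ide by (simp add: ext_pushI)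
  then show ?thesis using that e ext_push_class by blast
qed

lemma ext_push_push:
  assumes "u \<in> extensions C X T" "v \<in> extensions C X T'" "ext_morphism C u v f (Ide C X)" "g \<in> Hom C T' Y"
  shows "EP X Y v g = EP X Y u (g \<cdot> f)"
proof -
  have "ext_morphism C v e g (Ide C X) \<longleftrightarrow> ext_morphism C u e (g \<cdot> f) (Ide C X)" if "e \<in> extensions C X Y" for e
    using push_comp[OF assms(1,2) that assms(3)] cancel_push[OF assms(1,2) that assms(3) _ assms(4)] by blast
  then show ?thesis by (auto simp: ext_push_def)
qed

lemma direct_sum_short_exact:
  assumes e1: "short_exact C i\<^sub>1 p\<^sub>1" "i\<^sub>1 \<in> Hom C Y\<^sub>1 E\<^sub>1" "p\<^sub>1 \<in> Hom C E\<^sub>1 X\<^sub>1"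
    and e2: "short_exact C i\<^sub>2 p\<^sub>2" "i\<^sub>2 \<in> Hom C Y\<^sub>2 E\<^sub>2" "p\<^sub>2 \<in> Hom C E\<^sub>2 X\<^sub>2"
    and YY: "is_biproduct C Y\<^sub>1 Y\<^sub>2 YY s\<^sub>1 s\<^sub>2 r\<^sub>1 r\<^sub>2" and XX: "is_biproduct C X\<^sub>1 X\<^sub>2 XX t\<^sub>1 t\<^sub>2 q\<^sub>1 q\<^sub>2"
    and EE: "is_biproduct C E\<^sub>1 E\<^sub>2 EE u\<^sub>1 u\<^sub>2 v\<^sub>1 v\<^sub>2"
  defines "i \<equiv> Plus C (u\<^sub>1 \<cdot> i\<^sub>1 \<cdot> r\<^sub>1) (u\<^sub>2 \<cdot> i\<^sub>2 \<cdot> r\<^sub>2)" and "p \<equiv> Plus C (t\<^sub>1 \<cdot> p\<^sub>1 \<cdot> v\<^sub>1) (t\<^sub>2 \<cdot> p\<^sub>2 \<cdot> v\<^sub>2)"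
  shows "(i, p) \<in> extensions C XX YY" and "i \<in> Hom C YY EE" and "p \<in> Hom C EE XX"
    and "v\<^sub>1 \<cdot> i = i\<^sub>1 \<cdot> r\<^sub>1" and "v\<^sub>2 \<cdot> i = i\<^sub>2 \<cdot> r\<^sub>2" and "q\<^sub>1 \<cdot> p = p\<^sub>1 \<cdot> v\<^sub>1" and "q\<^sub>2 \<cdot> p = p\<^sub>2 \<cdot> v\<^sub>2"
proof -
  note Y = biproductD[OF YY] and X = biproductD[OF XX] and E = biproductD[OF EE]
  note d1 = short_exactD[OF e1(1,2), unfolded cod_hom[OF e1(3)]] and d2 = short_exactD[OF e2(1,2), unfolded cod_hom[OF e2(3)]]
  show i: "i \<in> Hom C YY EE" and p: "p \<in> Hom C EE XX"
    using Y(1-7) X(1-7) E(1-7) e1(2,3) e2(2,3) by (simp_all add: i_def p_def cat_simps)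
  show vi: "v\<^sub>1 \<cdot> i = i\<^sub>1 \<cdot> r\<^sub>1" "v\<^sub>2 \<cdot> i = i\<^sub>2 \<cdot> r\<^sub>2"
    using Y(1-7) E(1-7) e1(2,3) e2(2,3)
    by (simp_all add: i_def cat_simps reassoc[OF E(8)] reassoc[OF E(9)] reassoc[OF E(10)] reassoc[OF E(11)])
  show qp: "q\<^sub>1 \<cdot> p = p\<^sub>1 \<cdot> v\<^sub>1" "q\<^sub>2 \<cdot> p = p\<^sub>2 \<cdot> v\<^sub>2"
    using X(1-7) E(1-7) e1(2,3) e2(2,3)
    by (simp_all add: p_def cat_simps reassoc[OF X(8)] reassoc[OF X(9)] reassoc[OF X(10)] reassoc[OF X(11)])
  have pu: "p \<cdot> u\<^sub>1 = t\<^sub>1 \<cdot> p\<^sub>1" "p \<cdot> u\<^sub>2 = t\<^sub>2 \<cdot> p\<^sub>2"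
    using X(1-7) E(1-7) e1(2,3) e2(2,3)
    by (simp_all add: p_def cat_simps E(8-11))
  have "short_exact C i p"
  proof (rule short_exactI[OF i p])
    show "p \<cdot> i = Zer C YY XX"
      using X(1-7) Y(1-7) E(1-7) e1(2,3) e2(2,3) p
      by (simp add: i_def cat_simps reassoc[OF pu(1)] reassoc[OF pu(2)] reassoc[OF d1(2)] reassoc[OF d2(2)])
    show "is_mono C i"
    proof (rule is_monoI[OF i])
      fix W x assume x: "x \<in> Hom C W YY" "i \<cdot> x = Zer C W EE"
      have W: "W \<in> Ob C" using hom_ob[OF x(1)] by simp
      have "i\<^sub>1 \<cdot> (r\<^sub>1 \<cdot> x) = v\<^sub>1 \<cdot> (i \<cdot> x)" "i\<^sub>2 \<cdot> (r\<^sub>2 \<cdot> x) = v\<^sub>2 \<cdot> (i \<cdot> x)"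
        using x(1) i Y(1-7) E(1-7) e1(2) e2(2) by (simp_all add: cat_simps reassoc[OF vi(1)] reassoc[OF vi(2)])
      then have "i\<^sub>1 \<cdot> (r\<^sub>1 \<cdot> x) = Zer C W E\<^sub>1" "i\<^sub>2 \<cdot> (r\<^sub>2 \<cdot> x) = Zer C W E\<^sub>2"
        unfolding x(2) using E(1-7) W by (simp_all add: cat_simps)
      then have "r\<^sub>1 \<cdot> x = Zer C W Y\<^sub>1" "r\<^sub>2 \<cdot> x = Zer C W Y\<^sub>2"
        using mono_zer[OF d1(3) e1(2) comp_hom[OF x(1) Y(6)]] mono_zer[OF d2(3) e2(2) comp_hom[OF x(1) Y(7)]]
        by simp_all
      then show "x = Zer C W YY" using biproduct_expand[OF YY x(1)] Y(1-7) W by (simp add: cat_simps)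
    qed
    show "is_epi C p"
    proof (rule is_epiI[OF p])
      fix W x assume x: "x \<in> Hom C XX W" "x \<cdot> p = Zer C EE W"
      have W: "W \<in> Ob C" using hom_ob[OF x(1)] by simp
      have "(x \<cdot> t\<^sub>1) \<cdot> p\<^sub>1 = (x \<cdot> p) \<cdot> u\<^sub>1" "(x \<cdot> t\<^sub>2) \<cdot> p\<^sub>2 = (x \<cdot> p) \<cdot> u\<^sub>2"
        using x(1) p X(1-7) E(1-7) e1(3) e2(3) by (simp_all add: cat_simps pu)
      then have "(x \<cdot> t\<^sub>1) \<cdot> p\<^sub>1 = Zer C E\<^sub>1 W" "(x \<cdot> t\<^sub>2) \<cdot> p\<^sub>2 = Zer C E\<^sub>2 W"
        unfolding x(2) using E(1-7) W by (simp_all add: cat_simps)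
      then have z: "x \<cdot> t\<^sub>1 = Zer C X\<^sub>1 W" "x \<cdot> t\<^sub>2 = Zer C X\<^sub>2 W"
        using epi_zer[OF d1(4) e1(3) comp_hom[OF X(4) x(1)]] epi_zer[OF d2(4) e2(3) comp_hom[OF X(5) x(1)]]
        by simp_all
      show "x = Zer C XX W" using biproduct_coexpand[OF XX x(1)] x(1) X(1-7) W
        by (simp add: cat_simps reassoc[OF z(1)] reassoc[OF z(2)])
    qed
  next
    fix W x assume x: "x \<in> Hom C W EE" "p \<cdot> x = Zer C W XX"
    have W: "W \<in> Ob C" using hom_ob[OF x(1)] by simp
    have "p\<^sub>1 \<cdot> (v\<^sub>1 \<cdot> x) = q\<^sub>1 \<cdot> (p \<cdot> x)" "p\<^sub>2 \<cdot> (v\<^sub>2 \<cdot> x) = q\<^sub>2 \<cdot> (p \<cdot> x)"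
      using x(1) p X(1-7) E(1-7) e1(3) e2(3) by (simp_all add: cat_simps reassoc[OF qp(1)] reassoc[OF qp(2)])
    then have "p\<^sub>1 \<cdot> (v\<^sub>1 \<cdot> x) = Zer C W X\<^sub>1" "p\<^sub>2 \<cdot> (v\<^sub>2 \<cdot> x) = Zer C W X\<^sub>2"
      unfolding x(2) using X(1-7) W by (simp_all add: cat_simps)
    then obtain y1 y2 where y: "y1 \<in> Hom C W Y\<^sub>1" "i\<^sub>1 \<cdot> y1 = v\<^sub>1 \<cdot> x" "y2 \<in> Hom C W Y\<^sub>2" "i\<^sub>2 \<cdot> y2 = v\<^sub>2 \<cdot> x"
      using d1(5)[OF comp_hom[OF x(1) E(6)]] d2(5)[OF comp_hom[OF x(1) E(7)]] by blast
    have "i \<cdot> Plus C (s\<^sub>1 \<cdot> y1) (s\<^sub>2 \<cdot> y2) = Plus C (u\<^sub>1 \<cdot> (i\<^sub>1 \<cdot> y1)) (u\<^sub>2 \<cdot> (i\<^sub>2 \<cdot> y2))"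
      using y(1,3) Y(1-7) E(1-7) e1(2) e2(2) W
      by (simp add: i_def cat_simps reassoc[OF Y(8)] reassoc[OF Y(9)] reassoc[OF Y(10)] reassoc[OF Y(11)])
    then have "i \<cdot> Plus C (s\<^sub>1 \<cdot> y1) (s\<^sub>2 \<cdot> y2) = x" unfolding y using biproduct_expand[OF EE x(1)] by simp
    then show "\<exists>h\<in>Hom C W YY. i \<cdot> h = x"
      using y(1,3) Y(1-7) plus_hom comp_hom by metis
  qed
  then show "(i, p) \<in> extensions C XX YY" using extension_iff[OF i p] by simp
qed

text \<open>The maps into the two factors determine a map into a direct sum of extensions.\<close>

lemma map_to_direct_sum:
  assumes e1: "short_exact C i\<^sub>1 p\<^sub>1" "i\<^sub>1 \<in> Hom C Y\<^sub>1 E\<^sub>1" "p\<^sub>1 \<in> Hom C E\<^sub>1 X\<^sub>1"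
    and e2: "short_exact C i\<^sub>2 p\<^sub>2" "i\<^sub>2 \<in> Hom C Y\<^sub>2 E\<^sub>2" "p\<^sub>2 \<in> Hom C E\<^sub>2 X\<^sub>2"
    and YY: "is_biproduct C Y\<^sub>1 Y\<^sub>2 YY s\<^sub>1 s\<^sub>2 r\<^sub>1 r\<^sub>2" and XX: "is_biproduct C X\<^sub>1 X\<^sub>2 XX t\<^sub>1 t\<^sub>2 q\<^sub>1 q\<^sub>2"
    and EE: "is_biproduct C E\<^sub>1 E\<^sub>2 EE u\<^sub>1 u\<^sub>2 v\<^sub>1 v\<^sub>2"
    and w: "w \<in> extensions C X Y" "ext_morphism C w (i\<^sub>1, p\<^sub>1) f\<^sub>1 g\<^sub>1" "ext_morphism C w (i\<^sub>2, p\<^sub>2) f\<^sub>2 g\<^sub>2"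
  shows "ext_morphism C w (Plus C (u\<^sub>1 \<cdot> i\<^sub>1 \<cdot> r\<^sub>1) (u\<^sub>2 \<cdot> i\<^sub>2 \<cdot> r\<^sub>2), Plus C (t\<^sub>1 \<cdot> p\<^sub>1 \<cdot> v\<^sub>1) (t\<^sub>2 \<cdot> p\<^sub>2 \<cdot> v\<^sub>2))
    (Plus C (s\<^sub>1 \<cdot> f\<^sub>1) (s\<^sub>2 \<cdot> f\<^sub>2)) (Plus C (t\<^sub>1 \<cdot> g\<^sub>1) (t\<^sub>2 \<cdot> g\<^sub>2))"
proof -
  note Y = biproductD[OF YY] and X = biproductD[OF XX] and E = biproductD[OF EE]
  note ds = direct_sum_short_exact[OF e1 e2 YY XX EE]
  obtain i p E' where w': "w = (i, p)" "i \<in> Hom C Y E'" "p \<in> Hom C E' X" using w(1) by (auto elim: extensionE)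
  obtain m1 where m1: "f\<^sub>1 \<in> Hom C Y Y\<^sub>1" "g\<^sub>1 \<in> Hom C X X\<^sub>1" "m1 \<in> Hom C E' E\<^sub>1" "m1 \<cdot> i = i\<^sub>1 \<cdot> f\<^sub>1" "p\<^sub>1 \<cdot> m1 = g\<^sub>1 \<cdot> p"
    using w(2) unfolding w'(1) ext_morphism_iff[OF w'(2,3) e1(2,3)] by blast
  obtain m2 where m2: "f\<^sub>2 \<in> Hom C Y Y\<^sub>2" "g\<^sub>2 \<in> Hom C X X\<^sub>2" "m2 \<in> Hom C E' E\<^sub>2" "m2 \<cdot> i = i\<^sub>2 \<cdot> f\<^sub>2" "p\<^sub>2 \<cdot> m2 = g\<^sub>2 \<cdot> p"
    using w(3) unfolding w'(1) ext_morphism_iff[OF w'(2,3) e2(2,3)] by blast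
  show ?thesis
    unfolding w'(1) ext_morphism_iff[OF w'(2,3) ds(2,3)]
  proof (intro conjI bexI)
    show "Plus C (u\<^sub>1 \<cdot> m1) (u\<^sub>2 \<cdot> m2) \<in> Hom C E' EE" "Plus C (s\<^sub>1 \<cdot> f\<^sub>1) (s\<^sub>2 \<cdot> f\<^sub>2) \<in> Hom C Y YY"
      "Plus C (t\<^sub>1 \<cdot> g\<^sub>1) (t\<^sub>2 \<cdot> g\<^sub>2) \<in> Hom C X XX"
      using m1(1-3) m2(1-3) E(1-7) Y(1-7) X(1-7) by (auto intro!: plus_hom comp_hom)
    show "Plus C (u\<^sub>1 \<cdot> m1) (u\<^sub>2 \<cdot> m2) \<cdot> i =
      Plus C (u\<^sub>1 \<cdot> i\<^sub>1 \<cdot> r\<^sub>1) (u\<^sub>2 \<cdot> i\<^sub>2 \<cdot> r\<^sub>2) \<cdot> Plus C (s\<^sub>1 \<cdot> f\<^sub>1) (s\<^sub>2 \<cdot> f\<^sub>2)"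
      using m1(1-3) m2(1-3) E(1-7) Y(1-7) w'(2,3) e1(2) e2(2) hom_ob[OF m1(1)]
      by (simp add: cat_simps m1(4) m2(4) reassoc[OF Y(8)] reassoc[OF Y(9)] reassoc[OF Y(10)] reassoc[OF Y(11)])
    show "Plus C (t\<^sub>1 \<cdot> p\<^sub>1 \<cdot> v\<^sub>1) (t\<^sub>2 \<cdot> p\<^sub>2 \<cdot> v\<^sub>2) \<cdot> Plus C (u\<^sub>1 \<cdot> m1) (u\<^sub>2 \<cdot> m2) =
      Plus C (t\<^sub>1 \<cdot> g\<^sub>1) (t\<^sub>2 \<cdot> g\<^sub>2) \<cdot> p"
      using m1(1-3) m2(1-3) E(1-7) X(1-7) w'(2,3) e1(3) e2(3) hom_ob[OF m1(3)]
      by (simp add: cat_simps m1(5) m2(5) reassoc[OF E(8)] reassoc[OF E(9)] reassoc[OF E(10)] reassoc[OF E(11)])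
  qed
qed

text \<open>The direct sum of the two extensions has quotient \<open>X \<oplus> X\<close>; its pullback along the diagonal
  maps to both summands.\<close>

lemma joint_extension:
  assumes "e\<^sub>1 \<in> extensions C X Y\<^sub>1" "e\<^sub>2 \<in> extensions C X Y\<^sub>2"
  obtains T u f\<^sub>1 f\<^sub>2 where "u \<in> extensions C X T" "ext_morphism C u e\<^sub>1 f\<^sub>1 (Ide C X)" "ext_morphism C u e\<^sub>2 f\<^sub>2 (Ide C X)"
proof -
  obtain i1 p1 E1 where e1: "e\<^sub>1 = (i1, p1)" "short_exact C i1 p1" "i1 \<in> Hom C Y\<^sub>1 E1" "p1 \<in> Hom C E1 X"
    using assms(1) by (auto elim: extensionE)
  obtain i2 p2 E2 where e2: "e\<^sub>2 = (i2, p2)" "short_exact C i2 p2" "i2 \<in> Hom C Y\<^sub>2 E2" "p2 \<in> Hom C E2 X"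
    using assms(2) by (auto elim: extensionE)
  have obs: "X \<in> Ob C" "Y\<^sub>1 \<in> Ob C" "Y\<^sub>2 \<in> Ob C" "E1 \<in> Ob C" "E2 \<in> Ob C" using hom_ob e1 e2 by blast+
  obtain YY s1 s2 r1 r2 where YY: "is_biproduct C Y\<^sub>1 Y\<^sub>2 YY s1 s2 r1 r2" using biproducts obs by blast
  obtain XX t1 t2 q1 q2 where XX: "is_biproduct C X X XX t1 t2 q1 q2" using biproducts obs by blast
  obtain EE u1 u2 v1 v2 where EE: "is_biproduct C E1 E2 EE u1 u2 v1 v2" using biproducts obs by blast
  note Y = biproductD[OF YY] and X = biproductD[OF XX] and E = biproductD[OF EE]
  note ds = direct_sum_short_exact[OF e1(2-4) e2(2-4) YY XX EE]
  let ?e = "(Plus C (u1 \<cdot> i1 \<cdot> r1) (u2 \<cdot> i2 \<cdot> r2), Plus C (t1 \<cdot> p1 \<cdot> v1) (t2 \<cdot> p2 \<cdot> v2))"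
  have m: "ext_morphism C ?e e\<^sub>1 r1 q1" "ext_morphism C ?e e\<^sub>2 r2 q2"
    unfolding e1(1) e2(1) ext_morphism_iff[OF ds(2,3) e1(3,4)] ext_morphism_iff[OF ds(2,3) e2(3,4)]
    using Y(6,7) X(6,7) E(6,7) ds(4-7) by metis+
  have diag: "Plus C t1 t2 \<in> Hom C X XX" using X by (simp add: plus_hom)
  have qd: "q1 \<cdot> Plus C t1 t2 = Ide C X" "q2 \<cdot> Plus C t1 t2 = Ide C X"
    using X by (simp_all add: cat_simps)
  obtain u where u: "u \<in> extensions C X YY" "ext_morphism C u ?e (Ide C YY) (Plus C t1 t2)"
    using pull_exists[OF ds(1) diag] by blast
  have "ext_morphism C u e\<^sub>1 r1 (Ide C X)" "ext_morphism C u e\<^sub>2 r2 (Ide C X)"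
    using ext_morphism_comp[OF u(1) ds(1) assms(1) u(2) m(1)] ext_morphism_comp[OF u(1) ds(1) assms(2) u(2) m(2)]
    unfolding qd comp_ide_right[OF Y(6)] comp_ide_right[OF Y(7)] by simp_all
  then show ?thesis using that u(1) by blast
qed

text \<open>The composite of the diagonal map into a direct sum of extensions with the pushout along the
  codiagonal.\<close>

lemma diagonal_then_codiagonal:
  assumes e1: "short_exact C i1 p1" "i1 \<in> Hom C Y E1" "p1 \<in> Hom C E1 X"
    and e2: "short_exact C i2 p2" "i2 \<in> Hom C Y E2" "p2 \<in> Hom C E2 X"
    and YY: "is_biproduct C Y Y YY s1 s2 r1 r2" and XX: "is_biproduct C X X XX t1 t2 q1 q2"
    and EE: "is_biproduct C E1 E2 EE u1 u2 v1 v2"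
    and u: "u \<in> extensions C X T" "ext_morphism C u (i1, p1) f (Ide C X)" "ext_morphism C u (i2, p2) g (Ide C X)"
    and e': "e' \<in> extensions C XX Y"
      "ext_morphism C (Plus C (u1 \<cdot> i1 \<cdot> r1) (u2 \<cdot> i2 \<cdot> r2), Plus C (t1 \<cdot> p1 \<cdot> v1) (t2 \<cdot> p2 \<cdot> v2)) e' (Plus C r1 r2) (Ide C XX)"
  shows "ext_morphism C u e' (Plus C f g) (Plus C t1 t2)"
proof -
  note B = biproductD[OF YY] and X = biproductD[OF XX]
  note ds = direct_sum_short_exact[OF e1 e2 YY XX EE]
  have fg: "f \<in> Hom C T Y" "g \<in> Hom C T Y"
    using ext_morphism_hom(1)[OF u(1) _ u(2), of X Y] ext_morphism_hom(1)[OF u(1) _ u(3), of X Y]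
      extension_iff[OF e1(2,3)] extension_iff[OF e2(2,3)] e1(1) e2(1) by blast+
  have T: "T \<in> Ob C" using hom_ob[OF fg(1)] by simp
  from ext_morphism_comp[OF u(1) ds(1) e'(1) map_to_direct_sum[OF e1 e2 YY XX EE u] e'(2)]
  have "ext_morphism C u e' (Plus C r1 r2 \<cdot> Plus C (s1 \<cdot> f) (s2 \<cdot> g)) (Ide C XX \<cdot> Plus C (t1 \<cdot> Ide C X) (t2 \<cdot> Ide C X))" .
  moreover have "Plus C r1 r2 \<cdot> Plus C (s1 \<cdot> f) (s2 \<cdot> g) = Plus C f g"
    using B(1-7) fg T by (simp add: cat_simps reassoc[OF B(8)] reassoc[OF B(9)] reassoc[OF B(10)] reassoc[OF B(11)])
  moreover have "Ide C XX \<cdot> Plus C (t1 \<cdot> Ide C X) (t2 \<cdot> Ide C X) = Plus C t1 t2"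
    using X by (simp add: cat_simps)
  ultimately show ?thesis by simp
qed

text \<open>The next two lemmas identify the Baer sum of \<open>f\<^sub>* u\<close> and \<open>g\<^sub>* u\<close> with \<open>(f + g)\<^sub>* u\<close>. In both
  directions the map from \<open>u\<close> to the direct sum of representatives is composed with the pushout
  \<open>e'\<close> that occurs in the definition of the Baer sum, and one of the cancellation rules is applied.\<close>

lemma baer_sum_of_push:
  assumes "u \<in> extensions C X T"
    "e\<^sub>1 \<in> EP X Y u f" "e\<^sub>2 \<in> EP X Y u g" "e \<in> EP X Y u (Plus C f g)"
  shows "baer_sum C X Y e\<^sub>1 e\<^sub>2 e"
proof -
  note m = ext_pushD[OF assms(2)] ext_pushD[OF assms(3)] ext_pushD[OF assms(4)]
  obtain i1 p1 E1 where e1: "e\<^sub>1 = (i1, p1)" "short_exact C i1 p1" "i1 \<in> Hom C Y E1" "p1 \<in> Hom C E1 X"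
    using m(1) by (auto elim: extensionE)
  obtain i2 p2 E2 where e2: "e\<^sub>2 = (i2, p2)" "short_exact C i2 p2" "i2 \<in> Hom C Y E2" "p2 \<in> Hom C E2 X"
    using m(3) by (auto elim: extensionE)
  have obs: "X \<in> Ob C" "Y \<in> Ob C" "E1 \<in> Ob C" "E2 \<in> Ob C" using hom_ob e1 e2 by blast+
  obtain YY s1 s2 r1 r2 where YY: "is_biproduct C Y Y YY s1 s2 r1 r2" using biproducts obs by blast
  obtain XX t1 t2 q1 q2 where XX: "is_biproduct C X X XX t1 t2 q1 q2" using biproducts obs by blast
  obtain EE u1 u2 v1 v2 where EE: "is_biproduct C E1 E2 EE u1 u2 v1 v2" using biproducts obs by blast
  note B = biproductD[OF YY] and X = biproductD[OF XX] and E = biproductD[OF EE]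
  note ds = direct_sum_short_exact[OF e1(2-4) e2(2-4) YY XX EE]
  let ?e = "(Plus C (u1 \<cdot> i1 \<cdot> r1) (u2 \<cdot> i2 \<cdot> r2), Plus C (t1 \<cdot> p1 \<cdot> v1) (t2 \<cdot> p2 \<cdot> v2))"
  have fg: "f \<in> Hom C T Y" "g \<in> Hom C T Y"
    using ext_morphism_hom(1)[OF assms(1) m(1,2)] ext_morphism_hom(1)[OF assms(1) m(3,4)] .
  have codiag: "Plus C r1 r2 \<in> Hom C YY Y" and diag: "Plus C t1 t2 \<in> Hom C X XX"
    using B X by (simp_all add: plus_hom)
  obtain e' where e': "e' \<in> extensions C XX Y" "ext_morphism C ?e e' (Plus C r1 r2) (Ide C XX)"
    using push_exists[OF ds(1) codiag] by blast
  have "ext_morphism C u e' (Plus C f g) (Plus C t1 t2)"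
    using diagonal_then_codiagonal[OF e1(2-4) e2(2-4) YY XX EE assms(1) _ _ e'] m unfolding e1(1) e2(1) by blast
  then have "ext_morphism C u e' (Ide C Y \<cdot> Plus C f g) (Plus C t1 t2)"
    using plus_hom[OF fg] by (simp add: comp_ide_left)
  then have "ext_morphism C e e' (Ide C Y) (Plus C t1 t2)"
    using cancel_push[OF assms(1) m(5) e'(1) m(6)] ide_hom[OF obs(2)] by blast
  then have "\<exists>e'\<in>extensions C XX Y. ext_morphism C ?e e' (Plus C r1 r2) (Ide C XX) \<and> ext_morphism C e e' (Ide C Y) (Plus C t1 t2)"
    using e' by blast
  then show ?thesis
    unfolding baer_sum_def e1(1) e2(1) prod.case cod_hom[OF e1(3)] cod_hom[OF e2(3)]
    using m(5) YY XX EE by blast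
qed

lemma push_of_baer_sum:
  assumes "e\<^sub>1 \<in> extensions C X Y" "e\<^sub>2 \<in> extensions C X Y" "baer_sum C X Y e\<^sub>1 e\<^sub>2 e"
    and u: "u \<in> extensions C X T" "ext_morphism C u e\<^sub>1 f (Ide C X)" "ext_morphism C u e\<^sub>2 g (Ide C X)"
  shows "e \<in> EP X Y u (Plus C f g)"
proof -
  obtain i1 p1 E1 where e1: "e\<^sub>1 = (i1, p1)" "short_exact C i1 p1" "i1 \<in> Hom C Y E1" "p1 \<in> Hom C E1 X"
    using assms(1) by (auto elim: extensionE)
  obtain i2 p2 E2 where e2: "e\<^sub>2 = (i2, p2)" "short_exact C i2 p2" "i2 \<in> Hom C Y E2" "p2 \<in> Hom C E2 X"
    using assms(2) by (auto elim: extensionE)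
  let ?e = "\<lambda>r1 r2 t1 t2 u1 u2 v1 v2. (Plus C (u1 \<cdot> i1 \<cdot> r1) (u2 \<cdot> i2 \<cdot> r2), Plus C (t1 \<cdot> p1 \<cdot> v1) (t2 \<cdot> p2 \<cdot> v2))"
  obtain YY s1 s2 r1 r2 XX t1 t2 q1 q2 EE u1 u2 v1 v2 e' where
    YY: "is_biproduct C Y Y YY s1 s2 r1 r2" and XX: "is_biproduct C X X XX t1 t2 q1 q2"
    and EE: "is_biproduct C E1 E2 EE u1 u2 v1 v2" and e': "e' \<in> extensions C XX Y"
    "ext_morphism C (?e r1 r2 t1 t2 u1 u2 v1 v2) e' (Plus C r1 r2) (Ide C XX)"
    "ext_morphism C e e' (Ide C Y) (Plus C t1 t2)" and e: "e \<in> extensions C X Y"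
    using assms(3) unfolding baer_sum_def e1(1) e2(1) prod.case cod_hom[OF e1(3)] cod_hom[OF e2(3)] by blast
  note X = biproductD[OF XX]
  have "ext_morphism C u e' (Plus C f g) (Plus C t1 t2)"
    using diagonal_then_codiagonal[OF e1(2-4) e2(2-4) YY XX EE u(1) _ _ e'(1,2)] u(2,3) unfolding e1(1) e2(1) by blast
  then have "ext_morphism C u e' (Plus C f g) (Plus C t1 t2 \<cdot> Ide C X)"
    using comp_ide_right[OF plus_hom[OF X(4,5)]] by simp
  then have "ext_morphism C u e (Plus C f g) (Ide C X)"
    using cancel_pull[OF e e'(1) u(1) e'(3)] ide_hom[OF X(2)] by blast
  then show ?thesis using e by (simp add: ext_pushI)
qed

text \<open>All operations of the extension space are transported from the operations on arrows along
  \<open>f \<mapsto> f\<^sub>* u\<close>, and any finite number of classes are pushed forward from one common extension. Hence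
  the vector space axioms follow from those of the spaces of arrows.\<close>

lemma Ext1_add:
  assumes "u \<in> extensions C X T" "f \<in> Hom C T Y" "g \<in> Hom C T Y"
  shows "EP X Y u f \<oplus>\<^bsub>Ext1 C X Y\<^esub> EP X Y u g = EP X Y u (Plus C f g)"
proof -
  obtain e1 e2 where e: "e1 \<in> EP X Y u f" "e2 \<in> EP X Y u g" using ext_push_nonempty assms by metis
  have "EP X Y u f \<oplus>\<^bsub>Ext1 C X Y\<^esub> EP X Y u g = {e. \<exists>a\<in>EP X Y u f. \<exists>b\<in>EP X Y u g. baer_sum C X Y a b e}"
    by (simp add: Ext1_def)
  also have "\<dots> = EP X Y u (Plus C f g)"
  proof (intro equalityI subsetI)
    fix x assume "x \<in> EP X Y u (Plus C f g)"
    then show "x \<in> {e. \<exists>a\<in>EP X Y u f. \<exists>b\<in>EP X Y u g. baer_sum C X Y a b e}"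
      using baer_sum_of_push[OF assms(1) e] e by blast
  next
    fix x assume "x \<in> {e. \<exists>a\<in>EP X Y u f. \<exists>b\<in>EP X Y u g. baer_sum C X Y a b e}"
    then obtain a b where "a \<in> EP X Y u f" "b \<in> EP X Y u g" "baer_sum C X Y a b x" by blast
    then show "x \<in> EP X Y u (Plus C f g)" using push_of_baer_sum[OF _ _ _ assms(1)] ext_pushD by blast
  qed
  finally show ?thesis .
qed

lemma Ext1_smult:
  assumes "u \<in> extensions C X T" "f \<in> Hom C T Y"
  shows "c \<odot>\<^bsub>Ext1 C X Y\<^esub> EP X Y u f = EP X Y u (Scal C c f)"
proof -
  obtain e where e: "e \<in> EP X Y u f" using ext_push_nonempty assms by metis
  note eD = ext_pushD[OF e]
  have Y: "Y \<in> Ob C" using hom_ob assms by blast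
  have c: "Scal C c (Ide C Y) \<in> Hom C Y Y" "Scal C c (Ide C Y) \<cdot> f = Scal C c f"
    using Y assms(2) by (simp_all add: cat_simps)
  have "c \<odot>\<^bsub>Ext1 C X Y\<^esub> EP X Y u f = {e' \<in> extensions C X Y. \<exists>a\<in>EP X Y u f. ext_morphism C a e' (Scal C c (Ide C Y)) (Ide C X)}"
    by (simp add: Ext1_def)
  also have "\<dots> = EP X Y u (Scal C c f)"
  proof (intro equalityI subsetI)
    fix x assume x: "x \<in> EP X Y u (Scal C c f)"
    then have "ext_morphism C e x (Scal C c (Ide C Y)) (Ide C X)"
      using cancel_push[OF assms(1) eD(1) _ eD(2) _ c(1), of x X "Ide C X"] ext_pushD[OF x] c(2) by simp
    then show "x \<in> {e' \<in> extensions C X Y. \<exists>a\<in>EP X Y u f. ext_morphism C a e' (Scal C c (Ide C Y)) (Ide C X)}"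
      using e ext_pushD[OF x] by blast
  next
    fix x assume "x \<in> {e' \<in> extensions C X Y. \<exists>a\<in>EP X Y u f. ext_morphism C a e' (Scal C c (Ide C Y)) (Ide C X)}"
    then obtain a where a: "x \<in> extensions C X Y" "a \<in> EP X Y u f" "ext_morphism C a x (Scal C c (Ide C Y)) (Ide C X)" by blast
    show "x \<in> EP X Y u (Scal C c f)"
      using push_comp[OF assms(1) ext_pushD(1)[OF a(2)] a(1) ext_pushD(2)[OF a(2)] a(3)] a(1) c(2) by (simp add: ext_pushI)
  qed
  finally show ?thesis .
qed

lemma push_zero_iff_split:
  assumes "u \<in> extensions C X T" "Y \<in> Ob C" "i \<in> Hom C Y E" "p \<in> Hom C E X" "short_exact C i p"
  shows "ext_morphism C u (i, p) (Zer C T Y) (Ide C X) \<longleftrightarrow> (\<exists>s \<in> Hom C X E. p \<cdot> s = Ide C X)"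
proof -
  obtain i' p' E' where u: "u = (i', p')" "short_exact C i' p'" "i' \<in> Hom C T E'" "p' \<in> Hom C E' X"
    using assms(1) by (auto elim: extensionE)
  note d = short_exactD[OF u(2,3), unfolded cod_hom[OF u(4)]]
  have obs: "T \<in> Ob C" "X \<in> Ob C" "E \<in> Ob C" using hom_ob u(3,4) assms(3) by blast+
  show ?thesis
  proof
    assume "ext_morphism C u (i, p) (Zer C T Y) (Ide C X)"
    then obtain m where m: "m \<in> Hom C E' E" "m \<cdot> i' = i \<cdot> Zer C T Y" "p \<cdot> m = Ide C X \<cdot> p'"
      unfolding u(1) ext_morphism_iff[OF u(3,4) assms(3,4)] by blast
    have "m \<cdot> i' = Zer C T E" using m assms(2,3) obs by (simp add: cat_simps)
    then obtain s where s: "s \<in> Hom C X E" "s \<cdot> p' = m" using d(6)[OF m(1)] by blast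
    have "(p \<cdot> s) \<cdot> p' = Ide C X \<cdot> p'" using s(1) m(3) u(4) assms(4) by (simp add: cat_simps s(2))
    then have "p \<cdot> s = Ide C X"
      using epi_cancel[OF d(4) u(4) comp_hom[OF s(1) assms(4)] ide_hom[OF obs(2)]] by simp
    then show "\<exists>s \<in> Hom C X E. p \<cdot> s = Ide C X" using s by blast
  next
    assume "\<exists>s \<in> Hom C X E. p \<cdot> s = Ide C X"
    then obtain s where s: "s \<in> Hom C X E" "p \<cdot> s = Ide C X" by blast
    have "s \<cdot> p' \<in> Hom C E' E" "(s \<cdot> p') \<cdot> i' = i \<cdot> Zer C T Y" "p \<cdot> (s \<cdot> p') = Ide C X \<cdot> p'"
      using s(1) u(3,4) assms(2-4) obs by (simp_all add: cat_simps d(2) reassoc[OF s(2)])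
    then show "ext_morphism C u (i, p) (Zer C T Y) (Ide C X)"
      unfolding u(1) ext_morphism_iff[OF u(3,4) assms(3,4)]
      using zer_hom[OF obs(1) assms(2)] ide_hom[OF obs(2)] by blast
  qed
qed

lemma Ext1_zero:
  assumes "u \<in> extensions C X T" "Y \<in> Ob C"
  shows "\<zero>\<^bsub>Ext1 C X Y\<^esub> = EP X Y u (Zer C T Y)"
proof -
  have "(\<exists>s \<in> Hom C X (Dom C p). p \<cdot> s = Ide C X) \<longleftrightarrow> ext_morphism C u (i, p) (Zer C T Y) (Ide C X)"
    if ext: "(i, p) \<in> extensions C X Y" for i p
  proof -
    obtain E where e: "short_exact C i p" "i \<in> Hom C Y E" "p \<in> Hom C E X"
      using ext by (auto elim: extensionE)
    then show ?thesis using push_zero_iff_split[OF assms e(2,3,1)] by (simp add: dom_hom[OF e(3)])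
  qed
  then show ?thesis unfolding Ext1_def ext_push_def by auto
qed

lemma Ext1_joint:
  assumes "A \<in> carrier (Ext1 C X Y)" "B \<in> carrier (Ext1 C X Y')"
  obtains T u f g where "u \<in> extensions C X T" "f \<in> Hom C T Y" "g \<in> Hom C T Y'"
    "A = EP X Y u f" "B = EP X Y' u g"
proof -
  obtain a b where ab: "a \<in> extensions C X Y" "A = EP X Y a (Ide C Y)" "b \<in> extensions C X Y'" "B = EP X Y' b (Ide C Y')"
    using assms Ext1_carrierE by metis
  obtain T u f g where u: "u \<in> extensions C X T" "ext_morphism C u a f (Ide C X)" "ext_morphism C u b g (Ide C X)"
    using joint_extension[OF ab(1,3)] by metis
  have fg: "f \<in> Hom C T Y" "g \<in> Hom C T Y'"
    using ext_morphism_hom(1)[OF u(1) ab(1) u(2)] ext_morphism_hom(1)[OF u(1) ab(3) u(3)] .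
  have "A = EP X Y u f" "B = EP X Y' u g"
    using ext_push_push[OF u(1) ab(1) u(2) ide_hom] ext_push_push[OF u(1) ab(3) u(3) ide_hom] ab fg hom_ob
    by (simp_all add: comp_ide_left)
  then show ?thesis using that u(1) fg by blast
qed

lemma Ext1_joint3:
  assumes "A \<in> carrier (Ext1 C X Y)" "B \<in> carrier (Ext1 C X Y)" "D \<in> carrier (Ext1 C X Y)"
  obtains T u f g h where "u \<in> extensions C X T" "f \<in> Hom C T Y" "g \<in> Hom C T Y" "h \<in> Hom C T Y"
    "A = EP X Y u f" "B = EP X Y u g" "D = EP X Y u h"
proof -
  obtain T u f g where u: "u \<in> extensions C X T" "f \<in> Hom C T Y" "g \<in> Hom C T Y" "A = EP X Y u f" "B = EP X Y u g"
    using Ext1_joint[OF assms(1,2)] by metis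
  have T: "T \<in> Ob C" using hom_ob u by blast
  have "EP X T u (Ide C T) \<in> carrier (Ext1 C X T)" using ext_push_carrier[OF u(1) ide_hom[OF T]] .
  then obtain T' u' k h where u': "u' \<in> extensions C X T'" "k \<in> Hom C T' T" "h \<in> Hom C T' Y"
    "EP X T u (Ide C T) = EP X T u' k" "D = EP X Y u' h"
    using Ext1_joint[OF _ assms(3)] by metis
  have "u \<in> EP X T u (Ide C T)" using ext_morphism_ide[OF u(1)] u(1) by (simp add: ext_pushI)
  then have m: "ext_morphism C u' u k (Ide C X)" using u'(4) ext_pushD by blast
  show ?thesis
    using that[OF u'(1) comp_hom[OF u'(2) u(2)] comp_hom[OF u'(2) u(3)] u'(3)] u(4,5) u'(5)
      ext_push_push[OF u'(1) u(1) m u(2)] ext_push_push[OF u'(1) u(1) m u(3)] by simp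
qed

lemma biproduct_short_exact:
  assumes bi: "is_biproduct C Y X T i j p q"
  shows "short_exact C i q"
proof -
  note b = biproductD[OF bi]
  show ?thesis
  proof (rule short_exactI[OF b(4,7)])
    show "q \<cdot> i = Zer C Y X" using b by simp
    show "is_mono C i" using mono_of_comp[OF _ b(4,6)] iso_mono[OF ide_iso ide_hom] b by simp
    show "is_epi C q" using epi_of_comp[OF _ b(5,7)] iso_epi[OF ide_iso ide_hom] b by simp
    fix W x assume x: "x \<in> Hom C W T" "q \<cdot> x = Zer C W X"
    have "i \<cdot> (p \<cdot> x) = x" using biproduct_expand[OF bi x(1)] x b(1-7) hom_ob[OF x(1)] by (simp add: cat_simps)
    then show "\<exists>h\<in>Hom C W Y. i \<cdot> h = x" using comp_hom[OF x(1) b(6)] by blast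
  qed
qed

lemma vect_Ext1:
  assumes "X \<in> Ob C" "Y \<in> Ob C"
  shows "vect (Ext1 C X Y)"
  unfolding vect_def
proof (rule moduleI)
  let ?E = "Ext1 C X Y"
  have zero: "\<exists>u. u \<in> extensions C X Y"
  proof -
    obtain S i j p q where bi: "is_biproduct C Y X S i j p q" using biproducts assms by blast
    note b = biproductD[OF bi]
    show ?thesis using extension_iff[OF b(4,7)] biproduct_short_exact[OF bi] by blast
  qed
  show "cring (ring_of_type_algebra :: 'k ring)" by (rule cring_from_type_algebra)
  show "abelian_group ?E"
  proof (rule abelian_groupI)
    fix A B D assume A: "A \<in> carrier ?E" and B: "B \<in> carrier ?E" and D: "D \<in> carrier ?E"
    obtain T u f g h where u: "u \<in> extensions C X T" "f \<in> Hom C T Y" "g \<in> Hom C T Y" "h \<in> Hom C T Y"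
      "A = EP X Y u f" "B = EP X Y u g" "D = EP X Y u h" using Ext1_joint3[OF A B D] by metis
    show "A \<oplus>\<^bsub>?E\<^esub> B \<oplus>\<^bsub>?E\<^esub> D = A \<oplus>\<^bsub>?E\<^esub> (B \<oplus>\<^bsub>?E\<^esub> D)"
      unfolding u(5-7) Ext1_add[OF u(1-3)] Ext1_add[OF u(1,3,4)] Ext1_add[OF u(1) plus_hom[OF u(2,3)] u(4)]
        Ext1_add[OF u(1,2) plus_hom[OF u(3,4)]]
      using u(2-4) plus_assoc[of f g h] by (simp add: Hom_iff)
  next
    fix A B assume A: "A \<in> carrier ?E" and B: "B \<in> carrier ?E"
    obtain T u f g where u: "u \<in> extensions C X T" "f \<in> Hom C T Y" "g \<in> Hom C T Y"
      "A = EP X Y u f" "B = EP X Y u g" using Ext1_joint[OF A B] by metis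
    show "A \<oplus>\<^bsub>?E\<^esub> B \<in> carrier ?E"
      unfolding u(4,5) Ext1_add[OF u(1-3)] by (rule ext_push_carrier[OF u(1) plus_hom[OF u(2,3)]])
    show "A \<oplus>\<^bsub>?E\<^esub> B = B \<oplus>\<^bsub>?E\<^esub> A"
      unfolding u(4,5) Ext1_add[OF u(1-3)] Ext1_add[OF u(1,3,2)] using plus_comm[of f g] u(2,3) by (simp add: Hom_iff)
  next
    obtain u where u: "u \<in> extensions C X Y" using zero by blast
    show "\<zero>\<^bsub>?E\<^esub> \<in> carrier ?E"
      unfolding Ext1_zero[OF u assms(2)] by (rule ext_push_carrier[OF u zer_hom[OF assms(2,2)]])
  next
    fix A assume A: "A \<in> carrier ?E"
    obtain u where u: "u \<in> extensions C X Y" "A = EP X Y u (Ide C Y)" using Ext1_carrierE[OF A] .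
    have h: "Ide C Y \<in> Hom C Y Y" "Zer C Y Y \<in> Hom C Y Y" "Scal C (- 1) (Ide C Y) \<in> Hom C Y Y"
      using assms by (simp_all add: ide_hom zer_hom scal_hom)
    show "\<zero>\<^bsub>?E\<^esub> \<oplus>\<^bsub>?E\<^esub> A = A"
      unfolding u(2) Ext1_zero[OF u(1) assms(2)] Ext1_add[OF u(1) h(2,1)] using assms by (simp add: cat_simps)
    show "\<exists>B\<in>carrier ?E. B \<oplus>\<^bsub>?E\<^esub> A = \<zero>\<^bsub>?E\<^esub>"
    proof
      show "EP X Y u (Scal C (- 1) (Ide C Y)) \<in> carrier ?E" by (rule ext_push_carrier[OF u(1) h(3)])
      show "EP X Y u (Scal C (- 1) (Ide C Y)) \<oplus>\<^bsub>?E\<^esub> A = \<zero>\<^bsub>?E\<^esub>"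
        unfolding u(2) Ext1_zero[OF u(1) assms(2)] Ext1_add[OF u(1) h(3,1)] using assms by (simp add: cat_simps)
    qed
  qed
  fix a b :: 'k and A assume A: "A \<in> carrier ?E"
  obtain u where u: "u \<in> extensions C X Y" "A = EP X Y u (Ide C Y)" using Ext1_carrierE[OF A] .
  have h: "Ide C Y \<in> Hom C Y Y" using assms by (simp add: ide_hom)
  show "a \<odot>\<^bsub>?E\<^esub> A \<in> carrier ?E"
    unfolding u(2) Ext1_smult[OF u(1) h] by (rule ext_push_carrier[OF u(1) scal_hom[OF h]])
  show "(a \<oplus>\<^bsub>ring_of_type_algebra\<^esub> b) \<odot>\<^bsub>?E\<^esub> A = a \<odot>\<^bsub>?E\<^esub> A \<oplus>\<^bsub>?E\<^esub> b \<odot>\<^bsub>?E\<^esub> A"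
    unfolding u(2) Ext1_smult[OF u(1) h] Ext1_add[OF u(1) scal_hom[OF h] scal_hom[OF h]]
    using scal_plus_left[of "Ide C Y" a b] assms by (simp add: cat_simps)
  show "a \<otimes>\<^bsub>ring_of_type_algebra\<^esub> b \<odot>\<^bsub>?E\<^esub> A = a \<odot>\<^bsub>?E\<^esub> (b \<odot>\<^bsub>?E\<^esub> A)"
    unfolding u(2) Ext1_smult[OF u(1) h] Ext1_smult[OF u(1) scal_hom[OF h]] using assms by (simp add: cat_simps)
  show "\<one>\<^bsub>ring_of_type_algebra\<^esub> \<odot>\<^bsub>?E\<^esub> A = A"
    unfolding u(2) Ext1_smult[OF u(1) h] using assms by (simp add: cat_simps)
next
  let ?E = "Ext1 C X Y"
  fix a :: 'k and A B assume A: "A \<in> carrier ?E" and B: "B \<in> carrier ?E"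
  obtain T u f g where u: "u \<in> extensions C X T" "f \<in> Hom C T Y" "g \<in> Hom C T Y"
    "A = EP X Y u f" "B = EP X Y u g" using Ext1_joint[OF A B] by metis
  show "a \<odot>\<^bsub>?E\<^esub> (A \<oplus>\<^bsub>?E\<^esub> B) = a \<odot>\<^bsub>?E\<^esub> A \<oplus>\<^bsub>?E\<^esub> a \<odot>\<^bsub>?E\<^esub> B"
    unfolding u(4,5) Ext1_add[OF u(1-3)] Ext1_smult[OF u(1,2)] Ext1_smult[OF u(1,3)]
      Ext1_smult[OF u(1) plus_hom[OF u(2,3)]] Ext1_add[OF u(1) scal_hom[OF u(2)] scal_hom[OF u(3)]]
    using u(2,3) by (simp add: cat_simps)
qed

section \<open>Functoriality and exactness of the extension spaces\<close>

definition Ext1_push :: "'o \<Rightarrow> 'o \<Rightarrow> 'm \<Rightarrow> ('m \<times> 'm) set \<Rightarrow> ('m \<times> 'm) set" where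
  "Ext1_push X Y' a A = {e' \<in> extensions C X Y'. \<exists>e\<in>A. ext_morphism C e e' a (Ide C X)}"

definition Ext1_pull :: "'o \<Rightarrow> 'o \<Rightarrow> 'm \<Rightarrow> ('m \<times> 'm) set \<Rightarrow> ('m \<times> 'm) set" where
  "Ext1_pull X' Y b A = {e' \<in> extensions C X' Y. \<exists>e\<in>A. ext_morphism C e' e (Ide C Y) b}"

lemma Ext1_push_eq:
  assumes "u \<in> extensions C X T" "f \<in> Hom C T Y" "a \<in> Hom C Y Y'"
  shows "Ext1_push X Y' a (EP X Y u f) = EP X Y' u (a \<cdot> f)"
proof (intro equalityI subsetI)
  fix x assume "x \<in> Ext1_push X Y' a (EP X Y u f)"
  then obtain e where e: "x \<in> extensions C X Y'" "e \<in> EP X Y u f" "ext_morphism C e x a (Ide C X)"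
    unfolding Ext1_push_def by blast
  show "x \<in> EP X Y' u (a \<cdot> f)"
    using push_comp[OF assms(1) ext_pushD(1)[OF e(2)] e(1) ext_pushD(2)[OF e(2)] e(3)] e(1) by (simp add: ext_pushI)
next
  fix x assume x: "x \<in> EP X Y' u (a \<cdot> f)"
  obtain e where e: "e \<in> EP X Y u f" using ext_push_nonempty[OF assms(1,2)] .
  have "ext_morphism C e x a (Ide C X)"
    using cancel_push[OF assms(1) ext_pushD(1)[OF e] ext_pushD(1)[OF x] ext_pushD(2)[OF e] ext_pushD(2)[OF x] assms(3)] .
  then show "x \<in> Ext1_push X Y' a (EP X Y u f)" unfolding Ext1_push_def using e ext_pushD(1)[OF x] by blast
qed

lemma Ext1_pull_eq:
  assumes "u \<in> extensions C X T" "u' \<in> extensions C X' T" "ext_morphism C u' u (Ide C T) b" "f \<in> Hom C T Y"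
  shows "Ext1_pull X' Y b (EP X Y u f) = EP X' Y u' f"
proof -
  have b: "b \<in> Hom C X' X" using ext_morphism_hom[OF assms(2,1,3)] by simp
  have obs: "X \<in> Ob C" "X' \<in> Ob C" "Y \<in> Ob C" using hom_ob b assms(4) by blast+
  show ?thesis
  proof (intro equalityI subsetI)
    fix x assume "x \<in> Ext1_pull X' Y b (EP X Y u f)"
    then obtain e where e: "x \<in> extensions C X' Y" "e \<in> EP X Y u f" "ext_morphism C x e (Ide C Y) b"
      unfolding Ext1_pull_def by blast
    have "ext_morphism C u' e (f \<cdot> Ide C T) (Ide C X \<cdot> b)"
      by (rule ext_morphism_comp[OF assms(2,1) ext_pushD(1)[OF e(2)] assms(3) ext_pushD(2)[OF e(2)]])
    then have "ext_morphism C u' e f (b \<cdot> Ide C X')"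
      using assms(4) b by (simp add: comp_ide_left comp_ide_right)
    then have "ext_morphism C u' x f (Ide C X')"
      using cancel_pull[OF e(1) ext_pushD(1)[OF e(2)] assms(2) e(3)] ide_hom[OF obs(2)] by blast
    then show "x \<in> EP X' Y u' f" using e(1) by (simp add: ext_pushI)
  next
    fix x assume x: "x \<in> EP X' Y u' f"
    obtain e where e: "e \<in> EP X Y u f" using ext_push_nonempty[OF assms(1,4)] .
    have "ext_morphism C u' e (f \<cdot> Ide C T) (Ide C X \<cdot> b)"
      by (rule ext_morphism_comp[OF assms(2,1) ext_pushD(1)[OF e] assms(3) ext_pushD(2)[OF e]])
    then have "ext_morphism C u' e (Ide C Y \<cdot> f) b"
      using assms(4) b by (simp add: comp_ide_left comp_ide_right)
    then have "ext_morphism C x e (Ide C Y) b"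
      using cancel_push[OF assms(2) ext_pushD(1)[OF x] ext_pushD(1)[OF e] ext_pushD(2)[OF x]] ide_hom[OF obs(3)] by blast
    then show "x \<in> Ext1_pull X' Y b (EP X Y u f)" unfolding Ext1_pull_def using e ext_pushD(1)[OF x] by blast
  qed
qed

lemma lin_map_push:
  assumes "X \<in> Ob C" "a \<in> Hom C Y Y'"
  shows "lin_map (Ext1 C X Y) (Ext1 C X Y') (Ext1_push X Y' a)"
  unfolding lin_map_def
proof (intro conjI ballI allI funcsetI)
  fix A B assume A: "A \<in> carrier (Ext1 C X Y)" and B: "B \<in> carrier (Ext1 C X Y)"
  obtain T u f g where u: "u \<in> extensions C X T" "f \<in> Hom C T Y" "g \<in> Hom C T Y"
    "A = EP X Y u f" "B = EP X Y u g" using Ext1_joint[OF A B] by metis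
  have af: "a \<cdot> f \<in> Hom C T Y'" "a \<cdot> g \<in> Hom C T Y'" using u assms by (simp_all add: comp_hom)
  show "Ext1_push X Y' a (A \<oplus>\<^bsub>Ext1 C X Y\<^esub> B) = Ext1_push X Y' a A \<oplus>\<^bsub>Ext1 C X Y'\<^esub> Ext1_push X Y' a B"
    unfolding u(4,5) Ext1_add[OF u(1-3)] Ext1_push_eq[OF u(1) u(2) assms(2)] Ext1_push_eq[OF u(1) u(3) assms(2)]
      Ext1_push_eq[OF u(1) plus_hom[OF u(2,3)] assms(2)] Ext1_add[OF u(1) af]
    using comp_plus_right[OF u(2,3) assms(2)] by simp
  show "Ext1_push X Y' a A \<in> carrier (Ext1 C X Y')"
    unfolding u(4) Ext1_push_eq[OF u(1) u(2) assms(2)] by (rule ext_push_carrier[OF u(1) af(1)])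
  fix c show "Ext1_push X Y' a (c \<odot>\<^bsub>Ext1 C X Y\<^esub> A) = c \<odot>\<^bsub>Ext1 C X Y'\<^esub> Ext1_push X Y' a A"
    unfolding u(4) Ext1_smult[OF u(1,2)] Ext1_push_eq[OF u(1) u(2) assms(2)]
      Ext1_push_eq[OF u(1) scal_hom[OF u(2)] assms(2)] Ext1_smult[OF u(1) af(1)]
    using comp_scal_right[OF u(2) assms(2)] by simp
qed

lemma lin_map_pull:
  assumes "Y \<in> Ob C" "b \<in> Hom C X' X"
  shows "lin_map (Ext1 C X Y) (Ext1 C X' Y) (Ext1_pull X' Y b)"
  unfolding lin_map_def
proof (intro conjI ballI allI funcsetI)
  fix A B assume A: "A \<in> carrier (Ext1 C X Y)" and B: "B \<in> carrier (Ext1 C X Y)"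
  obtain T u f g where u: "u \<in> extensions C X T" "f \<in> Hom C T Y" "g \<in> Hom C T Y"
    "A = EP X Y u f" "B = EP X Y u g" using Ext1_joint[OF A B] by metis
  obtain u' where u': "u' \<in> extensions C X' T" "ext_morphism C u' u (Ide C T) b"
    using pull_exists[OF u(1) assms(2)] .
  note eq = Ext1_pull_eq[OF u(1) u']
  show "Ext1_pull X' Y b (A \<oplus>\<^bsub>Ext1 C X Y\<^esub> B) = Ext1_pull X' Y b A \<oplus>\<^bsub>Ext1 C X' Y\<^esub> Ext1_pull X' Y b B"
    unfolding u(4,5) Ext1_add[OF u(1-3)] eq[OF u(2)] eq[OF u(3)] eq[OF plus_hom[OF u(2,3)]] Ext1_add[OF u'(1) u(2,3)] ..
  show "Ext1_pull X' Y b A \<in> carrier (Ext1 C X' Y)"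
    unfolding u(4) eq[OF u(2)] by (rule ext_push_carrier[OF u'(1) u(2)])
  fix c show "Ext1_pull X' Y b (c \<odot>\<^bsub>Ext1 C X Y\<^esub> A) = c \<odot>\<^bsub>Ext1 C X' Y\<^esub> Ext1_pull X' Y b A"
    unfolding u(4) Ext1_smult[OF u(1,2)] eq[OF u(2)] eq[OF scal_hom[OF u(2)]] Ext1_smult[OF u'(1) u(2)] ..
qed

text \<open>A splitting of \<open>e''\<close> yields an arrow \<open>\<gamma>\<close> on the middle term of \<open>e\<close> that extends \<open>\<beta>\<close>. Its kernel is
  the middle term of an extension of \<open>X\<close> by the kernel of \<open>\<beta>\<close>.\<close>

lemma extension_lift:
  assumes "short_exact C \<alpha> \<beta>" "\<alpha> \<in> Hom C Y' Y" "\<beta> \<in> Hom C Y Y''"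
    and "e \<in> extensions C X Y" "e'' \<in> \<zero>\<^bsub>Ext1 C X Y''\<^esub>" "ext_morphism C e e'' \<beta> (Ide C X)"
  shows "\<exists>e'\<in>extensions C X Y'. ext_morphism C e' e \<alpha> (Ide C X)"
proof -
  note dab = short_exactD[OF assms(1,2), unfolded cod_hom[OF assms(3)]]
  obtain i p E where e: "e = (i, p)" "short_exact C i p" "i \<in> Hom C Y E" "p \<in> Hom C E X"
    using assms(4) by (auto elim: extensionE)
  note d = short_exactD[OF e(2,3), unfolded cod_hom[OF e(4)]]
  have e''ext: "e'' \<in> extensions C X Y''" using assms(5) by (auto simp: Ext1_def)
  obtain i'' p'' E'' where e'': "e'' = (i'', p'')" "short_exact C i'' p''" "i'' \<in> Hom C Y'' E''" "p'' \<in> Hom C E'' X"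
    using e''ext by (auto elim: extensionE)
  note d'' = short_exactD[OF e''(2,3), unfolded cod_hom[OF e''(4)]]
  have obs: "X \<in> Ob C" "Y \<in> Ob C" "Y' \<in> Ob C" "Y'' \<in> Ob C" "E \<in> Ob C" "E'' \<in> Ob C" using hom_ob e'' e assms(2,3) by blast+
  obtain s where s: "s \<in> Hom C X E''" "p'' \<cdot> s = Ide C X"
    using assms(5) unfolding e''(1) by (auto simp: Ext1_def dom_hom[OF e''(4)])
  obtain m where m: "m \<in> Hom C E E''" "m \<cdot> i = i'' \<cdot> \<beta>" "p'' \<cdot> m = Ide C X \<cdot> p"
    using assms(6) unfolding e(1) e''(1) ext_morphism_iff[OF e(3,4) e''(3,4)] by blast
  have pm: "p'' \<cdot> m = p" using m(3) e(4) by (simp add: comp_ide_left)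
  \<comment> \<open>\<open>m - s p\<close> lands in the subobject of the split extension\<close>
  have "\<exists>\<gamma>\<in>Hom C E Y''. i'' \<cdot> \<gamma> = Plus C m (Scal C (- 1) (s \<cdot> p))"
    by (rule d''(5)) (use m(1) s(1) e(4) e''(4) in \<open>simp_all add: cat_simps pm reassoc[OF s(2)]\<close>)
  then obtain \<gamma> where \<gamma>: "\<gamma> \<in> Hom C E Y''" "i'' \<cdot> \<gamma> = Plus C m (Scal C (- 1) (s \<cdot> p))" by blast
  have "i'' \<cdot> (\<gamma> \<cdot> i) = Plus C m (Scal C (- 1) (s \<cdot> p)) \<cdot> i"
    using \<gamma>(1) e(3) e''(3) by (simp add: cat_simps reassoc[OF \<gamma>(2)])
  also have "\<dots> = i'' \<cdot> \<beta>"
    using m(1,2) s(1) e(3,4) e''(3) assms(3) obs by (simp add: cat_simps d(2))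
  finally have \<gamma>i: "\<gamma> \<cdot> i = \<beta>"
    using mono_cancel[OF d''(3) e''(3) comp_hom[OF e(3) \<gamma>(1)] assms(3)] by simp
  obtain k where k: "is_kernel C \<gamma> k" using kernels \<gamma>(1) by (auto simp: Hom_iff)
  define E' where "E' = Dom C k"
  note kD = is_kernelD[OF k \<gamma>(1), folded E'_def]
  have "\<exists>h\<in>Hom C Y' E'. k \<cdot> h = i \<cdot> \<alpha>"
    by (rule kD(4)) (use e(3) assms(2,3) \<gamma>(1) in \<open>simp_all add: cat_simps reassoc[OF \<gamma>i] dab(2)\<close>)
  then obtain i' where i': "i' \<in> Hom C Y' E'" "k \<cdot> i' = i \<cdot> \<alpha>" by blast
  define p' where "p' = p \<cdot> k"
  have p': "p' \<in> Hom C E' X" using kD(1) e(4) by (simp add: p'_def comp_hom)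
  have "short_exact C i' p'"
  proof (rule short_exactI[OF i'(1) p'])
    show "p' \<cdot> i' = Zer C Y' X"
      using i' kD(1) e(3,4) assms(2) obs by (simp add: p'_def cat_simps reassoc[OF d(2)])
    have "is_mono C (k \<cdot> i')" unfolding i'(2) using mono_comp[OF dab(3) assms(2) d(3) e(3)] .
    then show "is_mono C i'" using mono_of_comp[OF _ i'(1) kD(1)] by blast
    obtain V r z where r: "is_epi C r" "r \<in> Hom C V X" and z: "z \<in> Hom C V E" "p \<cdot> z = Ide C X \<cdot> r"
      using epi_cover[OF d(4) e(4) ide_hom[OF obs(1)]] by blast
    obtain V2 r2 y where r2: "is_epi C r2" "r2 \<in> Hom C V2 V" and y: "y \<in> Hom C V2 Y" "\<beta> \<cdot> y = (\<gamma> \<cdot> z) \<cdot> r2"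
      using epi_cover[OF dab(4) assms(3) comp_hom[OF z(1) \<gamma>(1)]] by blast
    have pz: "p \<cdot> z = r" using z(2) r(2) by (simp add: comp_ide_left)
    have yz: "\<beta> \<cdot> y = \<gamma> \<cdot> (z \<cdot> r2)" using y(2) z(1) r2(2) \<gamma>(1) by (simp add: cat_simps)
    have V2: "V2 \<in> Ob C" using hom_ob[OF y(1)] by simp
    have "\<exists>h\<in>Hom C V2 E'. k \<cdot> h = Plus C (z \<cdot> r2) (Scal C (- 1) (i \<cdot> y))"
      by (rule kD(4))
        (use y(1) z(1) r2(2) \<gamma>(1) e(3) assms(3) in \<open>simp_all add: cat_simps reassoc[OF \<gamma>i] yz\<close>)
    then obtain t where t: "t \<in> Hom C V2 E'" "k \<cdot> t = Plus C (z \<cdot> r2) (Scal C (- 1) (i \<cdot> y))" by blast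
    have "p' \<cdot> t = r \<cdot> r2"
      using t kD(1) e(3,4) z(1) r2(2) r(2) y(1) obs V2
      by (simp add: p'_def cat_simps reassoc[OF pz] reassoc[OF d(2)])
    then have "is_epi C (p' \<cdot> t)" using epi_comp[OF r2 r] by simp
    then show "is_epi C p'" using epi_of_comp[OF _ t(1) p'] by blast
  next
    fix W x assume x: "x \<in> Hom C W E'" "p' \<cdot> x = Zer C W X"
    have W: "W \<in> Ob C" using hom_ob[OF x(1)] by simp
    have kx: "k \<cdot> x \<in> Hom C W E" using x(1) kD(1) by (simp add: comp_hom)
    have "p \<cdot> (k \<cdot> x) = Zer C W X" using x kD(1) e(4) by (simp add: p'_def cat_simps)
    then obtain y where y: "y \<in> Hom C W Y" "i \<cdot> y = k \<cdot> x" using d(5)[OF kx] by blast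
    have "\<beta> \<cdot> y = \<gamma> \<cdot> (i \<cdot> y)" using y(1) e(3) \<gamma>(1) by (simp add: cat_simps reassoc[OF \<gamma>i])
    also have "\<dots> = Zer C W Y''" unfolding y(2) using x(1) kD(1) \<gamma>(1) W obs by (simp add: cat_simps reassoc[OF kD(2)])
    finally obtain y' where y': "y' \<in> Hom C W Y'" "\<alpha> \<cdot> y' = y" using dab(5)[OF y(1)] by blast
    have "k \<cdot> (i' \<cdot> y') = k \<cdot> x"
      using i'(1) y'(1) kD(1) e(3) assms(2) by (simp add: cat_simps reassoc[OF i'(2)] y'(2) y(2))
    then have "i' \<cdot> y' = x" using mono_cancel[OF kD(3,1) comp_hom[OF y'(1) i'(1)] x(1)] by simp
    then show "\<exists>h\<in>Hom C W Y'. i' \<cdot> h = x" using y' by blast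
  qed
  then have "(i', p') \<in> extensions C X Y'" using extension_iff[OF i'(1) p'] by simp
  moreover have "ext_morphism C (i', p') e \<alpha> (Ide C X)"
    unfolding e(1) ext_morphism_iff[OF i'(1) p' e(3,4)]
    using assms(2) obs kD(1) i'(2) comp_ide_left[OF p'] by (auto simp: p'_def ide_hom)
  ultimately show ?thesis by blast
qed

lemma Ext1_exact_push:
  assumes "short_exact C \<alpha> \<beta>" "\<alpha> \<in> Hom C Y' Y" "\<beta> \<in> Hom C Y Y''" "A \<in> carrier (Ext1 C X Y)"
    "Ext1_push X Y'' \<beta> A = \<zero>\<^bsub>Ext1 C X Y''\<^esub>"
  shows "A \<in> Ext1_push X Y \<alpha> ` carrier (Ext1 C X Y')"
proof -
  obtain e where e: "e \<in> extensions C X Y" "A = EP X Y e (Ide C Y)" using Ext1_carrierE[OF assms(4)] .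
  have obs: "Y \<in> Ob C" "Y' \<in> Ob C" "X \<in> Ob C" using hom_ob assms(2) extension_ob e by blast+
  obtain e'' where e'': "e'' \<in> extensions C X Y''" "ext_morphism C e e'' \<beta> (Ide C X)"
    using push_exists[OF e(1) assms(3)] .
  have "e \<in> A" using e ext_morphism_ide by (simp add: ext_pushI)
  then have "e'' \<in> \<zero>\<^bsub>Ext1 C X Y''\<^esub>" using assms(5) e'' unfolding Ext1_push_def by blast
  then obtain e' where e': "e' \<in> extensions C X Y'" "ext_morphism C e' e \<alpha> (Ide C X)"
    using extension_lift[OF assms(1-3) e(1) _ e''(2)] by blast
  have "A = EP X Y e' \<alpha>"
    using ext_push_push[OF e'(1) e(1) e'(2) ide_hom[OF obs(1)]] e(2) comp_ide_left[OF assms(2)] by simp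
  also have "\<dots> = Ext1_push X Y \<alpha> (EP X Y' e' (Ide C Y'))"
    using Ext1_push_eq[OF e'(1) ide_hom[OF obs(2)] assms(2)] comp_ide_right[OF assms(2)] by simp
  finally show ?thesis using ext_push_carrier[OF e'(1) ide_hom[OF obs(2)]] by blast
qed

text \<open>A section of \<open>p\<close> and a retraction of \<open>i\<close> determine each other. This makes the zero class
  self-dual, so that exactness in the contravariant variable follows from the covariant one.\<close>

lemma Ext1_zero_mem_iff:
  "e \<in> \<zero>\<^bsub>Ext1 C X Y\<^esub> \<longleftrightarrow> e \<in> extensions C X Y \<and> (\<exists>r \<in> Hom C (Cod C (fst e)) Y. r \<cdot> fst e = Ide C Y)"
proof (cases "e \<in> extensions C X Y")
  case True
  obtain i p E where e: "e = (i, p)" "short_exact C i p" "i \<in> Hom C Y E" "p \<in> Hom C E X"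
    using True by (auto elim: extensionE)
  note d = short_exactD[OF e(2,3), unfolded cod_hom[OF e(4)]]
  have obs: "X \<in> Ob C" "Y \<in> Ob C" "E \<in> Ob C" using hom_ob e by blast+
  have "(\<exists>s\<in>Hom C X E. p \<cdot> s = Ide C X) \<longleftrightarrow> (\<exists>r \<in> Hom C E Y. r \<cdot> i = Ide C Y)"
  proof
    assume "\<exists>s\<in>Hom C X E. p \<cdot> s = Ide C X"
    then obtain s where s: "s \<in> Hom C X E" "p \<cdot> s = Ide C X" by blast
    have "\<exists>h\<in>Hom C E Y. i \<cdot> h = Plus C (Ide C E) (Scal C (- 1) (s \<cdot> p))"
      by (rule d(5)) (use s(1) e(3,4) obs in \<open>simp_all add: cat_simps reassoc[OF s(2)]\<close>)
    then obtain r where r: "r \<in> Hom C E Y" "i \<cdot> r = Plus C (Ide C E) (Scal C (- 1) (s \<cdot> p))" by blast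
    have "i \<cdot> (r \<cdot> i) = i \<cdot> Ide C Y"
      using r(1) e(3,4) s(1) obs by (simp add: cat_simps reassoc[OF r(2)] d(2))
    then have "r \<cdot> i = Ide C Y" using mono_cancel[OF d(3) e(3) comp_hom[OF e(3) r(1)] ide_hom[OF obs(2)]] by simp
    then show "\<exists>r \<in> Hom C E Y. r \<cdot> i = Ide C Y" using r by blast
  next
    assume "\<exists>r \<in> Hom C E Y. r \<cdot> i = Ide C Y"
    then obtain r where r: "r \<in> Hom C E Y" "r \<cdot> i = Ide C Y" by blast
    have "\<exists>h\<in>Hom C X E. h \<cdot> p = Plus C (Ide C E) (Scal C (- 1) (i \<cdot> r))"
      by (rule d(6)) (use r(1) e(3,4) obs in \<open>simp_all add: cat_simps r(2)\<close>)
    then obtain s where s: "s \<in> Hom C X E" "s \<cdot> p = Plus C (Ide C E) (Scal C (- 1) (i \<cdot> r))" by blast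
    have "(p \<cdot> s) \<cdot> p = Ide C X \<cdot> p"
      using s e(3,4) r(1) obs by (simp add: cat_simps reassoc[OF d(2)])
    then have "p \<cdot> s = Ide C X" using epi_cancel[OF d(4) e(4) comp_hom[OF s(1) e(4)] ide_hom[OF obs(1)]] by simp
    then show "\<exists>s\<in>Hom C X E. p \<cdot> s = Ide C X" using s by blast
  qed
  then show ?thesis using True unfolding e(1) by (simp add: Ext1_def dom_hom[OF e(4)] cod_hom[OF e(3)])
qed (auto simp: Ext1_def)

lemma op_Ext1_zero: "e \<in> \<zero>\<^bsub>Ext1 (op_cat C) Y X\<^esub> \<longleftrightarrow> prod.swap e \<in> \<zero>\<^bsub>Ext1 C X Y\<^esub>"
proof -
  have "e \<in> extensions (op_cat C) Y X \<longleftrightarrow> prod.swap e \<in> extensions C X Y"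
    using op_extension[of "prod.swap e" Y X] by simp
  then show ?thesis using Ext1_zero_mem_iff[of "prod.swap e" X Y]
    by (auto simp: Ext1_def)
qed

lemma extension_colift:
  assumes "short_exact C \<alpha> \<beta>" "\<alpha> \<in> Hom C X' X" "\<beta> \<in> Hom C X X''"
    and "e \<in> extensions C X Y" "e' \<in> \<zero>\<^bsub>Ext1 C X' Y\<^esub>" "ext_morphism C e' e (Ide C Y) \<alpha>"
  shows "\<exists>e''\<in>extensions C X'' Y. ext_morphism C e e'' (Ide C Y) \<beta>"
proof -
  interpret op: abelian_category "op_cat C" by (rule op_abelian)
  have e'ext: "e' \<in> extensions C X' Y" using assms(5) by (auto simp: Ext1_def)
  have "\<exists>e''\<in>extensions (op_cat C) Y X''. ext_morphism (op_cat C) e'' (prod.swap e) \<beta> (Ide C Y)"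
    using op.extension_lift[of \<beta> \<alpha> X'' X X' "prod.swap e" Y "prod.swap e'"] assms
      op_ext_morphism[OF e'ext assms(4)] op_Ext1_zero[of "prod.swap e'" Y X'] by simp
  then obtain e'' where e'': "e'' \<in> extensions (op_cat C) Y X''" "ext_morphism (op_cat C) e'' (prod.swap e) \<beta> (Ide C Y)" by blast
  have "prod.swap e'' \<in> extensions C X'' Y" using op_extension[of "prod.swap e''" Y X''] e'' by simp
  then show ?thesis using op_ext_morphism[OF assms(4), of "prod.swap e''" X'' Y] e''(2) by auto
qed

lemma Ext1_exact_pull:
  assumes "short_exact C \<alpha> \<beta>" "\<alpha> \<in> Hom C X' X" "\<beta> \<in> Hom C X X''" "A \<in> carrier (Ext1 C X Y)"
    "Ext1_pull X' Y \<alpha> A = \<zero>\<^bsub>Ext1 C X' Y\<^esub>"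
  shows "A \<in> Ext1_pull X Y \<beta> ` carrier (Ext1 C X'' Y)"
proof -
  obtain e where e: "e \<in> extensions C X Y" "A = EP X Y e (Ide C Y)" using Ext1_carrierE[OF assms(4)] .
  have obs: "X \<in> Ob C" "X'' \<in> Ob C" "Y \<in> Ob C" using hom_ob assms(3) extension_ob e by blast+
  obtain e' where e': "e' \<in> extensions C X' Y" "ext_morphism C e' e (Ide C Y) \<alpha>"
    using pull_exists[OF e(1) assms(2)] .
  have "e \<in> A" using e ext_morphism_ide by (simp add: ext_pushI)
  then have "e' \<in> \<zero>\<^bsub>Ext1 C X' Y\<^esub>" using assms(5) e' unfolding Ext1_pull_def by blast
  then obtain e'' where e'': "e'' \<in> extensions C X'' Y" "ext_morphism C e e'' (Ide C Y) \<beta>"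
    using extension_colift[OF assms(1-3) e(1) _ e'(2)] by blast
  have "A = Ext1_pull X Y \<beta> (EP X'' Y e'' (Ide C Y))"
    unfolding e(2) by (rule Ext1_pull_eq[OF e''(1) e(1) e''(2) ide_hom[OF obs(3)], symmetric])
  then show ?thesis using ext_push_carrier[OF e''(1) ide_hom[OF obs(3)]] by blast
qed

end

section \<open>Extension closures\<close>

text \<open>Filtrations of a given length, read from the bottom: the first step lies in \<open>S\<close>, and the quotient
  by it is filtered by the remaining steps.\<close>

primrec blen :: "('k, 'o, 'm) lin_cat \<Rightarrow> 'o set \<Rightarrow> nat \<Rightarrow> 'o \<Rightarrow> bool" where
  "blen C S 0 X \<longleftrightarrow> is_zero_ob C X"
| "blen C S (Suc l) X \<longleftrightarrow> (\<exists>A\<in>S. \<exists>j p. short_exact C j p \<and> j \<in> Hom C A X \<and> blen C S l (Cod C p))"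

context abelian_category
begin

lemma short_exact_iso_middle:
  assumes "short_exact C i p" "i \<in> Hom C Y E" "p \<in> Hom C E X" "is_iso C f" "f \<in> Hom C E E'"
    "g \<in> Hom C E' E" "g \<cdot> f = Ide C E" "f \<cdot> g = Ide C E'"
  shows "short_exact C (f \<cdot> i) (p \<cdot> g)"
proof -
  note d = short_exactD[OF assms(1,2), unfolded cod_hom[OF assms(3)]]
  have g: "is_iso C g" using is_isoI[OF assms(6,5)] assms by simp
  have obs: "E \<in> Ob C" "E' \<in> Ob C" using hom_ob[OF assms(5)] by auto
  show ?thesis
  proof (rule short_exactI[OF comp_hom[OF assms(2,5)] comp_hom[OF assms(6,3)]])
    show "(p \<cdot> g) \<cdot> (f \<cdot> i) = Zer C Y X"
      using assms(2,3,5,6) obs by (simp add: cat_simps reassoc[OF assms(7)] d(2))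
    show "is_mono C (f \<cdot> i)" using mono_comp[OF d(3) assms(2) iso_mono[OF assms(4,5)] assms(5)] .
    show "is_epi C (p \<cdot> g)" using epi_comp[OF iso_epi[OF g assms(6)] assms(6) d(4) assms(3)] .
    fix W x assume x: "x \<in> Hom C W E'" "(p \<cdot> g) \<cdot> x = Zer C W X"
    have "p \<cdot> (g \<cdot> x) = Zer C W X" using x assms(3,6) by (simp add: cat_simps)
    then obtain h where h: "h \<in> Hom C W Y" "i \<cdot> h = g \<cdot> x" using d(5)[OF comp_hom[OF x(1) assms(6)]] by blast
    have "(f \<cdot> i) \<cdot> h = x" using h x(1) assms(2,5,6) by (simp add: cat_simps reassoc[OF assms(8)])
    then show "\<exists>h\<in>Hom C W Y. (f \<cdot> i) \<cdot> h = x" using h by blast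
  qed
qed

lemma short_exact_iso_left:
  assumes "short_exact C i p" "i \<in> Hom C Y E" "p \<in> Hom C E X" "is_iso C f" "f \<in> Hom C Y' Y"
  shows "short_exact C (i \<cdot> f) p"
proof -
  note d = short_exactD[OF assms(1,2), unfolded cod_hom[OF assms(3)]]
  obtain g where g: "g \<in> Hom C Y Y'" "f \<cdot> g = Ide C Y" using is_isoE[OF assms(4,5)] by metis
  have obs: "Y' \<in> Ob C" using hom_ob[OF assms(5)] by auto
  show ?thesis
  proof (rule short_exactI[OF comp_hom[OF assms(5,2)] assms(3)])
    show "p \<cdot> (i \<cdot> f) = Zer C Y' X"
      using assms(2,3,5) obs hom_ob[OF assms(3)] by (simp add: cat_simps reassoc[OF d(2)])
    show "is_mono C (i \<cdot> f)" using mono_comp[OF iso_mono[OF assms(4,5)] assms(5) d(3) assms(2)] .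
    show "is_epi C p" by (rule d(4))
    fix W x assume x: "x \<in> Hom C W E" "p \<cdot> x = Zer C W X"
    then obtain h where h: "h \<in> Hom C W Y" "i \<cdot> h = x" using d(5) by blast
    have "(i \<cdot> f) \<cdot> (g \<cdot> h) = x" using h g(1) assms(2,5) by (simp add: cat_simps reassoc[OF g(2)])
    then show "\<exists>h\<in>Hom C W Y'. (i \<cdot> f) \<cdot> h = x" using comp_hom[OF h(1) g(1)] by blast
  qed
qed

lemma ide_short_exact:
  assumes "X \<in> Ob C" "is_zero_ob C N"
  shows "short_exact C (Ide C X) (Zer C X N)"
proof -
  have N: "N \<in> Ob C" using assms by (simp add: is_zero_ob_def)
  show ?thesis
  proof (rule short_exactI[OF ide_hom[OF assms(1)] zer_hom[OF assms(1) N]])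
    show "Zer C X N \<cdot> Ide C X = Zer C X N" using assms N by (simp add: cat_simps)
    show "is_mono C (Ide C X)" using iso_mono[OF ide_iso ide_hom] assms by blast
    show "is_epi C (Zer C X N)"
      by (rule is_epiI[OF zer_hom[OF assms(1) N]]) (use zero_ob_from[OF assms(2)] in blast)
    show "\<exists>h\<in>Hom C W X. Ide C X \<cdot> h = x" if "x \<in> Hom C W X" for W x
      using that comp_ide_left[OF that] by blast
  qed
qed

lemma zero_kernel_iso:
  assumes "short_exact C i p" "i \<in> Hom C Y E" "p \<in> Hom C E X" "is_zero_ob C Y"
  shows "is_iso C p"
proof -
  note d = short_exactD[OF assms(1,2), unfolded cod_hom[OF assms(3)]]
  have "is_mono C p"
  proof (rule is_monoI[OF assms(3)])
    fix W x assume x: "x \<in> Hom C W E" "p \<cdot> x = Zer C W X"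
    then obtain h where h: "h \<in> Hom C W Y" "i \<cdot> h = x" using d(5) by blast
    have "h = Zer C W Y" using zero_ob_to[OF assms(4) h(1)] .
    then show "x = Zer C W E" using h(2) assms(2) hom_ob[OF h(1)] by (simp add: cat_simps)
  qed
  then show ?thesis using mono_epi_iso d(4) assms(3) by blast
qed

text \<open>The isomorphism theorem \<open>(E / S) / (Y / S) = E / Y\<close>.\<close>

lemma quotient_extension:
  assumes ip: "short_exact C i p" "i \<in> Hom C Y E" "p \<in> Hom C E X"
    and jq: "short_exact C j q" "j \<in> Hom C S Y" "q \<in> Hom C Y Y'"
    and c: "short_exact C (i \<cdot> j) c" "c \<in> Hom C E E'"
  shows "\<exists>i'\<in>Hom C Y' E'. \<exists>p'\<in>Hom C E' X. short_exact C i' p'"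
proof -
  note d = short_exactD[OF ip(1,2), unfolded cod_hom[OF ip(3)]]
  note e = short_exactD[OF jq(1,2), unfolded cod_hom[OF jq(3)]]
  note f = short_exactD[OF c(1) comp_hom[OF jq(2) ip(2)], unfolded cod_hom[OF c(2)]]
  have obs: "Y \<in> Ob C" "E \<in> Ob C" "X \<in> Ob C" "S \<in> Ob C" "Y' \<in> Ob C" "E' \<in> Ob C"
    using hom_ob ip jq c by blast+
  have cij: "c \<cdot> (i \<cdot> j) = Zer C S E'" by (rule f(2))
  have "\<exists>h\<in>Hom C Y' E'. h \<cdot> q = c \<cdot> i"
    by (rule e(6)) (use ip(2) jq(2) c(2) in \<open>simp_all add: cat_simps f(2)\<close>)
  then obtain i' where i': "i' \<in> Hom C Y' E'" "i' \<cdot> q = c \<cdot> i" by blast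
  have "\<exists>h\<in>Hom C E' X. h \<cdot> c = p"
    by (rule f(6)) (use ip(2,3) jq(2) c(2) obs in \<open>simp_all add: cat_simps reassoc[OF d(2)]\<close>)
  then obtain p' where p': "p' \<in> Hom C E' X" "p' \<cdot> c = p" by blast
  have mono: "is_mono C i'"
  proof (rule is_monoI[OF i'(1)])
    fix W y assume y: "y \<in> Hom C W Y'" "i' \<cdot> y = Zer C W E'"
    obtain V r z where r: "is_epi C r" "r \<in> Hom C V W" and z: "z \<in> Hom C V Y" "q \<cdot> z = y \<cdot> r"
      using epi_cover[OF e(4) jq(3) y(1)] by blast
    have V: "V \<in> Ob C" "W \<in> Ob C" using hom_ob[OF r(2)] by auto
    have "c \<cdot> (i \<cdot> z) = i' \<cdot> (q \<cdot> z)" using z(1) ip(2) c(2) i'(1) jq(3) by (simp add: cat_simps reassoc[OF i'(2)])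
    also have "\<dots> = Zer C V E'" unfolding z(2) using i'(1) y(1) r(2) V obs by (simp add: cat_simps reassoc[OF y(2)])
    finally obtain s where s: "s \<in> Hom C V S" "(i \<cdot> j) \<cdot> s = i \<cdot> z" using f(5)[OF comp_hom[OF z(1) ip(2)]] by blast
    have "i \<cdot> (j \<cdot> s) = i \<cdot> z" using s ip(2) jq(2) by (simp add: cat_simps)
    then have js: "j \<cdot> s = z" using mono_cancel[OF d(3) ip(2) comp_hom[OF s(1) jq(2)] z(1)] by simp
    have "y \<cdot> r = (q \<cdot> j) \<cdot> s" unfolding z(2)[symmetric] js[symmetric] using s(1) jq(2,3) by (simp add: cat_simps)
    also have "\<dots> = Zer C V Y'" unfolding e(2) using s(1) obs by (simp add: cat_simps)
    finally show "y = Zer C W Y'" using epi_zer[OF r y(1)] by simp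
  qed
  have "short_exact C i' p'"
  proof (rule short_exactI[OF i'(1) p'(1) _ mono])
    have "(p' \<cdot> i') \<cdot> q = Zer C Y X"
      using i' p'(1) jq(3) c(2) ip(2,3) by (simp add: cat_simps reassoc[OF p'(2)] d(2))
    then show "p' \<cdot> i' = Zer C Y' X" using epi_zer[OF e(4) jq(3) comp_hom[OF i'(1) p'(1)]] by simp
    show "is_epi C p'" using epi_of_comp[OF _ c(2) p'(1)] p'(2) d(4) by simp
    fix W x assume x: "x \<in> Hom C W E'" "p' \<cdot> x = Zer C W X"
    obtain V r z where r: "is_epi C r" "r \<in> Hom C V W" and z: "z \<in> Hom C V E" "c \<cdot> z = x \<cdot> r"
      using epi_cover[OF f(4) c(2) x(1)] by blast
    have V: "V \<in> Ob C" "W \<in> Ob C" using hom_ob[OF r(2)] by auto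
    have "p \<cdot> z = p' \<cdot> (c \<cdot> z)" using z(1) c(2) p'(1) by (simp add: cat_simps reassoc[OF p'(2)])
    also have "\<dots> = Zer C V X" unfolding z(2) using p'(1) x(1) r(2) V obs by (simp add: cat_simps reassoc[OF x(2)])
    finally obtain y where y: "y \<in> Hom C V Y" "i \<cdot> y = z" using d(5)[OF z(1)] by blast
    have "i' \<cdot> (q \<cdot> y) = x \<cdot> r"
      unfolding z(2)[symmetric] y(2)[symmetric]
      using y(1) i'(1) jq(3) c(2) ip(2) by (simp add: cat_simps reassoc[OF i'(2)])
    then show "\<exists>h\<in>Hom C W Y'. i' \<cdot> h = x"
      using mono_lift_along_epi[OF mono i'(1) r x(1) comp_hom[OF y(1) jq(3)]] by simp
  qed
  then show ?thesis using i'(1) p'(1) by blast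
qed

lemma mono_short_exactE:
  assumes "is_mono C m" "m \<in> Hom C X Y"
  obtains c Q where "short_exact C m c" "c \<in> Hom C Y Q"
proof -
  obtain c where c: "short_exact C m c" using mono_short_exact[OF assms(1)] .
  show ?thesis using that[OF c short_exact_hom[OF c assms(2)]] .
qed

lemma blen_SucI:
  "\<lbrakk>A \<in> S; short_exact C j p; j \<in> Hom C A X; p \<in> Hom C X Q; blen C S l Q\<rbrakk> \<Longrightarrow> blen C S (Suc l) X"
  using cod_hom[of p C X Q] unfolding blen.simps by metis

lemma blen_iso:
  assumes "isomorphic C X Y" "blen C S l X"
  shows "blen C S l Y"
proof (cases l)
  case 0
  then show ?thesis using isomorphic_zero assms by simp
next
  case (Suc l')
  then obtain A j p where A: "A \<in> S" "short_exact C j p" "j \<in> Hom C A X" "blen C S l' (Cod C p)"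
    using assms(2) by auto
  have p: "p \<in> Hom C X (Cod C p)" using short_exact_hom[OF A(2,3)] .
  obtain f where f: "f \<in> Hom C X Y" "is_iso C f" using assms(1) by (auto simp: isomorphic_def)
  obtain g where g: "g \<in> Hom C Y X" "g \<cdot> f = Ide C X" "f \<cdot> g = Ide C Y" using is_isoE[OF f(2,1)] by metis
  have "short_exact C (f \<cdot> j) (p \<cdot> g)" using short_exact_iso_middle[OF A(2,3) p f(2,1) g] .
  then show ?thesis unfolding Suc
    using blen_SucI[OF A(1) _ comp_hom[OF A(3) f(1)] comp_hom[OF g(1) p] A(4)] by blast
qed

text \<open>Dividing out the bottom step of \<open>Y\<close> from \<open>Y\<close> and from \<open>E\<close> leaves the quotient \<open>X\<close> unchanged.\<close>

lemma blen_ext: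
  "\<lbrakk>blen C S l Y; short_exact C i p; i \<in> Hom C Y E; p \<in> Hom C E X; blen C S m X\<rbrakk> \<Longrightarrow> blen C S (l + m) E"
proof (induction l arbitrary: Y E i p)
  case 0
  then have "is_iso C p" using zero_kernel_iso by simp
  then have "isomorphic C E X" using 0(4) by (auto simp: isomorphic_def)
  then show ?case using blen_iso[OF isomorphic_sym] 0(5) by simp
next
  case (Suc l)
  then obtain A j q where A: "A \<in> S" "short_exact C j q" "j \<in> Hom C A Y" "blen C S l (Cod C q)" by auto
  have q: "q \<in> Hom C Y (Cod C q)" using short_exact_hom[OF A(2,3)] .
  have ij: "i \<cdot> j \<in> Hom C A E" "is_mono C (i \<cdot> j)"
    using comp_hom[OF A(3) Suc.prems(3)] mono_comp[OF short_exact_mono[OF A(2,3)] A(3) short_exact_mono[OF Suc.prems(2,3)] Suc.prems(3)] .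
  obtain c Q where c: "short_exact C (i \<cdot> j) c" "c \<in> Hom C E Q" using mono_short_exactE[OF ij(2,1)] .
  obtain i' p' where "i' \<in> Hom C (Cod C q) Q" "p' \<in> Hom C Q X" "short_exact C i' p'"
    using quotient_extension[OF Suc.prems(2-4) A(2,3) q c] by blast
  then have "blen C S (l + m) Q" using Suc.IH[OF A(4)] Suc.prems(5) by blast
  then show ?case using blen_SucI[OF A(1) c(1) ij(1) c(2)] by simp
qed

lemma blen_ob:
  assumes "blen C S l X"
  shows "X \<in> Ob C"
proof (cases l)
  case 0
  then show ?thesis using assms by (simp add: is_zero_ob_def)
next
  case (Suc m)
  then obtain A j where "j \<in> Hom C A X" using assms by auto
  then show ?thesis using hom_ob by blast
qed

lemma ext_closure_iff_blen:
  assumes "S \<subseteq> Ob C"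
  shows "X \<in> ext_closure C S \<longleftrightarrow> (\<exists>l. blen C S l X)"
proof
  assume "X \<in> ext_closure C S"
  then show "\<exists>l. blen C S l X"
  proof induction
    case (zero X)
    then have "blen C S 0 X" by simp
    then show ?case by blast
  next
    case (base X)
    obtain N where N: "is_zero_ob C N" using zero_ob by blast
    have X: "X \<in> Ob C" "N \<in> Ob C" using base assms N by (auto simp: is_zero_ob_def)
    have "blen C S (Suc 0) X"
      using blen_SucI[OF base ide_short_exact[OF X(1) N] ide_hom[OF X(1)] zer_hom[OF X], of 0] N
        unfolding blen.simps(1) by blast
    then show ?case by blast
  next
    case (iso X Y)
    then show ?case using blen_iso by blast
  next
    case (ext X Y i p E)
    have i: "i \<in> Hom C Y E" using ext by (auto simp: Hom_iff short_exact_def is_kernel_def)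
    have p: "p \<in> Hom C E X" using short_exact_hom[OF ext(3) i] ext by simp
    then show ?case using blen_ext[OF _ ext(3) i p] ext.IH by blast
  qed
next
  assume "\<exists>l. blen C S l X"
  then obtain l where "blen C S l X" by blast
  then show "X \<in> ext_closure C S"
  proof (induction l arbitrary: X)
    case 0
    then show ?case by (simp add: ext_closure.zero)
  next
    case (Suc l)
    then obtain A j p where A: "A \<in> S" "short_exact C j p" "j \<in> Hom C A X" "blen C S l (Cod C p)" by auto
    show ?case
      by (rule ext_closure.ext[OF Suc.IH[OF A(4)] ext_closure.base[OF A(1)] A(2)]) (use A(3) in \<open>simp_all add: Hom_iff\<close>)
  qed
qed

lemma ext_closure_ob: "S \<subseteq> Ob C \<Longrightarrow> X \<in> ext_closure C S \<Longrightarrow> X \<in> Ob C"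
  using ext_closure_iff_blen blen_ob by blast

lemma ext_closure_ext:
  assumes "short_exact C i p" "i \<in> Hom C Y E" "p \<in> Hom C E X" "Y \<in> ext_closure C S" "X \<in> ext_closure C S"
  shows "E \<in> ext_closure C S"
  by (rule ext_closure.ext[OF assms(5,4,1)]) (use assms(2,3) in \<open>simp_all add: Hom_iff\<close>)

lemma ext_closure_op_subset: "X \<in> ext_closure C S \<Longrightarrow> X \<in> ext_closure (op_cat C) S"
proof (induction rule: ext_closure.induct)
  case (iso X Y)
  have "isomorphic (op_cat C) X Y" using isomorphic_sym[OF iso(2)] by (auto simp: isomorphic_def)
  then show ?case using iso ext_closure.iso by metis
next
  case (ext X Y i p E)
  have "Dom C p = E" using ext by (auto simp: short_exact_def is_kernel_def)
  then show ?case using ext by (intro ext_closure.ext[of Y "op_cat C" S X p i E]) auto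
qed (auto intro: ext_closure.intros)

lemma op_op [simp]: "op_cat (op_cat C) = C"
  by (simp add: op_cat_def)

lemma ext_closure_op [simp]: "ext_closure (op_cat C) S = ext_closure C S"
  using ext_closure_op_subset abelian_category.ext_closure_op_subset[OF op_abelian, of _ S] by auto

text \<open>Objects of the extension closure have filtrations whose bottom step is in \<open>S\<close>; by duality
  they also have filtrations whose top step is in \<open>S\<close>. Both give an induction principle.\<close>

lemma ext_closure_bottom_induct [consumes 2, case_names zero step]:
  assumes "S \<subseteq> Ob C" "X \<in> ext_closure C S"
    and "\<And>X. is_zero_ob C X \<Longrightarrow> P X"
    and "\<And>A X Q j p. \<lbrakk>A \<in> S; short_exact C j p; j \<in> Hom C A X; p \<in> Hom C X Q; Q \<in> ext_closure C S; P Q\<rbrakk> \<Longrightarrow> P X"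
  shows "P X"
proof -
  obtain l where "blen C S l X" using assms(1,2) ext_closure_iff_blen by blast
  then show ?thesis
  proof (induction l arbitrary: X)
    case (Suc l)
    then obtain A j p where A: "A \<in> S" "short_exact C j p" "j \<in> Hom C A X" "blen C S l (Cod C p)" by auto
    show ?case
      using assms(4)[OF A(1-3) short_exact_hom[OF A(2,3)]] Suc.IH[OF A(4)] A(4) ext_closure_iff_blen[OF assms(1)] by blast
  qed (simp add: assms)
qed

lemma ext_closure_top_induct [consumes 2, case_names zero step]:
  assumes "S \<subseteq> Ob C" "X \<in> ext_closure C S"
    and "\<And>X. is_zero_ob C X \<Longrightarrow> P X"
    and "\<And>A X U j p. \<lbrakk>A \<in> S; short_exact C j p; j \<in> Hom C U X; p \<in> Hom C X A; U \<in> ext_closure C S; P U\<rbrakk> \<Longrightarrow> P X"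
  shows "P X"
  using abelian_category.ext_closure_bottom_induct[OF op_abelian, of S X P] assms by simp

end

section \<open>Orthogonal bricks\<close>

locale orthogonal_bricks = abelian_category C for C :: "('k::field, 'o, 'm) lin_cat" (structure) +
  fixes S :: "'o set"
  assumes S_ob: "S \<subseteq> Ob C"
    and brick: "\<lbrakk>A \<in> S; B \<in> S; f \<in> Hom C A B; f \<noteq> Zer C A B\<rbrakk> \<Longrightarrow> is_iso C f"
    and brick_nonzero: "A \<in> S \<Longrightarrow> \<not> is_zero_ob C A"
begin

abbreviation F where "F \<equiv> ext_closure C S"

lemma F_ob: "X \<in> F \<Longrightarrow> X \<in> Ob C"
  using ext_closure_ob S_ob by blast

lemma S_F: "A \<in> S \<Longrightarrow> A \<in> F"
  by (rule ext_closure.base)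

text \<open>Let \<open>B\<close> be the bottom step of \<open>Y\<close>. If \<open>f\<close> vanishes modulo \<open>B\<close>, it is an isomorphism onto \<open>B\<close>
  followed by the inclusion. Otherwise the induction hypothesis embeds \<open>A\<close> into \<open>Y / B\<close>, and
  \<open>Y / A\<close> is an extension of the quotient of this embedding by \<open>B\<close>.\<close>

lemma brick_map:
  assumes "A \<in> S" "Y \<in> F" "f \<in> Hom C A Y" "f \<noteq> Zer C A Y"
  shows "\<exists>c. short_exact C f c \<and> Cod C c \<in> F"
  using S_ob assms(2,3,4)
proof (induction arbitrary: f rule: ext_closure_bottom_induct)
  case (zero Y)
  then show ?case using zero_ob_to[of Y f A] by simp
next
  case (step B Y Q j q f)
  note d = short_exactD[OF step(2,3), unfolded cod_hom[OF step(4)]]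
  have obs: "A \<in> Ob C" "B \<in> Ob C" "Y \<in> Ob C" "Q \<in> Ob C" using hom_ob step(3,4,7) by blast+
  have qf: "q \<cdot> f \<in> Hom C A Q" using step(4,7) by (simp add: comp_hom)
  show ?case
  proof (cases "q \<cdot> f = Zer C A Q")
    case True
    then obtain g where g: "g \<in> Hom C A B" "j \<cdot> g = f" using d(5)[OF step(7)] by blast
    have "g \<noteq> Zer C A B" using g(2) step(3,8) obs by (auto simp: cat_simps)
    then have "is_iso C g" using brick[OF assms(1) step(1) g(1)] by blast
    then have "short_exact C (j \<cdot> g) q" using short_exact_iso_left[OF step(2-4)] g(1) by blast
    then show ?thesis using g(2) step(5) cod_hom[OF step(4)] by auto
  next
    case False
    then obtain c' where c': "short_exact C (q \<cdot> f) c'" "Cod C c' \<in> F" using step(6)[OF qf] by blast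
    define Q' where "Q' = Cod C c'"
    note e = short_exactD[OF c'(1) qf, folded Q'_def]
    have fm: "is_mono C f" using mono_of_comp[OF e(3) step(7,4)] .
    obtain c E where c: "short_exact C f c" "c \<in> Hom C Y E" using mono_short_exactE[OF fm step(7)] .
    note g = short_exactD[OF c(1) step(7), unfolded cod_hom[OF c(2)]]
    have obs2: "E \<in> Ob C" "Q' \<in> Ob C" using hom_ob c(2) e(1) by blast+
    have c'qf: "c' \<cdot> (q \<cdot> f) = Zer C A Q'" by (rule e(2))
    have "\<exists>h\<in>Hom C E Q'. h \<cdot> c = c' \<cdot> q"
      by (rule g(6)) (use step(4,7) e(1) in \<open>simp_all add: cat_simps e(2)\<close>)
    then obtain p where p: "p \<in> Hom C E Q'" "p \<cdot> c = c' \<cdot> q" by blast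
    have cj: "c \<cdot> j \<in> Hom C B E" using step(3) c(2) by (simp add: comp_hom)
    have mono: "is_mono C (c \<cdot> j)"
    proof (rule is_monoI[OF cj])
      fix W b assume b: "b \<in> Hom C W B" "(c \<cdot> j) \<cdot> b = Zer C W E"
      have W: "W \<in> Ob C" using hom_ob[OF b(1)] by simp
      have "c \<cdot> (j \<cdot> b) = Zer C W E" using b step(3) c(2) by (simp add: cat_simps)
      then obtain a where a: "a \<in> Hom C W A" "f \<cdot> a = j \<cdot> b" using g(5)[OF comp_hom[OF b(1) step(3)]] by blast
      have "(q \<cdot> f) \<cdot> a = Zer C W Q"
        using a b(1) step(3,4,7) obs by (simp add: cat_simps reassoc[OF d(2)])
      then have "a = Zer C W A" using mono_zer[OF e(3) qf a(1)] by simp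
      then have "j \<cdot> b = Zer C W Y" using a(2) step(7) W by (simp add: cat_simps)
      then show "b = Zer C W B" using mono_zer[OF d(3) step(3) b(1)] by simp
    qed
    have "short_exact C (c \<cdot> j) p"
    proof (rule short_exactI[OF cj p(1) _ mono])
      show "p \<cdot> (c \<cdot> j) = Zer C B Q'"
        using p(1) c(2) step(3,4) e(1) obs by (simp add: cat_simps reassoc[OF p(2)] d(2))
      have "is_epi C (p \<cdot> c)" unfolding p(2) using epi_comp[OF d(4) step(4) e(4,1)] .
      then show "is_epi C p" using epi_of_comp[OF _ c(2) p(1)] by simp
      fix W x assume x: "x \<in> Hom C W E" "p \<cdot> x = Zer C W Q'"
      obtain V r z where r: "is_epi C r" "r \<in> Hom C V W" and z: "z \<in> Hom C V Y" "c \<cdot> z = x \<cdot> r"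
        using epi_cover[OF g(4) c(2) x(1)] by blast
      have V: "V \<in> Ob C" "W \<in> Ob C" using hom_ob[OF r(2)] by auto
      have "c' \<cdot> (q \<cdot> z) = p \<cdot> (c \<cdot> z)" using z(1) c(2) p(1) step(4) e(1) by (simp add: cat_simps reassoc[OF p(2)])
      also have "\<dots> = Zer C V Q'" unfolding z(2) using p(1) x(1) r(2) V obs2 by (simp add: cat_simps reassoc[OF x(2)])
      finally obtain a where a: "a \<in> Hom C V A" "(q \<cdot> f) \<cdot> a = q \<cdot> z" using e(5)[OF comp_hom[OF z(1) step(4)]] by blast
      have qfa: "q \<cdot> (f \<cdot> a) = q \<cdot> z" using a step(4,7) by (simp add: cat_simps)
      have "\<exists>h\<in>Hom C V B. j \<cdot> h = Plus C z (Scal C (- 1) (f \<cdot> a))"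
        by (rule d(5)) (use z(1) a(1) step(4,7) in \<open>simp_all add: cat_simps qfa\<close>)
      then obtain b where b: "b \<in> Hom C V B" "j \<cdot> b = Plus C z (Scal C (- 1) (f \<cdot> a))" by blast
      have "(c \<cdot> j) \<cdot> b = c \<cdot> z"
        using b step(3,7) c(2) z(1) a(1) V obs2 by (simp add: cat_simps reassoc[OF g(2)])
      then show "\<exists>h\<in>Hom C W B. (c \<cdot> j) \<cdot> h = x"
        using mono_lift_along_epi[OF mono cj r x(1) b(1)] z(2) by simp
    qed
    then have "E \<in> F" using ext_closure_ext[OF _ cj p(1) S_F[OF step(1)]] c'(2) Q'_def by simp
    then have "Cod C c \<in> F" using cod_hom[OF c(2)] by simp
    then show ?thesis using c(1) by blast
  qed
qed

text \<open>Let \<open>A\<close> be a bottom step of \<open>X\<close>. If \<open>f\<close> kills \<open>A\<close>, the cokernel of \<open>f\<close> is that of the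
  induced arrow on \<open>X / A\<close>, and its kernel is an extension of the induced kernel by \<open>A\<close>. Otherwise
  \<open>A\<close> embeds into \<open>Y\<close> by the previous lemma, and the arrow from \<open>X / A\<close> to \<open>Y / A\<close> has the same
  kernel and cokernel as \<open>f\<close>.\<close>

lemma F_ker_coker:
  assumes "X \<in> F" "Y \<in> F" "f \<in> Hom C X Y" "is_kernel C f k" "is_cokernel C f c"
  shows "Dom C k \<in> F \<and> Cod C c \<in> F"
  using S_ob assms
proof (induction arbitrary: Y f k c rule: ext_closure_bottom_induct)
  case (zero X)
  note kD = is_kernelD[OF zero(4,3)] and cD = is_cokernelD[OF zero(5,3)]
  have obs: "X \<in> Ob C" "Y \<in> Ob C" "Dom C k \<in> Ob C" using hom_ob zero(3) kD(1) by blast+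
  have "k \<cdot> Ide C (Dom C k) = k \<cdot> Zer C (Dom C k) (Dom C k)"
    using zero_ob_to[OF zero(1)] kD(1) obs comp_hom[OF ide_hom kD(1)] comp_hom[OF zer_hom kD(1)] by metis
  then have "Ide C (Dom C k) = Zer C (Dom C k) (Dom C k)"
    using mono_cancel[OF kD(3,1) ide_hom zer_hom] obs by blast
  then have "is_zero_ob C (Dom C k)" using obs by (simp add: is_zero_ob_iff)
  moreover have "Ide C Y \<cdot> f = Zer C X Y" using zero_ob_from[OF zero(1)] comp_hom[OF zero(3) ide_hom] obs by blast
  then obtain h where h: "h \<in> Hom C (Cod C c) Y" "h \<cdot> c = Ide C Y" using cD(4)[OF ide_hom[OF obs(2)]] by blast
  then have "is_mono C c" using mono_of_comp[OF _ cD(1) h(1)] iso_mono[OF ide_iso ide_hom] obs by simp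
  then have "is_iso C c" using mono_epi_iso cD(3,1) by blast
  then have "isomorphic C Y (Cod C c)" using cD(1) by (auto simp: isomorphic_def)
  ultimately show ?case using zero(2) ext_closure.zero ext_closure.iso by metis
next
  case (step A X X' j q)
  note kD = is_kernelD[OF step(9,8)] and cD = is_cokernelD[OF step(10,8)]
  note d = short_exactD[OF step(2,3), unfolded cod_hom[OF step(4)]]
  define K where "K = Dom C k"
  define Q where "Q = Cod C c"
  note kD = kD[folded K_def] and cD = cD[folded Q_def]
  have obs: "A \<in> Ob C" "X \<in> Ob C" "X' \<in> Ob C" "Y \<in> Ob C" "K \<in> Ob C" "Q \<in> Ob C"
    using hom_ob step(3,4,8) kD(1) cD(1) by blast+
  have fj: "f \<cdot> j \<in> Hom C A Y" using step(3,8) by (simp add: comp_hom)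
  show ?case
  proof (cases "f \<cdot> j = Zer C A Y")
    case True
    then obtain f' where f': "f' \<in> Hom C X' Y" "f' \<cdot> q = f" using d(6)[OF step(8)] by blast
    have "(c \<cdot> f') \<cdot> q = Zer C X Q" using f' cD(1,2) step(4) by (simp add: cat_simps)
    then have cf': "c \<cdot> f' = Zer C X' Q" using epi_zer[OF d(4) step(4) comp_hom[OF f'(1) cD(1)]] by simp
    have coker: "is_cokernel C f' c"
    proof (rule is_cokernelI[OF f'(1) cD(1) cf' cD(3)])
      fix W x assume x: "x \<in> Hom C Y W" "x \<cdot> f' = Zer C X' W"
      have "x \<cdot> f = (x \<cdot> f') \<cdot> q" using x(1) f' step(4) by (simp add: cat_simps)
      then have "x \<cdot> f = Zer C X W" unfolding x(2) using step(4) hom_ob[OF x(1)] by (simp add: cat_simps)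
      then show "\<exists>h\<in>Hom C Q W. h \<cdot> c = x" using cD(4)[OF x(1)] by blast
    qed
    obtain k' where k': "is_kernel C f' k'" using kernels f'(1) by (auto simp: Hom_iff)
    define K' where "K' = Dom C k'"
    note k'D = is_kernelD[OF k' f'(1), folded K'_def]
    have IH: "K' \<in> F" "Q \<in> F" using step(6)[OF step(7) f'(1) k' coker] by (auto simp: K'_def Q_def)
    have K': "K' \<in> Ob C" using hom_ob[OF k'D(1)] by simp
    obtain j' where j': "j' \<in> Hom C A K" "k \<cdot> j' = j" using kD(4)[OF step(3) True] by blast
    have "f' \<cdot> (q \<cdot> k) = Zer C K Y" using f' kD(1,2) step(4) by (simp add: cat_simps reassoc[OF f'(2)])
    then obtain q' where q': "q' \<in> Hom C K K'" "k' \<cdot> q' = q \<cdot> k" using k'D(4)[OF comp_hom[OF kD(1) step(4)]] by blast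
    have "short_exact C j' q'"
    proof (rule short_exactI[OF j'(1) q'(1)])
      have "k' \<cdot> (q' \<cdot> j') = Zer C A X'"
        using k'D(1) q'(1) j' kD(1) step(4) by (simp add: cat_simps reassoc[OF q'(2)] d(2))
      then show "q' \<cdot> j' = Zer C A K'" using mono_zer[OF k'D(3,1) comp_hom[OF j'(1) q'(1)]] by simp
      show "is_mono C j'" using mono_of_comp[OF _ j'(1) kD(1)] j'(2) d(3) by simp
      obtain V r x where r: "is_epi C r" "r \<in> Hom C V K'" and x: "x \<in> Hom C V X" "q \<cdot> x = k' \<cdot> r"
        using epi_cover[OF d(4) step(4) k'D(1)] by blast
      have V: "V \<in> Ob C" using hom_ob[OF r(2)] by simp
      have "f \<cdot> x = f' \<cdot> (q \<cdot> x)" using f' x(1) step(4) by (simp add: cat_simps reassoc[OF f'(2)])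
      also have "\<dots> = Zer C V Y" unfolding x(2) using f'(1) k'D(1) r(2) V obs by (simp add: cat_simps reassoc[OF k'D(2)])
      finally obtain t where t: "t \<in> Hom C V K" "k \<cdot> t = x" using kD(4)[OF x(1)] by blast
      have "k' \<cdot> (q' \<cdot> t) = k' \<cdot> r" using t x k'D(1) q'(1) kD(1) step(4) by (simp add: cat_simps reassoc[OF q'(2)])
      then have "q' \<cdot> t = r" using mono_cancel[OF k'D(3,1) comp_hom[OF t(1) q'(1)] r(2)] by simp
      then show "is_epi C q'" using epi_of_comp[OF _ t(1) q'(1)] r(1) by simp
    next
      fix W x assume x: "x \<in> Hom C W K" "q' \<cdot> x = Zer C W K'"
      have W: "W \<in> Ob C" using hom_ob[OF x(1)] by simp
      have "q \<cdot> (k \<cdot> x) = k' \<cdot> (q' \<cdot> x)" using x(1) k'D(1) q'(1) kD(1) step(4) by (simp add: cat_simps reassoc[OF q'(2)])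
      then have "q \<cdot> (k \<cdot> x) = Zer C W X'" unfolding x(2) using k'D(1) W by (simp add: cat_simps)
      then obtain a where a: "a \<in> Hom C W A" "j \<cdot> a = k \<cdot> x" using d(5)[OF comp_hom[OF x(1) kD(1)]] by blast
      have "k \<cdot> (j' \<cdot> a) = k \<cdot> x" using a j' kD(1) by (simp add: cat_simps reassoc[OF j'(2)])
      then have "j' \<cdot> a = x" using mono_cancel[OF kD(3,1) comp_hom[OF a(1) j'(1)] x(1)] by simp
      then show "\<exists>h\<in>Hom C W A. j' \<cdot> h = x" using a(1) by blast
    qed
    then have "K \<in> F" using ext_closure_ext[OF _ j'(1) q'(1) S_F[OF step(1)] IH(1)] by blast
    then show ?thesis using IH(2) by (simp add: K_def Q_def)
  next
    case False
    then obtain e where e: "short_exact C (f \<cdot> j) e" "Cod C e \<in> F" using brick_map[OF step(1,7) fj] by blast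
    define Y' where "Y' = Cod C e"
    note eD = short_exactD[OF e(1) fj, folded Y'_def]
    have Y': "Y' \<in> Ob C" using hom_ob[OF eD(1)] by simp
    have "\<exists>h\<in>Hom C X' Y'. h \<cdot> q = e \<cdot> f"
      by (rule d(6)) (use eD(1) step(3,8) in \<open>simp_all add: cat_simps eD(2)\<close>)
    then obtain f' where f': "f' \<in> Hom C X' Y'" "f' \<cdot> q = e \<cdot> f" by blast
    have qk: "q \<cdot> k \<in> Hom C K X'" using kD(1) step(4) by (simp add: comp_hom)
    have mono: "is_mono C (q \<cdot> k)"
    proof (rule is_monoI[OF qk])
      fix W x assume x: "x \<in> Hom C W K" "(q \<cdot> k) \<cdot> x = Zer C W X'"
      have W: "W \<in> Ob C" using hom_ob[OF x(1)] by simp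
      have "q \<cdot> (k \<cdot> x) = Zer C W X'" using x kD(1) step(4) by (simp add: cat_simps)
      then obtain a where a: "a \<in> Hom C W A" "j \<cdot> a = k \<cdot> x" using d(5)[OF comp_hom[OF x(1) kD(1)]] by blast
      have "(f \<cdot> j) \<cdot> a = Zer C W Y" using a step(3,8) x(1) kD(1) W obs by (simp add: cat_simps reassoc[OF kD(2)])
      then have "a = Zer C W A" using mono_zer[OF eD(3) fj a(1)] by simp
      then have "k \<cdot> x = Zer C W X" using a(2) step(3) W by (simp add: cat_simps)
      then show "x = Zer C W K" using mono_zer[OF kD(3,1) x(1)] by simp
    qed
    have ker: "is_kernel C f' (q \<cdot> k)"
    proof (rule is_kernelI[OF f'(1) qk _ mono])
      show "f' \<cdot> (q \<cdot> k) = Zer C K Y'"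
        using f'(1) step(4,8) kD(1,2) eD(1) obs by (simp add: cat_simps reassoc[OF f'(2)])
      fix W y assume y: "y \<in> Hom C W X'" "f' \<cdot> y = Zer C W Y'"
      obtain V r x where r: "is_epi C r" "r \<in> Hom C V W" and x: "x \<in> Hom C V X" "q \<cdot> x = y \<cdot> r"
        using epi_cover[OF d(4) step(4) y(1)] by blast
      have V: "V \<in> Ob C" "W \<in> Ob C" using hom_ob[OF r(2)] by auto
      have "e \<cdot> (f \<cdot> x) = f' \<cdot> (q \<cdot> x)" using f'(1) x(1) step(4,8) eD(1) by (simp add: cat_simps reassoc[OF f'(2)])
      also have "\<dots> = Zer C V Y'" unfolding x(2) using f'(1) y(1) r(2) V Y' by (simp add: cat_simps reassoc[OF y(2)])
      finally obtain a where a: "a \<in> Hom C V A" "(f \<cdot> j) \<cdot> a = f \<cdot> x" using eD(5)[OF comp_hom[OF x(1) step(8)]] by blast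
      have fja: "f \<cdot> (j \<cdot> a) = f \<cdot> x" using a step(3,8) by (simp add: cat_simps)
      have "\<exists>h\<in>Hom C V K. k \<cdot> h = Plus C x (Scal C (- 1) (j \<cdot> a))"
        by (rule kD(4)) (use x(1) a(1) step(3,8) in \<open>simp_all add: cat_simps fja\<close>)
      then obtain t where t: "t \<in> Hom C V K" "k \<cdot> t = Plus C x (Scal C (- 1) (j \<cdot> a))" by blast
      have "(q \<cdot> k) \<cdot> t = y \<cdot> r"
        using t step(3,4) kD(1) x a(1) y(1) r(2) V obs by (simp add: cat_simps reassoc[OF d(2)])
      then show "\<exists>h\<in>Hom C W K. (q \<cdot> k) \<cdot> h = y" using mono_lift_along_epi[OF mono qk r y(1) t(1)] by simp
    qed
    have "\<exists>h\<in>Hom C Y' Q. h \<cdot> e = c"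
      by (rule eD(6)) (use cD(1) step(3,8) obs in \<open>simp_all add: cat_simps reassoc[OF cD(2)]\<close>)
    then obtain c' where c': "c' \<in> Hom C Y' Q" "c' \<cdot> e = c" by blast
    have "is_cokernel C f' c'"
    proof (rule is_cokernelI[OF f'(1) c'(1)])
      have "(c' \<cdot> f') \<cdot> q = Zer C X Q"
        using c' f' step(4,8) eD(1) by (simp add: cat_simps reassoc[OF c'(2)] cD(2))
      then show "c' \<cdot> f' = Zer C X' Q" using epi_zer[OF d(4) step(4) comp_hom[OF f'(1) c'(1)]] by simp
      show "is_epi C c'" using epi_of_comp[OF _ eD(1) c'(1)] c'(2) cD(3) by simp
      fix W x assume x: "x \<in> Hom C Y' W" "x \<cdot> f' = Zer C X' W"
      have W: "W \<in> Ob C" using hom_ob[OF x(1)] by simp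
      have "(x \<cdot> e) \<cdot> f = (x \<cdot> f') \<cdot> q" using x(1) f' step(4,8) eD(1) by (simp add: cat_simps)
      then have "(x \<cdot> e) \<cdot> f = Zer C X W" unfolding x(2) using step(4) W by (simp add: cat_simps)
      then obtain h where h: "h \<in> Hom C Q W" "h \<cdot> c = x \<cdot> e" using cD(4)[OF comp_hom[OF eD(1) x(1)]] by blast
      have "(h \<cdot> c') \<cdot> e = x \<cdot> e" using h c' eD(1) by (simp add: cat_simps)
      then have "h \<cdot> c' = x" using epi_cancel[OF eD(4,1) comp_hom[OF c'(1) h(1)] x(1)] by simp
      then show "\<exists>h\<in>Hom C Q W. h \<cdot> c' = x" using h(1) by blast
    qed
    then have "Dom C (q \<cdot> k) \<in> F \<and> Cod C c' \<in> F" using step(6)[OF _ f'(1) ker] e(2) by (simp add: Y'_def)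
    then show ?thesis using dom_hom[OF qk] cod_hom[OF c'(1)] by (simp add: K_def Q_def)
  qed
qed

end

section \<open>Full abelian subcategories\<close>

lemma full_subcat_sel [simp]:
  "Ob (full_subcat C S) = S" "Arr (full_subcat C S) = {f \<in> Arr C. Dom C f \<in> S \<and> Cod C f \<in> S}"
  "Dom (full_subcat C S) = Dom C" "Cod (full_subcat C S) = Cod C" "Ide (full_subcat C S) = Ide C"
  "Comp (full_subcat C S) = Comp C" "Zer (full_subcat C S) = Zer C"
  "Plus (full_subcat C S) = Plus C" "Scal (full_subcat C S) = Scal C"
  by (simp_all add: full_subcat_def)

lemma full_subcat_hom: "f \<in> Hom (full_subcat C S) X Y \<longleftrightarrow> X \<in> S \<and> Y \<in> S \<and> f \<in> Hom C X Y"
  by (auto simp: Hom_iff)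

lemma full_subcat_hom_eq [simp]: "\<lbrakk>X \<in> S; Y \<in> S\<rbrakk> \<Longrightarrow> Hom (full_subcat C S) X Y = Hom C X Y"
  by (auto simp: full_subcat_hom)

lemma full_subcat_hom_space [simp]: "\<lbrakk>X \<in> S; Y \<in> S\<rbrakk> \<Longrightarrow> hom_space (full_subcat C S) X Y = hom_space C X Y"
  by (simp add: hom_space_def)

lemma op_full_subcat: "op_cat (full_subcat C S) = full_subcat (op_cat C) S"
  by (auto simp: op_cat_def full_subcat_def)

lemma ext_morphism_full_subcat:
  assumes "i \<in> Hom C Y E" "p \<in> Hom C E X" "i' \<in> Hom C Y' E'" "p' \<in> Hom C E' X'"
    "X \<in> S" "Y \<in> S" "E \<in> S" "X' \<in> S" "Y' \<in> S" "E' \<in> S"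
  shows "ext_morphism (full_subcat C S) (i, p) (i', p') a b \<longleftrightarrow> ext_morphism C (i, p) (i', p') a b"
  using assms by (simp add: ext_morphism_def dom_hom cod_hom)

text \<open>The closure conditions make the inclusion exact: kernels, cokernels, short exact sequences and
  extensions are the same in the subcategory and in the ambient category.\<close>

locale abelian_subcategory = abelian_category C for C :: "('k::field, 'o, 'm) lin_cat" (structure) +
  fixes S :: "'o set"
  assumes sub_ob: "S \<subseteq> Ob C"
    and sub_zero: "is_zero_ob C X \<Longrightarrow> X \<in> S"
    and sub_ext: "\<lbrakk>short_exact C i p; i \<in> Hom C Y E; p \<in> Hom C E X; X \<in> S; Y \<in> S\<rbrakk> \<Longrightarrow> E \<in> S"
    and sub_ker: "\<lbrakk>f \<in> Hom C X Y; X \<in> S; Y \<in> S; is_kernel C f k\<rbrakk> \<Longrightarrow> Dom C k \<in> S"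
    and sub_coker: "\<lbrakk>f \<in> Hom C X Y; X \<in> S; Y \<in> S; is_cokernel C f q\<rbrakk> \<Longrightarrow> Cod C q \<in> S"
begin

abbreviation D where "D \<equiv> full_subcat C S"

lemma op_sub: "abelian_subcategory (op_cat C) S"
proof (rule abelian_subcategory.intro[OF op_abelian], rule abelian_subcategory_axioms.intro)
  fix i p Y E X assume "short_exact (op_cat C) i p" "i \<in> Hom (op_cat C) Y E" "p \<in> Hom (op_cat C) E X" "X \<in> S" "Y \<in> S"
  then show "E \<in> S" using sub_ext[of p i X E Y] by simp
qed (use sub_ob sub_zero sub_ker sub_coker in simp_all)

lemma linear_D: "linear_category D"
proof (rule linear_category.intro)
  fix f g h X Y Z W assume "f \<in> Hom D X Y" "g \<in> Hom D Y Z" "h \<in> Hom D Z W"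
  then show "h \<cdot>\<^bsub>D\<^esub> (g \<cdot>\<^bsub>D\<^esub> f) = (h \<cdot>\<^bsub>D\<^esub> g) \<cdot>\<^bsub>D\<^esub> f"
    using comp_assoc[of f X Y g Z h W] by (simp add: full_subcat_hom)
qed (use sub_ob in \<open>auto simp: full_subcat_hom ide_hom comp_hom comp_ide_left comp_ide_right
  hom_vector_space comp_plus_left comp_plus_right comp_scal_left comp_scal_right subset_iff\<close>)

sublocale D: linear_category D
  by (rule linear_D)

lemma D_ob: "X \<in> S \<Longrightarrow> X \<in> Ob C"
  using sub_ob by blast

lemma D_zero_ob: "is_zero_ob D X \<longleftrightarrow> is_zero_ob C X"
  using D.is_zero_ob_iff is_zero_ob_iff sub_zero sub_ob by auto

lemma D_iso: "is_iso D f \<longleftrightarrow> f \<in> Arr D \<and> is_iso C f"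
  by (auto simp: is_iso_def)

lemma D_mono: "is_mono D f \<longleftrightarrow> f \<in> Arr D \<and> is_mono C f"
proof
  assume f: "is_mono D f"
  then have fD: "f \<in> Arr D" by (simp add: is_mono_def)
  define X Y where "X = Dom C f" and "Y = Cod C f"
  have h: "f \<in> Hom C X Y" "X \<in> S" "Y \<in> S" "f \<in> Hom D X Y" using fD by (auto simp: Hom_iff X_def Y_def)
  obtain k where k: "is_kernel C f k" using kernels h(1) by (auto simp: Hom_iff)
  define K where "K = Dom C k"
  note kD = is_kernelD[OF k h(1), folded K_def]
  have K: "K \<in> S" using sub_ker[OF h(1-3) k] by (simp add: K_def)
  have k0: "k = Zer C K X"
    using D.mono_zer[OF f h(4), of k K] kD(1,2) K h by simp
  have "is_mono C f"
  proof (rule is_monoI[OF h(1)])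
    fix W x assume x: "x \<in> Hom C W X" "f \<cdot> x = Zer C W Y"
    then obtain t where t: "t \<in> Hom C W K" "k \<cdot> t = x" using kD(4) by blast
    then show "x = Zer C W X" using k0 h D_ob[OF K] D_ob[OF h(2)] by (auto simp: cat_simps)
  qed
  then show "f \<in> Arr D \<and> is_mono C f" using fD by simp
next
  assume f: "f \<in> Arr D \<and> is_mono C f"
  show "is_mono D f" unfolding is_mono_def
  proof (intro conjI ballI impI)
    fix W g h assume "W \<in> Ob D" "g \<in> Hom D W (Dom D f)" "h \<in> Hom D W (Dom D f)" "f \<cdot>\<^bsub>D\<^esub> g = f \<cdot>\<^bsub>D\<^esub> h"
    then show "g = h" using mono_cancel[of f "Dom C f" "Cod C f" g W h] f by (simp add: full_subcat_hom Hom_iff)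
  qed (use f in simp)
qed

lemma D_kernel: "is_kernel D f k \<longleftrightarrow> f \<in> Arr D \<and> k \<in> Arr D \<and> is_kernel C f k"
proof
  assume *: "is_kernel D f k"
  then have fk: "f \<in> Arr D" "k \<in> Arr D" by (auto simp: is_kernel_def)
  define X Y K where "X = Dom C f" and "Y = Cod C f" and "K = Dom C k"
  have h: "f \<in> Hom C X Y" "X \<in> S" "Y \<in> S" "f \<in> Hom D X Y" using fk by (auto simp: Hom_iff X_def Y_def)
  have DK: "Dom D k = K" and K: "K \<in> S" using fk by (simp_all add: K_def)
  note kD = D.is_kernelD[OF * h(4), unfolded DK]
  have k: "k \<in> Hom C K X" using kD(1) by (simp add: full_subcat_hom)
  obtain k0 where k0: "is_kernel C f k0" using kernels h(1) by (auto simp: Hom_iff)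
  define K0 where "K0 = Dom C k0"
  note k0D = is_kernelD[OF k0 h(1), folded K0_def]
  have K0: "K0 \<in> S" using sub_ker[OF h(1-3) k0] by (simp add: K0_def)
  obtain v where v: "v \<in> Hom C K0 K" "k \<cdot> v = k0"
    using kD(4)[of k0 K0] k0D(1,2) K0 h K by (auto simp: full_subcat_hom)
  have "is_kernel C f k"
  proof (rule is_kernelI[OF h(1) k])
    show "f \<cdot> k = Zer C K Y" using kD(2) by simp
    show "is_mono C k" using kD(3) by (simp add: D_mono)
    fix W x assume x: "x \<in> Hom C W X" "f \<cdot> x = Zer C W Y"
    then obtain t where t: "t \<in> Hom C W K0" "k0 \<cdot> t = x" using k0D(4) by blast
    have "k \<cdot> (v \<cdot> t) = x" using t v k k0D(1) by (simp add: cat_simps reassoc[OF v(2)])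
    then show "\<exists>h\<in>Hom C W K. k \<cdot> h = x" using comp_hom[OF t(1) v(1)] by blast
  qed
  then show "f \<in> Arr D \<and> k \<in> Arr D \<and> is_kernel C f k" using fk by simp
next
  assume *: "f \<in> Arr D \<and> k \<in> Arr D \<and> is_kernel C f k"
  then show "is_kernel D f k"
    using D_ob by (simp add: is_kernel_def)
qed

lemma D_epi: "is_epi D f \<longleftrightarrow> f \<in> Arr D \<and> is_epi C f"
  using abelian_subcategory.D_mono[OF op_sub, of f] by (auto simp: op_full_subcat[symmetric])

lemma D_cokernel: "is_cokernel D f q \<longleftrightarrow> f \<in> Arr D \<and> q \<in> Arr D \<and> is_cokernel C f q"
  using abelian_subcategory.D_kernel[OF op_sub, of f q] by (auto simp: op_full_subcat[symmetric])

lemma D_short_exact: "short_exact D i p \<longleftrightarrow> i \<in> Arr D \<and> p \<in> Arr D \<and> short_exact C i p"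
  by (auto simp: short_exact_def D_kernel D_cokernel)

lemma abelian_D: "abelian_category D"
proof (rule abelian_category.intro[OF linear_D], rule abelian_category_axioms.intro)
  show "\<exists>X. is_zero_ob D X" using zero_ob by (simp add: D_zero_ob)
  show "\<exists>T i j p q. is_biproduct D A B T i j p q" if AB: "A \<in> Ob D" "B \<in> Ob D" for A B
  proof -
    have AB': "A \<in> S" "B \<in> S" using AB by simp_all
    obtain T i j p q where bi: "is_biproduct C A B T i j p q"
      using biproducts[OF D_ob D_ob, OF AB'] by blast
    note b = biproductD[OF bi]
    have "T \<in> S" using sub_ext[OF biproduct_short_exact[OF bi] b(4,7)] AB' by simp
    then have "is_biproduct D A B T i j p q" using bi AB' by (simp add: is_biproduct_def)
    then show ?thesis by blast
  qed
  show "\<exists>k. is_kernel D f k" if f: "f \<in> Arr D" for f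
  proof -
    obtain k where k: "is_kernel C f k" using kernels f by auto
    then have "k \<in> Arr D" using sub_ker[of f "Dom C f" "Cod C f" k] f by (auto simp: Hom_iff is_kernel_def)
    then show ?thesis using k f D_kernel by blast
  qed
  show "\<exists>k. is_cokernel D f k" if f: "f \<in> Arr D" for f
  proof -
    obtain k where k: "is_cokernel C f k" using cokernels f by auto
    then have "k \<in> Arr D" using sub_coker[of f "Dom C f" "Cod C f" k] f by (auto simp: Hom_iff is_cokernel_def)
    then show ?thesis using k f D_cokernel by blast
  qed
  show "\<exists>f. is_kernel D f m" if m: "is_mono D m" for m
  proof -
    have m: "m \<in> Arr D" "is_mono C m" using m by (simp_all add: D_mono)
    obtain c where c: "is_cokernel C m c" using cokernels m by auto
    then have "c \<in> Arr D" using sub_coker[of m "Dom C m" "Cod C m" c] m by (auto simp: Hom_iff is_cokernel_def)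
    then show ?thesis
      using mono_kernel_of_cokernel[of m "Dom C m" "Cod C m" c] m c D_kernel by (auto simp: Hom_iff)
  qed
  show "\<exists>f. is_cokernel D f m" if m: "is_epi D m" for m
  proof -
    have m: "m \<in> Arr D" "is_epi C m" using m by (simp_all add: D_epi)
    obtain k where k: "is_kernel C m k" using kernels m by auto
    then have "k \<in> Arr D" using sub_ker[of m "Dom C m" "Cod C m" k] m by (auto simp: Hom_iff is_kernel_def)
    then show ?thesis
      using short_exactI_kernel[OF k m(2)] D_cokernel m(1) by (auto simp: short_exact_def)
  qed
qed

lemma D_extensions:
  assumes "X \<in> S" "Y \<in> S"
  shows "extensions D X Y = extensions C X Y"
proof -
  have "i \<in> Arr D \<and> p \<in> Arr D" if ip: "(i, p) \<in> extensions C X Y" for i p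
  proof -
    obtain E where e: "short_exact C i p" "i \<in> Hom C Y E" "p \<in> Hom C E X" using ip by (auto elim: extensionE)
    then show ?thesis using sub_ext[OF e assms] assms by (auto simp: Hom_iff)
  qed
  then show ?thesis by (auto simp: extensions_def D_short_exact)
qed

lemma D_ext_morphism:
  assumes "e \<in> extensions C X Y" "e' \<in> extensions C X' Y'" "X \<in> S" "Y \<in> S" "X' \<in> S" "Y' \<in> S"
  shows "ext_morphism D e e' a b \<longleftrightarrow> ext_morphism C e e' a b"
proof -
  obtain i p E where e: "e = (i, p)" "short_exact C i p" "i \<in> Hom C Y E" "p \<in> Hom C E X" using assms(1) by (auto elim: extensionE)
  obtain i' p' E' where e': "e' = (i', p')" "short_exact C i' p'" "i' \<in> Hom C Y' E'" "p' \<in> Hom C E' X'"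
    using assms(2) by (auto elim: extensionE)
  show ?thesis unfolding e(1) e'(1)
    using ext_morphism_full_subcat[OF e(3,4) e'(3,4)] sub_ext[OF e(2-4)] sub_ext[OF e'(2-4)] assms(3-6) by blast
qed

lemma D_ext_push:
  assumes "u \<in> extensions C X T" "X \<in> S" "T \<in> S" "Y \<in> S"
  shows "ext_push D X Y u f = ext_push C X Y u f"
  using D_ext_morphism[OF assms(1)] D_extensions assms by (auto simp: ext_push_def)

text \<open>The two extension spaces have the same elements, but their operations are defined by quantifying
  over the objects of different categories. They agree on classes, because both are given by
  \<open>f\<^sub>* u + g\<^sub>* u = (f + g)\<^sub>* u\<close>.\<close>

lemma D_Ext1_finite_dim:
  assumes "X \<in> S" "Y \<in> S" "finite_dim (Ext1 C X Y)"
  shows "finite_dim (Ext1 D X Y)"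
proof -
  interpret DA: abelian_category D by (rule abelian_D)
  have obs: "X \<in> Ob C" "Y \<in> Ob C" using assms D_ob by auto
  have ext: "extensions D X Y = extensions C X Y" by (rule D_extensions[OF assms(1,2)])
  have "ext_equiv D X Y = ext_equiv C X Y"
    unfolding ext_equiv_def ext using D_ext_morphism assms(1,2) by auto
  then have carr: "carrier (Ext1 D X Y) = carrier (Ext1 C X Y)" by (simp add: ext)
  have "lin_map (Ext1 C X Y) (Ext1 D X Y) id"
    unfolding lin_map_def
  proof (intro conjI ballI allI)
    show "id \<in> carrier (Ext1 C X Y) \<rightarrow> carrier (Ext1 D X Y)" using carr by auto
    fix A c assume A: "A \<in> carrier (Ext1 C X Y)"
    then have A': "A \<in> carrier (Ext1 D X Y)" using carr by blast
    {
      fix B assume B: "B \<in> carrier (Ext1 C X Y)"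
      then have B': "B \<in> carrier (Ext1 D X Y)" using carr by blast
      obtain T u f g where u: "u \<in> extensions D X T" "f \<in> Hom D T Y" "g \<in> Hom D T Y"
        "A = ext_push D X Y u f" "B = ext_push D X Y u g" using DA.Ext1_joint[OF A' B'] by metis
      have T: "T \<in> S" and h: "f \<in> Hom C T Y" "g \<in> Hom C T Y" using u by (simp_all add: full_subcat_hom)
      have uC: "u \<in> extensions C X T" using u(1) D_extensions[OF assms(1) T] by blast
      note eq = D_ext_push[OF uC assms(1) T assms(2)]
      show "id (A \<oplus>\<^bsub>Ext1 C X Y\<^esub> B) = id A \<oplus>\<^bsub>Ext1 D X Y\<^esub> id B"
        using DA.Ext1_add[OF u(1-3)] Ext1_add[OF uC h] unfolding u(4,5) eq by simp
    }
    obtain u where u: "u \<in> extensions D X Y" "A = ext_push D X Y u (Ide D Y)" using DA.Ext1_carrierE[OF A'] .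
    have uC: "u \<in> extensions C X Y" using u(1) ext by blast
    note eq = D_ext_push[OF uC assms(1,2,2)]
    have h: "Ide D Y \<in> Hom C Y Y" "Ide D Y \<in> Hom D Y Y" using ide_hom[OF obs(2)] assms(2) by simp_all
    show "id (c \<odot>\<^bsub>Ext1 C X Y\<^esub> A) = c \<odot>\<^bsub>Ext1 D X Y\<^esub> id A"
      using DA.Ext1_smult[OF u(1) h(2)] Ext1_smult[OF uC h(1)] unfolding u(2) eq by simp
  qed
  then show ?thesis
    using finite_dim_surj[OF vect_Ext1[OF obs] DA.vect_Ext1[of X Y] _ assms(3), of id] carr assms(1,2) by simp
qed

end

section \<open>Finiteness on extension closures\<close>

context abelian_category
begin

lemma vect_hom: "\<lbrakk>X \<in> Ob C; Y \<in> Ob C\<rbrakk> \<Longrightarrow> vect (hom_space C X Y)"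
  unfolding vect_def by (rule hom_vector_space)

lemma trivial_finite_dim:
  assumes "vect V" "carrier V \<subseteq> {\<zero>\<^bsub>V\<^esub>}"
  shows "finite_dim V"
  using assms by (simp add: vect.finite_dim_iff[OF assms(1)] exI[of _ "[]"])

lemma Ext1_trivial:
  assumes "X \<in> Ob C" "Y \<in> Ob C" "is_zero_ob C X \<or> is_zero_ob C Y"
  shows "carrier (Ext1 C X Y) \<subseteq> {\<zero>\<^bsub>Ext1 C X Y\<^esub>}"
proof
  fix A assume "A \<in> carrier (Ext1 C X Y)"
  then obtain u where u: "u \<in> extensions C X Y" "A = EP X Y u (Ide C Y)" using Ext1_carrierE by metis
  obtain i p E where e: "u = (i, p)" "short_exact C i p" "i \<in> Hom C Y E" "p \<in> Hom C E X"
    using u(1) by (auto elim: extensionE)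
  note d = short_exactD[OF e(2,3), unfolded cod_hom[OF e(4)]]
  have E: "E \<in> Ob C" using hom_ob[OF e(3)] by simp
  have "\<exists>s\<in>Hom C X E. p \<cdot> s = Ide C X"
  proof (cases "is_zero_ob C X")
    case True
    have "p \<cdot> Zer C X E = Ide C X"
      using zero_ob_to[OF True] comp_hom[OF zer_hom[OF assms(1) E] e(4)] ide_hom[OF assms(1)] by metis
    then show ?thesis using zer_hom[OF assms(1) E] by blast
  next
    case False
    then have "is_iso C p" using zero_kernel_iso[OF e(2-4)] assms(3) by blast
    then show ?thesis using is_isoE[OF _ e(4)] by metis
  qed
  then have "ext_morphism C u (i, p) (Zer C Y Y) (Ide C X)"
    using push_zero_iff_split[OF u(1) assms(2) e(3,4,2)] by blast
  then have "u \<in> EP X Y u (Zer C Y Y)" unfolding e(1) using u(1) e(1) by (simp add: ext_push_def)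
  moreover have "u \<in> EP X Y u (Ide C Y)" using u(1) ext_morphism_ide by (simp add: ext_pushI)
  ultimately have "EP X Y u (Zer C Y Y) = EP X Y u (Ide C Y)" using ext_push_class[OF u(1)] by metis
  then show "A \<in> {\<zero>\<^bsub>Ext1 C X Y\<^esub>}" using u(2) Ext1_zero[OF u(1) assms(2)] by simp
qed

lemma lin_map_hom_post:
  assumes "X \<in> Ob C" "g \<in> Hom C Y Y'"
  shows "lin_map (hom_space C X Y) (hom_space C X Y') (\<lambda>f. g \<cdot> f)"
  unfolding lin_map_def using comp_hom[OF _ assms(2)] comp_plus_right[OF _ _ assms(2)] comp_scal_right[OF _ assms(2)] by auto

lemma lin_map_hom_pre:
  assumes "Y \<in> Ob C" "g \<in> Hom C X' X"
  shows "lin_map (hom_space C X Y) (hom_space C X' Y) (\<lambda>f. f \<cdot> g)"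
  unfolding lin_map_def using comp_hom[OF assms(2)] comp_plus_left[OF assms(2)] comp_scal_left[OF assms(2)] by auto

definition fd_pair :: "'o \<Rightarrow> 'o \<Rightarrow> bool" where
  "fd_pair X Y \<longleftrightarrow> finite_dim (hom_space C X Y) \<and> finite_dim (Ext1 C X Y)"

lemma fd_pair_zero:
  assumes "X \<in> Ob C" "Y \<in> Ob C" "is_zero_ob C X \<or> is_zero_ob C Y"
  shows "fd_pair X Y"
proof -
  have "Hom C X Y \<subseteq> {Zer C X Y}" using assms(3) zero_ob_from zero_ob_to by blast
  then show ?thesis unfolding fd_pair_def
    using trivial_finite_dim vect_hom vect_Ext1 Ext1_trivial assms by (metis carrier_hom_space zero_hom_space)
qed

lemma fd_pair_second:
  assumes "X \<in> Ob C" "short_exact C i p" "i \<in> Hom C A Y" "p \<in> Hom C Y B" "fd_pair X A" "fd_pair X B"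
  shows "fd_pair X Y"
proof -
  note d = short_exactD[OF assms(2,3), unfolded cod_hom[OF assms(4)]]
  have obs: "A \<in> Ob C" "Y \<in> Ob C" "B \<in> Ob C" using hom_ob assms(3,4) by blast+
  have "finite_dim (hom_space C X Y)"
    using finite_dim_exact[OF vect_hom[OF assms(1) obs(1)] vect_hom[OF assms(1) obs(2)] vect_hom[OF assms(1) obs(3)]
      lin_map_hom_post[OF assms(1,3)] lin_map_hom_post[OF assms(1,4)]] assms(5,6) d(5) by (auto simp: fd_pair_def image_iff)
  moreover have "finite_dim (Ext1 C X Y)"
    using finite_dim_exact[OF vect_Ext1[OF assms(1) obs(1)] vect_Ext1[OF assms(1) obs(2)] vect_Ext1[OF assms(1) obs(3)]
      lin_map_push[OF assms(1,3)] lin_map_push[OF assms(1,4)]] assms(5,6) Ext1_exact_push[OF assms(2-4)] by (simp only: fd_pair_def)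
  ultimately show ?thesis by (simp add: fd_pair_def)
qed

lemma fd_pair_first:
  assumes "Y \<in> Ob C" "short_exact C i p" "i \<in> Hom C A X" "p \<in> Hom C X B" "fd_pair A Y" "fd_pair B Y"
  shows "fd_pair X Y"
proof -
  note d = short_exactD[OF assms(2,3), unfolded cod_hom[OF assms(4)]]
  have obs: "A \<in> Ob C" "X \<in> Ob C" "B \<in> Ob C" using hom_ob assms(3,4) by blast+
  have "finite_dim (hom_space C X Y)"
    using finite_dim_exact[OF vect_hom[OF obs(3) assms(1)] vect_hom[OF obs(2) assms(1)] vect_hom[OF obs(1) assms(1)]
      lin_map_hom_pre[OF assms(1,4)] lin_map_hom_pre[OF assms(1,3)]] assms(5,6) d(6) by (auto simp: fd_pair_def image_iff)
  moreover have "finite_dim (Ext1 C X Y)"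
    using finite_dim_exact[OF vect_Ext1[OF obs(3) assms(1)] vect_Ext1[OF obs(2) assms(1)] vect_Ext1[OF obs(1) assms(1)]
      lin_map_pull[OF assms(1,4)] lin_map_pull[OF assms(1,3)]] assms(5,6) Ext1_exact_pull[OF assms(2-4)] by (simp only: fd_pair_def)
  ultimately show ?thesis by (simp add: fd_pair_def)
qed

lemma fd_pair_ext_closure:
  assumes "S \<subseteq> Ob C" "\<And>A B. \<lbrakk>A \<in> S; B \<in> S\<rbrakk> \<Longrightarrow> fd_pair A B" "X \<in> ext_closure C S" "Y \<in> ext_closure C S"
  shows "fd_pair X Y"
proof -
  have obY: "Y \<in> Ob C" using ext_closure_ob assms by blast
  have step: "fd_pair A Y" if A: "A \<in> S" for A
    using assms(1,4)
  proof (induction rule: ext_closure_bottom_induct)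
    case (zero Y)
    then show ?case using fd_pair_zero A assms(1) by (auto simp: is_zero_ob_def)
  next
    case (step B Y Q j p)
    then show ?case using fd_pair_second[OF _ step(2-4)] assms(1,2) A by blast
  qed
  from assms(1,3) show ?thesis
  proof (induction rule: ext_closure_bottom_induct)
    case (zero X)
    then show ?case using fd_pair_zero obY by (auto simp: is_zero_ob_def)
  next
    case (step A X Q j p)
    then show ?case using fd_pair_first[OF obY step(2-4)] \<open>\<And>A. A \<in> S \<Longrightarrow> fd_pair A Y\<close> by blast
  qed
qed

text \<open>A retraction on either side induces a surjection of extension spaces.\<close>

lemma Ext1_finite_dim_retract_second:
  assumes "X \<in> Ob C" "s \<in> Hom C B W" "r \<in> Hom C W B" "r \<cdot> s = Ide C B" "finite_dim (Ext1 C X W)"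
  shows "finite_dim (Ext1 C X B)"
proof -
  have obs: "B \<in> Ob C" "W \<in> Ob C" using hom_ob[OF assms(2)] by auto
  have "carrier (Ext1 C X B) \<subseteq> Ext1_push X B r ` carrier (Ext1 C X W)"
  proof
    fix A assume "A \<in> carrier (Ext1 C X B)"
    then obtain u where u: "u \<in> extensions C X B" "A = EP X B u (Ide C B)" using Ext1_carrierE by metis
    have "Ext1_push X B r (EP X W u s) = A"
      using Ext1_push_eq[OF u(1) assms(2,3)] assms(4) u(2) by simp
    then show "A \<in> Ext1_push X B r ` carrier (Ext1 C X W)" using ext_push_carrier[OF u(1) assms(2)] by blast
  qed
  then show ?thesis
    using finite_dim_surj[OF vect_Ext1[OF assms(1) obs(2)] vect_Ext1[OF assms(1) obs(1)] lin_map_push[OF assms(1,3)] assms(5)] by blast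
qed

lemma Ext1_finite_dim_retract_first:
  assumes "Y \<in> Ob C" "s \<in> Hom C B W" "r \<in> Hom C W B" "r \<cdot> s = Ide C B" "finite_dim (Ext1 C W Y)"
  shows "finite_dim (Ext1 C B Y)"
proof -
  have obs: "B \<in> Ob C" "W \<in> Ob C" using hom_ob[OF assms(2)] by auto
  have "carrier (Ext1 C B Y) \<subseteq> Ext1_pull B Y s ` carrier (Ext1 C W Y)"
  proof
    fix A assume "A \<in> carrier (Ext1 C B Y)"
    then obtain u where u: "u \<in> extensions C B Y" "A = EP B Y u (Ide C Y)" using Ext1_carrierE by metis
    obtain v where v: "v \<in> extensions C W Y" "ext_morphism C v u (Ide C Y) r" using pull_exists[OF u(1) assms(3)] .
    have "ext_morphism C u v (Ide C Y) s"
      using cancel_pull[OF v(1) u(1) u(1) v(2) _ assms(2)] ext_morphism_ide[OF u(1)] assms(4) by simp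
    then have "Ext1_pull B Y s (EP W Y v (Ide C Y)) = A"
      using Ext1_pull_eq[OF v(1) u(1) _ ide_hom[OF assms(1)]] u(2) by simp
    then show "A \<in> Ext1_pull B Y s ` carrier (Ext1 C W Y)" using ext_push_carrier[OF v(1) ide_hom[OF assms(1)]] by blast
  qed
  then show ?thesis
    using finite_dim_surj[OF vect_Ext1[OF obs(2) assms(1)] vect_Ext1[OF obs(1) assms(1)] lin_map_pull[OF assms(1,2)] assms(5)] by blast
qed

end

sublocale orthogonal_bricks \<subseteq> sub: abelian_subcategory C F
proof
  show "F \<subseteq> Ob C" using F_ob by blast
  show "\<And>X. is_zero_ob C X \<Longrightarrow> X \<in> F" by (rule ext_closure.zero)
  show "\<And>i p Y E X. \<lbrakk>short_exact C i p; i \<in> Hom C Y E; p \<in> Hom C E X; X \<in> F; Y \<in> F\<rbrakk> \<Longrightarrow> E \<in> F"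
    using ext_closure_ext by blast
  fix f X Y assume f: "f \<in> Hom C X Y" "X \<in> F" "Y \<in> F"
  have "f \<in> Arr C" using f(1) by (simp add: Hom_iff)
  then obtain k0 q0 where k0: "is_kernel C f k0" "is_cokernel C f q0" using kernels cokernels by blast
  show "Dom C k \<in> F" if "is_kernel C f k" for k using F_ker_coker[OF f(2,3,1) that k0(2)] by simp
  show "Cod C q \<in> F" if "is_cokernel C f q" for q using F_ker_coker[OF f(2,3,1) k0(1) that] by simp
qed

section \<open>Modules over the product algebra\<close>

lemma prod_alg_sel [simp]:
  "carrier (prod_alg n) = {..<n} \<rightarrow>\<^sub>E UNIV"
  "\<one>\<^bsub>prod_alg n\<^esub> = (\<lambda>i\<in>{..<n}. 1)" "\<zero>\<^bsub>prod_alg n\<^esub> = (\<lambda>i\<in>{..<n}. 0)"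
  "f \<otimes>\<^bsub>prod_alg n\<^esub> g = (\<lambda>i\<in>{..<n}. f i * g i)" "f \<oplus>\<^bsub>prod_alg n\<^esub> g = (\<lambda>i\<in>{..<n}. f i + g i)"
  by (simp_all add: prod_alg_def)

lemma cring_prod_alg: "cring (prod_alg n :: (nat \<Rightarrow> 'k::field) ring)"
proof (rule cringI)
  show "abelian_group (prod_alg n :: (nat \<Rightarrow> 'k) ring)"
  proof (rule abelian_groupI)
    fix x :: "nat \<Rightarrow> 'k" assume "x \<in> carrier (prod_alg n)"
    then show "\<exists>y\<in>carrier (prod_alg n). y \<oplus>\<^bsub>prod_alg n\<^esub> x = \<zero>\<^bsub>prod_alg n\<^esub>"
      by (intro bexI[of _ "\<lambda>i\<in>{..<n}. - x i"]) (auto simp: fun_eq_iff)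
  qed (auto simp: fun_eq_iff PiE_iff extensional_def)
  show "Group.comm_monoid (prod_alg n :: (nat \<Rightarrow> 'k) ring)"
    by (rule comm_monoidI) (auto simp: fun_eq_iff PiE_iff extensional_def)
qed (auto simp: fun_eq_iff PiE_iff extensional_def distrib_right)

definition unit_vec :: "nat \<Rightarrow> nat \<Rightarrow> nat \<Rightarrow> 'k::field" where
  "unit_vec n i = (\<lambda>j\<in>{..<n}. if j = i then 1 else 0)"

abbreviation pconst :: "nat \<Rightarrow> 'k::field \<Rightarrow> nat \<Rightarrow> 'k" where
  "pconst n c \<equiv> (\<lambda>i\<in>{..<n}. c)"

text \<open>Restriction of scalars to the diagonal copy of the field.\<close>

definition diag_space :: "nat \<Rightarrow> (nat \<Rightarrow> 'k::field, 'v) module \<Rightarrow> ('k, 'v) module" where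
  "diag_space n M = \<lparr>carrier = carrier M, monoid.mult = monoid.mult M, monoid.one = monoid.one M,
     ring.zero = ring.zero M, ring.add = ring.add M, module.smult = (\<lambda>c x. pconst n c \<odot>\<^bsub>M\<^esub> x)\<rparr>"

lemma diag_space_sel [simp]:
  "carrier (diag_space n M) = carrier M" "\<zero>\<^bsub>diag_space n M\<^esub> = \<zero>\<^bsub>M\<^esub>"
  "x \<oplus>\<^bsub>diag_space n M\<^esub> y = x \<oplus>\<^bsub>M\<^esub> y" "c \<odot>\<^bsub>diag_space n M\<^esub> x = pconst n c \<odot>\<^bsub>M\<^esub> x"
  by (simp_all add: diag_space_def)

lemma finsum_diag_space [simp]: "finsum (diag_space n M) f A = finsum M f A"
  by (simp add: finsum_def finprod_def diag_space_def)

lemma (in abelian_monoid) finsum_lessThan_Suc: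
  "f \<in> {..<Suc d} \<rightarrow> carrier G \<Longrightarrow> (\<Oplus>i\<in>{..<Suc d}. f i) = f d \<oplus> (\<Oplus>i\<in>{..<d}. f i)"
  by (subst lessThan_Suc, subst finsum_insert) auto

section \<open>Linear independence\<close>

primrec lind :: "('k::field, 'v) module \<Rightarrow> 'v list \<Rightarrow> bool" where
  "lind V [] \<longleftrightarrow> True"
| "lind V (b # bs) \<longleftrightarrow> b \<notin> lspan V bs \<and> lind V bs"

context vect
begin

lemma lspan_zero: "set bs \<subseteq> carrier V \<Longrightarrow> \<zero> \<in> lspan V bs"
proof (induction bs)
  case (Cons b bs)
  then have "0 \<odot> b \<oplus> \<zero> = \<zero>" by simp
  then show ?case using Cons by (simp only: lspan.simps mem_Collect_eq) (metis list.set_intros(2) subset_iff)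
qed simp

lemma lspan_mem: "set bs \<subseteq> carrier V \<Longrightarrow> b \<in> set bs \<Longrightarrow> b \<in> lspan V bs"
proof (induction bs)
  case (Cons a bs)
  have z: "\<zero> \<in> lspan V bs" using lspan_zero Cons.prems by simp
  show ?case
  proof (cases "b = a")
    case True
    then have "b = 1 \<odot> a \<oplus> \<zero>" using Cons.prems by simp
    then show ?thesis using z by auto
  next
    case False
    then have b: "b \<in> lspan V bs" using Cons by auto
    then have "b = 0 \<odot> a \<oplus> b" using Cons.prems lspan_closed[of bs] by auto
    then show ?thesis using b by auto
  qed
qed simp

lemma lind_extract:
  assumes "set bs \<subseteq> carrier V"
  shows "\<exists>bs'. set bs' \<subseteq> set bs \<and> lind V bs' \<and> lspan V bs \<subseteq> lspan V bs'"
  using assms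
proof (induction bs)
  case Nil
  show ?case by (intro exI[of _ "[]"]) simp
next
  case (Cons b bs)
  then obtain bs' where bs': "set bs' \<subseteq> set bs" "lind V bs'" "lspan V bs \<subseteq> lspan V bs'" by auto
  have sub: "set bs' \<subseteq> carrier V" using bs' Cons.prems by auto
  show ?case
  proof (cases "b \<in> lspan V bs'")
    case True
    have "lspan V (b # bs) \<subseteq> lspan V bs'"
      using lspan_add[OF sub lspan_smult[OF sub True]] bs'(3) by auto
    then show ?thesis using bs' by (intro exI[of _ bs']) auto
  next
    case False
    then show ?thesis using bs' by (intro exI[of _ "b # bs'"]) auto
  qed
qed

lemma lind_unique:
  assumes "b \<in> {..<d::nat} \<rightarrow> carrier V" "lind V (map b (rev [0..<d]))"
    "(\<Oplus>i\<in>{..<d}. c i \<odot> b i) = (\<Oplus>i\<in>{..<d}. c' i \<odot> b i)"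
  shows "\<forall>i<d. c i = c' i"
  using assms
proof (induction d)
  case (Suc d)
  have b: "b \<in> {..<d} \<rightarrow> carrier V" "b d \<in> carrier V" using Suc.prems(1) by auto
  have lind: "b d \<notin> lspan V (map b (rev [0..<d]))" "lind V (map b (rev [0..<d]))" using Suc.prems(2) by auto
  have sub: "set (map b (rev [0..<d])) \<subseteq> carrier V" using b by auto
  define x where "x = (\<Oplus>i\<in>{..<d}. c i \<odot> b i)"
  define x' where "x' = (\<Oplus>i\<in>{..<d}. c' i \<odot> b i)"
  have xs: "x \<in> lspan V (map b (rev [0..<d]))" "x' \<in> lspan V (map b (rev [0..<d]))"
    unfolding lspan_upt[OF b(1)] x_def x'_def by blast+
  have xc: "x \<in> carrier V" "x' \<in> carrier V" using xs lspan_closed[OF sub] by auto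
  have fs: "(\<Oplus>i\<in>{..<Suc d}. c i \<odot> b i) = c d \<odot> b d \<oplus> x" "(\<Oplus>i\<in>{..<Suc d}. c' i \<odot> b i) = c' d \<odot> b d \<oplus> x'"
    unfolding x_def x'_def using Suc.prems(1) by (auto intro!: M.finsum_lessThan_Suc)
  have eq: "c d \<odot> b d \<oplus> x = c' d \<odot> b d \<oplus> x'" using Suc.prems(3) fs by simp
  have cd: "c d = c' d"
  proof (rule ccontr)
    assume ne: "c d \<noteq> c' d"
    have "(c d - c' d) \<odot> b d \<oplus> (c' d \<odot> b d \<oplus> x) = c d \<odot> b d \<oplus> x"
      using b(2) xc vsmult_ldistr[of "b d" "c d - c' d" "c' d"] by (simp add: M.a_assoc[symmetric])
    also have "\<dots> = c' d \<odot> b d \<oplus> x'" by (rule eq)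
    finally have "c' d \<odot> b d \<oplus> ((c d - c' d) \<odot> b d \<oplus> x) = c' d \<odot> b d \<oplus> x'"
      using b(2) xc by (simp add: M.a_lcomm)
    then have "(c d - c' d) \<odot> b d \<oplus> x = x'"
      using b(2) xc by (subst (asm) M.add.l_cancel) auto
    then have "(c d - c' d) \<odot> b d = x' \<oplus> (- 1) \<odot> x"
      using b(2) xc vneg[of x] by (auto simp: M.a_assoc)
    then have "(c d - c' d) \<odot> b d \<in> lspan V (map b (rev [0..<d]))"
      using lspan_add[OF sub xs(2) lspan_smult[OF sub xs(1)]] by simp
    from lspan_smult[OF sub this, of "1 / (c d - c' d)"] show False
      using lind(1) ne b(2) by (simp add: vsmult_assoc)
  qed
  then have "x = x'" using eq b(2) xc by (subst (asm) cd, subst (asm) M.add.l_cancel) auto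
  then have "\<forall>i<d. c i = c' i" using Suc.IH[OF b(1) lind(2)] unfolding x_def x'_def by blast
  then show ?case using cd less_Suc_eq by auto
qed simp

end

section \<open>Homogeneous bases\<close>

text \<open>A basis over the field all of whose members are fixed by one of the primitive idempotents, so
  that each member spans a copy of the simple module \<open>t j\<close>.\<close>

definition hbasis :: "nat \<Rightarrow> (nat \<Rightarrow> 'k::field, 'v) module \<Rightarrow> nat \<Rightarrow> (nat \<Rightarrow> nat) \<Rightarrow> (nat \<Rightarrow> 'v) \<Rightarrow> bool" where
  "hbasis n M d t b \<longleftrightarrow> (\<forall>j<d. t j < n \<and> b j \<in> carrier M \<and> unit_vec n (t j) \<odot>\<^bsub>M\<^esub> b j = b j) \<and>
     carrier M \<subseteq> lspan (diag_space n M) (map b (rev [0..<d])) \<and> lind (diag_space n M) (map b (rev [0..<d]))"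

locale pmodule = module "prod_alg n" M for n :: nat and M :: "(nat \<Rightarrow> 'k::field, 'v) module" (structure)
begin

sublocale V: vect "diag_space n M"
  unfolding vect_def
proof (rule moduleI)
  show "abelian_group (diag_space n M)"
  proof (rule abelian_groupI)
    fix x assume "x \<in> carrier (diag_space n M)"
    then show "\<exists>y\<in>carrier (diag_space n M). y \<oplus>\<^bsub>diag_space n M\<^esub> x = \<zero>\<^bsub>diag_space n M\<^esub>"
      using M.l_neg M.a_inv_closed by auto
  qed (simp_all add: M.a_ac)
  fix a b :: 'k and x assume x: "x \<in> carrier (diag_space n M)"
  have "pconst n (a + b) = pconst n a \<oplus>\<^bsub>prod_alg n\<^esub> pconst n b"
    "pconst n (a * b) = pconst n a \<otimes>\<^bsub>prod_alg n\<^esub> pconst n b" by (auto simp: fun_eq_iff)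
  then show "(a \<oplus>\<^bsub>ring_of_type_algebra\<^esub> b) \<odot>\<^bsub>diag_space n M\<^esub> x = a \<odot>\<^bsub>diag_space n M\<^esub> x \<oplus>\<^bsub>diag_space n M\<^esub> b \<odot>\<^bsub>diag_space n M\<^esub> x"
    "a \<otimes>\<^bsub>ring_of_type_algebra\<^esub> b \<odot>\<^bsub>diag_space n M\<^esub> x = a \<odot>\<^bsub>diag_space n M\<^esub> (b \<odot>\<^bsub>diag_space n M\<^esub> x)"
    using smult_l_distr[of "pconst n a" "pconst n b" x] smult_assoc1[of "pconst n a" "pconst n b" x] x by simp_all
  show "\<one>\<^bsub>ring_of_type_algebra\<^esub> \<odot>\<^bsub>diag_space n M\<^esub> x = x" using smult_one[of x] x by simp
qed (use smult_r_distr smult_closed in \<open>simp_all add: cring_from_type_algebra\<close>)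

text \<open>The algebra acts on a vector fixed by the idempotent \<open>unit_vec n i\<close> through its \<open>i\<close>-th coordinate.\<close>

lemma homogeneous_smult:
  assumes "i < n" "x \<in> carrier M" "unit_vec n i \<odot> x = x" "a \<in> carrier (prod_alg n)"
  shows "a \<odot> x = pconst n (a i) \<odot> x"
proof -
  have u: "unit_vec n i \<in> carrier (prod_alg n)" by (simp add: unit_vec_def)
  have "a \<otimes>\<^bsub>prod_alg n\<^esub> unit_vec n i = pconst n (a i) \<otimes>\<^bsub>prod_alg n\<^esub> unit_vec n i"
    by (auto simp: unit_vec_def fun_eq_iff)
  then show ?thesis
    using smult_assoc1[OF assms(4) u assms(2)] smult_assoc1[of "pconst n (a i)" "unit_vec n i" x] assms u by simp
qed

lemma smult_unit_vec:
  assumes "i < n" "x \<in> carrier M"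
  shows "unit_vec n i \<odot> x \<in> carrier M" "unit_vec n i \<odot> (unit_vec n i \<odot> x) = unit_vec n i \<odot> x"
proof -
  have u: "unit_vec n i \<in> carrier (prod_alg n)" by (simp add: unit_vec_def)
  then show "unit_vec n i \<odot> x \<in> carrier M" using assms by (rule_tac smult_closed)
  have "unit_vec n i \<otimes>\<^bsub>prod_alg n\<^esub> unit_vec n i = (unit_vec n i :: nat \<Rightarrow> 'k)"
    by (auto simp: unit_vec_def fun_eq_iff)
  then show "unit_vec n i \<odot> (unit_vec n i \<odot> x) = unit_vec n i \<odot> x"
    using smult_assoc1[OF u u assms(2)] by simp
qed

lemma homogeneous_parts:
  assumes "a \<in> carrier (prod_alg n)" "x \<in> carrier M" "k \<le> n"
  shows "(\<Oplus>i\<in>{..<k}. pconst n (a i) \<odot> (unit_vec n i \<odot> x)) = (\<lambda>j\<in>{..<n}. if j < k then a j else 0) \<odot> x"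
  using assms(3)
proof (induction k)
  case 0
  have "(\<lambda>j\<in>{..<n}. if j < 0 then a j else 0) = pconst n 0" by (auto simp: fun_eq_iff)
  then show ?case using smult_l_null[OF assms(2)] by (simp only: prod_alg_sel lessThan_0 M.finsum_empty)
next
  case (Suc k)
  have c: "(\<lambda>i. pconst n (a i) \<odot> (unit_vec n i \<odot> x)) \<in> {..<Suc k} \<rightarrow> carrier M"
    using Suc.prems smult_unit_vec(1)[OF _ assms(2)] by (auto intro!: smult_closed)
  have u: "(unit_vec n k :: nat \<Rightarrow> 'k) \<in> carrier (prod_alg n)" by (simp add: unit_vec_def)
  have "(\<Oplus>i\<in>{..<Suc k}. pconst n (a i) \<odot> (unit_vec n i \<odot> x)) =
      pconst n (a k) \<odot> (unit_vec n k \<odot> x) \<oplus> (\<lambda>j\<in>{..<n}. if j < k then a j else 0) \<odot> x"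
    by (simp only: M.finsum_lessThan_Suc[OF c] Suc.IH[OF Suc_leD[OF Suc.prems]])
  also have "\<dots> = ((pconst n (a k) \<otimes>\<^bsub>prod_alg n\<^esub> unit_vec n k) \<oplus>\<^bsub>prod_alg n\<^esub> (\<lambda>j\<in>{..<n}. if j < k then a j else 0)) \<odot> x"
    using smult_assoc1[of "pconst n (a k)" "unit_vec n k" x] u assms(2)
      smult_l_distr[of "pconst n (a k) \<otimes>\<^bsub>prod_alg n\<^esub> unit_vec n k" "\<lambda>j\<in>{..<n}. if j < k then a j else 0" x] by simp
  also have "(pconst n (a k) \<otimes>\<^bsub>prod_alg n\<^esub> unit_vec n k) \<oplus>\<^bsub>prod_alg n\<^esub> (\<lambda>j\<in>{..<n}. if j < k then a j else 0)
      = (\<lambda>j\<in>{..<n}. if j < Suc k then a j else 0)"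
    using Suc.prems by (auto simp: unit_vec_def fun_eq_iff less_Suc_eq)
  finally show ?case .
qed

text \<open>The idempotents split generators over the algebra into generators over the field, from which an
  independent list is extracted.\<close>

lemma hbasis_exists:
  assumes "finitely_presented (prod_alg n) M"
  shows "\<exists>d t b. hbasis n M d t b"
proof -
  obtain q g where g: "g \<in> {..<q::nat} \<rightarrow> carrier M"
    "\<forall>m\<in>carrier M. \<exists>a\<in>{..<q} \<rightarrow> carrier (prod_alg n). m = (\<Oplus>j\<in>{..<q}. a j \<odot> g j)"
    using assms unfolding finitely_presented_def by blast
  define bs where "bs = concat (map (\<lambda>j. map (\<lambda>i. unit_vec n i \<odot> g j) [0..<n]) [0..<q])"
  have "set bs = (\<Union>j\<in>{..<q}. (\<lambda>i. unit_vec n i \<odot> g j) ` {..<n})" by (auto simp: bs_def)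
  then have set_bs: "set bs = {unit_vec n i \<odot> g j |i j. i < n \<and> j < q}" by blast
  have bs: "set bs \<subseteq> carrier (diag_space n M)"
    using g(1) smult_unit_vec(1) by (auto simp: set_bs)
  have sum: "(\<Oplus>j\<in>{..<k}. f j) \<in> lspan (diag_space n M) bs"
    if "\<And>j. j < k \<Longrightarrow> f j \<in> lspan (diag_space n M) bs" for f :: "nat \<Rightarrow> 'v" and k
    using that
  proof (induction k)
    case 0
    have "\<zero> \<in> lspan (diag_space n M) bs" using V.lspan_zero[OF bs] by simp
    then show ?case by simp
  next
    case (Suc k)
    have "f \<in> {..<Suc k} \<rightarrow> carrier M" using V.lspan_closed[OF bs] Suc.prems by auto
    then show ?case
      using M.finsum_lessThan_Suc[of f k] V.lspan_add[OF bs, of "f k" "\<Oplus>j\<in>{..<k}. f j"] Suc by simp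
  qed
  have span: "carrier M \<subseteq> lspan (diag_space n M) bs"
  proof
    fix m assume "m \<in> carrier M"
    then obtain a where a: "a \<in> {..<q} \<rightarrow> carrier (prod_alg n)" "m = (\<Oplus>j\<in>{..<q}. a j \<odot> g j)" using g(2) by blast
    have "a j \<odot> g j \<in> lspan (diag_space n M) bs" if j: "j < q" for j
    proof -
      have aj: "a j \<in> carrier (prod_alg n)" "g j \<in> carrier M" using a(1) g(1) j by auto
      have "(\<lambda>i\<in>{..<n}. if i < n then a j i else 0) = a j"
        using aj(1) by (auto simp: fun_eq_iff PiE_iff extensional_def)
      then have "a j \<odot> g j = (\<Oplus>i\<in>{..<n}. pconst n (a j i) \<odot> (unit_vec n i \<odot> g j))"
        using homogeneous_parts[OF aj order.refl] by simp
      moreover have "pconst n (a j i) \<odot> (unit_vec n i \<odot> g j) \<in> lspan (diag_space n M) bs" if i: "i < n" for i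
        using V.lspan_smult[OF bs V.lspan_mem[OF bs], of "unit_vec n i \<odot> g j" "a j i"] i j set_bs by auto
      ultimately show ?thesis using sum by simp
    qed
    then show "m \<in> lspan (diag_space n M) bs" unfolding a(2) by (rule sum)
  qed
  obtain bs' where bs': "set bs' \<subseteq> set bs" "lind (diag_space n M) bs'" "lspan (diag_space n M) bs \<subseteq> lspan (diag_space n M) bs'"
    using V.lind_extract[OF bs] by blast
  define d where "d = length bs'"
  define b where "b = (!) (rev bs')"
  have map_b: "map b (rev [0..<d]) = bs'"
    using map_nth[of "rev bs'"] unfolding b_def d_def rev_map[symmetric] by simp
  have "\<exists>i<n. b j \<in> carrier M \<and> unit_vec n i \<odot> b j = b j" if "j < d" for j
  proof -
    have "b j \<in> set bs" using that nth_mem[of j "rev bs'"] bs'(1) by (auto simp: b_def d_def)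
    then obtain i j' where ij: "i < n" "j' < q" "b j = unit_vec n i \<odot> g j'" using set_bs by auto
    have "g j' \<in> carrier M" using g(1) ij by auto
    then show ?thesis using ij smult_unit_vec by auto
  qed
  then obtain t where "\<forall>j<d. t j < n \<and> b j \<in> carrier M \<and> unit_vec n (t j) \<odot> b j = b j" by metis
  then have "hbasis n M d t b" unfolding hbasis_def map_b using bs'(2,3) span by blast
  then show ?thesis by blast
qed

context
  fixes d t b assumes hb: "hbasis n M d t b"
begin

lemma hbasis_mem: "j < d \<Longrightarrow> t j < n" "j < d \<Longrightarrow> b j \<in> carrier M" "j < d \<Longrightarrow> unit_vec n (t j) \<odot> b j = b j"
  "b \<in> {..<d} \<rightarrow> carrier M"
  using hb by (auto simp: hbasis_def)

lemma hbasis_unique: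
  "(\<Oplus>j\<in>{..<d}. pconst n (c j) \<odot> b j) = (\<Oplus>j\<in>{..<d}. pconst n (c' j) \<odot> b j) \<Longrightarrow> j < d \<Longrightarrow> c j = c' j"
  using V.lind_unique[of b d c c'] hb hbasis_mem(4) by (auto simp: hbasis_def)

lemma comb_closed: "(\<lambda>j. pconst n (c j) \<odot> b j) \<in> {..<d} \<rightarrow> carrier M"
  using hbasis_mem(2) by (auto intro!: smult_closed)

text \<open>Independence of the basis determines the values at the indices below \<open>d\<close>; the others are arbitrary.\<close>

definition hcoord :: "'v \<Rightarrow> nat \<Rightarrow> 'k" where
  "hcoord m = (SOME c. m = (\<Oplus>j\<in>{..<d}. pconst n (c j) \<odot> b j))"

lemma hcoord_sum: "m \<in> carrier M \<Longrightarrow> (\<Oplus>j\<in>{..<d}. pconst n (hcoord m j) \<odot> b j) = m"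
proof -
  assume "m \<in> carrier M"
  then have "\<exists>c. m = (\<Oplus>j\<in>{..<d}. pconst n (c j) \<odot> b j)"
    using hb V.lspan_upt[of b d] hbasis_mem(4) by (auto simp: hbasis_def)
  from someI_ex[OF this] show ?thesis by (simp add: hcoord_def)
qed

lemma hcoord_eqI: "m = (\<Oplus>j\<in>{..<d}. pconst n (c j) \<odot> b j) \<Longrightarrow> j < d \<Longrightarrow> hcoord m j = c j"
  using hbasis_unique[of "hcoord m" c j] hcoord_sum[of m] M.finsum_closed[OF comb_closed[of c]] by simp

lemma hcoord_add:
  assumes "x \<in> carrier M" "y \<in> carrier M" "j < d"
  shows "hcoord (x \<oplus> y) j = hcoord x j + hcoord y j"
proof (rule hcoord_eqI[OF _ assms(3)])
  have "x \<oplus> y = (\<Oplus>j\<in>{..<d}. pconst n (hcoord x j) \<odot> b j \<oplus> pconst n (hcoord y j) \<odot> b j)"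
    using M.finsum_addf[OF comb_closed[of "hcoord x"] comb_closed[of "hcoord y"]]
      hcoord_sum[OF assms(1)] hcoord_sum[OF assms(2)] by simp
  also have "\<dots> = (\<Oplus>j\<in>{..<d}. pconst n (hcoord x j + hcoord y j) \<odot> b j)"
  proof (rule M.finsum_cong')
    show "(\<lambda>j. pconst n (hcoord x j + hcoord y j) \<odot> b j) \<in> {..<d} \<rightarrow> carrier M" by (rule comb_closed)
    fix j assume "j \<in> {..<d}"
    then show "pconst n (hcoord x j) \<odot> b j \<oplus> pconst n (hcoord y j) \<odot> b j = pconst n (hcoord x j + hcoord y j) \<odot> b j"
      using V.vsmult_ldistr[of "b j" "hcoord x j" "hcoord y j"] hbasis_mem(2)[of j] by simp
  qed simp
  finally show "x \<oplus> y = (\<Oplus>j\<in>{..<d}. pconst n (hcoord x j + hcoord y j) \<odot> b j)" .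
qed

lemma hcoord_smult:
  assumes "x \<in> carrier M" "a \<in> carrier (prod_alg n)" "j < d"
  shows "hcoord (a \<odot> x) j = a (t j) * hcoord x j"
proof (rule hcoord_eqI[OF _ assms(3)])
  have "a \<odot> x = (\<Oplus>j\<in>{..<d}. a \<odot> (pconst n (hcoord x j) \<odot> b j))"
    using finsum_smult_ldistr[OF _ assms(2) comb_closed[of "hcoord x"]] hcoord_sum[OF assms(1)] by simp
  also have "\<dots> = (\<Oplus>j\<in>{..<d}. pconst n (a (t j) * hcoord x j) \<odot> b j)"
  proof (rule M.finsum_cong')
    show "(\<lambda>j. pconst n (a (t j) * hcoord x j) \<odot> b j) \<in> {..<d} \<rightarrow> carrier M" by (rule comb_closed)
    fix j assume "j \<in> {..<d}"
    then have j: "j < d" by simp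
    have p: "pconst n (hcoord x j) \<in> carrier (prod_alg n)" by simp
    have ap: "a \<otimes>\<^bsub>prod_alg n\<^esub> pconst n (hcoord x j) \<in> carrier (prod_alg n)" by simp
    show "a \<odot> (pconst n (hcoord x j) \<odot> b j) = pconst n (a (t j) * hcoord x j) \<odot> b j"
      using smult_assoc1[OF assms(2) p hbasis_mem(2)[OF j]]
        homogeneous_smult[OF hbasis_mem(1)[OF j] hbasis_mem(2)[OF j] hbasis_mem(3)[OF j] ap] hbasis_mem(1)[OF j] by simp
  qed simp
  finally show "a \<odot> x = (\<Oplus>j\<in>{..<d}. pconst n (a (t j) * hcoord x j) \<odot> b j)" .
qed

lemma hcoord_basis:
  assumes "j < d" "l < d"
  shows "hcoord (pconst n c \<odot> b l) j = (if j = l then c else 0)"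
proof (rule hcoord_eqI[OF _ assms(1)])
  have z: "pconst n 0 \<odot> b j = \<zero>" if "j < d" for j using V.vsmult_zero[of "b j"] hbasis_mem(2)[OF that] by simp
  have "(\<Oplus>j\<in>{..<d}. pconst n (if j = l then c else 0) \<odot> b j) = (\<Oplus>j\<in>{..<d}. if l = j then pconst n c \<odot> b j else \<zero>)"
    using z hbasis_mem(2) by (intro M.finsum_cong') (auto intro!: smult_closed)
  also have "\<dots> = pconst n c \<odot> b l"
    using assms hbasis_mem(2) by (intro M.add.finprod_singleton) (auto intro!: smult_closed)
  finally show "pconst n c \<odot> b l = (\<Oplus>j\<in>{..<d}. pconst n (if j = l then c else 0) \<odot> b j)" by simp
qed

text \<open>The only relations between the members of the basis say that the idempotents other than
  \<open>unit_vec n (t j)\<close> kill \<open>b j\<close>.\<close>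

lemma hbasis_finitely_presented: "finitely_presented (prod_alg n) M"
proof -
  define r :: "nat \<Rightarrow> nat \<Rightarrow> nat \<Rightarrow> 'k" where
    "r i j = (if i = j then (\<lambda>l\<in>{..<n}. if l = t i then 0 else 1) else pconst n 0)" for i j
  have r: "r i j \<in> carrier (prod_alg n)" for i j by (simp add: r_def)
  have rb: "r i j \<odot> b j = \<zero>" if "j < d" for i j
  proof -
    have "r i j (t j) = 0" using hbasis_mem(1)[OF that] by (simp add: r_def)
    then have "r i j \<odot> b j = pconst n 0 \<odot> b j"
      using homogeneous_smult[OF hbasis_mem(1)[OF that] hbasis_mem(2)[OF that] hbasis_mem(3)[OF that] r] by simp
    then show ?thesis using V.vsmult_zero[of "b j"] hbasis_mem(2)[OF that] by simp
  qed
  have gen: "\<exists>a\<in>{..<d} \<rightarrow> carrier (prod_alg n). m = (\<Oplus>j\<in>{..<d}. a j \<odot> b j)" if "m \<in> carrier M" for m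
    using hcoord_sum[OF that] by (intro bexI[of _ "\<lambda>j. pconst n (hcoord m j)"]) auto
  have rel: "(\<Oplus>j\<in>{..<d}. r i j \<odot> b j) = \<zero>" for i
    using rb by (intro M.add.finprod_one_eqI) auto
  have all: "\<exists>c\<in>{..<d} \<rightarrow> carrier (prod_alg n). \<forall>j<d. a j = (\<Oplus>\<^bsub>prod_alg n\<^esub>i\<in>{..<d}. c i \<otimes>\<^bsub>prod_alg n\<^esub> r i j)"
    if a: "a \<in> {..<d} \<rightarrow> carrier (prod_alg n)" "(\<Oplus>j\<in>{..<d}. a j \<odot> b j) = \<zero>" for a
  proof (intro bexI[of _ a] allI impI)
    fix j assume j: "j < d"
    have aj: "a l \<in> carrier (prod_alg n)" if "l < d" for l using a(1) that by auto
    have "(\<Oplus>j\<in>{..<d}. a j \<odot> b j) = (\<Oplus>j\<in>{..<d}. pconst n (a j (t j)) \<odot> b j)"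
      using homogeneous_smult[OF hbasis_mem(1-3) aj] comb_closed[of "\<lambda>j. a j (t j)"] by (intro M.finsum_cong') auto
    then have "\<zero> = (\<Oplus>j\<in>{..<d}. pconst n (a j (t j)) \<odot> b j)" using a(2) by simp
    moreover have "\<zero> = (\<Oplus>j\<in>{..<d}. pconst n 0 \<odot> b j)"
      using V.vsmult_zero hbasis_mem(2) by (intro M.add.finprod_one_eqI[symmetric]) auto
    ultimately have atj: "a j (t j) = 0" using hbasis_unique[of "\<lambda>j. a j (t j)" "\<lambda>j. 0", OF _ j] by simp
    interpret R: cring "prod_alg n :: (nat \<Rightarrow> 'k) ring" by (rule cring_prod_alg)
    have "(\<Oplus>\<^bsub>prod_alg n\<^esub>i\<in>{..<d}. a i \<otimes>\<^bsub>prod_alg n\<^esub> r i j) =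
        (\<Oplus>\<^bsub>prod_alg n\<^esub>i\<in>{..<d}. if j = i then a i else \<zero>\<^bsub>prod_alg n\<^esub>)"
    proof (rule R.finsum_cong')
      fix i assume "i \<in> {..<d}"
      show "a i \<otimes>\<^bsub>prod_alg n\<^esub> r i j = (if j = i then a i else \<zero>\<^bsub>prod_alg n\<^esub>)"
        using atj aj[OF j] by (auto simp: r_def fun_eq_iff PiE_iff extensional_def)
    qed (use aj in auto)
    also have "\<dots> = a j" using j aj by (intro R.add.finprod_singleton) auto
    finally show "a j = (\<Oplus>\<^bsub>prod_alg n\<^esub>i\<in>{..<d}. a i \<otimes>\<^bsub>prod_alg n\<^esub> r i j)" by simp
  qed (use a in simp)
  show ?thesis unfolding finitely_presented_def
    using hbasis_mem(4) gen r rel all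
    by (intro exI[of _ d] exI[of _ b] exI[of _ r] conjI ballI allI impI) auto
qed

end

end

section \<open>The category of modules over the product algebra\<close>

lemma fp_modules_pmodule: "M \<in> fp_modules n \<Longrightarrow> pmodule n M"
  by (simp add: fp_modules_def pmodule_def)

lemma mod_prod_sel [simp]:
  "Ob (mod_prod n) = fp_modules n" "Dom (mod_prod n) (M, f, N) = M" "Cod (mod_prod n) (M, f, N) = N"
  "(M, f, N) \<in> Arr (mod_prod n) \<longleftrightarrow> M \<in> fp_modules n \<and> N \<in> fp_modules n \<and> f \<in> module_maps (prod_alg n) M N"
  "Ide (mod_prod n) M = (M, \<lambda>x\<in>carrier M. x, M)"
  "Comp (mod_prod n) (M', g, N') (M, f, N) = (M, \<lambda>x\<in>carrier M. g (f x), N')"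
  "Zer (mod_prod n) M N = (M, \<lambda>x\<in>carrier M. \<zero>\<^bsub>N\<^esub>, N)"
  "Plus (mod_prod n) (M, f, N) (M', g, N') = (M, \<lambda>x\<in>carrier M. f x \<oplus>\<^bsub>N\<^esub> g x, N)"
  "Scal (mod_prod n) c (M, f, N) = (M, \<lambda>x\<in>carrier M. pconst n c \<odot>\<^bsub>N\<^esub> f x, N)"
  by (simp_all add: mod_prod_def)

lemma mod_prod_hom_iff:
  "f \<in> Hom (mod_prod n) M N \<longleftrightarrow>
     (\<exists>\<phi>. f = (M, \<phi>, N) \<and> M \<in> fp_modules n \<and> N \<in> fp_modules n \<and> \<phi> \<in> module_maps (prod_alg n) M N)"
  by (cases f) (auto simp: Hom_iff)

lemma module_mapsD:
  assumes "\<phi> \<in> module_maps R M N"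
  shows "x \<in> carrier M \<Longrightarrow> \<phi> x \<in> carrier N"
    and "\<lbrakk>x \<in> carrier M; y \<in> carrier M\<rbrakk> \<Longrightarrow> \<phi> (x \<oplus>\<^bsub>M\<^esub> y) = \<phi> x \<oplus>\<^bsub>N\<^esub> \<phi> y"
    and "\<lbrakk>a \<in> carrier R; x \<in> carrier M\<rbrakk> \<Longrightarrow> \<phi> (a \<odot>\<^bsub>M\<^esub> x) = a \<odot>\<^bsub>N\<^esub> \<phi> x"
    and "restrict \<phi> (carrier M) = \<phi>"
  using assms by (auto simp: module_maps_def PiE_restrict)

lemma module_mapsI:
  assumes "\<And>x. x \<in> carrier M \<Longrightarrow> \<phi> x \<in> carrier N"
    and "\<And>x y. \<lbrakk>x \<in> carrier M; y \<in> carrier M\<rbrakk> \<Longrightarrow> x \<oplus>\<^bsub>M\<^esub> y \<in> carrier M \<and> \<phi> (x \<oplus>\<^bsub>M\<^esub> y) = \<phi> x \<oplus>\<^bsub>N\<^esub> \<phi> y"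
    and "\<And>a x. \<lbrakk>a \<in> carrier R; x \<in> carrier M\<rbrakk> \<Longrightarrow> a \<odot>\<^bsub>M\<^esub> x \<in> carrier M \<and> \<phi> (a \<odot>\<^bsub>M\<^esub> x) = a \<odot>\<^bsub>N\<^esub> \<phi> x"
  shows "restrict \<phi> (carrier M) \<in> module_maps R M N"
  using assms by (auto simp: module_maps_def)

lemma (in pmodule) pconst_smult_closed: "x \<in> carrier M \<Longrightarrow> pconst n c \<odot> x \<in> carrier M"
  by (rule smult_closed) simp_all

lemma (in pmodule) smult_commute:
  assumes "a \<in> carrier (prod_alg n)" "b \<in> carrier (prod_alg n)" "x \<in> carrier M"
  shows "a \<odot> (b \<odot> x) = b \<odot> (a \<odot> x)"
  using smult_assoc1[OF assms] smult_assoc1[OF assms(2,1,3)] R.m_comm[OF assms(1,2)] by simp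

lemma linear_mod_prod: "linear_category (mod_prod n :: ('k::field, 'k pmod, 'k parr) lin_cat)"
proof (rule linear_category.intro)
  fix f :: "'k parr" assume "f \<in> Arr (mod_prod n)"
  then show "Dom (mod_prod n) f \<in> Ob (mod_prod n) \<and> Cod (mod_prod n) f \<in> Ob (mod_prod n)"
    by (cases f) auto
next
  fix M :: "'k pmod" assume M: "M \<in> Ob (mod_prod n)"
  then interpret M: pmodule n M by (simp add: fp_modules_pmodule)
  show "Ide (mod_prod n) M \<in> Hom (mod_prod n) M M"
    using M by (auto simp: mod_prod_hom_iff intro!: module_mapsI M.smult_closed)
next
  fix f g :: "'k parr" and M N P assume f: "f \<in> Hom (mod_prod n) M N" and g: "g \<in> Hom (mod_prod n) N P"
  then obtain \<phi> \<psi> where h: "f = (M, \<phi>, N)" "g = (N, \<psi>, P)" "M \<in> fp_modules n" "P \<in> fp_modules n"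
    "\<phi> \<in> module_maps (prod_alg n) M N" "\<psi> \<in> module_maps (prod_alg n) N P"
    by (auto simp: mod_prod_hom_iff)
  interpret M: pmodule n M using h(3) by (rule fp_modules_pmodule)
  show "g \<cdot>\<^bsub>mod_prod n\<^esub> f \<in> Hom (mod_prod n) M P"
    using h module_mapsD[OF h(5)] module_mapsD[OF h(6)]
    by (auto simp: mod_prod_hom_iff simp del: prod_alg_sel intro!: module_mapsI M.smult_closed)
next
  fix f g h :: "'k parr" and M N P Q
  assume "f \<in> Hom (mod_prod n) M N" "g \<in> Hom (mod_prod n) N P" "h \<in> Hom (mod_prod n) P Q"
  then show "h \<cdot>\<^bsub>mod_prod n\<^esub> (g \<cdot>\<^bsub>mod_prod n\<^esub> f) = (h \<cdot>\<^bsub>mod_prod n\<^esub> g) \<cdot>\<^bsub>mod_prod n\<^esub> f"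
    by (auto simp: mod_prod_hom_iff module_mapsD intro!: restrict_ext)
next
  fix f :: "'k parr" and M N assume f: "f \<in> Hom (mod_prod n) M N"
  then obtain \<phi> where h: "f = (M, \<phi>, N)" "\<phi> \<in> module_maps (prod_alg n) M N" by (auto simp: mod_prod_hom_iff)
  have "(\<lambda>x\<in>carrier M. \<phi> ((\<lambda>x\<in>carrier M. x) x)) = restrict \<phi> (carrier M)" by (intro restrict_ext) simp
  then show "f \<cdot>\<^bsub>mod_prod n\<^esub> Ide (mod_prod n) M = f" using h module_mapsD(4)[OF h(2)] by simp
  have "(\<lambda>x\<in>carrier M. (\<lambda>x\<in>carrier N. x) (\<phi> x)) = restrict \<phi> (carrier M)"
    using module_mapsD(1)[OF h(2)] by (intro restrict_ext) simp
  then show "Ide (mod_prod n) N \<cdot>\<^bsub>mod_prod n\<^esub> f = f" using h module_mapsD(4)[OF h(2)] by simp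
next
  fix M N :: "'k pmod" assume MN: "M \<in> Ob (mod_prod n)" "N \<in> Ob (mod_prod n)"
  interpret M: pmodule n M using MN by (simp add: fp_modules_pmodule)
  interpret N: pmodule n N using MN by (simp add: fp_modules_pmodule)
  let ?H = "hom_space (mod_prod n) M N"
  have mem: "(M, \<phi>, N) \<in> carrier ?H \<longleftrightarrow> \<phi> \<in> module_maps (prod_alg n) M N" for \<phi>
    using MN by (auto simp: mod_prod_hom_iff)
  have memE: "\<exists>\<phi>. f = (M, \<phi>, N) \<and> \<phi> \<in> module_maps (prod_alg n) M N" if "f \<in> carrier ?H" for f
    using that by (auto simp: mod_prod_hom_iff)
  have plus: "(\<lambda>x\<in>carrier M. \<phi> x \<oplus>\<^bsub>N\<^esub> \<psi> x) \<in> module_maps (prod_alg n) M N"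
    if "\<phi> \<in> module_maps (prod_alg n) M N" "\<psi> \<in> module_maps (prod_alg n) M N" for \<phi> \<psi>
    using that by (intro module_mapsI)
      (simp_all add: module_mapsD M.smult_closed N.smult_r_distr N.V.add_swap[simplified] del: prod_alg_sel)
  have scal: "(\<lambda>x\<in>carrier M. pconst n c \<odot>\<^bsub>N\<^esub> \<phi> x) \<in> module_maps (prod_alg n) M N"
    if \<phi>: "\<phi> \<in> module_maps (prod_alg n) M N" for \<phi> c
  proof (rule module_mapsI)
    fix x y assume x: "x \<in> carrier M" and y: "y \<in> carrier M"
    show "pconst n c \<odot>\<^bsub>N\<^esub> \<phi> x \<in> carrier N" using N.pconst_smult_closed module_mapsD(1)[OF \<phi> x] .
    show "x \<oplus>\<^bsub>M\<^esub> y \<in> carrier M \<and> pconst n c \<odot>\<^bsub>N\<^esub> \<phi> (x \<oplus>\<^bsub>M\<^esub> y) = pconst n c \<odot>\<^bsub>N\<^esub> \<phi> x \<oplus>\<^bsub>N\<^esub> pconst n c \<odot>\<^bsub>N\<^esub> \<phi> y"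
      using x y N.V.vsmult_rdistr[of "\<phi> x" "\<phi> y" c] module_mapsD[OF \<phi>] by simp
  next
    fix x a assume x: "x \<in> carrier M" and a: "a \<in> carrier (prod_alg n :: (nat \<Rightarrow> 'k) ring)"
    show "a \<odot>\<^bsub>M\<^esub> x \<in> carrier M \<and> pconst n c \<odot>\<^bsub>N\<^esub> \<phi> (a \<odot>\<^bsub>M\<^esub> x) = a \<odot>\<^bsub>N\<^esub> (pconst n c \<odot>\<^bsub>N\<^esub> \<phi> x)"
      using N.smult_commute[OF a _ module_mapsD(1)[OF \<phi> x], of "pconst n c"] M.smult_closed[OF a x]
        module_mapsD(3)[OF \<phi> a x] by simp
  qed
  have zero: "(\<lambda>x\<in>carrier M. \<zero>\<^bsub>N\<^esub>) \<in> module_maps (prod_alg n) M N"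
    by (intro module_mapsI) (simp_all add: M.smult_closed N.smult_r_null del: prod_alg_sel)
  show "module ring_of_type_algebra ?H"
  proof (rule moduleI)
    show "abelian_group ?H"
    proof (rule abelian_groupI)
      fix f g assume f: "f \<in> carrier ?H" and g: "g \<in> carrier ?H"
      obtain \<phi> \<psi> where h: "f = (M, \<phi>, N)" "g = (M, \<psi>, N)" "\<phi> \<in> module_maps (prod_alg n) M N" "\<psi> \<in> module_maps (prod_alg n) M N"
        using memE[OF f] memE[OF g] by blast
      show "f \<oplus>\<^bsub>?H\<^esub> g \<in> carrier ?H" using plus[OF h(3,4)] unfolding h(1,2) add_hom_space mod_prod_sel mem .
      show "f \<oplus>\<^bsub>?H\<^esub> g = g \<oplus>\<^bsub>?H\<^esub> f"
        using h by (auto simp: module_mapsD N.M.a_comm intro!: restrict_ext)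
      fix k assume k: "k \<in> carrier ?H"
      obtain \<chi> where "k = (M, \<chi>, N)" "\<chi> \<in> module_maps (prod_alg n) M N" using memE[OF k] by blast
      then show "f \<oplus>\<^bsub>?H\<^esub> g \<oplus>\<^bsub>?H\<^esub> k = f \<oplus>\<^bsub>?H\<^esub> (g \<oplus>\<^bsub>?H\<^esub> k)"
        using h by (auto simp: module_mapsD N.M.a_assoc intro!: restrict_ext)
    next
      show "\<zero>\<^bsub>?H\<^esub> \<in> carrier ?H" using zero unfolding zero_hom_space mod_prod_sel mem .
      fix f assume f: "f \<in> carrier ?H"
      obtain \<phi> where h: "f = (M, \<phi>, N)" "\<phi> \<in> module_maps (prod_alg n) M N" using memE[OF f] by blast
      have "(\<lambda>x\<in>carrier M. (\<lambda>x\<in>carrier M. \<zero>\<^bsub>N\<^esub>) x \<oplus>\<^bsub>N\<^esub> \<phi> x) = restrict \<phi> (carrier M)"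
        using h by (intro restrict_ext) (simp add: module_mapsD)
      then show "\<zero>\<^bsub>?H\<^esub> \<oplus>\<^bsub>?H\<^esub> f = f" using h module_mapsD(4)[OF h(2)] by simp
      show "\<exists>g\<in>carrier ?H. g \<oplus>\<^bsub>?H\<^esub> f = \<zero>\<^bsub>?H\<^esub>"
      proof
        show "Scal (mod_prod n) (- 1) f \<in> carrier ?H" using scal[OF h(2)] unfolding h(1) mod_prod_sel mem .
        have "pconst n (- 1) \<odot>\<^bsub>N\<^esub> \<phi> x \<oplus>\<^bsub>N\<^esub> \<phi> x = \<zero>\<^bsub>N\<^esub>" if "x \<in> carrier M" for x
        proof -
          have "\<phi> x \<in> carrier N" "pconst n (- 1) \<odot>\<^bsub>N\<^esub> \<phi> x \<in> carrier N"
            using module_mapsD(1)[OF h(2) that] N.pconst_smult_closed by blast+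
          then show ?thesis using N.V.vneg[of "\<phi> x"] N.M.a_comm by simp
        qed
        then show "Scal (mod_prod n) (- 1) f \<oplus>\<^bsub>?H\<^esub> f = \<zero>\<^bsub>?H\<^esub>"
          using h by (auto intro!: restrict_ext)
      qed
    qed
  next
    fix f and a b :: 'k assume f: "f \<in> carrier ?H"
    obtain \<phi> where h: "f = (M, \<phi>, N)" "\<phi> \<in> module_maps (prod_alg n) M N" using memE[OF f] by blast
    note c = module_mapsD(1)[OF h(2)]
    show "a \<odot>\<^bsub>?H\<^esub> f \<in> carrier ?H" using scal[OF h(2)] unfolding h(1) smult_hom_space mod_prod_sel mem .
    show "(a \<oplus>\<^bsub>ring_of_type_algebra\<^esub> b) \<odot>\<^bsub>?H\<^esub> f = a \<odot>\<^bsub>?H\<^esub> f \<oplus>\<^bsub>?H\<^esub> b \<odot>\<^bsub>?H\<^esub> f"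
      using N.V.vsmult_ldistr[of _ a b] h c by (auto intro!: restrict_ext)
    show "a \<otimes>\<^bsub>ring_of_type_algebra\<^esub> b \<odot>\<^bsub>?H\<^esub> f = a \<odot>\<^bsub>?H\<^esub> (b \<odot>\<^bsub>?H\<^esub> f)"
      using N.V.vsmult_assoc[of _ a b] h c by (auto intro!: restrict_ext)
    have "(\<lambda>x\<in>carrier M. pconst n 1 \<odot>\<^bsub>N\<^esub> \<phi> x) = restrict \<phi> (carrier M)"
      using N.V.vsmult_one c by (intro restrict_ext) simp
    then show "\<one>\<^bsub>ring_of_type_algebra\<^esub> \<odot>\<^bsub>?H\<^esub> f = f" using h module_mapsD(4)[OF h(2)] by simp
    fix g assume g: "g \<in> carrier ?H"
    obtain \<psi> where h': "g = (M, \<psi>, N)" "\<psi> \<in> module_maps (prod_alg n) M N" using memE[OF g] by blast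
    show "a \<odot>\<^bsub>?H\<^esub> (f \<oplus>\<^bsub>?H\<^esub> g) = a \<odot>\<^bsub>?H\<^esub> f \<oplus>\<^bsub>?H\<^esub> a \<odot>\<^bsub>?H\<^esub> g"
      using N.V.vsmult_rdistr[of _ _ a] h h' c module_mapsD(1)[OF h'(2)] by (auto intro!: restrict_ext)
  qed (rule cring_from_type_algebra)
next
  fix f f' g :: "'k parr" and M N P
  assume *: "f \<in> Hom (mod_prod n) M N" "f' \<in> Hom (mod_prod n) M N" "g \<in> Hom (mod_prod n) N P"
  then show "g \<cdot>\<^bsub>mod_prod n\<^esub> Plus (mod_prod n) f f' =
      Plus (mod_prod n) (g \<cdot>\<^bsub>mod_prod n\<^esub> f) (g \<cdot>\<^bsub>mod_prod n\<^esub> f')"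
    by (auto simp: mod_prod_hom_iff module_mapsD intro!: restrict_ext)
next
  fix f g g' :: "'k parr" and M N P
  assume *: "f \<in> Hom (mod_prod n) M N" "g \<in> Hom (mod_prod n) N P" "g' \<in> Hom (mod_prod n) N P"
  then show "Plus (mod_prod n) g g' \<cdot>\<^bsub>mod_prod n\<^esub> f =
      Plus (mod_prod n) (g \<cdot>\<^bsub>mod_prod n\<^esub> f) (g' \<cdot>\<^bsub>mod_prod n\<^esub> f)"
    by (auto simp: mod_prod_hom_iff module_mapsD intro!: restrict_ext)
next
  fix f g :: "'k parr" and c :: 'k and M N P
  assume *: "f \<in> Hom (mod_prod n) M N" "g \<in> Hom (mod_prod n) N P"
  have "pconst n c \<in> carrier (prod_alg n)" by simp
  then show "g \<cdot>\<^bsub>mod_prod n\<^esub> Scal (mod_prod n) c f = Scal (mod_prod n) c (g \<cdot>\<^bsub>mod_prod n\<^esub> f)"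
    using * by (auto simp: mod_prod_hom_iff module_mapsD simp del: prod_alg_sel intro!: restrict_ext)
  show "Scal (mod_prod n) c g \<cdot>\<^bsub>mod_prod n\<^esub> f = Scal (mod_prod n) c (g \<cdot>\<^bsub>mod_prod n\<^esub> f)"
    using * by (auto simp: mod_prod_hom_iff module_mapsD intro!: restrict_ext)
qed

lemma finsum_mod_prod_hom:
  assumes "M \<in> fp_modules n" "N \<in> fp_modules n" "\<And>i. i < d \<Longrightarrow> \<phi> i \<in> module_maps (prod_alg n) M N"
  shows "(\<Oplus>\<^bsub>hom_space (mod_prod n) M N\<^esub>i\<in>{..<d::nat}. (M, \<phi> i, N)) = (M, \<lambda>x\<in>carrier M. \<Oplus>\<^bsub>N\<^esub>i\<in>{..<d}. \<phi> i x, N)"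
  using assms(3)
proof (induction d)
  case 0
  interpret H: abelian_group "hom_space (mod_prod n) M N"
    using linear_category.hom_abelian_group[OF linear_mod_prod] assms by simp
  interpret N: pmodule n N using assms(2) by (rule fp_modules_pmodule)
  show ?case unfolding lessThan_0 H.finsum_empty N.M.finsum_empty zero_hom_space mod_prod_sel ..
next
  case (Suc d)
  interpret H: abelian_group "hom_space (mod_prod n) M N"
    using linear_category.hom_abelian_group[OF linear_mod_prod] assms by simp
  interpret N: pmodule n N using assms(2) by (rule fp_modules_pmodule)
  have "(\<Oplus>\<^bsub>hom_space (mod_prod n) M N\<^esub>i\<in>{..<Suc d}. (M, \<phi> i, N)) =
      (M, \<phi> d, N) \<oplus>\<^bsub>hom_space (mod_prod n) M N\<^esub> (\<Oplus>\<^bsub>hom_space (mod_prod n) M N\<^esub>i\<in>{..<d}. (M, \<phi> i, N))"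
    using Suc.prems assms by (intro H.finsum_lessThan_Suc) (auto simp: mod_prod_hom_iff)
  also have "\<dots> = (M, \<lambda>x\<in>carrier M. \<phi> d x \<oplus>\<^bsub>N\<^esub> (\<Oplus>\<^bsub>N\<^esub>i\<in>{..<d}. \<phi> i x), N)"
    using Suc by (auto intro!: restrict_ext)
  also have "\<dots> = (M, \<lambda>x\<in>carrier M. \<Oplus>\<^bsub>N\<^esub>i\<in>{..<Suc d}. \<phi> i x, N)"
    using module_mapsD(1)[OF Suc.prems] by (auto intro!: restrict_ext N.M.finsum_lessThan_Suc[symmetric])
  finally show ?case .
qed

section \<open>Simple modules and powers of the field\<close>

lemma simple_mod_sel [simp]:
  "carrier (simple_mod n i) = {v \<in> {..<n} \<rightarrow>\<^sub>E UNIV. \<forall>j<n. j \<noteq> i \<longrightarrow> v j = 0}"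
  "\<zero>\<^bsub>simple_mod n i\<^esub> = (\<lambda>i\<in>{..<n}. 0)" "f \<oplus>\<^bsub>simple_mod n i\<^esub> g = (\<lambda>i\<in>{..<n}. f i + g i)"
  "f \<odot>\<^bsub>simple_mod n i\<^esub> g = (\<lambda>i\<in>{..<n}. f i * g i)"
  by (simp_all add: simple_mod_def)

lemma pmodule_simple_mod: "pmodule n (simple_mod n i :: 'k::field pmod)"
  unfolding pmodule_def
proof (rule moduleI)
  show "cring (prod_alg n :: (nat \<Rightarrow> 'k) ring)" by (rule cring_prod_alg)
  show "abelian_group (simple_mod n i :: 'k pmod)"
  proof (rule abelian_groupI)
    fix x :: "nat \<Rightarrow> 'k" assume "x \<in> carrier (simple_mod n i)"
    then show "\<exists>y\<in>carrier (simple_mod n i). y \<oplus>\<^bsub>simple_mod n i\<^esub> x = \<zero>\<^bsub>simple_mod n i\<^esub>"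
      by (intro bexI[of _ "\<lambda>i\<in>{..<n}. - x i"]) (auto simp: fun_eq_iff)
  qed (auto simp: fun_eq_iff PiE_iff extensional_def)
qed (auto simp: fun_eq_iff PiE_iff extensional_def algebra_simps)

lemma unit_vec_simple_mod: "unit_vec n i \<in> carrier (simple_mod n i)"
  by (auto simp: unit_vec_def)

lemma simple_mod_elem:
  assumes "v \<in> carrier (simple_mod n i)"
  shows "v = pconst n (v i) \<odot>\<^bsub>simple_mod n i\<^esub> unit_vec n i"
  using assms by (auto simp: unit_vec_def fun_eq_iff PiE_iff extensional_def)

lemma hbasis_simple_mod:
  assumes "i < n"
  shows "hbasis n (simple_mod n i :: 'k::field pmod) 1 (\<lambda>_. i) (\<lambda>_. unit_vec n i)"
proof -
  interpret S: pmodule n "simple_mod n i :: 'k pmod" by (rule pmodule_simple_mod)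
  have u: "(unit_vec n i :: nat \<Rightarrow> 'k) \<in> carrier (simple_mod n i)" by (rule unit_vec_simple_mod)
  have ne: "(unit_vec n i :: nat \<Rightarrow> 'k) \<noteq> \<zero>\<^bsub>simple_mod n i\<^esub>"
  proof
    assume "(unit_vec n i :: nat \<Rightarrow> 'k) = \<zero>\<^bsub>simple_mod n i\<^esub>"
    then have "(unit_vec n i :: nat \<Rightarrow> 'k) i = 0" using assms by simp
    then show False using assms by (simp add: unit_vec_def)
  qed
  have uu: "unit_vec n i \<odot>\<^bsub>simple_mod n i\<^esub> unit_vec n i = (unit_vec n i :: nat \<Rightarrow> 'k)"
    by (auto simp: unit_vec_def fun_eq_iff)
  have "carrier (simple_mod n i) \<subseteq> lspan (diag_space n (simple_mod n i)) [unit_vec n i :: nat \<Rightarrow> 'k]"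
  proof
    fix v :: "nat \<Rightarrow> 'k" assume v: "v \<in> carrier (simple_mod n i)"
    have "v = v i \<odot>\<^bsub>diag_space n (simple_mod n i)\<^esub> unit_vec n i \<oplus>\<^bsub>diag_space n (simple_mod n i)\<^esub> \<zero>\<^bsub>diag_space n (simple_mod n i)\<^esub>"
      using simple_mod_elem[OF v] S.pconst_smult_closed[OF u, of "v i"] S.V.M.r_zero[of v] v
      by (simp only: diag_space_sel)
    then show "v \<in> lspan (diag_space n (simple_mod n i)) [unit_vec n i]"
      unfolding lspan.simps by blast
  qed
  then show ?thesis using assms u uu ne unfolding hbasis_def by auto
qed

lemma simple_mod_fp:
  assumes "i < n"
  shows "(simple_mod n i :: 'k::field pmod) \<in> fp_modules n"
proof -
  interpret S: pmodule n "simple_mod n i :: 'k pmod" by (rule pmodule_simple_mod)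
  have "finitely_presented (prod_alg n) (simple_mod n i :: 'k pmod)"
    by (rule S.hbasis_finitely_presented[OF hbasis_simple_mod[OF assms]])
  then show ?thesis using S.module_axioms by (simp add: fp_modules_def)
qed

lemma simple_mod_end:
  fixes f :: "'k::field parr"
  assumes "i < n" "f \<in> Hom (mod_prod n) (simple_mod n i) (simple_mod n i)"
  shows "\<exists>c. f = Scal (mod_prod n) c (Ide (mod_prod n) (simple_mod n i))"
proof -
  let ?S = "simple_mod n i :: 'k pmod"
  obtain \<phi> where \<phi>: "f = (?S, \<phi>, ?S)" "\<phi> \<in> module_maps (prod_alg n) ?S ?S" using assms(2) by (auto simp: mod_prod_hom_iff)
  define c where "c = \<phi> (unit_vec n i) i"
  have "\<phi> v = pconst n c \<odot>\<^bsub>?S\<^esub> v" if v: "v \<in> carrier ?S" for v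
  proof -
    have u: "\<phi> (unit_vec n i) \<in> carrier ?S" using module_mapsD(1)[OF \<phi>(2) unit_vec_simple_mod] .
    have "\<phi> v = \<phi> (pconst n (v i) \<odot>\<^bsub>?S\<^esub> unit_vec n i)" using simple_mod_elem[OF v] by simp
    also have "\<dots> = pconst n (v i) \<odot>\<^bsub>?S\<^esub> \<phi> (unit_vec n i)"
      using module_mapsD(3)[OF \<phi>(2) _ unit_vec_simple_mod, of "pconst n (v i)"] by simp
    also have "\<dots> = pconst n c \<odot>\<^bsub>?S\<^esub> v"
    proof -
      have "v i * \<phi> (unit_vec n i) x = c * v x" if "x < n" for x
        using u v that by (cases "x = i") (auto simp: c_def)
      then show ?thesis by (auto simp: fun_eq_iff)
    qed
    finally show ?thesis .
  qed
  then have "restrict \<phi> (carrier ?S) = (\<lambda>v\<in>carrier ?S. pconst n c \<odot>\<^bsub>?S\<^esub> (\<lambda>x\<in>carrier ?S. x) v)"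
    by (intro restrict_ext) simp
  then have "f = Scal (mod_prod n) c (Ide (mod_prod n) ?S)"
    unfolding \<phi>(1) mod_prod_sel using module_mapsD(4)[OF \<phi>(2)] by simp
  then show ?thesis by blast
qed

lemma simple_mod_orth:
  fixes f :: "'k::field parr"
  assumes "i < n" "i \<noteq> j" "f \<in> Hom (mod_prod n) (simple_mod n i) (simple_mod n j)"
  shows "f = Zer (mod_prod n) (simple_mod n i) (simple_mod n j)"
proof -
  let ?S = "simple_mod n i :: 'k pmod" and ?T = "simple_mod n j :: 'k pmod"
  obtain \<phi> where \<phi>: "f = (?S, \<phi>, ?T)" "\<phi> \<in> module_maps (prod_alg n) ?S ?T" using assms(3) by (auto simp: mod_prod_hom_iff)
  have "\<phi> v = \<zero>\<^bsub>?T\<^esub>" if v: "v \<in> carrier ?S" for v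
  proof -
    have "unit_vec n i \<odot>\<^bsub>?S\<^esub> v = v" using v by (auto simp: unit_vec_def fun_eq_iff PiE_iff extensional_def)
    then have "\<phi> v = unit_vec n i \<odot>\<^bsub>?T\<^esub> \<phi> v"
      using module_mapsD(3)[OF \<phi>(2) _ v, of "unit_vec n i"] by (simp add: unit_vec_def)
    then show ?thesis using module_mapsD(1)[OF \<phi>(2) v] assms(2)
      by (auto simp: unit_vec_def fun_eq_iff split: if_splits)
  qed
  then have "restrict \<phi> (carrier ?S) = (\<lambda>v\<in>carrier ?S. \<zero>\<^bsub>?T\<^esub>)" by (intro restrict_ext)
  then show ?thesis unfolding \<phi>(1) mod_prod_sel using module_mapsD(4)[OF \<phi>(2)] by simp
qed

lemma simple_mod_nonzero:
  assumes "i < n"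
  shows "Ide (mod_prod n) (simple_mod n i :: 'k::field pmod) \<noteq> Zer (mod_prod n) (simple_mod n i) (simple_mod n i)"
proof
  assume "Ide (mod_prod n) (simple_mod n i :: 'k pmod) = Zer (mod_prod n) (simple_mod n i) (simple_mod n i)"
  then have "(\<lambda>x\<in>carrier (simple_mod n i :: 'k pmod). x) (unit_vec n i) = (\<lambda>x\<in>carrier (simple_mod n i :: 'k pmod). \<zero>\<^bsub>simple_mod n i :: 'k pmod\<^esub>) (unit_vec n i)"
    by (simp only: mod_prod_sel prod.inject)
  then have "(unit_vec n i :: nat \<Rightarrow> 'k) i = (\<lambda>i\<in>{..<n}. 0) i"
    using unit_vec_simple_mod[of n i, where 'a='k] by simp
  then show False using assms by (simp add: unit_vec_def)
qed

text \<open>A homogeneous basis exhibits a module as a direct sum of simple modules.\<close>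

lemma hbasis_direct_sum:
  fixes M :: "'k::field pmod"
  assumes "M \<in> fp_modules n" "hbasis n M d t b"
  shows "is_direct_sum (mod_prod n) d (\<lambda>j. simple_mod n (t j)) M"
proof -
  interpret M: pmodule n M using assms(1) by (rule fp_modules_pmodule)
  note hm = M.hbasis_mem[OF assms(2)]
  let ?S = "\<lambda>j. simple_mod n (t j) :: 'k pmod"
  let ?h = "M.hcoord d b"
  define \<iota> where "\<iota> j = (\<lambda>v\<in>carrier (?S j). pconst n (v (t j)) \<odot>\<^bsub>M\<^esub> b j)" for j
  define \<pi> where "\<pi> j = (\<lambda>m\<in>carrier M. (\<lambda>i\<in>{..<n}. if i = t j then ?h m j else 0))" for j
  have \<iota>: "\<iota> j \<in> module_maps (prod_alg n) (?S j) M" if j: "j < d" for j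
    unfolding \<iota>_def
  proof (rule module_mapsI)
    interpret S: pmodule n "?S j" by (rule pmodule_simple_mod)
    fix v w assume v: "v \<in> carrier (?S j)" and w: "w \<in> carrier (?S j)"
    show "pconst n (v (t j)) \<odot>\<^bsub>M\<^esub> b j \<in> carrier M" using M.pconst_smult_closed hm(2)[OF j] by blast
    show "v \<oplus>\<^bsub>?S j\<^esub> w \<in> carrier (?S j) \<and>
      pconst n ((v \<oplus>\<^bsub>?S j\<^esub> w) (t j)) \<odot>\<^bsub>M\<^esub> b j = pconst n (v (t j)) \<odot>\<^bsub>M\<^esub> b j \<oplus>\<^bsub>M\<^esub> pconst n (w (t j)) \<odot>\<^bsub>M\<^esub> b j"
      using S.M.a_closed[OF v w] M.V.vsmult_ldistr[of "b j" "v (t j)" "w (t j)"] hm(1,2)[OF j] by simp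
  next
    interpret S: pmodule n "?S j" by (rule pmodule_simple_mod)
    fix a v assume a: "a \<in> carrier (prod_alg n :: (nat \<Rightarrow> 'k) ring)" and v: "v \<in> carrier (?S j)"
    have p: "pconst n (v (t j)) \<in> carrier (prod_alg n)" "a \<otimes>\<^bsub>prod_alg n\<^esub> pconst n (v (t j)) \<in> carrier (prod_alg n)"
      by simp_all
    have "a \<odot>\<^bsub>M\<^esub> (pconst n (v (t j)) \<odot>\<^bsub>M\<^esub> b j) = pconst n (a (t j) * v (t j)) \<odot>\<^bsub>M\<^esub> b j"
      using M.smult_assoc1[OF a p(1) hm(2)[OF j]] M.homogeneous_smult[OF hm(1)[OF j] hm(2)[OF j] hm(3)[OF j] p(2)] hm(1)[OF j]
      by simp
    then show "a \<odot>\<^bsub>?S j\<^esub> v \<in> carrier (?S j) \<and>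
      pconst n ((a \<odot>\<^bsub>?S j\<^esub> v) (t j)) \<odot>\<^bsub>M\<^esub> b j = a \<odot>\<^bsub>M\<^esub> (pconst n (v (t j)) \<odot>\<^bsub>M\<^esub> b j)"
      using S.smult_closed[OF a v] hm(1)[OF j] by simp
  qed
  have \<pi>: "\<pi> j \<in> module_maps (prod_alg n) M (?S j)" if j: "j < d" for j
    unfolding \<pi>_def
  proof (rule module_mapsI)
    fix x y assume x: "x \<in> carrier M" and y: "y \<in> carrier M"
    show "(\<lambda>i\<in>{..<n}. if i = t j then ?h x j else 0) \<in> carrier (?S j)" by auto
    show "x \<oplus>\<^bsub>M\<^esub> y \<in> carrier M \<and> (\<lambda>i\<in>{..<n}. if i = t j then ?h (x \<oplus>\<^bsub>M\<^esub> y) j else 0) =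
      (\<lambda>i\<in>{..<n}. if i = t j then ?h x j else 0) \<oplus>\<^bsub>?S j\<^esub> (\<lambda>i\<in>{..<n}. if i = t j then ?h y j else 0)"
      using M.hcoord_add[OF assms(2) x y j] x y by (auto simp: fun_eq_iff)
  next
    fix a x assume a: "a \<in> carrier (prod_alg n :: (nat \<Rightarrow> 'k) ring)" and x: "x \<in> carrier M"
    show "a \<odot>\<^bsub>M\<^esub> x \<in> carrier M \<and> (\<lambda>i\<in>{..<n}. if i = t j then ?h (a \<odot>\<^bsub>M\<^esub> x) j else 0) =
      a \<odot>\<^bsub>?S j\<^esub> (\<lambda>i\<in>{..<n}. if i = t j then ?h x j else 0)"
      using M.hcoord_smult[OF assms(2) x a j] M.smult_closed[OF a x] by (auto simp: fun_eq_iff)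
  qed
  have S: "?S j \<in> fp_modules n" if "j < d" for j using simple_mod_fp hm(1)[OF that] by blast
  have orth: "(M, \<pi> i, ?S i) \<cdot>\<^bsub>mod_prod n\<^esub> (?S j, \<iota> j, M) =
      (if i = j then Ide (mod_prod n) (?S i) else Zer (mod_prod n) (?S j) (?S i))" if ij: "i < d" "j < d" for i j
  proof -
    have "\<pi> i (\<iota> j v) = (if i = j then v else \<zero>\<^bsub>?S i\<^esub>)" if v: "v \<in> carrier (?S j)" for v
    proof -
      have "\<iota> j v \<in> carrier M" using module_mapsD(1)[OF \<iota>[OF ij(2)] v] .
      then have "\<pi> i (\<iota> j v) = (\<lambda>l\<in>{..<n}. if l = t i then ?h (\<iota> j v) i else 0)"
        by (simp only: \<pi>_def restrict_apply if_True)
      moreover have "\<iota> j v = pconst n (v (t j)) \<odot>\<^bsub>M\<^esub> b j" using v by (simp only: \<iota>_def restrict_apply if_True)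
      ultimately have "\<pi> i (\<iota> j v) = (\<lambda>l\<in>{..<n}. if l = t i then (if i = j then v (t j) else 0) else 0)"
        by (simp only: M.hcoord_basis[OF assms(2) ij])
      then show ?thesis using v by (auto simp: fun_eq_iff PiE_iff extensional_def)
    qed
    then have e: "(\<lambda>v\<in>carrier (?S j). \<pi> i (\<iota> j v)) = (\<lambda>v\<in>carrier (?S j). if i = j then v else \<zero>\<^bsub>?S i\<^esub>)"
      by (intro restrict_ext)
    show ?thesis unfolding mod_prod_sel e by (cases "i = j") (simp_all only: if_True if_False refl)
  qed
  have comp: "(\<lambda>m\<in>carrier M. \<iota> j (\<pi> j m)) \<in> module_maps (prod_alg n) M M" if j: "j < d" for j
    using linear_category.comp_hom[OF linear_mod_prod, of "(M, \<pi> j, ?S j)" n M "?S j" "(?S j, \<iota> j, M)" M]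
      assms(1) S[OF j] \<pi>[OF j] \<iota>[OF j] by (auto simp: mod_prod_hom_iff)
  have val: "\<iota> j (\<pi> j m) = pconst n (?h m j) \<odot>\<^bsub>M\<^esub> b j" if j: "j < d" and m: "m \<in> carrier M" for j m
  proof -
    have "\<pi> j m \<in> carrier (?S j)" using module_mapsD(1)[OF \<pi>[OF j] m] .
    moreover have "\<pi> j m (t j) = ?h m j" using m hm(1)[OF j] by (simp add: \<pi>_def)
    ultimately show ?thesis by (simp only: \<iota>_def restrict_apply if_True)
  qed
  have "(\<Oplus>\<^bsub>hom_space (mod_prod n) M M\<^esub>j\<in>{..<d}. (?S j, \<iota> j, M) \<cdot>\<^bsub>mod_prod n\<^esub> (M, \<pi> j, ?S j)) =
      (M, \<lambda>m\<in>carrier M. \<Oplus>\<^bsub>M\<^esub>j\<in>{..<d}. (\<lambda>m\<in>carrier M. \<iota> j (\<pi> j m)) m, M)"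
    unfolding mod_prod_sel using finsum_mod_prod_hom[OF assms(1,1) comp] .
  also have "(\<lambda>m\<in>carrier M. \<Oplus>\<^bsub>M\<^esub>j\<in>{..<d}. (\<lambda>m\<in>carrier M. \<iota> j (\<pi> j m)) m) = (\<lambda>m\<in>carrier M. m)"
  proof (rule restrict_ext)
    fix m assume m: "m \<in> carrier M"
    have "(\<Oplus>\<^bsub>M\<^esub>j\<in>{..<d}. (\<lambda>m\<in>carrier M. \<iota> j (\<pi> j m)) m) = (\<Oplus>\<^bsub>M\<^esub>j\<in>{..<d}. pconst n (?h m j) \<odot>\<^bsub>M\<^esub> b j)"
      using m val by (intro M.M.finsum_cong' M.comb_closed[OF assms(2)]) simp_all
    then show "(\<Oplus>\<^bsub>M\<^esub>j\<in>{..<d}. (\<lambda>m\<in>carrier M. \<iota> j (\<pi> j m)) m) = m" using M.hcoord_sum[OF assms(2) m] by simp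
  qed
  finally have sum: "(\<Oplus>\<^bsub>hom_space (mod_prod n) M M\<^esub>j\<in>{..<d}. (?S j, \<iota> j, M) \<cdot>\<^bsub>mod_prod n\<^esub> (M, \<pi> j, ?S j)) = Ide (mod_prod n) M"
    by (simp only: mod_prod_sel)
  show ?thesis
    unfolding is_direct_sum_def
  proof (intro conjI allI impI exI)
    show "M \<in> Ob (mod_prod n)" using assms by simp
    show "\<And>i. i < d \<Longrightarrow> ?S i \<in> Ob (mod_prod n)" using S by simp
    show "\<And>i. i < d \<Longrightarrow> (?S i, \<iota> i, M) \<in> Hom (mod_prod n) (?S i) M" "\<And>i. i < d \<Longrightarrow> (M, \<pi> i, ?S i) \<in> Hom (mod_prod n) M (?S i)"
      using S \<iota> \<pi> assms(1) by (auto simp: mod_prod_hom_iff)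
  qed (use orth sum in blast)+
qed

lemma fp_direct_sum:
  fixes M :: "'k::field pmod"
  assumes "M \<in> fp_modules n"
  shows "\<exists>d t. (\<forall>j<d. t j < n) \<and> is_direct_sum (mod_prod n) d (\<lambda>j. simple_mod n (t j)) M"
proof -
  interpret M: pmodule n M using assms(1) by (rule fp_modules_pmodule)
  obtain d t b where hb: "hbasis n M d t b" using M.hbasis_exists assms by (auto simp: fp_modules_def)
  then show ?thesis using hbasis_direct_sum[OF assms hb] by (auto simp: hbasis_def)
qed

text \<open>The \<open>d\<close>-th power of the field, where the algebra acts on the \<open>j\<close>-th coordinate through its \<open>t j\<close>-th
  factor.\<close>

definition power_mod :: "nat \<Rightarrow> nat \<Rightarrow> (nat \<Rightarrow> nat) \<Rightarrow> 'k::field pmod" where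
  "power_mod n d t = \<lparr>carrier = {..<d} \<rightarrow>\<^sub>E UNIV, monoid.mult = undefined, monoid.one = undefined,
     ring.zero = (\<lambda>j\<in>{..<d}. 0), ring.add = (\<lambda>v w. \<lambda>j\<in>{..<d}. v j + w j),
     module.smult = (\<lambda>a v. \<lambda>j\<in>{..<d}. a (t j) * v j)\<rparr>"

lemma power_mod_sel [simp]:
  "carrier (power_mod n d t) = {..<d} \<rightarrow>\<^sub>E UNIV" "\<zero>\<^bsub>power_mod n d t\<^esub> = (\<lambda>j\<in>{..<d}. 0)"
  "v \<oplus>\<^bsub>power_mod n d t\<^esub> w = (\<lambda>j\<in>{..<d}. v j + w j)" "a \<odot>\<^bsub>power_mod n d t\<^esub> v = (\<lambda>j\<in>{..<d}. a (t j) * v j)"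
  by (simp_all add: power_mod_def)

lemma direct_sum_of_simples_exists:
  assumes "\<forall>j<d. t j < n"
  shows "\<exists>M \<in> fp_modules n. is_direct_sum (mod_prod n) d (\<lambda>j. simple_mod n (t j)) (M :: 'k::field pmod)"
proof -
  let ?M = "power_mod n d t :: 'k pmod"
  have pM: "pmodule n ?M"
    unfolding pmodule_def
  proof (rule moduleI)
    show "cring (prod_alg n :: (nat \<Rightarrow> 'k) ring)" by (rule cring_prod_alg)
    show "abelian_group ?M"
    proof (rule abelian_groupI)
      fix x assume "x \<in> carrier ?M"
      then show "\<exists>y\<in>carrier ?M. y \<oplus>\<^bsub>?M\<^esub> x = \<zero>\<^bsub>?M\<^esub>"
        by (intro bexI[of _ "\<lambda>i\<in>{..<d}. - x i"]) (auto simp: fun_eq_iff)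
    qed (auto simp: fun_eq_iff PiE_iff extensional_def)
  qed (use assms in \<open>auto simp: fun_eq_iff PiE_iff extensional_def algebra_simps\<close>)
  interpret M: pmodule n ?M by (rule pM)
  have u: "unit_vec d \<in> {..<k} \<rightarrow> carrier ?M" for k by (auto simp: unit_vec_def)
  have partial: "(\<Oplus>\<^bsub>?M\<^esub>j\<in>{..<k}. pconst n (c j) \<odot>\<^bsub>?M\<^esub> unit_vec d j) = (\<lambda>j\<in>{..<d}. if j < k then c j else 0)"
    if "k \<le> d" for k c
    using that
  proof (induction k)
    case 0
    have "(\<lambda>j\<in>{..<d}. if j < 0 then c j else 0) = \<zero>\<^bsub>?M\<^esub>" by (auto simp: fun_eq_iff)
    then show ?case by (simp only: lessThan_0 M.M.finsum_empty)
  next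
    case (Suc k)
    have cl: "(\<lambda>j. pconst n (c j) \<odot>\<^bsub>?M\<^esub> unit_vec d j) \<in> {..<Suc k} \<rightarrow> carrier ?M" by auto
    show ?case
      unfolding M.M.finsum_lessThan_Suc[OF cl] Suc.IH[OF Suc_leD[OF Suc.prems]]
      using Suc.prems assms by (auto simp: unit_vec_def fun_eq_iff less_Suc_eq)
  qed
  have span: "lspan (diag_space n ?M) (map (unit_vec d) (rev [0..<k])) = {\<lambda>j\<in>{..<d}. if j < k then c j else 0 |c. True}"
    if "k \<le> d" for k
    using M.V.lspan_upt[of "unit_vec d" k] u partial[OF that] by simp
  have "lind (diag_space n ?M) (map (unit_vec d) (rev [0..<k]))" if "k \<le> d" for k
    using that
  proof (induction k)
    case (Suc k)
    have "unit_vec d k \<notin> lspan (diag_space n ?M) (map (unit_vec d) (rev [0..<k]))"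
    proof
      assume "unit_vec d k \<in> lspan (diag_space n ?M) (map (unit_vec d) (rev [0..<k]))"
      then obtain c where "unit_vec d k = (\<lambda>j\<in>{..<d}. if j < k then c j else 0 :: 'k)"
        using span[of k] Suc.prems by auto
      then have "unit_vec d k k = (\<lambda>j\<in>{..<d}. if j < k then c j else 0 :: 'k) k" by simp
      then show False using Suc.prems by (simp add: unit_vec_def)
    qed
    then show ?case using Suc by simp
  qed simp
  moreover have "carrier ?M \<subseteq> lspan (diag_space n ?M) (map (unit_vec d) (rev [0..<d]))"
  proof
    fix v assume v: "v \<in> carrier ?M"
    have "v = (\<lambda>j\<in>{..<d}. if j < d then v j else 0)" using v by (auto simp: fun_eq_iff PiE_iff extensional_def)
    then show "v \<in> lspan (diag_space n ?M) (map (unit_vec d) (rev [0..<d]))" unfolding span[OF order.refl] by blast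
  qed
  moreover have "unit_vec n (t j) \<odot>\<^bsub>?M\<^esub> unit_vec d j = unit_vec d j" if "j < d" for j
    using that assms by (auto simp: unit_vec_def fun_eq_iff)
  moreover have "unit_vec d j \<in> carrier ?M" for j by (auto simp: unit_vec_def)
  ultimately have hb: "hbasis n ?M d t (unit_vec d)" using assms unfolding hbasis_def by blast
  have "?M \<in> fp_modules n"
    using M.hbasis_finitely_presented[OF hb] pM by (simp add: fp_modules_def pmodule_def)
  then show ?thesis using hbasis_direct_sum hb by blast
qed

section \<open>Direct sums\<close>

text \<open>Direct sums with their inclusions and projections named, as these serve as coordinates for
  matrices.\<close>

definition dsum :: "('k, 'o, 'm) lin_cat \<Rightarrow> nat \<Rightarrow> (nat \<Rightarrow> 'o) \<Rightarrow> 'o \<Rightarrow> (nat \<Rightarrow> 'm) \<Rightarrow> (nat \<Rightarrow> 'm) \<Rightarrow> bool" where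
  "dsum C d X S \<iota> \<pi> \<longleftrightarrow> S \<in> Ob C \<and> (\<forall>i<d. X i \<in> Ob C) \<and>
     (\<forall>i<d. \<iota> i \<in> Hom C (X i) S \<and> \<pi> i \<in> Hom C S (X i)) \<and>
     (\<forall>i<d. \<forall>j<d. \<pi> i \<cdot>\<^bsub>C\<^esub> \<iota> j = (if i = j then Ide C (X i) else Zer C (X j) (X i))) \<and>
     (\<Oplus>\<^bsub>hom_space C S S\<^esub>i\<in>{..<d}. \<iota> i \<cdot>\<^bsub>C\<^esub> \<pi> i) = Ide C S"

lemma is_direct_sum_iff: "is_direct_sum C d X S \<longleftrightarrow> (\<exists>\<iota> \<pi>. dsum C d X S \<iota> \<pi>)"
  unfolding is_direct_sum_def dsum_def by blast

context linear_category
begin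

lemma finsum_hom_Suc:
  assumes "X \<in> Ob C" "Y \<in> Ob C" "\<And>i. i < Suc d \<Longrightarrow> f i \<in> Hom C X Y"
  shows "(\<Oplus>\<^bsub>hom_space C X Y\<^esub>i\<in>{..<Suc d}. f i) = Plus C (f d) (\<Oplus>\<^bsub>hom_space C X Y\<^esub>i\<in>{..<d}. f i)"
proof -
  interpret H: abelian_group "hom_space C X Y" by (rule hom_abelian_group[OF assms(1,2)])
  show ?thesis using H.finsum_lessThan_Suc[of f d] assms(3) by auto
qed

lemma finsum_hom_0: "X \<in> Ob C \<Longrightarrow> Y \<in> Ob C \<Longrightarrow> (\<Oplus>\<^bsub>hom_space C X Y\<^esub>i\<in>{..<0::nat}. f i) = Zer C X Y"
proof -
  assume "X \<in> Ob C" "Y \<in> Ob C"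
  then interpret H: abelian_group "hom_space C X Y" by (rule hom_abelian_group)
  show ?thesis using H.finsum_empty[of f] by simp
qed

lemma finsum_hom_closed:
  assumes "X \<in> Ob C" "Y \<in> Ob C" "\<And>i. i < d \<Longrightarrow> f i \<in> Hom C X Y"
  shows "(\<Oplus>\<^bsub>hom_space C X Y\<^esub>i\<in>{..<d::nat}. f i) \<in> Hom C X Y"
proof -
  interpret H: abelian_group "hom_space C X Y" by (rule hom_abelian_group[OF assms(1,2)])
  show ?thesis using H.finsum_closed[of f "{..<d}"] assms(3) by auto
qed

lemma finsum_hom_cong:
  assumes "X \<in> Ob C" "Y \<in> Ob C" "\<And>i. i < d \<Longrightarrow> g i \<in> Hom C X Y" "\<And>i. i < d \<Longrightarrow> f i = g i"
  shows "(\<Oplus>\<^bsub>hom_space C X Y\<^esub>i\<in>{..<d::nat}. f i) = (\<Oplus>\<^bsub>hom_space C X Y\<^esub>i\<in>{..<d}. g i)"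
proof -
  interpret H: abelian_group "hom_space C X Y" by (rule hom_abelian_group[OF assms(1,2)])
  show ?thesis by (rule H.finsum_cong') (use assms in auto)
qed

lemma finsum_hom_delta:
  assumes "X \<in> Ob C" "Y \<in> Ob C" "l < d" "\<And>i. i < d \<Longrightarrow> f i = (if i = l then x else Zer C X Y)" "x \<in> Hom C X Y"
  shows "(\<Oplus>\<^bsub>hom_space C X Y\<^esub>i\<in>{..<d::nat}. f i) = x"
proof -
  interpret H: abelian_group "hom_space C X Y" by (rule hom_abelian_group[OF assms(1,2)])
  have "(\<Oplus>\<^bsub>hom_space C X Y\<^esub>i\<in>{..<d}. f i) = (\<Oplus>\<^bsub>hom_space C X Y\<^esub>i\<in>{..<d}. if l = i then x else \<zero>\<^bsub>hom_space C X Y\<^esub>)"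
    by (rule H.finsum_cong') (use assms H.zero_closed in auto)
  also have "\<dots> = x" using assms by (intro H.add.finprod_singleton) auto
  finally show ?thesis .
qed

lemma comp_finsum_l:
  assumes "Y \<in> Ob C" "T \<in> Ob C" "x \<in> Hom C W Y" "\<And>i. i < d \<Longrightarrow> f i \<in> Hom C Y T"
  shows "(\<Oplus>\<^bsub>hom_space C Y T\<^esub>i\<in>{..<d::nat}. f i) \<cdot> x = (\<Oplus>\<^bsub>hom_space C W T\<^esub>i\<in>{..<d}. f i \<cdot> x)"
  using assms(4)
proof (induction d)
  case 0
  then show ?case using assms(1-3) hom_ob[OF assms(3)] by (simp add: finsum_hom_0[unfolded lessThan_0] cat_simps)
next
  case (Suc d)
  have W: "W \<in> Ob C" using hom_ob[OF assms(3)] by simp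
  have c: "(\<Oplus>\<^bsub>hom_space C Y T\<^esub>i\<in>{..<d}. f i) \<in> Hom C Y T" using finsum_hom_closed[OF assms(1,2)] Suc.prems by simp
  show ?case
    using finsum_hom_Suc[OF assms(1,2) Suc.prems] finsum_hom_Suc[OF W assms(2), of d "\<lambda>i. f i \<cdot> x"]
      Suc comp_plus_left[OF assms(3) Suc.prems c] assms(3) by (simp add: comp_hom)
qed

lemma comp_finsum_r:
  assumes "Y \<in> Ob C" "W \<in> Ob C" "x \<in> Hom C Y T" "\<And>i. i < d \<Longrightarrow> f i \<in> Hom C W Y"
  shows "x \<cdot> (\<Oplus>\<^bsub>hom_space C W Y\<^esub>i\<in>{..<d::nat}. f i) = (\<Oplus>\<^bsub>hom_space C W T\<^esub>i\<in>{..<d}. x \<cdot> f i)"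
  using linear_category.comp_finsum_l[OF op_linear, of Y W x T d f] assms by simp

lemma dsumD:
  assumes "dsum C d X S \<iota> \<pi>"
  shows "S \<in> Ob C" "\<And>i. i < d \<Longrightarrow> X i \<in> Ob C" "\<And>i. i < d \<Longrightarrow> \<iota> i \<in> Hom C (X i) S" "\<And>i. i < d \<Longrightarrow> \<pi> i \<in> Hom C S (X i)"
    "\<And>i j. \<lbrakk>i < d; j < d\<rbrakk> \<Longrightarrow> \<pi> i \<cdot> \<iota> j = (if i = j then Ide C (X i) else Zer C (X j) (X i))"
    "(\<Oplus>\<^bsub>hom_space C S S\<^esub>i\<in>{..<d}. \<iota> i \<cdot> \<pi> i) = Ide C S"
  using assms unfolding dsum_def by blast+

lemma dsum_expand:
  assumes "dsum C d X S \<iota> \<pi>" "x \<in> Hom C S T"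
  shows "(\<Oplus>\<^bsub>hom_space C S T\<^esub>i\<in>{..<d}. x \<cdot> (\<iota> i \<cdot> \<pi> i)) = x"
proof -
  note D = dsumD[OF assms(1)]
  show ?thesis using comp_finsum_r[OF D(1,1) assms(2), of d "\<lambda>i. \<iota> i \<cdot> \<pi> i"] D(6) comp_hom[OF D(4,3)] comp_ide_right[OF assms(2)] by simp
qed

lemma dsum_eqI_source:
  assumes "dsum C d X S \<iota> \<pi>" "x \<in> Hom C S T" "y \<in> Hom C S T" "\<And>i. i < d \<Longrightarrow> x \<cdot> \<iota> i = y \<cdot> \<iota> i"
  shows "x = y"
proof -
  note D = dsumD[OF assms(1)]
  have T: "T \<in> Ob C" using hom_ob[OF assms(2)] by simp
  have eq: "x \<cdot> (\<iota> i \<cdot> \<pi> i) = y \<cdot> (\<iota> i \<cdot> \<pi> i)" if "i < d" for i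
    using comp_assoc[OF D(4)[OF that] D(3)[OF that] assms(2)] comp_assoc[OF D(4)[OF that] D(3)[OF that] assms(3)]
      assms(4)[OF that] by simp
  have "(\<Oplus>\<^bsub>hom_space C S T\<^esub>i\<in>{..<d}. x \<cdot> (\<iota> i \<cdot> \<pi> i)) = (\<Oplus>\<^bsub>hom_space C S T\<^esub>i\<in>{..<d}. y \<cdot> (\<iota> i \<cdot> \<pi> i))"
    by (rule finsum_hom_cong[OF D(1) T comp_hom[OF comp_hom[OF D(4,3)] assms(3)] eq])
  then show ?thesis using dsum_expand[OF assms(1,2)] dsum_expand[OF assms(1,3)] by simp
qed

lemma op_dsum: "dsum C d X S \<iota> \<pi> \<Longrightarrow> dsum (op_cat C) d X S \<pi> \<iota>"
proof -
  assume "dsum C d X S \<iota> \<pi>"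
  note D = dsumD[OF this]
  show ?thesis
    unfolding dsum_def op_cat_sel op_hom op_hom_space
  proof (intro conjI allI impI)
    show "\<pi> j \<cdot> \<iota> i = (if i = j then Ide C (X i) else Zer C (X i) (X j))" if "i < d" "j < d" for i j
      using D(5)[OF that(2,1)] by simp
  qed (use D in blast)+
qed

lemma dsum_eqI_target:
  assumes "dsum C d X S \<iota> \<pi>" "x \<in> Hom C T S" "y \<in> Hom C T S" "\<And>i. i < d \<Longrightarrow> \<pi> i \<cdot> x = \<pi> i \<cdot> y"
  shows "x = y"
  using linear_category.dsum_eqI_source[OF op_linear op_dsum[OF assms(1)], of x T y] assms by simp

lemma dsum_glue:
  assumes "dsum C d X S \<iota> \<pi>" "T \<in> Ob C" "\<And>i. i < d \<Longrightarrow> g i \<in> Hom C (X i) T"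
  shows "\<exists>h \<in> Hom C S T. \<forall>i<d. h \<cdot> \<iota> i = g i"
proof -
  note D = dsumD[OF assms(1)]
  define h where "h = (\<Oplus>\<^bsub>hom_space C S T\<^esub>i\<in>{..<d}. g i \<cdot> \<pi> i)"
  have gp: "g i \<cdot> \<pi> i \<in> Hom C S T" if "i < d" for i using comp_hom[OF D(4) assms(3)] that by blast
  have h: "h \<in> Hom C S T" unfolding h_def by (rule finsum_hom_closed[OF D(1) assms(2) gp])
  have "h \<cdot> \<iota> l = g l" if l: "l < d" for l
  proof -
    have "h \<cdot> \<iota> l = (\<Oplus>\<^bsub>hom_space C (X l) T\<^esub>i\<in>{..<d}. (g i \<cdot> \<pi> i) \<cdot> \<iota> l)"
      unfolding h_def by (rule comp_finsum_l[OF D(1) assms(2) D(3)[OF l] gp])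
    also have "\<dots> = g l"
    proof (rule finsum_hom_delta[OF D(2)[OF l] assms(2) l])
      fix i assume i: "i < d"
      have "(g i \<cdot> \<pi> i) \<cdot> \<iota> l = g i \<cdot> (\<pi> i \<cdot> \<iota> l)" using comp_assoc[OF D(3)[OF l] D(4)[OF i] assms(3)[OF i]] by simp
      then show "(g i \<cdot> \<pi> i) \<cdot> \<iota> l = (if i = l then g l else Zer C (X l) T)"
        using D(5)[OF i l] assms(3)[OF i] D(2)[OF l] by (cases "i = l") (simp_all add: cat_simps)
    qed (rule assms(3)[OF l])
    finally show ?thesis .
  qed
  then show ?thesis using h by blast
qed

lemma dsum_coglue:
  assumes "dsum C d X S \<iota> \<pi>" "T \<in> Ob C" "\<And>i. i < d \<Longrightarrow> g i \<in> Hom C T (X i)"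
  shows "\<exists>h \<in> Hom C T S. \<forall>i<d. \<pi> i \<cdot> h = g i"
  using linear_category.dsum_glue[OF op_linear op_dsum[OF assms(1)], of T g] assms by simp

text \<open>Arrows between direct sums are matrices.\<close>

lemma dsum_matrix_exists:
  assumes "dsum C d X S \<iota> \<pi>" "dsum C e Y T \<iota>' \<pi>'" "\<And>l j. \<lbrakk>l < e; j < d\<rbrakk> \<Longrightarrow> a l j \<in> Hom C (X j) (Y l)"
  shows "\<exists>h \<in> Hom C S T. \<forall>l<e. \<forall>j<d. \<pi>' l \<cdot> (h \<cdot> \<iota> j) = a l j"
proof -
  note D = dsumD[OF assms(1)] and E = dsumD[OF assms(2)]
  have "\<forall>j<d. \<exists>h \<in> Hom C (X j) T. \<forall>l<e. \<pi>' l \<cdot> h = a l j"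
  proof (intro allI impI)
    fix j assume j: "j < d"
    show "\<exists>h \<in> Hom C (X j) T. \<forall>l<e. \<pi>' l \<cdot> h = a l j" by (rule dsum_coglue[OF assms(2) D(2)[OF j] assms(3)[OF _ j]])
  qed
  then obtain h where h: "\<And>j. j < d \<Longrightarrow> h j \<in> Hom C (X j) T \<and> (\<forall>l<e. \<pi>' l \<cdot> h j = a l j)" by metis
  then obtain g where "g \<in> Hom C S T" "\<forall>j<d. g \<cdot> \<iota> j = h j" using dsum_glue[OF assms(1) E(1), of h] by blast
  then show ?thesis using h by (intro bexI[of _ g]) auto
qed

lemma dsum_matrix_unique:
  assumes "dsum C d X S \<iota> \<pi>" "dsum C e Y T \<iota>' \<pi>'" "x \<in> Hom C S T" "y \<in> Hom C S T"
    "\<And>l j. \<lbrakk>l < e; j < d\<rbrakk> \<Longrightarrow> \<pi>' l \<cdot> (x \<cdot> \<iota> j) = \<pi>' l \<cdot> (y \<cdot> \<iota> j)"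
  shows "x = y"
proof (rule dsum_eqI_source[OF assms(1,3,4)])
  fix j assume j: "j < d"
  note \<iota> = dsumD(3)[OF assms(1) j]
  show "x \<cdot> \<iota> j = y \<cdot> \<iota> j"
    by (rule dsum_eqI_target[OF assms(2) comp_hom[OF \<iota> assms(3)] comp_hom[OF \<iota> assms(4)] assms(5)[OF _ j]])
qed

lemma direct_sum_isomorphic:
  assumes "is_direct_sum C d X S" "is_direct_sum C d X' S'" "\<And>j. j < d \<Longrightarrow> isomorphic C (X j) (X' j)"
  shows "isomorphic C S S'"
proof -
  obtain \<iota> \<pi> \<iota>' \<pi>' where D: "dsum C d X S \<iota> \<pi>" "dsum C d X' S' \<iota>' \<pi>'" using assms is_direct_sum_iff by metis
  note D1 = dsumD[OF D(1)] and D2 = dsumD[OF D(2)]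
  have "\<forall>j<d. \<exists>h k. h \<in> Hom C (X j) (X' j) \<and> k \<in> Hom C (X' j) (X j) \<and> k \<cdot> h = Ide C (X j) \<and> h \<cdot> k = Ide C (X' j)"
    using assms(3) unfolding isomorphic_def by (meson is_isoE)
  then obtain h k where hk: "\<And>j. j < d \<Longrightarrow> h j \<in> Hom C (X j) (X' j)" "\<And>j. j < d \<Longrightarrow> k j \<in> Hom C (X' j) (X j)"
    "\<And>j. j < d \<Longrightarrow> k j \<cdot> h j = Ide C (X j)" "\<And>j. j < d \<Longrightarrow> h j \<cdot> k j = Ide C (X' j)" by metis
  have "\<exists>f \<in> Hom C S S'. \<forall>i<d. f \<cdot> \<iota> i = \<iota>' i \<cdot> h i" by (rule dsum_glue[OF D(1) D2(1) comp_hom[OF hk(1) D2(3)]])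
  then obtain f where f: "f \<in> Hom C S S'" "\<And>i. i < d \<Longrightarrow> f \<cdot> \<iota> i = \<iota>' i \<cdot> h i" by blast
  have "\<exists>g \<in> Hom C S' S. \<forall>i<d. g \<cdot> \<iota>' i = \<iota> i \<cdot> k i" by (rule dsum_glue[OF D(2) D1(1) comp_hom[OF hk(2) D1(3)]])
  then obtain g where g: "g \<in> Hom C S' S" "\<And>i. i < d \<Longrightarrow> g \<cdot> \<iota>' i = \<iota> i \<cdot> k i" by blast
  have "g \<cdot> f = Ide C S"
  proof (rule dsum_eqI_source[OF D(1) comp_hom[OF f(1) g(1)] ide_hom[OF D1(1)]])
    fix i assume i: "i < d"
    show "(g \<cdot> f) \<cdot> \<iota> i = Ide C S \<cdot> \<iota> i"
      using f(1) g(1) D1(3)[OF i] D2(3)[OF i] hk(1,2)[OF i]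
      by (simp add: cat_simps f(2)[OF i] reassoc[OF g(2)[OF i]] hk(3)[OF i])
  qed
  moreover have "f \<cdot> g = Ide C S'"
  proof (rule dsum_eqI_source[OF D(2) comp_hom[OF g(1) f(1)] ide_hom[OF D2(1)]])
    fix i assume i: "i < d"
    show "(f \<cdot> g) \<cdot> \<iota>' i = Ide C S' \<cdot> \<iota>' i"
      using f(1) g(1) D1(3)[OF i] D2(3)[OF i] hk(1,2)[OF i]
      by (simp add: cat_simps g(2)[OF i] reassoc[OF f(2)[OF i]] hk(4)[OF i])
  qed
  ultimately show ?thesis unfolding isomorphic_def using is_isoI[OF f(1) g(1)] f(1) by blast
qed

lemma is_direct_sum_cong: "\<lbrakk>is_direct_sum C d X S; \<And>i. i < d \<Longrightarrow> X i = Y i\<rbrakk> \<Longrightarrow> is_direct_sum C d Y S"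
proof -
  assume "is_direct_sum C d X S" and eq: "\<And>i. i < d \<Longrightarrow> X i = Y i"
  then obtain \<iota> \<pi> where "dsum C d X S \<iota> \<pi>" using is_direct_sum_iff by metis
  note D = dsumD[OF this]
  have "dsum C d Y S \<iota> \<pi>"
    unfolding dsum_def
  proof (intro conjI allI impI)
    show "\<pi> i \<cdot> \<iota> j = (if i = j then Ide C (Y i) else Zer C (Y j) (Y i))" if "i < d" "j < d" for i j
      using D(5)[OF that] eq[OF that(1)] eq[OF that(2)] by simp
    show "Y i \<in> Ob C" "\<iota> i \<in> Hom C (Y i) S" "\<pi> i \<in> Hom C S (Y i)" if "i < d" for i
      using D(2-4)[OF that] eq[OF that] by simp_all
  qed (rule D(1,6))+
  then show ?thesis using is_direct_sum_iff by metis
qed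

lemma dsum_single:
  assumes "X \<in> Ob C"
  shows "dsum C 1 (\<lambda>_. X) X (\<lambda>_. Ide C X) (\<lambda>_. Ide C X)"
proof -
  have "(\<Oplus>\<^bsub>hom_space C X X\<^esub>i\<in>{..<1::nat}. Ide C X \<cdot> Ide C X) = Ide C X"
    by (rule finsum_hom_delta[OF assms assms, of 0]) (use assms in \<open>simp_all add: cat_simps\<close>)
  then show ?thesis unfolding dsum_def using assms by (simp add: cat_simps)
qed

lemma is_direct_sum_single: "X \<in> Ob C \<Longrightarrow> is_direct_sum C 1 (\<lambda>_. X) X"
  using dsum_single is_direct_sum_iff by metis

end

context linear_functor
begin

lemma on_zer: "X \<in> Ob A \<Longrightarrow> Y \<in> Ob A \<Longrightarrow> on_arr F (Zer A X Y) = Zer B (on_ob F X) (on_ob F Y)"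
proof -
  assume XY: "X \<in> Ob A" "Y \<in> Ob A"
  have "Zer A X Y = Scal A 0 (Zer A X Y)" using XY by (simp add: A.cat_simps)
  then have "on_arr F (Zer A X Y) = Scal B 0 (on_arr F (Zer A X Y))" using on_scal[OF A.zer_hom[OF XY], of 0] by simp
  also have "\<dots> = Zer B (on_ob F X) (on_ob F Y)"
    using on_arr[OF A.zer_hom[OF XY]] by (intro B.scal_zero) (simp_all add: Hom_iff)
  finally show ?thesis .
qed

lemma on_finsum:
  assumes "X \<in> Ob A" "Y \<in> Ob A" "\<And>i. i < d \<Longrightarrow> f i \<in> Hom A X Y"
  shows "on_arr F (\<Oplus>\<^bsub>hom_space A X Y\<^esub>i\<in>{..<d::nat}. f i) = (\<Oplus>\<^bsub>hom_space B (on_ob F X) (on_ob F Y)\<^esub>i\<in>{..<d}. on_arr F (f i))"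
  using assms(3)
proof (induction d)
  case 0
  show ?case using A.finsum_hom_0[OF assms(1,2)] B.finsum_hom_0[OF on_ob[OF assms(1)] on_ob[OF assms(2)]] on_zer[OF assms(1,2)]
    by metis
next
  case (Suc d)
  have c: "(\<Oplus>\<^bsub>hom_space A X Y\<^esub>i\<in>{..<d}. f i) \<in> Hom A X Y" using A.finsum_hom_closed[OF assms(1,2)] Suc.prems by simp
  have "on_arr F (\<Oplus>\<^bsub>hom_space A X Y\<^esub>i\<in>{..<Suc d}. f i) = Plus B (on_arr F (f d)) (on_arr F (\<Oplus>\<^bsub>hom_space A X Y\<^esub>i\<in>{..<d}. f i))"
    using A.finsum_hom_Suc[OF assms(1,2) Suc.prems] on_plus[OF Suc.prems c] by simp
  also have "\<dots> = Plus B (on_arr F (f d)) (\<Oplus>\<^bsub>hom_space B (on_ob F X) (on_ob F Y)\<^esub>i\<in>{..<d}. on_arr F (f i))"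
    using Suc by simp
  also have "\<dots> = (\<Oplus>\<^bsub>hom_space B (on_ob F X) (on_ob F Y)\<^esub>i\<in>{..<Suc d}. on_arr F (f i))"
    using B.finsum_hom_Suc[OF on_ob[OF assms(1)] on_ob[OF assms(2)], of d "\<lambda>i. on_arr F (f i)"] on_arr[OF Suc.prems] by simp
  finally show ?case .
qed

lemma on_dsum:
  assumes "dsum A d X S \<iota> \<pi>"
  shows "dsum B d (\<lambda>i. on_ob F (X i)) (on_ob F S) (\<lambda>i. on_arr F (\<iota> i)) (\<lambda>i. on_arr F (\<pi> i))"
proof -
  note D = A.dsumD[OF assms]
  have orth: "on_arr F (\<pi> i) \<cdot>\<^bsub>B\<^esub> on_arr F (\<iota> j) = (if i = j then Ide B (on_ob F (X i)) else Zer B (on_ob F (X j)) (on_ob F (X i)))"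
    if "i < d" "j < d" for i j
    using on_comp[OF D(3)[OF that(2)] D(4)[OF that(1)]] D(5)[OF that] on_ide[OF D(2)[OF that(1)]] on_zer[OF D(2)[OF that(2)] D(2)[OF that(1)]]
    by (simp split: if_splits)
  have "(\<Oplus>\<^bsub>hom_space B (on_ob F S) (on_ob F S)\<^esub>i\<in>{..<d}. on_arr F (\<iota> i) \<cdot>\<^bsub>B\<^esub> on_arr F (\<pi> i)) =
      (\<Oplus>\<^bsub>hom_space B (on_ob F S) (on_ob F S)\<^esub>i\<in>{..<d}. on_arr F (\<iota> i \<cdot>\<^bsub>A\<^esub> \<pi> i))"
    by (rule B.finsum_hom_cong[OF on_ob[OF D(1)] on_ob[OF D(1)]])
      (use on_arr[OF A.comp_hom[OF D(4,3)]] on_comp[OF D(4,3)] in simp_all)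
  also have "\<dots> = Ide B (on_ob F S)"
    using on_finsum[OF D(1,1), of d "\<lambda>i. \<iota> i \<cdot>\<^bsub>A\<^esub> \<pi> i"] A.comp_hom[OF D(4,3)] D(6) on_ide[OF D(1)] by simp
  finally show ?thesis unfolding dsum_def using orth D on_ob on_arr by simp
qed

lemma on_direct_sum: "is_direct_sum A d X S \<Longrightarrow> is_direct_sum B d (\<lambda>i. on_ob F (X i)) (on_ob F S)"
  using on_dsum is_direct_sum_iff by metis

end

section \<open>Orthogonal families with scalar endomorphisms\<close>

locale scalar_family = linear_category C for C :: "('k::field, 'o, 'm) lin_cat" (structure) +
  fixes n :: nat and L :: "nat \<Rightarrow> 'o"
  assumes family_ob: "i < n \<Longrightarrow> L i \<in> Ob C"
    and family_end: "\<lbrakk>i < n; f \<in> Hom C (L i) (L i)\<rbrakk> \<Longrightarrow> \<exists>c. f = Scal C c (Ide C (L i))"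
    and family_nonzero: "i < n \<Longrightarrow> Ide C (L i) \<noteq> Zer C (L i) (L i)"
    and family_orth: "\<lbrakk>i < n; j < n; i \<noteq> j; f \<in> Hom C (L i) (L j)\<rbrakk> \<Longrightarrow> f = Zer C (L i) (L j)"
begin

lemma family_inj: "\<lbrakk>i < n; j < n; L i = L j\<rbrakk> \<Longrightarrow> i = j"
  using family_orth[of i j "Ide C (L i)"] family_nonzero[of i] ide_hom[OF family_ob[of i]] by auto

end

text \<open>
  When two such families have the same length and every object of the first category is a direct
  sum of members of its family, arrows of the first category are block matrices of scalars. The
  same matrices define arrows between direct sums of the second family. This gives existence of a
  linear functor that matches the families, and full faithfulness of every such functor.
\<close>

locale scalar_family_pair = A: scalar_family A n L + B: scalar_family B n Zs
  for A :: "('k::field, 'o, 'm) lin_cat" and B :: "('k, 'p, 'q) lin_cat" and n L Zs +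
  assumes generate: "M \<in> Ob A \<Longrightarrow> \<exists>d t. (\<forall>j<d. t j < n) \<and> is_direct_sum A d (\<lambda>j. L (t j)) M"
begin

definition scalar_of :: "nat \<Rightarrow> 'm \<Rightarrow> 'k" where
  "scalar_of i f = (SOME c. f = Scal A c (Ide A (L i)))"

definition transport :: "nat \<Rightarrow> nat \<Rightarrow> 'm \<Rightarrow> 'q" where
  "transport i j f = (if i = j then Scal B (scalar_of i f) (Ide B (Zs i)) else Zer B (Zs i) (Zs j))"

lemma scalar_of:
  assumes "i < n" "f \<in> Hom A (L i) (L i)"
  shows "Scal A (scalar_of i f) (Ide A (L i)) = f"
  using someI_ex[OF A.family_end[OF assms]] unfolding scalar_of_def by simp

lemma scalar_of_Scal:
  assumes i: "i < n"
  shows "scalar_of i (Scal A c (Ide A (L i))) = c"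
proof -
  have I: "Ide A (L i) \<in> Hom A (L i) (L i)" by (rule A.ide_hom[OF A.family_ob[OF i]])
  show ?thesis by (rule A.scal_cancel[OF I A.family_nonzero[OF i] scalar_of[OF i A.scal_hom[OF I]]])
qed

lemma transport_hom: "\<lbrakk>i < n; j < n\<rbrakk> \<Longrightarrow> transport i j f \<in> Hom B (Zs i) (Zs j)"
  using B.family_ob B.scal_hom B.ide_hom B.zer_hom by (auto simp: transport_def)

lemma transport_ide: "i < n \<Longrightarrow> transport i i (Ide A (L i)) = Ide B (Zs i)"
proof -
  assume i: "i < n"
  have I: "Ide A (L i) \<in> Arr A" using A.ide_hom[OF A.family_ob[OF i]] unfolding Hom_iff by blast
  have "scalar_of i (Ide A (L i)) = 1"
    using scalar_of_Scal[OF i, of 1] unfolding A.scal_one[OF I] .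
  then show ?thesis using B.family_ob[OF i] by (simp add: transport_def B.cat_simps)
qed

lemma scalar_of_zero: "i < n \<Longrightarrow> scalar_of i (Zer A (L i) (L i)) = 0"
proof -
  assume i: "i < n"
  have I: "Ide A (L i) \<in> Hom A (L i) (L i)" using A.ide_hom[OF A.family_ob[OF i]] .
  then have "Scal A 0 (Ide A (L i)) = Zer A (L i) (L i)"
    unfolding Hom_iff by (intro A.scal_zero) blast+
  then show ?thesis using scalar_of_Scal[OF i, of 0] by metis
qed

lemma transport_zero: "\<lbrakk>i < n; j < n\<rbrakk> \<Longrightarrow> transport i j (Zer A (L i) (L j)) = Zer B (Zs i) (Zs j)"
  using scalar_of_zero[of i] B.family_ob[of i] by (auto simp: transport_def B.cat_simps)

lemma transport_plus:
  assumes "i < n" "j < n" "f \<in> Hom A (L i) (L j)" "g \<in> Hom A (L i) (L j)"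
  shows "transport i j (Plus A f g) = Plus B (transport i j f) (transport i j g)"
proof (cases "i = j")
  case True
  have I: "Ide A (L i) \<in> Arr A" using A.ide_hom[OF A.family_ob[OF assms(1)]] unfolding Hom_iff by blast
  have fg: "f \<in> Hom A (L i) (L i)" "g \<in> Hom A (L i) (L i)" using assms True by simp_all
  have "Plus A f g = Scal A (scalar_of i f + scalar_of i g) (Ide A (L i))"
    using A.scal_plus_left[OF I, of "scalar_of i f" "scalar_of i g"] unfolding scalar_of[OF assms(1) fg(1)] scalar_of[OF assms(1) fg(2)] by simp
  then have "scalar_of i (Plus A f g) = scalar_of i f + scalar_of i g" using scalar_of_Scal[OF assms(1)] by metis
  then show ?thesis using True B.family_ob[OF assms(1)] B.scal_plus_left[of "Ide B (Zs i)"] by (simp add: transport_def B.cat_simps)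
next
  case False
  then show ?thesis using B.family_ob assms(1,2) by (simp add: transport_def B.cat_simps)
qed

lemma transport_scal:
  assumes "i < n" "j < n" "f \<in> Hom A (L i) (L j)"
  shows "transport i j (Scal A c f) = Scal B c (transport i j f)"
proof (cases "i = j")
  case True
  have I: "Ide A (L i) \<in> Arr A" using A.ide_hom[OF A.family_ob[OF assms(1)]] unfolding Hom_iff by blast
  have f: "f \<in> Hom A (L i) (L i)" using assms True by simp
  have "Scal A c f = Scal A (c * scalar_of i f) (Ide A (L i))"
    using A.scal_scal[OF I, of c "scalar_of i f"] unfolding scalar_of[OF assms(1) f] by simp
  then have "scalar_of i (Scal A c f) = c * scalar_of i f" using scalar_of_Scal[OF assms(1)] by metis
  then show ?thesis using True B.family_ob[OF assms(1)] by (simp add: transport_def B.cat_simps)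
next
  case False
  then show ?thesis using B.family_ob assms(1,2) by (simp add: transport_def B.cat_simps)
qed

lemma transport_comp:
  assumes "i < n" "j < n" "k < n" "f \<in> Hom A (L i) (L j)" "g \<in> Hom A (L j) (L k)"
  shows "transport i k (g \<cdot>\<^bsub>A\<^esub> f) = transport j k g \<cdot>\<^bsub>B\<^esub> transport i j f"
proof -
  have fA: "f \<in> Arr A" "Dom A f = L i" "Cod A f = L j"
    and gA: "g \<in> Arr A" "Dom A g = L j" "Cod A g = L k"
    using assms unfolding Hom_iff by blast+
  note ob = A.family_ob[OF assms(1)] A.family_ob[OF assms(2)] A.family_ob[OF assms(3)]
  show ?thesis
  proof (cases "i = j \<and> j = k")
    case True
    let ?I = "Ide A (L i)"
    have I: "?I \<in> Hom A (L i) (L i)" using A.ide_hom[OF ob(1)] .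
    then have IA: "?I \<in> Arr A" unfolding Hom_iff by blast
    have fg: "f \<in> Hom A (L i) (L i)" "g \<in> Hom A (L i) (L i)" using assms True by simp_all
    have "g \<cdot>\<^bsub>A\<^esub> f = g \<cdot>\<^bsub>A\<^esub> Scal A (scalar_of i f) ?I"
      using scalar_of[OF assms(1) fg(1)] by simp
    also have "\<dots> = Scal A (scalar_of i f) g"
      unfolding A.comp_scal_right[OF I fg(2)] A.comp_ide_right[OF fg(2)] ..
    also have "\<dots> = Scal A (scalar_of i f) (Scal A (scalar_of i g) ?I)"
      using scalar_of[OF assms(1) fg(2)] by simp
    also have "\<dots> = Scal A (scalar_of i f * scalar_of i g) ?I" by (rule A.scal_scal[OF IA])
    finally have "scalar_of i (g \<cdot>\<^bsub>A\<^esub> f) = scalar_of i f * scalar_of i g"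
      using scalar_of_Scal[OF assms(1)] by metis
    then show ?thesis using True B.family_ob[OF assms(1)] by (auto simp: transport_def B.cat_simps mult.commute)
  next
    case False
    then have "f = Zer A (L i) (L j) \<or> g = Zer A (L j) (L k)"
      using A.family_orth assms by blast
    then have "g \<cdot>\<^bsub>A\<^esub> f = Zer A (L i) (L k)"
      using A.comp_zer_r[OF gA(1,2) ob(1)] A.comp_zer_l[OF fA(1,3) ob(3)] fA gA by auto
    then have "transport i k (g \<cdot>\<^bsub>A\<^esub> f) = Zer B (Zs i) (Zs k)" using transport_zero[OF assms(1,3)] by metis
    moreover have "transport j k g \<cdot>\<^bsub>B\<^esub> transport i j f = Zer B (Zs i) (Zs k)"
      using False B.family_ob[OF assms(1)] B.family_ob[OF assms(2)] B.family_ob[OF assms(3)] by (auto simp: transport_def B.cat_simps)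
    ultimately show ?thesis by simp
  qed
qed

lemma transport_finsum:
  assumes "i < n" "j < n" "\<And>l. l < d \<Longrightarrow> f l \<in> Hom A (L i) (L j)"
  shows "transport i j (\<Oplus>\<^bsub>hom_space A (L i) (L j)\<^esub>l\<in>{..<d::nat}. f l) =
    (\<Oplus>\<^bsub>hom_space B (Zs i) (Zs j)\<^esub>l\<in>{..<d}. transport i j (f l))"
  using assms(3)
proof (induction d)
  case 0
  show ?case
    using A.finsum_hom_0[OF A.family_ob[OF assms(1)] A.family_ob[OF assms(2)], of f] B.finsum_hom_0[OF B.family_ob[OF assms(1)] B.family_ob[OF assms(2)]]
      transport_zero[OF assms(1,2)] by metis
next
  case (Suc d)
  note ob = A.family_ob[OF assms(1)] A.family_ob[OF assms(2)]
  have c: "(\<Oplus>\<^bsub>hom_space A (L i) (L j)\<^esub>l\<in>{..<d}. f l) \<in> Hom A (L i) (L j)"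
    by (rule A.finsum_hom_closed[OF ob]) (use Suc.prems in simp)
  have IH: "transport i j (\<Oplus>\<^bsub>hom_space A (L i) (L j)\<^esub>l\<in>{..<d}. f l) =
    (\<Oplus>\<^bsub>hom_space B (Zs i) (Zs j)\<^esub>l\<in>{..<d}. transport i j (f l))" by (rule Suc.IH) (use Suc.prems in simp)
  have sB: "(\<Oplus>\<^bsub>hom_space B (Zs i) (Zs j)\<^esub>l\<in>{..<Suc d}. transport i j (f l)) =
      Plus B (transport i j (f d)) (\<Oplus>\<^bsub>hom_space B (Zs i) (Zs j)\<^esub>l\<in>{..<d}. transport i j (f l))"
    by (rule B.finsum_hom_Suc[OF B.family_ob[OF assms(1)] B.family_ob[OF assms(2)] transport_hom[OF assms(1,2)]])
  have sA: "(\<Oplus>\<^bsub>hom_space A (L i) (L j)\<^esub>l\<in>{..<Suc d}. f l) =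
      Plus A (f d) (\<Oplus>\<^bsub>hom_space A (L i) (L j)\<^esub>l\<in>{..<d}. f l)"
    by (rule A.finsum_hom_Suc[OF ob Suc.prems])
  have "transport i j (Plus A (f d) (\<Oplus>\<^bsub>hom_space A (L i) (L j)\<^esub>l\<in>{..<d}. f l)) =
      Plus B (transport i j (f d)) (transport i j (\<Oplus>\<^bsub>hom_space A (L i) (L j)\<^esub>l\<in>{..<d}. f l))"
    by (rule transport_plus[OF assms(1,2) Suc.prems[OF lessI] c])
  then show ?case using sA sB IH by metis
qed

text \<open>Every object of the first category receives a decomposition and a direct sum of the second family
  of the same shape; members of the family keep the trivial decomposition, so that they are sent
  exactly to their partners. Arrows between direct sums are determined by their matrices, hence the
  functor laws are identities between matrices of scalars.\<close>

lemma functor_extending_family: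
  assumes sums: "\<And>d t. (\<forall>j<d. t j < n) \<Longrightarrow> \<exists>S. is_direct_sum B d (\<lambda>j. Zs (t j)) S"
  shows "\<exists>\<zeta>. linear_functor A B \<zeta> \<and> (\<forall>i<n. on_ob \<zeta> (L i) = Zs i)"
proof -
  have data: "\<exists>d t \<iota> \<pi> S \<iota>' \<pi>'. (\<forall>j<d. t j < n) \<and> dsum A d (\<lambda>j. L (t j)) M \<iota> \<pi> \<and>
      dsum B d (\<lambda>j. Zs (t j)) S \<iota>' \<pi>' \<and> (\<forall>i<n. M = L i \<longrightarrow> S = Zs i)" if M: "M \<in> Ob A" for M :: "'o"
  proof (cases "\<exists>i<n. M = L i")
    case True
    then obtain i where i: "i < n" "M = L i" by blast
    have "\<forall>i'<n. M = L i' \<longrightarrow> Zs i = Zs i'" using i A.family_inj by metis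
    moreover have "\<forall>j<1::nat. i < n" using i by simp
    moreover have "dsum A 1 (\<lambda>j. L i) M (\<lambda>_. Ide A M) (\<lambda>_. Ide A M)"
      unfolding i(2) by (rule A.dsum_single[OF A.family_ob[OF i(1)]])
    ultimately show ?thesis using B.dsum_single[OF B.family_ob[OF i(1)]]
      by (intro exI[of _ 1] exI[of _ "\<lambda>_. i"] exI[of _ "\<lambda>_. Ide A M"] exI[of _ "Zs i"]
        exI[of _ "\<lambda>_. Ide B (Zs i)"] conjI)
  next
    case False
    obtain d t where dt: "\<forall>j<d. t j < n" "is_direct_sum A d (\<lambda>j. L (t j)) M" using generate[OF M] by blast
    obtain S where "is_direct_sum B d (\<lambda>j. Zs (t j)) S" using sums[OF dt(1)] by blast
    then show ?thesis using dt False is_direct_sum_iff by metis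
  qed
  obtain d t \<iota> \<pi> S \<iota>' \<pi>' where D:
    "\<And>M :: 'o. M \<in> Ob A \<Longrightarrow> (\<forall>j<d M. t M j < n) \<and> dsum A (d M) (\<lambda>j. L (t M j)) M (\<iota> M) (\<pi> M) \<and>
      dsum B (d M) (\<lambda>j. Zs (t M j)) (S M) (\<iota>' M) (\<pi>' M) \<and> (\<forall>i<n. M = L i \<longrightarrow> S M = Zs i)"
    using data by metis
  have t: "j < d M \<Longrightarrow> t M j < n" and DA: "dsum A (d M) (\<lambda>j. L (t M j)) M (\<iota> M) (\<pi> M)"
    and DB: "dsum B (d M) (\<lambda>j. Zs (t M j)) (S M) (\<iota>' M) (\<pi>' M)" and SS: "i < n \<Longrightarrow> M = L i \<Longrightarrow> S M = Zs i"
    if "M \<in> Ob A" for M :: "'o" and i j using D[OF that] by blast+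
  define matrix_of where "matrix_of f h \<longleftrightarrow> h \<in> Hom B (S (Dom A f)) (S (Cod A f)) \<and>
      (\<forall>l<d (Cod A f). \<forall>j<d (Dom A f). \<pi>' (Cod A f) l \<cdot>\<^bsub>B\<^esub> (h \<cdot>\<^bsub>B\<^esub> \<iota>' (Dom A f) j) =
        transport (t (Dom A f) j) (t (Cod A f) l)
          (\<pi> (Cod A f) l \<cdot>\<^bsub>A\<^esub> (f \<cdot>\<^bsub>A\<^esub> \<iota> (Dom A f) j)))" for f :: "'m" and h
  have matrix_of: "matrix_of f h \<longleftrightarrow> h \<in> Hom B (S M) (S N) \<and>
      (\<forall>l<d N. \<forall>j<d M. \<pi>' N l \<cdot>\<^bsub>B\<^esub> (h \<cdot>\<^bsub>B\<^esub> \<iota>' M j) = transport (t M j) (t N l) (\<pi> N l \<cdot>\<^bsub>A\<^esub> (f \<cdot>\<^bsub>A\<^esub> \<iota> M j)))"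
    if "f \<in> Hom A M N" for f h M N
    using that unfolding matrix_of_def Hom_iff by (simp only: )
  have fp: "M \<in> Ob A \<and> N \<in> Ob A" if "f \<in> Hom A M N" for f :: "'m" and M N
    using A.hom_ob[OF that] .
  have ex: "\<exists>h. matrix_of f h" if f: "f \<in> Hom A M N" for f M N
    unfolding matrix_of[OF f]
  proof -
    have F: "M \<in> Ob A" "N \<in> Ob A" using fp[OF f] by blast+
    show "\<exists>h. h \<in> Hom B (S M) (S N) \<and> (\<forall>l<d N. \<forall>j<d M. \<pi>' N l \<cdot>\<^bsub>B\<^esub> (h \<cdot>\<^bsub>B\<^esub> \<iota>' M j) =
        transport (t M j) (t N l) (\<pi> N l \<cdot>\<^bsub>A\<^esub> (f \<cdot>\<^bsub>A\<^esub> \<iota> M j)))"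
      using B.dsum_matrix_exists[OF DB[OF F(1)] DB[OF F(2)], of "\<lambda>l j. transport (t M j) (t N l) (\<pi> N l \<cdot>\<^bsub>A\<^esub> (f \<cdot>\<^bsub>A\<^esub> \<iota> M j))",
        OF transport_hom[OF t[OF F(1)] t[OF F(2)]]] unfolding Bex_def by simp
  qed
  have uniq: "h = h'" if f: "f \<in> Hom A M N" and "matrix_of f h" "matrix_of f h'" for f h h' M N
    using B.dsum_matrix_unique[OF DB DB, of M N h h'] fp[OF f] that(2,3) unfolding matrix_of[OF f] by simp
  define \<zeta> where "\<zeta> = \<lparr>on_ob = S, on_arr = (\<lambda>f. SOME h. matrix_of f h)\<rparr>"
  have on: "matrix_of f (on_arr \<zeta> f)" if "f \<in> Hom A M N" for f M N
    using someI_ex[OF ex[OF that]] by (simp add: \<zeta>_def)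
  have onI: "on_arr \<zeta> f = h" if "f \<in> Hom A M N" "matrix_of f h" for f M N h
    using uniq[OF that(1) on[OF that(1)] that(2)] .
  have ob: "on_ob \<zeta> = S" by (simp add: \<zeta>_def)
  have hom: "on_arr \<zeta> f \<in> Hom B (S M) (S N)" and entry: "\<lbrakk>l < d N; j < d M\<rbrakk> \<Longrightarrow>
      \<pi>' N l \<cdot>\<^bsub>B\<^esub> (on_arr \<zeta> f \<cdot>\<^bsub>B\<^esub> \<iota>' M j) = transport (t M j) (t N l) (\<pi> N l \<cdot>\<^bsub>A\<^esub> (f \<cdot>\<^bsub>A\<^esub> \<iota> M j))"
    if "f \<in> Hom A M N" for f M N l j
    using on[OF that] unfolding matrix_of[OF that] by blast+
  have "linear_functor A B \<zeta>"
  proof (rule linear_functor.intro[OF A.linear_category_axioms B.linear_category_axioms], rule linear_functor_axioms.intro)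
    show "on_ob \<zeta> X \<in> Ob B" if "X \<in> Ob A" for X
      using that B.dsumD(1)[OF DB] unfolding ob by blast
    show "on_arr \<zeta> f \<in> Hom B (on_ob \<zeta> X) (on_ob \<zeta> Y)" if "f \<in> Hom A X Y" for f X Y
      using hom[OF that] unfolding ob .
  next
    fix M :: "'o" assume M: "M \<in> Ob A"
    then have Mfp: "M \<in> Ob A" .
    note a = A.dsumD[OF DA[OF Mfp]] and b = B.dsumD[OF DB[OF Mfp]]
    have "matrix_of (Ide A M) (Ide B (S M))"
      unfolding matrix_of[OF A.ide_hom[OF M]]
    proof (intro conjI allI impI)
      show "Ide B (S M) \<in> Hom B (S M) (S M)" by (rule B.ide_hom[OF b(1)])
      fix l j assume l: "l < d M" and j: "j < d M"
      show "\<pi>' M l \<cdot>\<^bsub>B\<^esub> (Ide B (S M) \<cdot>\<^bsub>B\<^esub> \<iota>' M j) =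
          transport (t M j) (t M l) (\<pi> M l \<cdot>\<^bsub>A\<^esub> (Ide A M \<cdot>\<^bsub>A\<^esub> \<iota> M j))"
        unfolding B.comp_ide_left[OF b(3)[OF j]] A.comp_ide_left[OF a(3)[OF j]] b(5)[OF l j] a(5)[OF l j]
        using transport_ide[OF t[OF Mfp l]] transport_zero[OF t[OF Mfp j] t[OF Mfp l]] by (cases "l = j") (simp_all only: if_True if_False refl)
    qed
    then show "on_arr \<zeta> (Ide A M) = Ide B (on_ob \<zeta> M)"
      unfolding ob using onI[OF A.ide_hom[OF M]] by blast
  next
    fix f g :: "'m" and M N P
    assume f: "f \<in> Hom A M N" and g: "g \<in> Hom A N P"
    have gf: "g \<cdot>\<^bsub>A\<^esub> f \<in> Hom A M P" by (rule A.comp_hom[OF f g])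
    have F: "M \<in> Ob A" "N \<in> Ob A" "P \<in> Ob A" using fp[OF f] fp[OF g] by blast+
    note aM = A.dsumD[OF DA[OF F(1)]] and aN = A.dsumD[OF DA[OF F(2)]] and aP = A.dsumD[OF DA[OF F(3)]]
    note bM = B.dsumD[OF DB[OF F(1)]] and bN = B.dsumD[OF DB[OF F(2)]] and bP = B.dsumD[OF DB[OF F(3)]]
    have "matrix_of (g \<cdot>\<^bsub>A\<^esub> f) (on_arr \<zeta> g \<cdot>\<^bsub>B\<^esub> on_arr \<zeta> f)"
      unfolding matrix_of[OF gf]
    proof (intro conjI allI impI)
      show "on_arr \<zeta> g \<cdot>\<^bsub>B\<^esub> on_arr \<zeta> f \<in> Hom B (S M) (S P)" by (rule B.comp_hom[OF hom[OF f] hom[OF g]])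
      fix l j assume l: "l < d P" and j: "j < d M"
      define x where "x = \<pi>' P l \<cdot>\<^bsub>B\<^esub> on_arr \<zeta> g"
      define y where "y = on_arr \<zeta> f \<cdot>\<^bsub>B\<^esub> \<iota>' M j"
      define u where "u = \<pi> P l \<cdot>\<^bsub>A\<^esub> g"
      define v where "v = f \<cdot>\<^bsub>A\<^esub> \<iota> M j"
      have x: "x \<in> Hom B (S N) (Zs (t P l))" unfolding x_def by (rule B.comp_hom[OF hom[OF g] bP(4)[OF l]])
      have y: "y \<in> Hom B (Zs (t M j)) (S N)" unfolding y_def by (rule B.comp_hom[OF bM(3)[OF j] hom[OF f]])
      have u: "u \<in> Hom A N (L (t P l))" unfolding u_def by (rule A.comp_hom[OF g aP(4)[OF l]])
      have v: "v \<in> Hom A (L (t M j)) N" unfolding v_def by (rule A.comp_hom[OF aM(3)[OF j] f])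
      have e1: "x \<cdot>\<^bsub>B\<^esub> \<iota>' N k = transport (t N k) (t P l) (u \<cdot>\<^bsub>A\<^esub> \<iota> N k)" if k: "k < d N" for k
        using entry[OF g l k] B.comp_assoc[OF bN(3)[OF k] hom[OF g] bP(4)[OF l]] A.comp_assoc[OF aN(3)[OF k] g aP(4)[OF l]]
        unfolding x_def u_def by metis
      have e2: "\<pi>' N k \<cdot>\<^bsub>B\<^esub> y = transport (t M j) (t N k) (\<pi> N k \<cdot>\<^bsub>A\<^esub> v)" if k: "k < d N" for k
        using entry[OF f k j] unfolding y_def v_def .
      have yk: "\<pi>' N k \<cdot>\<^bsub>B\<^esub> y \<in> Hom B (Zs (t M j)) (Zs (t N k))" if k: "k < d N" for k by (rule B.comp_hom[OF y bN(4)[OF k]])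
      have vk: "\<pi> N k \<cdot>\<^bsub>A\<^esub> v \<in> Hom A (L (t M j)) (L (t N k))" if k: "k < d N" for k by (rule A.comp_hom[OF v aN(4)[OF k]])
      have uk: "u \<cdot>\<^bsub>A\<^esub> \<iota> N k \<in> Hom A (L (t N k)) (L (t P l))" if k: "k < d N" for k by (rule A.comp_hom[OF aN(3)[OF k] u])
      have tm: "t M j < n" "t P l < n" "\<And>k. k < d N \<Longrightarrow> t N k < n" using t F l j by blast+
      have xe: "x \<cdot>\<^bsub>B\<^esub> (\<iota>' N k \<cdot>\<^bsub>B\<^esub> \<pi>' N k) \<in> Hom B (S N) (Zs (t P l))" if k: "k < d N" for k
        by (rule B.comp_hom[OF B.comp_hom[OF bN(4)[OF k] bN(3)[OF k]] x])
      have ue: "u \<cdot>\<^bsub>A\<^esub> (\<iota> N k \<cdot>\<^bsub>A\<^esub> \<pi> N k) \<in> Hom A N (L (t P l))" if k: "k < d N" for k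
        by (rule A.comp_hom[OF A.comp_hom[OF aN(4)[OF k] aN(3)[OF k]] u])
      have "x \<cdot>\<^bsub>B\<^esub> y = (\<Oplus>\<^bsub>hom_space B (S N) (Zs (t P l))\<^esub>k\<in>{..<d N}. x \<cdot>\<^bsub>B\<^esub> (\<iota>' N k \<cdot>\<^bsub>B\<^esub> \<pi>' N k)) \<cdot>\<^bsub>B\<^esub> y"
        unfolding B.dsum_expand[OF DB[OF F(2)] x] ..
      also have "\<dots> = (\<Oplus>\<^bsub>hom_space B (Zs (t M j)) (Zs (t P l))\<^esub>k\<in>{..<d N}. (x \<cdot>\<^bsub>B\<^esub> (\<iota>' N k \<cdot>\<^bsub>B\<^esub> \<pi>' N k)) \<cdot>\<^bsub>B\<^esub> y)"
        by (rule B.comp_finsum_l[OF bN(1) B.family_ob[OF tm(2)] y xe])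
      also have "\<dots> = (\<Oplus>\<^bsub>hom_space B (Zs (t M j)) (Zs (t P l))\<^esub>k\<in>{..<d N}.
          transport (t M j) (t P l) ((u \<cdot>\<^bsub>A\<^esub> (\<iota> N k \<cdot>\<^bsub>A\<^esub> \<pi> N k)) \<cdot>\<^bsub>A\<^esub> v))"
      proof (rule B.finsum_hom_cong[OF B.family_ob[OF tm(1)] B.family_ob[OF tm(2)] transport_hom[OF tm(1,2)]])
        fix k assume k: "k < d N"
        have "(x \<cdot>\<^bsub>B\<^esub> (\<iota>' N k \<cdot>\<^bsub>B\<^esub> \<pi>' N k)) \<cdot>\<^bsub>B\<^esub> y = (x \<cdot>\<^bsub>B\<^esub> \<iota>' N k) \<cdot>\<^bsub>B\<^esub> (\<pi>' N k \<cdot>\<^bsub>B\<^esub> y)"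
          using x y bN(3)[OF k] bN(4)[OF k] by (simp add: B.cat_simps)
        also have "\<dots> = transport (t M j) (t P l) ((u \<cdot>\<^bsub>A\<^esub> \<iota> N k) \<cdot>\<^bsub>A\<^esub> (\<pi> N k \<cdot>\<^bsub>A\<^esub> v))"
          unfolding e1[OF k] e2[OF k] by (rule transport_comp[OF tm(1) tm(3)[OF k] tm(2) vk[OF k] uk[OF k], symmetric])
        also have "(u \<cdot>\<^bsub>A\<^esub> \<iota> N k) \<cdot>\<^bsub>A\<^esub> (\<pi> N k \<cdot>\<^bsub>A\<^esub> v) = (u \<cdot>\<^bsub>A\<^esub> (\<iota> N k \<cdot>\<^bsub>A\<^esub> \<pi> N k)) \<cdot>\<^bsub>A\<^esub> v"
          using u v aN(3)[OF k] aN(4)[OF k] by (simp add: A.cat_simps)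
        finally show "(x \<cdot>\<^bsub>B\<^esub> (\<iota>' N k \<cdot>\<^bsub>B\<^esub> \<pi>' N k)) \<cdot>\<^bsub>B\<^esub> y =
          transport (t M j) (t P l) ((u \<cdot>\<^bsub>A\<^esub> (\<iota> N k \<cdot>\<^bsub>A\<^esub> \<pi> N k)) \<cdot>\<^bsub>A\<^esub> v)" .
      qed
      also have "\<dots> = transport (t M j) (t P l) (\<Oplus>\<^bsub>hom_space A (L (t M j)) (L (t P l))\<^esub>k\<in>{..<d N}.
          (u \<cdot>\<^bsub>A\<^esub> (\<iota> N k \<cdot>\<^bsub>A\<^esub> \<pi> N k)) \<cdot>\<^bsub>A\<^esub> v)"
        by (rule transport_finsum[OF tm(1,2) A.comp_hom[OF v ue], symmetric])
      also have "(\<Oplus>\<^bsub>hom_space A (L (t M j)) (L (t P l))\<^esub>k\<in>{..<d N}.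
          (u \<cdot>\<^bsub>A\<^esub> (\<iota> N k \<cdot>\<^bsub>A\<^esub> \<pi> N k)) \<cdot>\<^bsub>A\<^esub> v) = u \<cdot>\<^bsub>A\<^esub> v"
      proof -
        have "(\<Oplus>\<^bsub>hom_space A N (L (t P l))\<^esub>k\<in>{..<d N}. u \<cdot>\<^bsub>A\<^esub> (\<iota> N k \<cdot>\<^bsub>A\<^esub> \<pi> N k)) \<cdot>\<^bsub>A\<^esub> v =
          (\<Oplus>\<^bsub>hom_space A (L (t M j)) (L (t P l))\<^esub>k\<in>{..<d N}.
            (u \<cdot>\<^bsub>A\<^esub> (\<iota> N k \<cdot>\<^bsub>A\<^esub> \<pi> N k)) \<cdot>\<^bsub>A\<^esub> v)"
          by (rule A.comp_finsum_l[OF aN(1) A.family_ob[OF tm(2)] v ue])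
        then show ?thesis unfolding A.dsum_expand[OF DA[OF F(2)] u] by (rule sym)
      qed
      finally have "x \<cdot>\<^bsub>B\<^esub> y = transport (t M j) (t P l) (u \<cdot>\<^bsub>A\<^esub> v)" .
      moreover have "\<pi>' P l \<cdot>\<^bsub>B\<^esub> ((on_arr \<zeta> g \<cdot>\<^bsub>B\<^esub> on_arr \<zeta> f) \<cdot>\<^bsub>B\<^esub> \<iota>' M j) = x \<cdot>\<^bsub>B\<^esub> y"
        unfolding x_def y_def using bP(4)[OF l] hom[OF g] hom[OF f] bM(3)[OF j] by (simp add: B.cat_simps)
      moreover have "\<pi> P l \<cdot>\<^bsub>A\<^esub> ((g \<cdot>\<^bsub>A\<^esub> f) \<cdot>\<^bsub>A\<^esub> \<iota> M j) = u \<cdot>\<^bsub>A\<^esub> v"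
        unfolding u_def v_def using aP(4)[OF l] g f aM(3)[OF j] by (simp add: A.cat_simps)
      ultimately show "\<pi>' P l \<cdot>\<^bsub>B\<^esub> ((on_arr \<zeta> g \<cdot>\<^bsub>B\<^esub> on_arr \<zeta> f) \<cdot>\<^bsub>B\<^esub> \<iota>' M j) =
          transport (t M j) (t P l) (\<pi> P l \<cdot>\<^bsub>A\<^esub> ((g \<cdot>\<^bsub>A\<^esub> f) \<cdot>\<^bsub>A\<^esub> \<iota> M j))" by simp
    qed
    then show "on_arr \<zeta> (g \<cdot>\<^bsub>A\<^esub> f) = on_arr \<zeta> g \<cdot>\<^bsub>B\<^esub> on_arr \<zeta> f" using onI[OF gf] by blast
  next
    fix f g :: "'m" and M N
    assume f: "f \<in> Hom A M N" and g: "g \<in> Hom A M N"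
    have F: "M \<in> Ob A" "N \<in> Ob A" using fp[OF f] by blast+
    note aM = A.dsumD[OF DA[OF F(1)]] and aN = A.dsumD[OF DA[OF F(2)]] and bM = B.dsumD[OF DB[OF F(1)]] and bN = B.dsumD[OF DB[OF F(2)]]
    have fg: "Plus A f g \<in> Hom A M N" by (rule A.plus_hom[OF f g])
    have "matrix_of (Plus A f g) (Plus B (on_arr \<zeta> f) (on_arr \<zeta> g))"
      unfolding matrix_of[OF fg]
    proof (intro conjI allI impI)
      show "Plus B (on_arr \<zeta> f) (on_arr \<zeta> g) \<in> Hom B (S M) (S N)" by (rule B.plus_hom[OF hom[OF f] hom[OF g]])
      fix l j assume l: "l < d N" and j: "j < d M"
      have tn: "t M j < n" "t N l < n" using t F l j by blast+
      have 1: "\<pi> N l \<cdot>\<^bsub>A\<^esub> (f \<cdot>\<^bsub>A\<^esub> \<iota> M j) \<in> Hom A (L (t M j)) (L (t N l))"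
        "\<pi> N l \<cdot>\<^bsub>A\<^esub> (g \<cdot>\<^bsub>A\<^esub> \<iota> M j) \<in> Hom A (L (t M j)) (L (t N l))"
        by (rule A.comp_hom[OF A.comp_hom[OF aM(3)[OF j] f] aN(4)[OF l]] A.comp_hom[OF A.comp_hom[OF aM(3)[OF j] g] aN(4)[OF l]])+
      have 2: "\<pi> N l \<cdot>\<^bsub>A\<^esub> (Plus A f g \<cdot>\<^bsub>A\<^esub> \<iota> M j) =
          Plus A (\<pi> N l \<cdot>\<^bsub>A\<^esub> (f \<cdot>\<^bsub>A\<^esub> \<iota> M j)) (\<pi> N l \<cdot>\<^bsub>A\<^esub> (g \<cdot>\<^bsub>A\<^esub> \<iota> M j))"
        using f g aM(3)[OF j] aN(4)[OF l] by (simp add: A.cat_simps)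
      have "\<pi>' N l \<cdot>\<^bsub>B\<^esub> (Plus B (on_arr \<zeta> f) (on_arr \<zeta> g) \<cdot>\<^bsub>B\<^esub> \<iota>' M j) =
          Plus B (\<pi>' N l \<cdot>\<^bsub>B\<^esub> (on_arr \<zeta> f \<cdot>\<^bsub>B\<^esub> \<iota>' M j)) (\<pi>' N l \<cdot>\<^bsub>B\<^esub> (on_arr \<zeta> g \<cdot>\<^bsub>B\<^esub> \<iota>' M j))"
        using hom[OF f] hom[OF g] bM(3)[OF j] bN(4)[OF l] by (simp add: B.cat_simps)
      then show "\<pi>' N l \<cdot>\<^bsub>B\<^esub> (Plus B (on_arr \<zeta> f) (on_arr \<zeta> g) \<cdot>\<^bsub>B\<^esub> \<iota>' M j) =
          transport (t M j) (t N l) (\<pi> N l \<cdot>\<^bsub>A\<^esub> (Plus A f g \<cdot>\<^bsub>A\<^esub> \<iota> M j))"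
        unfolding 2 transport_plus[OF tn 1] entry[OF f l j] entry[OF g l j] .
    qed
    then show "on_arr \<zeta> (Plus A f g) = Plus B (on_arr \<zeta> f) (on_arr \<zeta> g)" using onI[OF fg] by blast
  next
    fix f :: "'m" and M N and c :: 'k
    assume f: "f \<in> Hom A M N"
    have F: "M \<in> Ob A" "N \<in> Ob A" using fp[OF f] by blast+
    note aM = A.dsumD[OF DA[OF F(1)]] and aN = A.dsumD[OF DA[OF F(2)]] and bM = B.dsumD[OF DB[OF F(1)]] and bN = B.dsumD[OF DB[OF F(2)]]
    have cf: "Scal A c f \<in> Hom A M N" by (rule A.scal_hom[OF f])
    have "matrix_of (Scal A c f) (Scal B c (on_arr \<zeta> f))"
      unfolding matrix_of[OF cf]
    proof (intro conjI allI impI)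
      show "Scal B c (on_arr \<zeta> f) \<in> Hom B (S M) (S N)" by (rule B.scal_hom[OF hom[OF f]])
      fix l j assume l: "l < d N" and j: "j < d M"
      have tn: "t M j < n" "t N l < n" using t F l j by blast+
      have 1: "\<pi> N l \<cdot>\<^bsub>A\<^esub> (f \<cdot>\<^bsub>A\<^esub> \<iota> M j) \<in> Hom A (L (t M j)) (L (t N l))"
        by (rule A.comp_hom[OF A.comp_hom[OF aM(3)[OF j] f] aN(4)[OF l]])
      have 2: "\<pi> N l \<cdot>\<^bsub>A\<^esub> (Scal A c f \<cdot>\<^bsub>A\<^esub> \<iota> M j) =
          Scal A c (\<pi> N l \<cdot>\<^bsub>A\<^esub> (f \<cdot>\<^bsub>A\<^esub> \<iota> M j))"
        using f aM(3)[OF j] aN(4)[OF l] by (simp add: A.cat_simps)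
      have "\<pi>' N l \<cdot>\<^bsub>B\<^esub> (Scal B c (on_arr \<zeta> f) \<cdot>\<^bsub>B\<^esub> \<iota>' M j) = Scal B c (\<pi>' N l \<cdot>\<^bsub>B\<^esub> (on_arr \<zeta> f \<cdot>\<^bsub>B\<^esub> \<iota>' M j))"
        using hom[OF f] bM(3)[OF j] bN(4)[OF l] by (simp add: B.cat_simps)
      then show "\<pi>' N l \<cdot>\<^bsub>B\<^esub> (Scal B c (on_arr \<zeta> f) \<cdot>\<^bsub>B\<^esub> \<iota>' M j) =
          transport (t M j) (t N l) (\<pi> N l \<cdot>\<^bsub>A\<^esub> (Scal A c f \<cdot>\<^bsub>A\<^esub> \<iota> M j))"
        unfolding 2 transport_scal[OF tn 1] entry[OF f l j] .
    qed
    then show "on_arr \<zeta> (Scal A c f) = Scal B c (on_arr \<zeta> f)" using onI[OF cf] by blast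
  qed
  moreover have "\<forall>i<n. on_ob \<zeta> (L i) = Zs i" unfolding ob using SS A.family_ob by blast
  ultimately show ?thesis by blast
qed

context
  fixes F assumes F_linear: "linear_functor A B F" and F_family: "\<And>i. i < n \<Longrightarrow> on_ob F (L i) = Zs i"
begin

interpretation F: linear_functor A B F
  by (rule F_linear)

lemma F_scal_ide:
  assumes "i < n"
  shows "on_arr F (Scal A c (Ide A (L i))) = Scal B c (Ide B (Zs i))"
proof -
  have ob: "L i \<in> Ob A" by (rule A.family_ob[OF assms])
  show ?thesis using F.on_scal[OF A.ide_hom[OF ob]] F.on_ide[OF ob] F_family[OF assms] by simp
qed

lemma F_family_inj:
  assumes "i < n" "j < n" "f \<in> Hom A (L i) (L j)"
    "g \<in> Hom A (L i) (L j)" "on_arr F f = on_arr F g"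
  shows "f = g"
proof (cases "i = j")
  case True
  obtain a b where ab: "f = Scal A a (Ide A (L i))" "g = Scal A b (Ide A (L i))"
    using A.family_end[OF assms(1)] assms(3,4) unfolding True[symmetric] by blast
  have "Scal B a (Ide B (Zs i)) = Scal B b (Ide B (Zs i))" using assms(5) F_scal_ide[OF assms(1)] unfolding ab by simp
  then have "a = b" using B.scal_cancel[OF B.ide_hom[OF B.family_ob[OF assms(1)]] B.family_nonzero[OF assms(1)]] by blast
  then show ?thesis using ab by simp
next
  case False
  then show ?thesis using A.family_orth[OF assms(1,2)] assms(3,4) by metis
qed

lemma F_family_surj:
  assumes "i < n" "j < n" "g \<in> Hom B (Zs i) (Zs j)"
  shows "\<exists>f \<in> Hom A (L i) (L j). on_arr F f = g"
proof (cases "i = j")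
  case True
  have ob: "L i \<in> Ob A" by (rule A.family_ob[OF assms(1)])
  obtain c where "g = Scal B c (Ide B (Zs i))" using B.family_end[OF assms(1)] assms(3) unfolding True[symmetric] by blast
  then show ?thesis using F_scal_ide[OF assms(1), of c] A.scal_hom[OF A.ide_hom[OF ob]] unfolding True[symmetric] by blast
next
  case False
  have ob: "L i \<in> Ob A" "L j \<in> Ob A" using A.family_ob assms by simp_all
  have "g = Zer B (Zs i) (Zs j)" using B.family_orth False assms by blast
  then have "on_arr F (Zer A (L i) (L j)) = g"
    using F.on_zer[OF ob] F_family assms by simp
  then show ?thesis using A.zer_hom[OF ob] by blast
qed

text \<open>The functor is bijective on arrows between members of the families, and it preserves the
  inclusions and projections that define matrices.\<close>

lemma F_fully_faithful: "fully_faithful A B F"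
  unfolding fully_faithful_def
proof (intro ballI)
  fix M N assume MN: "M \<in> Ob A" "N \<in> Ob A"
  obtain d t where t: "\<And>j. j < d \<Longrightarrow> t j < n" "is_direct_sum A d (\<lambda>j. L (t j)) M"
    using generate[OF MN(1)] by auto
  obtain e s where s: "\<And>j. j < e \<Longrightarrow> s j < n" "is_direct_sum A e (\<lambda>j. L (s j)) N"
    using generate[OF MN(2)] by auto
  obtain \<iota> \<pi> where DM: "dsum A d (\<lambda>j. L (t j)) M \<iota> \<pi>" using t(2) is_direct_sum_iff by metis
  obtain \<iota>' \<pi>' where DN: "dsum A e (\<lambda>j. L (s j)) N \<iota>' \<pi>'" using s(2) is_direct_sum_iff by metis
  note m = A.dsumD[OF DM] and n = A.dsumD[OF DN]
  note zM = F.on_dsum[OF DM] and zN = F.on_dsum[OF DN]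
  note zm = B.dsumD[OF zM] and zn = B.dsumD[OF zN]
  have ent: "on_arr F (\<pi>' l \<cdot>\<^bsub>A\<^esub> (f \<cdot>\<^bsub>A\<^esub> \<iota> j)) = on_arr F (\<pi>' l) \<cdot>\<^bsub>B\<^esub> (on_arr F f \<cdot>\<^bsub>B\<^esub> on_arr F (\<iota> j))"
    if "f \<in> Hom A M N" "l < e" "j < d" for f l j
    using F.on_comp[OF A.comp_hom[OF m(3)[OF that(3)] that(1)] n(4)[OF that(2)]] F.on_comp[OF m(3)[OF that(3)] that(1)] by simp
  show "bij_betw (on_arr F) (Hom A M N) (Hom B (on_ob F M) (on_ob F N))"
    unfolding bij_betw_def
  proof (intro conjI inj_onI equalityI subsetI)
    fix f g assume f: "f \<in> Hom A M N" and g: "g \<in> Hom A M N" and eq: "on_arr F f = on_arr F g"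
    show "f = g"
    proof (rule A.dsum_matrix_unique[OF DM DN f g])
      fix l j assume l: "l < e" and j: "j < d"
      show "\<pi>' l \<cdot>\<^bsub>A\<^esub> (f \<cdot>\<^bsub>A\<^esub> \<iota> j) = \<pi>' l \<cdot>\<^bsub>A\<^esub> (g \<cdot>\<^bsub>A\<^esub> \<iota> j)"
        by (rule F_family_inj[OF t(1)[OF j] s(1)[OF l]
            A.comp_hom[OF A.comp_hom[OF m(3)[OF j] f] n(4)[OF l]] A.comp_hom[OF A.comp_hom[OF m(3)[OF j] g] n(4)[OF l]]])
          (simp only: ent[OF f l j] ent[OF g l j] eq)
    qed
  next
    fix y assume "y \<in> on_arr F ` Hom A M N"
    then show "y \<in> Hom B (on_ob F M) (on_ob F N)" using F.on_arr by blast
  next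
    fix y assume y: "y \<in> Hom B (on_ob F M) (on_ob F N)"
    have "\<exists>a. a \<in> Hom A (L (t j)) (L (s l)) \<and> on_arr F a = on_arr F (\<pi>' l) \<cdot>\<^bsub>B\<^esub> (y \<cdot>\<^bsub>B\<^esub> on_arr F (\<iota> j))"
      if "l < e" "j < d" for l j
    proof -
      have "on_arr F (\<pi>' l) \<cdot>\<^bsub>B\<^esub> (y \<cdot>\<^bsub>B\<^esub> on_arr F (\<iota> j)) \<in> Hom B (Zs (t j)) (Zs (s l))"
        using B.comp_hom[OF B.comp_hom[OF zm(3)[OF that(2)] y] zn(4)[OF that(1)]] F_family[OF t(1)[OF that(2)]] F_family[OF s(1)[OF that(1)]] by simp
      from F_family_surj[OF t(1)[OF that(2)] s(1)[OF that(1)] this] show ?thesis by blast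
    qed
    then obtain a where a: "\<And>l j. \<lbrakk>l < e; j < d\<rbrakk> \<Longrightarrow> a l j \<in> Hom A (L (t j)) (L (s l))"
      "\<And>l j. \<lbrakk>l < e; j < d\<rbrakk> \<Longrightarrow> on_arr F (a l j) = on_arr F (\<pi>' l) \<cdot>\<^bsub>B\<^esub> (y \<cdot>\<^bsub>B\<^esub> on_arr F (\<iota> j))" by metis
    have "\<exists>h \<in> Hom A M N. \<forall>l<e. \<forall>j<d. \<pi>' l \<cdot>\<^bsub>A\<^esub> (h \<cdot>\<^bsub>A\<^esub> \<iota> j) = a l j"
      by (rule A.dsum_matrix_exists[OF DM DN a(1)])
    then obtain h where h: "h \<in> Hom A M N"
      "\<And>l j. \<lbrakk>l < e; j < d\<rbrakk> \<Longrightarrow> \<pi>' l \<cdot>\<^bsub>A\<^esub> (h \<cdot>\<^bsub>A\<^esub> \<iota> j) = a l j" by blast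
    have "on_arr F h = y"
    proof (rule B.dsum_matrix_unique[OF zM zN F.on_arr[OF h(1)] y])
      fix l j assume lj: "l < e" "j < d"
      show "on_arr F (\<pi>' l) \<cdot>\<^bsub>B\<^esub> (on_arr F h \<cdot>\<^bsub>B\<^esub> on_arr F (\<iota> j)) = on_arr F (\<pi>' l) \<cdot>\<^bsub>B\<^esub> (y \<cdot>\<^bsub>B\<^esub> on_arr F (\<iota> j))"
        unfolding ent[OF h(1) lj, symmetric] h(2)[OF lj] a(2)[OF lj] ..
    qed
    then show "y \<in> on_arr F ` Hom A M N" using h(1) by blast
  qed
qed

end

end

section \<open>Direct sums in abelian categories\<close>

lemma (in linear_category) direct_sum_iso:
  assumes "is_direct_sum C d X S" "isomorphic C S S'"
  shows "is_direct_sum C d X S'"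
proof -
  obtain \<iota> \<pi> where D: "dsum C d X S \<iota> \<pi>" using assms(1) is_direct_sum_iff by metis
  note D1 = dsumD[OF D]
  obtain f where f: "f \<in> Hom C S S'" "is_iso C f" using assms(2) by (auto simp: isomorphic_def)
  obtain g where g: "g \<in> Hom C S' S" "g \<cdot> f = Ide C S" "f \<cdot> g = Ide C S'" using is_isoE[OF f(2,1)] by metis
  have S': "S' \<in> Ob C" using hom_ob[OF g(1)] by simp
  have fi: "f \<cdot> \<iota> i \<in> Hom C (X i) S'" and gi: "\<pi> i \<cdot> g \<in> Hom C S' (X i)" if "i < d" for i
    using comp_hom[OF D1(3)[OF that] f(1)] comp_hom[OF g(1) D1(4)[OF that]] by blast+
  have "dsum C d X S' (\<lambda>i. f \<cdot> \<iota> i) (\<lambda>i. \<pi> i \<cdot> g)"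
    unfolding dsum_def
  proof (intro conjI allI impI)
    fix i j assume ij: "i < d" "j < d"
    have "(\<pi> i \<cdot> g) \<cdot> (f \<cdot> \<iota> j) = \<pi> i \<cdot> \<iota> j"
      using D1(3)[OF ij(2)] D1(4)[OF ij(1)] f(1) g(1) by (simp add: cat_simps reassoc[OF g(2)])
    then show "(\<pi> i \<cdot> g) \<cdot> (f \<cdot> \<iota> j) = (if i = j then Ide C (X i) else Zer C (X j) (X i))" using D1(5)[OF ij] by simp
  next
    have 1: "(f \<cdot> \<iota> i) \<cdot> (\<pi> i \<cdot> g) = (f \<cdot> (\<iota> i \<cdot> \<pi> i)) \<cdot> g" if "i < d" for i
      using D1(3,4)[OF that] f(1) g(1) by (simp add: cat_simps)
    have 2: "f \<cdot> (\<iota> i \<cdot> \<pi> i) \<in> Hom C S S'" if "i < d" for i using comp_hom[OF comp_hom[OF D1(4,3)[OF that]] f(1)] .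
    have "(\<Oplus>\<^bsub>hom_space C S' S'\<^esub>i\<in>{..<d}. (f \<cdot> \<iota> i) \<cdot> (\<pi> i \<cdot> g)) = (\<Oplus>\<^bsub>hom_space C S' S'\<^esub>i\<in>{..<d}. (f \<cdot> (\<iota> i \<cdot> \<pi> i)) \<cdot> g)"
      by (rule finsum_hom_cong[OF S' S' comp_hom[OF g(1) 2] 1])
    also have "\<dots> = (\<Oplus>\<^bsub>hom_space C S S'\<^esub>i\<in>{..<d}. f \<cdot> (\<iota> i \<cdot> \<pi> i)) \<cdot> g"
      by (rule comp_finsum_l[OF D1(1) S' g(1) 2, symmetric])
    also have "\<dots> = Ide C S'" unfolding dsum_expand[OF D f(1)] by (rule g(3))
    finally show "(\<Oplus>\<^bsub>hom_space C S' S'\<^esub>i\<in>{..<d}. (f \<cdot> \<iota> i) \<cdot> (\<pi> i \<cdot> g)) = Ide C S'" .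
  qed (use S' D1(2) fi gi in blast)+
  then show ?thesis using is_direct_sum_iff by metis
qed

lemma (in abelian_category) direct_sum_exists:
  assumes "\<forall>j<d. X j \<in> Ob C"
  shows "\<exists>S. is_direct_sum C d X S"
  using assms
proof (induction d)
  case 0
  obtain N where N: "is_zero_ob C N" using zero_ob by blast
  then have "N \<in> Ob C" "Ide C N = Zer C N N" by (simp_all add: is_zero_ob_iff)
  then have "dsum C 0 X N undefined undefined" unfolding dsum_def using finsum_hom_0[of N N] by simp
  then show ?case using is_direct_sum_iff by metis
next
  case (Suc d)
  then obtain S where "is_direct_sum C d X S" by auto
  then obtain \<iota> \<pi> where D: "dsum C d X S \<iota> \<pi>" using is_direct_sum_iff by metis
  note D1 = dsumD[OF D]
  have Xd: "X d \<in> Ob C" using Suc.prems by simp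
  obtain T i j p q where bi: "is_biproduct C S (X d) T i j p q" using biproducts[OF D1(1) Xd] by blast
  note b = biproductD[OF bi]
  define \<iota>' where "\<iota>' l = (if l = d then j else i \<cdot> \<iota> l)" for l
  define \<pi>' where "\<pi>' l = (if l = d then q else \<pi> l \<cdot> p)" for l
  have \<iota>': "\<iota>' l \<in> Hom C (X l) T" if "l < Suc d" for l
    using that b(5) comp_hom[OF D1(3) b(4)] less_Suc_eq[of l d] by (auto simp: \<iota>'_def)
  have \<pi>': "\<pi>' l \<in> Hom C T (X l)" if "l < Suc d" for l
    using that b(7) comp_hom[OF b(6) D1(4)] less_Suc_eq[of l d] by (auto simp: \<pi>'_def)
  have "dsum C (Suc d) X T \<iota>' \<pi>'"
    unfolding dsum_def
  proof (intro conjI allI impI)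
    fix l m assume lm: "l < Suc d" "m < Suc d"
    consider "l = d" "m = d" | "l = d" "m < d" | "l < d" "m = d" | "l < d" "m < d" using lm less_Suc_eq by auto
    then show "\<pi>' l \<cdot> \<iota>' m = (if l = m then Ide C (X l) else Zer C (X m) (X l))"
    proof cases
      case 1 then show ?thesis using b by (simp add: \<iota>'_def \<pi>'_def)
    next
      case 2 then show ?thesis using b(1-7) D1(3)[OF 2(2)] by (simp add: \<iota>'_def \<pi>'_def cat_simps reassoc[OF b(11)])
    next
      case 3 then show ?thesis using b(1-7) D1(4)[OF 3(1)] by (simp add: \<iota>'_def \<pi>'_def cat_simps b(10))
    next
      case 4
      then have "\<pi>' l \<cdot> \<iota>' m = \<pi> l \<cdot> \<iota> m"
        using b(1-7) D1(4)[OF 4(1)] D1(3)[OF 4(2)] by (simp add: \<iota>'_def \<pi>'_def cat_simps reassoc[OF b(8)])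
      then show ?thesis using D1(5)[OF 4] by simp
    qed
  next
    have 1: "i \<cdot> (\<iota> l \<cdot> \<pi> l) \<in> Hom C S T" if "l < d" for l using comp_hom[OF comp_hom[OF D1(4,3)[OF that]] b(4)] .
    have 2: "\<iota>' l \<cdot> \<pi>' l = (i \<cdot> (\<iota> l \<cdot> \<pi> l)) \<cdot> p" if "l < d" for l
      using that D1(3,4)[OF that] b(4,6) by (simp add: \<iota>'_def \<pi>'_def cat_simps)
    have "(\<Oplus>\<^bsub>hom_space C T T\<^esub>l\<in>{..<d}. \<iota>' l \<cdot> \<pi>' l) = (\<Oplus>\<^bsub>hom_space C T T\<^esub>l\<in>{..<d}. (i \<cdot> (\<iota> l \<cdot> \<pi> l)) \<cdot> p)"
      by (rule finsum_hom_cong[OF b(1,1) comp_hom[OF b(6) 1] 2])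
    also have "\<dots> = (\<Oplus>\<^bsub>hom_space C S T\<^esub>l\<in>{..<d}. i \<cdot> (\<iota> l \<cdot> \<pi> l)) \<cdot> p"
      by (rule comp_finsum_l[OF D1(1) b(1) b(6) 1, symmetric])
    also have "\<dots> = i \<cdot> p" unfolding dsum_expand[OF D b(4)] ..
    finally have "(\<Oplus>\<^bsub>hom_space C T T\<^esub>l\<in>{..<d}. \<iota>' l \<cdot> \<pi>' l) = i \<cdot> p" .
    then have "(\<Oplus>\<^bsub>hom_space C T T\<^esub>l\<in>{..<Suc d}. \<iota>' l \<cdot> \<pi>' l) = Plus C (j \<cdot> q) (i \<cdot> p)"
      using finsum_hom_Suc[OF b(1,1), of d "\<lambda>l. \<iota>' l \<cdot> \<pi>' l"] comp_hom[OF \<pi>' \<iota>'] by (simp add: \<iota>'_def \<pi>'_def)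
    also have "\<dots> = Plus C (i \<cdot> p) (j \<cdot> q)"
      by (rule plus_comm) (use b(4-7) in \<open>simp_all add: Hom_iff typed\<close>)
    also have "\<dots> = Ide C T" by (rule b(12))
    finally show "(\<Oplus>\<^bsub>hom_space C T T\<^esub>l\<in>{..<Suc d}. \<iota>' l \<cdot> \<pi>' l) = Ide C T" .
  qed (use b(1) Suc.prems \<iota>' \<pi>' in blast)+
  then show ?case using is_direct_sum_iff by metis
qed

section \<open>Simple collections\<close>

lemma has_dim_finite_dim: "has_dim V d \<Longrightarrow> finite_dim V"
  unfolding has_dim_def finite_dim_def by metis

locale simple_coll = abelian_category C for C :: "('k::field, 'o, 'm) lin_cat" (structure) +
  fixes n :: nat and Zs :: "nat \<Rightarrow> 'o"
  assumes coll: "simple_collection n C Zs"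
begin

lemma Zs_ob: "i < n \<Longrightarrow> Zs i \<in> Ob C"
  using coll by (simp add: simple_collection_def)

lemma Zs_orth:
  assumes "i < n" "j < n" "i \<noteq> j" "f \<in> Hom C (Zs i) (Zs j)"
  shows "f = Zer C (Zs i) (Zs j)"
proof -
  have "has_dim (hom_space C (Zs i) (Zs j)) 0" using coll assms unfolding simple_collection_def by force
  then obtain b where b: "\<forall>v\<in>Hom C (Zs i) (Zs j). \<exists>!c. c \<in> {..<0::nat} \<rightarrow>\<^sub>E UNIV \<and>
      v = (\<Oplus>\<^bsub>hom_space C (Zs i) (Zs j)\<^esub>l\<in>{..<0::nat}. c l \<odot>\<^bsub>hom_space C (Zs i) (Zs j)\<^esub> b l)"
    unfolding has_dim_def carrier_hom_space by (elim exE conjE) (rule that)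
  obtain c where c: "f = (\<Oplus>\<^bsub>hom_space C (Zs i) (Zs j)\<^esub>l\<in>{..<0::nat}. c l \<odot>\<^bsub>hom_space C (Zs i) (Zs j)\<^esub> b l)"
    using ex1_implies_ex[OF bspec[OF b assms(4)]] by (elim exE conjE) (rule that)
  show ?thesis unfolding c by (rule finsum_hom_0[OF Zs_ob[OF assms(1)] Zs_ob[OF assms(2)]])
qed

lemma Zs_end_basis:
  assumes "i < n"
  obtains b where "b \<in> Hom C (Zs i) (Zs i)" "\<And>v. v \<in> Hom C (Zs i) (Zs i) \<Longrightarrow> \<exists>c. v = Scal C c b" "b \<noteq> Zer C (Zs i) (Zs i)"
proof -
  let ?H = "hom_space C (Zs i) (Zs i)"
  have "has_dim ?H 1" using coll assms unfolding simple_collection_def by force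
  then obtain b where b: "b \<in> {..<1::nat} \<rightarrow> Hom C (Zs i) (Zs i)"
    "\<forall>v\<in>Hom C (Zs i) (Zs i). \<exists>!c. c \<in> {..<1} \<rightarrow>\<^sub>E UNIV \<and> v = (\<Oplus>\<^bsub>?H\<^esub>l\<in>{..<1}. c l \<odot>\<^bsub>?H\<^esub> b l)"
    unfolding has_dim_def carrier_hom_space by (elim exE conjE) (rule that)
  have b0: "b 0 \<in> Hom C (Zs i) (Zs i)" using b(1) by auto
  have sum: "(\<Oplus>\<^bsub>?H\<^esub>l\<in>{..<1::nat}. c l \<odot>\<^bsub>?H\<^esub> b l) = Scal C (c 0) (b 0)" for c
    by (rule finsum_hom_delta[OF Zs_ob[OF assms] Zs_ob[OF assms], of 0]) (use scal_hom[OF b0] in auto)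
  have 1: "\<exists>c. v = Scal C c (b 0)" if v: "v \<in> Hom C (Zs i) (Zs i)" for v
    using ex1_implies_ex[OF bspec[OF b(2) v]] unfolding sum by blast
  have "b 0 \<noteq> Zer C (Zs i) (Zs i)"
  proof
    assume z: "b 0 = Zer C (Zs i) (Zs i)"
    have "\<exists>!c. c \<in> {..<1::nat} \<rightarrow>\<^sub>E (UNIV :: 'k set) \<and> Zer C (Zs i) (Zs i) = Scal C (c 0) (b 0)"
      using bspec[OF b(2) zer_hom[OF Zs_ob[OF assms] Zs_ob[OF assms]]] unfolding sum .
    moreover have "Zer C (Zs i) (Zs i) = Scal C x (b 0)" for x unfolding z using scal_zer Zs_ob[OF assms] by simp
    ultimately have "\<exists>!c. c \<in> {..<1::nat} \<rightarrow>\<^sub>E (UNIV :: 'k set)" by simp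
    moreover have "(\<lambda>l\<in>{..<1}. 0) \<in> {..<1::nat} \<rightarrow>\<^sub>E (UNIV :: 'k set)" "(\<lambda>l\<in>{..<1}. 1) \<in> {..<1::nat} \<rightarrow>\<^sub>E (UNIV :: 'k set)" by auto
    ultimately have "(\<lambda>l\<in>{..<1::nat}. 0 :: 'k) = (\<lambda>l\<in>{..<1}. 1)" by blast
    then have "(\<lambda>l\<in>{..<1::nat}. 0 :: 'k) 0 = (\<lambda>l\<in>{..<1::nat}. 1) 0" by (rule fun_cong)
    then show False by simp
  qed
  then show ?thesis using that b0 1 by blast
qed

lemma Zs_nonzero:
  assumes "i < n"
  shows "Ide C (Zs i) \<noteq> Zer C (Zs i) (Zs i)"
proof
  assume z: "Ide C (Zs i) = Zer C (Zs i) (Zs i)"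
  obtain b where b: "b \<in> Hom C (Zs i) (Zs i)" "b \<noteq> Zer C (Zs i) (Zs i)" using Zs_end_basis[OF assms] by metis
  have "is_zero_ob C (Zs i)" using z Zs_ob[OF assms] by (simp add: is_zero_ob_iff)
  then show False using zero_ob_from[OF _ b(1)] b(2) by blast
qed

lemma Zs_end:
  assumes "i < n" "f \<in> Hom C (Zs i) (Zs i)"
  shows "\<exists>c. f = Scal C c (Ide C (Zs i))"
proof -
  obtain b where b: "b \<in> Hom C (Zs i) (Zs i)" "\<And>v. v \<in> Hom C (Zs i) (Zs i) \<Longrightarrow> \<exists>c. v = Scal C c b"
    using Zs_end_basis[OF assms(1)] by metis
  have bA: "b \<in> Arr C" "Dom C b = Zs i" "Cod C b = Zs i" using b(1) by (simp_all add: Hom_iff)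
  obtain c0 c1 where c: "Ide C (Zs i) = Scal C c0 b" "f = Scal C c1 b"
    using b(2)[OF ide_hom[OF Zs_ob[OF assms(1)]]] b(2)[OF assms(2)] by blast
  have "c0 \<noteq> 0" using c(1) scal_zero[OF bA] Zs_nonzero[OF assms(1)] by metis
  then have "Scal C (c1 / c0) (Ide C (Zs i)) = f" unfolding c using scal_scal[OF bA(1)] by simp
  then show ?thesis by metis
qed

sublocale orthogonal_bricks C "Zs ` {..<n}"
proof
  show "Zs ` {..<n} \<subseteq> Ob C" using Zs_ob by blast
  show "\<And>A. A \<in> Zs ` {..<n} \<Longrightarrow> \<not> is_zero_ob C A" using Zs_nonzero by (auto simp: is_zero_ob_iff)
  fix A B f assume AB: "A \<in> Zs ` {..<n}" "B \<in> Zs ` {..<n}" "f \<in> Hom C A B" "f \<noteq> Zer C A B"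
  then obtain i j where ij: "i < n" "j < n" "A = Zs i" "B = Zs j" by blast
  then have "i = j" using Zs_orth AB by blast
  then have AB': "B = A" using ij by simp
  obtain c where c: "f = Scal C c (Ide C A)" using Zs_end[OF ij(1)] AB(3) ij AB' by blast
  have A: "A \<in> Ob C" using Zs_ob ij by blast
  have c0: "c \<noteq> 0" using c AB(4) A unfolding AB' by (auto simp: cat_simps)
  show "is_iso C f"
  proof (rule is_isoI[OF AB(3)])
    show "Scal C (1 / c) (Ide C A) \<in> Hom C B A" unfolding AB' by (rule scal_hom[OF ide_hom[OF A]])
    show "Scal C (1 / c) (Ide C A) \<cdot> f = Ide C A" "f \<cdot> Scal C (1 / c) (Ide C A) = Ide C B"
      unfolding AB' c using c0 A by (simp_all add: cat_simps)
  qed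
qed

abbreviation Fcat where "Fcat \<equiv> full_subcat C F"

sublocale FA: abelian_category Fcat
  by (rule sub.abelian_D)

lemma filt_cat_eq: "filt_cat n C Zs = Fcat"
  by (simp add: filt_cat_def)

lemma Zs_F: "i < n \<Longrightarrow> Zs i \<in> F"
  using S_F by blast

lemma modules_pair: "scalar_family_pair (mod_prod n) Fcat n (simple_mod n) Zs"
proof -
  have 1: "scalar_family (mod_prod n) n (simple_mod n :: nat \<Rightarrow> 'k pmod)"
    by (rule scalar_family.intro[OF linear_mod_prod], rule scalar_family_axioms.intro)
      (use simple_mod_fp simple_mod_end simple_mod_nonzero simple_mod_orth in \<open>simp_all only: mod_prod_sel(1)\<close>)
  have 2: "scalar_family Fcat n Zs"
    by (rule scalar_family.intro[OF sub.linear_D], rule scalar_family_axioms.intro)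
      (use Zs_F Zs_end Zs_nonzero Zs_orth in \<open>simp_all\<close>)
  show ?thesis
    by (rule scalar_family_pair.intro[OF 1 2], rule scalar_family_pair_axioms.intro)
      (simp only: mod_prod_sel(1) fp_direct_sum)
qed

lemma structure_functor_exists: "\<exists>\<zeta>. sends_simples_to n Fcat Zs \<zeta>"
  unfolding sends_simples_to_def
  by (rule scalar_family_pair.functor_extending_family[OF modules_pair]) (use Zs_F FA.direct_sum_exists in auto)

section \<open>The simple objects of the extension closure\<close>

text \<open>This is why there are no simple objects besides the \<open>Zs i\<close>: a simple object coincides with the
  bottom step of its filtration.\<close>

lemma F_nonzero_bottom:
  assumes "X \<in> F" "\<not> is_zero_ob C X"
  obtains i j where "i < n" "j \<in> Hom C (Zs i) X" "is_mono C j"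
proof -
  have "is_zero_ob C X \<or> (\<exists>i j. i < n \<and> j \<in> Hom C (Zs i) X \<and> is_mono C j)"
    using S_ob assms(1)
  proof (induction rule: ext_closure_bottom_induct)
    case (step A X Q j p)
    then show ?case using short_exact_mono[OF step(2,3)] by blast
  qed simp
  then show ?thesis using that assms(2) by blast
qed

lemma Zs_simple:
  assumes "i < n"
  shows "is_simple Fcat (Zs i)"
  unfolding is_simple_def
proof (intro conjI allI impI)
  show "Zs i \<in> Ob Fcat" using Zs_F[OF assms] by simp
  show "\<not> is_zero_ob Fcat (Zs i)" using brick_nonzero assms by (simp add: sub.D_zero_ob)
  fix m assume m: "is_mono Fcat m \<and> Cod Fcat m = Zs i"
  define U where "U = Dom C m"
  have mA: "m \<in> Arr Fcat" "is_mono C m" using m sub.D_mono by blast+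
  have mh: "m \<in> Hom C U (Zs i)" "U \<in> F" using mA m by (simp_all add: Hom_iff U_def)
  show "is_zero_ob Fcat (Dom Fcat m) \<or> is_iso Fcat m"
  proof (cases "is_zero_ob C U")
    case True
    then show ?thesis by (simp add: sub.D_zero_ob U_def)
  next
    case False
    then obtain l j where j: "l < n" "j \<in> Hom C (Zs l) U" "is_mono C j" using F_nonzero_bottom mh(2) by blast
    have mj: "m \<cdot> j \<in> Hom C (Zs l) (Zs i)" "is_mono C (m \<cdot> j)"
      using comp_hom[OF j(2) mh(1)] mono_comp[OF j(3,2) mA(2) mh(1)] .
    have "m \<cdot> j \<noteq> Zer C (Zs l) (Zs i)"
    proof
      assume "m \<cdot> j = Zer C (Zs l) (Zs i)"
      then have "(m \<cdot> j) \<cdot> Ide C (Zs l) = Zer C (Zs l) (Zs i)" using comp_ide_right[OF mj(1)] by simp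
      then have "Ide C (Zs l) = Zer C (Zs l) (Zs l)" using mono_zer[OF mj(2,1) ide_hom[OF Zs_ob[OF j(1)]]] by blast
      then show False using Zs_nonzero[OF j(1)] by blast
    qed
    then have "is_iso C (m \<cdot> j)" using brick[OF _ _ mj(1)] j(1) assms by blast
    then have "is_epi C m" using epi_of_comp[OF iso_epi[OF _ mj(1)] j(2) mh(1)] by blast
    then have "is_iso C m" using mono_epi_iso mA(2) mh(1) by blast
    then show ?thesis using mA(1) by (simp add: sub.D_iso)
  qed
qed

lemma simple_iso_Zs:
  assumes "is_simple Fcat X"
  shows "\<exists>i<n. isomorphic Fcat (Zs i) X"
proof -
  have X: "X \<in> F" "\<not> is_zero_ob C X" using assms by (auto simp: is_simple_def sub.D_zero_ob)
  obtain i j where j: "i < n" "j \<in> Hom C (Zs i) X" "is_mono C j" using F_nonzero_bottom[OF X] by blast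
  have jD: "j \<in> Hom Fcat (Zs i) X" using j(2) Zs_F[OF j(1)] X(1) by simp
  then have "is_mono Fcat j" using j(3) sub.D_mono[of j] by (simp only: Hom_iff simp_thms)
  moreover have "\<forall>m. is_mono Fcat m \<and> Cod Fcat m = X \<longrightarrow> is_zero_ob Fcat (Dom Fcat m) \<or> is_iso Fcat m"
    using assms unfolding is_simple_def by (elim conjE)
  ultimately have "is_zero_ob Fcat (Zs i) \<or> is_iso Fcat j"
    using dom_hom[OF jD] cod_hom[OF jD] by metis
  then have "is_iso Fcat j" using brick_nonzero j(1) by (auto simp: sub.D_zero_ob)
  then show ?thesis using j(1) jD unfolding isomorphic_def by blast
qed

lemma Zs_semisimple: "i < n \<Longrightarrow> is_semisimple Fcat (Zs i)"
  unfolding is_semisimple_def using Zs_simple sub.D.is_direct_sum_single[of "Zs i"] Zs_F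
  by (intro exI[of _ 1] exI[of _ "\<lambda>_. Zs i"]) simp

lemma F_filtration:
  assumes "X \<in> F"
  shows "has_semisimple_filtration Fcat X"
proof -
  have "X \<in> F \<and> has_semisimple_filtration Fcat X"
    using S_ob assms
  proof (induction rule: ext_closure_top_induct)
    case (zero X)
    have "has_semisimple_filtration Fcat X"
      unfolding has_semisimple_filtration_def
      by (intro exI[of _ 0] exI[of _ "\<lambda>_. X"] exI) (use zero in \<open>simp add: sub.D_zero_ob\<close>)
    then show ?case using sub.sub_zero[OF zero] by blast
  next
    case (step A X U j p)
    have X: "X \<in> F" using ext_closure_ext[OF step(2-4) step(5) S_F[OF step(1)]] .
    obtain d G js ps where G: "is_zero_ob Fcat (G 0)" "G d = U"
      "\<And>i. i < d \<Longrightarrow> js i \<in> Hom Fcat (G i) (G (Suc i)) \<and> short_exact Fcat (js i) (ps i) \<and> is_semisimple Fcat (Cod Fcat (ps i))"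
      using step(6) unfolding has_semisimple_filtration_def by (elim conjE exE) blast
    have jp: "j \<in> Hom Fcat U X" "p \<in> Hom Fcat X A" using step X S_F[OF step(1)] by simp_all
    then have se: "short_exact Fcat j p" using step(2) unfolding sub.D_short_exact Hom_iff by blast
    have ss: "is_semisimple Fcat (Cod Fcat p)" using step(1) Zs_semisimple cod_hom[OF jp(2)] by auto
    define G' where "G' = G(Suc d := X)"
    have "has_semisimple_filtration Fcat X"
      unfolding has_semisimple_filtration_def
    proof (intro exI conjI allI impI)
      show "is_zero_ob Fcat (G' 0)" using G(1) by (simp add: G'_def)
      show "G' (Suc d) = X" by (simp add: G'_def)
      fix i assume i: "i < Suc d"
      show "(js(d := j)) i \<in> Hom Fcat (G' i) (G' (Suc i))" "short_exact Fcat ((js(d := j)) i) ((ps(d := p)) i)"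
        "is_semisimple Fcat (Cod Fcat ((ps(d := p)) i))"
        using G(2) G(3)[of i] jp(1) se ss i less_Suc_eq[of i d] by (auto simp: G'_def)
    qed
    then show ?case using X by blast
  qed
  then show ?thesis by blast
qed

lemma F_finitely_many_simples:
  "finite ({X. is_simple Fcat X} // {(X, Y). is_simple Fcat X \<and> is_simple Fcat Y \<and> isomorphic Fcat X Y})"
proof -
  let ?r = "{(X, Y). is_simple Fcat X \<and> is_simple Fcat Y \<and> isomorphic Fcat X Y}"
  have "{X. is_simple Fcat X} // ?r \<subseteq> (\<lambda>i. ?r `` {Zs i}) ` {..<n}"
  proof
    fix K assume "K \<in> {X. is_simple Fcat X} // ?r"
    then obtain X where X: "is_simple Fcat X" "K = ?r `` {X}" by (auto elim: quotientE)
    obtain i where i: "i < n" "isomorphic Fcat (Zs i) X" using simple_iso_Zs[OF X(1)] by blast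
    have "isomorphic Fcat X Y \<longleftrightarrow> isomorphic Fcat (Zs i) Y" for Y
      using i(2) sub.D.isomorphic_trans sub.D.isomorphic_sym by blast
    then have "K = ?r `` {Zs i}" unfolding X(2) using X(1) Zs_simple[OF i(1)] by auto
    then show "K \<in> (\<lambda>i. ?r `` {Zs i}) ` {..<n}" using i(1) by blast
  qed
  then show ?thesis using finite_subset by blast
qed

text \<open>The extension spaces of the \<open>Zs i\<close> are images of the one of \<open>W\<close>, since the \<open>Zs i\<close> are retracts
  of \<open>W\<close>; from there finiteness spreads along filtrations.\<close>

lemma F_finite_length:
  assumes "is_direct_sum C n Zs W" "finite_dim (Ext1 C W W)"
  shows "finite_length_category Fcat"
proof -
  obtain \<iota> \<pi> where D: "dsum C n Zs W \<iota> \<pi>" using assms(1) is_direct_sum_iff by metis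
  note D1 = dsumD[OF D]
  have base: "fd_pair (Zs i) (Zs j)" if "i < n" "j < n" for i j
  proof -
    have "finite_dim (hom_space C (Zs i) (Zs j))"
      using coll that has_dim_finite_dim unfolding simple_collection_def by blast
    moreover have "finite_dim (Ext1 C (Zs i) W)"
      by (rule Ext1_finite_dim_retract_first[OF D1(1) D1(3,4)[OF that(1)] _ assms(2)]) (use D1(5)[OF that(1,1)] in simp)
    then have "finite_dim (Ext1 C (Zs i) (Zs j))"
      by (rule Ext1_finite_dim_retract_second[OF D1(2)[OF that(1)] D1(3,4)[OF that(2)], rotated]) (use D1(5)[OF that(2,2)] in simp)
    ultimately show ?thesis by (simp add: fd_pair_def)
  qed
  have fd: "fd_pair X Y" if "X \<in> F" "Y \<in> F" for X Y
    by (rule fd_pair_ext_closure[OF S_ob _ that]) (use base in blast)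
  show ?thesis
  proof (rule finite_length_category.intro[OF sub.abelian_D], rule finite_length_category_axioms.intro)
    show "finite_dim (hom_space Fcat X Y)" if "X \<in> Ob Fcat" "Y \<in> Ob Fcat" for X Y
      using fd[of X Y] that by (simp add: fd_pair_def)
    show "finite_dim (Ext1 Fcat X Y)" if "X \<in> Ob Fcat" "Y \<in> Ob Fcat" for X Y
      using fd[of X Y] sub.D_Ext1_finite_dim[of X Y] that by (simp add: fd_pair_def)
    show "has_semisimple_filtration Fcat X" if "X \<in> Ob Fcat" for X using F_filtration that by simp
  qed (rule F_finitely_many_simples)
qed

section \<open>The structure functor\<close>

context
  fixes \<zeta> assumes \<zeta>: "sends_simples_to n Fcat Zs \<zeta>"
begin

interpretation \<zeta>: linear_functor "mod_prod n" Fcat \<zeta>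
  using \<zeta> by (simp add: sends_simples_to_def)

lemma \<zeta>_simple: "i < n \<Longrightarrow> on_ob \<zeta> (simple_mod n i) = Zs i"
  using \<zeta> by (simp add: sends_simples_to_def)

lemma \<zeta>_fully_faithful: "fully_faithful (mod_prod n) Fcat \<zeta>"
  by (rule scalar_family_pair.F_fully_faithful[OF modules_pair \<zeta>.linear_functor_axioms \<zeta>_simple])

lemma \<zeta>_essential_image:
  assumes "X \<in> F"
  shows "is_semisimple Fcat X \<longleftrightarrow> (\<exists>M \<in> Ob (mod_prod n). isomorphic Fcat (on_ob \<zeta> M) X)"
proof
  assume "is_semisimple Fcat X"
  then obtain d S where S: "\<forall>i<d. is_simple Fcat (S i)" "is_direct_sum Fcat d S X" unfolding is_semisimple_def by blast
  then have "\<forall>i<d. \<exists>t<n. isomorphic Fcat (Zs t) (S i)" using simple_iso_Zs by blast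
  then obtain t where t: "\<And>i. i < d \<Longrightarrow> t i < n \<and> isomorphic Fcat (Zs (t i)) (S i)" by metis
  obtain M :: "'k pmod" where M: "M \<in> fp_modules n" "is_direct_sum (mod_prod n) d (\<lambda>j. simple_mod n (t j)) M"
    using direct_sum_of_simples_exists[of d t n] t by blast
  have "is_direct_sum Fcat d (\<lambda>j. on_ob \<zeta> (simple_mod n (t j))) (on_ob \<zeta> M)" by (rule \<zeta>.on_direct_sum[OF M(2)])
  then have "is_direct_sum Fcat d (\<lambda>j. Zs (t j)) (on_ob \<zeta> M)"
    by (rule sub.D.is_direct_sum_cong) (use \<zeta>_simple t in blast)
  then have "isomorphic Fcat (on_ob \<zeta> M) X"
    by (rule sub.D.direct_sum_isomorphic[OF _ S(2)]) (use t in blast)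
  then show "\<exists>M \<in> Ob (mod_prod n). isomorphic Fcat (on_ob \<zeta> M) X" using M(1) by auto
next
  assume "\<exists>M \<in> Ob (mod_prod n). isomorphic Fcat (on_ob \<zeta> M) X"
  then obtain M where M: "M \<in> fp_modules n" "isomorphic Fcat (on_ob \<zeta> M) X" by auto
  obtain d t where t: "\<And>j. j < d \<Longrightarrow> t j < n" "is_direct_sum (mod_prod n) d (\<lambda>j. simple_mod n (t j)) M"
    using fp_direct_sum[OF M(1)] by blast
  have "is_direct_sum Fcat d (\<lambda>j. on_ob \<zeta> (simple_mod n (t j))) (on_ob \<zeta> M)" by (rule \<zeta>.on_direct_sum[OF t(2)])
  then have "is_direct_sum Fcat d (\<lambda>j. Zs (t j)) (on_ob \<zeta> M)"
    by (rule sub.D.is_direct_sum_cong) (use \<zeta>_simple t(1) in blast)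
  then have "is_direct_sum Fcat d (\<lambda>j. Zs (t j)) X" by (rule sub.D.direct_sum_iso[OF _ M(2)])
  moreover have "\<forall>i<d. is_simple Fcat (Zs (t i))" using Zs_simple t(1) by blast
  ultimately show "is_semisimple Fcat X" unfolding is_semisimple_def
    by (intro exI[of _ d] exI[of _ "\<lambda>j. Zs (t j)"] conjI)
qed

lemma F_df_tilde:
  assumes "is_direct_sum C n Zs W" "finite_dim (Ext1 C W W)"
  shows "(Fcat, \<zeta>) \<in> df_tilde n"
  unfolding df_tilde_def mem_Collect_eq prod.case
  using F_finite_length[OF assms] \<zeta>.linear_functor_axioms \<zeta>_fully_faithful \<zeta>_essential_image by simp

end

end

section \<open>Framed functors and deformations\<close>

lemma (in finite_length_category) filtration_induct [consumes 1, case_names zero semisimple ext]: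
  assumes "X \<in> Ob C"
    and zero: "\<And>X. is_zero_ob C X \<Longrightarrow> P X"
    and semisimple: "\<And>X. \<lbrakk>X \<in> Ob C; is_semisimple C X\<rbrakk> \<Longrightarrow> P X"
    and ext: "\<And>i p Y E X. \<lbrakk>short_exact C i p; i \<in> Hom C Y E; p \<in> Hom C E X; P Y; P X\<rbrakk> \<Longrightarrow> P E"
  shows "P X"
proof -
  obtain d G j p where G: "is_zero_ob C (G 0)" "G d = X"
    "\<And>i. i < d \<Longrightarrow> j i \<in> Hom C (G i) (G (Suc i)) \<and> short_exact C (j i) (p i) \<and> is_semisimple C (Cod C (p i))"
    using semisimple_filtration[OF assms(1)] unfolding has_semisimple_filtration_def by (elim conjE exE) blast
  have "i \<le> d \<Longrightarrow> P (G i)" for i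
  proof (induction i)
    case (Suc i)
    then have *: "j i \<in> Hom C (G i) (G (Suc i))" "short_exact C (j i) (p i)" "is_semisimple C (Cod C (p i))" "P (G i)"
      using G(3)[of i] by auto
    have pi: "p i \<in> Hom C (G (Suc i)) (Cod C (p i))" by (rule short_exact_hom[OF *(2,1)])
    have "P (Cod C (p i))" using semisimple hom_ob[OF pi] *(3) by blast
    then show ?case using ext[OF *(2,1) pi *(4)] by blast
  qed (simp add: zero G(1))
  then show ?thesis using G(2) by blast
qed

context linear_functor
begin

lemma on_iso:
  assumes "is_iso A f" "f \<in> Hom A X Y"
  shows "is_iso B (on_arr F f)"
proof -
  obtain g where g: "g \<in> Hom A Y X" "g \<cdot>\<^bsub>A\<^esub> f = Ide A X" "f \<cdot>\<^bsub>A\<^esub> g = Ide A Y" using A.is_isoE[OF assms] by metis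
  have XY: "X \<in> Ob A" "Y \<in> Ob A" using A.hom_ob[OF assms(2)] by auto
  show ?thesis
    by (rule B.is_isoI[OF on_arr[OF assms(2)] on_arr[OF g(1)]])
      (use on_comp[OF assms(2) g(1)] on_comp[OF g(1) assms(2)] g(2,3) on_ide XY in simp_all)
qed

lemma on_isomorphic: "isomorphic A X Y \<Longrightarrow> isomorphic B (on_ob F X) (on_ob F Y)"
  unfolding isomorphic_def using on_iso on_arr by blast

lemma on_zero_ob: "is_zero_ob A X \<Longrightarrow> is_zero_ob B (on_ob F X)"
  using on_ide[of X] on_zer[of X X] on_ob[of X] by (simp add: A.is_zero_ob_iff B.is_zero_ob_iff)

end

lemma functor_comp_sel [simp]:
  "on_ob (functor_comp G F) X = on_ob G (on_ob F X)" "on_arr (functor_comp G F) f = on_arr G (on_arr F f)"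
  by (simp_all add: functor_comp_def)

text \<open>A transformation of exact functors on a finite length category that is invertible on
  semisimple objects is invertible, by the five lemma along a filtration.\<close>

lemma framed_transformation_iso:
  assumes AQ: "(A, Q) \<in> df_tilde n" and B: "abelian_category B"
    and T: "exact_functor A B T" "nat_iso (mod_prod n) B (functor_comp T Q) \<xi> \<tau>"
    and T': "exact_functor A B T'" "nat_iso (mod_prod n) B (functor_comp T' Q) \<xi> \<tau>'"
    and \<psi>: "nat_trans A B T T' \<psi>" "\<And>M. M \<in> Ob (mod_prod n) \<Longrightarrow> \<tau>' M \<cdot>\<^bsub>B\<^esub> \<psi> (on_ob Q M) = \<tau> M"
    and X: "X \<in> Ob A"
  shows "is_iso B (\<psi> X)"
proof -
  interpret A: finite_length_category A using AQ by (simp add: df_tilde_def)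
  interpret Q: linear_functor "mod_prod n" A Q using AQ by (simp add: df_tilde_def)
  interpret B: abelian_category B by (rule B)
  interpret T: exact_functor A B T by (rule T(1))
  interpret T': exact_functor A B T' by (rule T'(1))
  have \<psi>h: "\<psi> X \<in> Hom B (on_ob T X) (on_ob T' X)" if "X \<in> Ob A" for X using \<psi>(1) that by (simp add: nat_trans_def)
  have nat: "on_arr T' f \<cdot>\<^bsub>B\<^esub> \<psi> X = \<psi> Y \<cdot>\<^bsub>B\<^esub> on_arr T f" if "f \<in> Hom A X Y" for f X Y
    using \<psi>(1) that A.hom_ob[OF that] unfolding nat_trans_def by blast
  have base: "is_iso B (\<psi> (on_ob Q M))" if M: "M \<in> Ob (mod_prod n)" for M
  proof -
    have t: "\<tau> M \<in> Hom B (on_ob T (on_ob Q M)) (on_ob \<xi> M)" "is_iso B (\<tau> M)"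
      "\<tau>' M \<in> Hom B (on_ob T' (on_ob Q M)) (on_ob \<xi> M)" "is_iso B (\<tau>' M)"
      using T(2) T'(2) M by (simp_all add: nat_iso_def nat_trans_def)
    obtain g where g: "g \<in> Hom B (on_ob \<xi> M) (on_ob T' (on_ob Q M))" "g \<cdot>\<^bsub>B\<^esub> \<tau>' M = Ide B (on_ob T' (on_ob Q M))" "is_iso B g"
      using B.is_isoE[OF t(4,3)] by metis
    note p = \<psi>h[OF Q.on_ob[OF M]]
    have "\<psi> (on_ob Q M) = g \<cdot>\<^bsub>B\<^esub> (\<tau>' M \<cdot>\<^bsub>B\<^esub> \<psi> (on_ob Q M))"
      using B.comp_assoc[OF p t(3) g(1)] g(2) B.comp_ide_left[OF p] by simp
    also have "\<dots> = g \<cdot>\<^bsub>B\<^esub> \<tau> M" using \<psi>(2)[OF M] by simp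
    finally show ?thesis using B.iso_comp[OF t(2,1) g(3,1)] by simp
  qed
  show ?thesis
    using X
  proof (induction rule: A.filtration_induct)
    case (zero X)
    note ob = T.on_zero_ob[OF zero] T'.on_zero_ob[OF zero]
    have X: "X \<in> Ob A" using zero by (simp add: is_zero_ob_def)
    have p: "\<psi> X \<in> Hom B (on_ob T X) (on_ob T' X)" by (rule \<psi>h[OF X])
    have z: "Zer B (on_ob T' X) (on_ob T X) \<in> Hom B (on_ob T' X) (on_ob T X)"
      by (rule B.zer_hom) (use T.on_ob T'.on_ob X in auto)
    show ?case
    proof (rule B.is_isoI[OF p z])
      show "Zer B (on_ob T' X) (on_ob T X) \<cdot>\<^bsub>B\<^esub> \<psi> X = Ide B (on_ob T X)"
        using B.zero_ob_from[OF ob(1) B.comp_hom[OF p z]] B.zero_ob_from[OF ob(1) B.ide_hom[OF T.on_ob[OF X]]] by simp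
      show "\<psi> X \<cdot>\<^bsub>B\<^esub> Zer B (on_ob T' X) (on_ob T X) = Ide B (on_ob T' X)"
        using B.zero_ob_from[OF ob(2) B.comp_hom[OF z p]] B.zero_ob_from[OF ob(2) B.ide_hom[OF T'.on_ob[OF X]]] by simp
    qed
  next
    case (semisimple X)
    then obtain M where M: "M \<in> Ob (mod_prod n)" "isomorphic A (on_ob Q M) X" using AQ by (auto simp: df_tilde_def)
    obtain f where f: "f \<in> Hom A (on_ob Q M) X" "is_iso A f" using M(2) by (auto simp: isomorphic_def)
    obtain g where g: "g \<in> Hom A X (on_ob Q M)" "f \<cdot>\<^bsub>A\<^esub> g = Ide A X" "is_iso A g" using A.is_isoE[OF f(2,1)] by metis
    note Tf = T.on_arr[OF f(1)] and Tg = T.on_arr[OF g(1)] and T'f = T'.on_arr[OF f(1)] and p = \<psi>h[OF Q.on_ob[OF M(1)]] and pX = \<psi>h[OF semisimple(1)]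
    have "\<psi> X = \<psi> X \<cdot>\<^bsub>B\<^esub> (on_arr T f \<cdot>\<^bsub>B\<^esub> on_arr T g)"
      using T.on_comp[OF g(1) f(1)] g(2) T.on_ide[OF semisimple(1)] B.comp_ide_right[OF pX] by simp
    also have "\<dots> = (on_arr T' f \<cdot>\<^bsub>B\<^esub> \<psi> (on_ob Q M)) \<cdot>\<^bsub>B\<^esub> on_arr T g"
      using B.comp_assoc[OF Tg Tf pX] nat[OF f(1)] by simp
    finally show ?case
      using B.iso_comp[OF T.on_iso[OF g(3,1)] Tg B.iso_comp[OF base[OF M(1)] p T'.on_iso[OF f(2,1)] T'f] B.comp_hom[OF p T'f]] by simp
  next
    case (ext i p Y E X)
    have ob: "Y \<in> Ob A" "E \<in> Ob A" "X \<in> Ob A" using A.hom_ob ext(2,3) by blast+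
    show ?case
      by (rule B.short_five[OF T.exact[OF ext(1)] T.on_arr[OF ext(2)] T.on_arr[OF ext(3)] T'.exact[OF ext(1)] T'.on_arr[OF ext(2)] T'.on_arr[OF ext(3)]
            \<psi>h[OF ob(1)] \<psi>h[OF ob(2)] \<psi>h[OF ob(3)] nat[OF ext(2), symmetric] nat[OF ext(3)] ext(4,5)])
  qed
qed

lemma framed_comp_full_subcat: "framed_comp (full_subcat C S) = framed_comp C"
  by (simp add: framed_comp_def fun_eq_iff)

context simple_coll
begin

lemma nat_trans_Fcat:
  assumes "\<And>X. X \<in> Ob A \<Longrightarrow> on_ob T X \<in> F" "\<And>X. X \<in> Ob A \<Longrightarrow> on_ob T' X \<in> F"
  shows "nat_trans A Fcat T T' \<psi> \<longleftrightarrow> nat_trans A C T T' \<psi>"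
  using assms by (simp add: nat_trans_def)

lemma nat_iso_Fcat:
  assumes "\<And>X. X \<in> Ob A \<Longrightarrow> on_ob T X \<in> F" "\<And>X. X \<in> Ob A \<Longrightarrow> on_ob T' X \<in> F"
  shows "nat_iso A Fcat T T' \<psi> \<longleftrightarrow> nat_iso A C T T' \<psi>"
proof -
  have "is_iso Fcat (\<psi> X) \<longleftrightarrow> is_iso C (\<psi> X)" if "X \<in> Ob A" "nat_trans A C T T' \<psi>" for X
  proof -
    have "\<psi> X \<in> Hom C (on_ob T X) (on_ob T' X)" using that by (simp add: nat_trans_def)
    then show ?thesis using assms[OF that(1)] by (simp add: sub.D_iso Hom_iff)
  qed
  then show ?thesis unfolding nat_iso_def using nat_trans_Fcat[OF assms, of A \<psi>] by blast
qed

lemma exact_functor_from_Fcat: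
  assumes "exact_functor A Fcat T"
  shows "exact_functor A C T"
proof -
  interpret T: exact_functor A Fcat T by (rule assms)
  have hom: "on_arr T f \<in> Hom Fcat (on_ob T X) (on_ob T Y)" if "f \<in> Hom A X Y" for f X Y by (rule T.on_arr[OF that])
  show ?thesis
  proof (rule exact_functor.intro, rule linear_functor.intro[OF T.A.linear_category_axioms linear_category_axioms],
      rule linear_functor_axioms.intro)
    show "on_ob T X \<in> Ob C" if "X \<in> Ob A" for X using T.on_ob[OF that] F_ob by simp
    show "on_arr T f \<in> Hom C (on_ob T X) (on_ob T Y)" if "f \<in> Hom A X Y" for f X Y
      using hom[OF that] unfolding full_subcat_hom by blast
    show "exact_functor_axioms A C T"
      by (rule exact_functor_axioms.intro) (use T.exact sub.D_short_exact in blast)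
  qed (use T.on_ide T.on_comp T.on_plus T.on_scal in simp_all)
qed

lemma exact_functor_to_Fcat:
  assumes "exact_functor A C T" "\<And>X. X \<in> Ob A \<Longrightarrow> on_ob T X \<in> F"
  shows "exact_functor A Fcat T"
proof -
  interpret T: exact_functor A C T by (rule assms(1))
  have hom: "on_arr T f \<in> Hom Fcat (on_ob T X) (on_ob T Y)" if "f \<in> Hom A X Y" for f X Y
    using T.on_arr[OF that] assms(2) T.A.hom_ob[OF that] by (simp add: full_subcat_hom)
  show ?thesis
  proof (rule exact_functor.intro, rule linear_functor.intro[OF T.A.linear_category_axioms sub.linear_D],
      rule linear_functor_axioms.intro)
    show "on_ob T X \<in> Ob Fcat" if "X \<in> Ob A" for X using assms(2)[OF that] by simp
    show "exact_functor_axioms A Fcat T"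
    proof (rule exact_functor_axioms.intro)
      fix i p assume ip: "short_exact A i p"
      then have "i \<in> Arr A" "p \<in> Arr A" by (auto simp: short_exact_def is_kernel_def)
      then have "on_arr T i \<in> Arr Fcat" "on_arr T p \<in> Arr Fcat"
        using hom[of i "Dom A i" "Cod A i"] hom[of p "Dom A p" "Cod A p"] unfolding Hom_iff by blast+
      then show "short_exact Fcat (on_arr T i) (on_arr T p)" using T.exact[OF ip] by (simp add: sub.D_short_exact)
    qed
  qed (use hom T.on_ide T.on_comp T.on_plus T.on_scal in simp_all)
qed

context
  fixes \<zeta> assumes \<zeta>: "sends_simples_to n Fcat Zs \<zeta>"
begin

interpretation \<zeta>: linear_functor "mod_prod n" Fcat \<zeta>
  using \<zeta> by (simp add: sends_simples_to_def)

lemma \<zeta>_F: "M \<in> Ob (mod_prod n) \<Longrightarrow> on_ob \<zeta> M \<in> F"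
  using \<zeta>.on_ob by simp

text \<open>Semisimple objects of \<open>A\<close> are isomorphic to objects \<open>Q M\<close>, which \<open>T\<close> sends to \<open>\<zeta> M\<close> up to
  isomorphism; all other objects are reached by extensions.\<close>

lemma framed_functor_image:
  assumes "(A, Q) \<in> df_tilde n" "exact_functor A C T" "nat_iso (mod_prod n) C (functor_comp T Q) \<zeta> \<tau>" "X \<in> Ob A"
  shows "on_ob T X \<in> F"
proof -
  interpret A: finite_length_category A using assms(1) by (simp add: df_tilde_def)
  interpret T: exact_functor A C T by (rule assms(2))
  show ?thesis
    using assms(4)
  proof (induction rule: A.filtration_induct)
    case (zero X)
    then show ?case using T.on_zero_ob sub.sub_zero by blast
  next
    case (semisimple X)
    then obtain M where M: "M \<in> Ob (mod_prod n)" "isomorphic A (on_ob Q M) X" using assms(1) by (auto simp: df_tilde_def)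
    have "\<tau> M \<in> Hom C (on_ob T (on_ob Q M)) (on_ob \<zeta> M)" "is_iso C (\<tau> M)"
      using assms(3) M(1) by (simp_all add: nat_iso_def nat_trans_def)
    then have "isomorphic C (on_ob \<zeta> M) (on_ob T (on_ob Q M))" using isomorphic_sym unfolding isomorphic_def by blast
    then have "isomorphic C (on_ob \<zeta> M) (on_ob T X)" using isomorphic_trans T.on_isomorphic[OF M(2)] by blast
    then show ?case by (rule ext_closure.iso[OF \<zeta>_F[OF M(1)]])
  next
    case (ext i p Y E X)
    show ?case by (rule ext_closure_ext[OF T.exact[OF ext(1)] T.on_arr[OF ext(2)] T.on_arr[OF ext(3)] ext(4,5)])
  qed
qed

lemma framed_functors_Fcat:
  assumes "(A, Q) \<in> df_tilde n"
  shows "framed_functors n (A, Q) Fcat \<zeta> = framed_functors n (A, Q) C \<zeta>"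
proof -
  interpret Q: linear_functor "mod_prod n" A Q using assms by (simp add: df_tilde_def)
  have "exact_functor A Fcat T \<and> nat_iso (mod_prod n) Fcat (functor_comp T Q) \<zeta> \<tau> \<longleftrightarrow>
      exact_functor A C T \<and> nat_iso (mod_prod n) C (functor_comp T Q) \<zeta> \<tau>" for T \<tau>
  proof
    assume *: "exact_functor A Fcat T \<and> nat_iso (mod_prod n) Fcat (functor_comp T Q) \<zeta> \<tau>"
    then interpret T: exact_functor A Fcat T by blast
    have "on_ob (functor_comp T Q) M \<in> F" if "M \<in> Ob (mod_prod n)" for M using T.on_ob[OF Q.on_ob[OF that]] by simp
    then show "exact_functor A C T \<and> nat_iso (mod_prod n) C (functor_comp T Q) \<zeta> \<tau>"
      using * exact_functor_from_Fcat nat_iso_Fcat[of "mod_prod n" "functor_comp T Q" \<zeta> \<tau>] \<zeta>_F by blast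
  next
    assume *: "exact_functor A C T \<and> nat_iso (mod_prod n) C (functor_comp T Q) \<zeta> \<tau>"
    have im: "on_ob T X \<in> F" if "X \<in> Ob A" for X using framed_functor_image[OF assms _ _ that] * by blast
    have "on_ob (functor_comp T Q) M \<in> F" if "M \<in> Ob (mod_prod n)" for M using im[OF Q.on_ob[OF that]] by simp
    then show "exact_functor A Fcat T \<and> nat_iso (mod_prod n) Fcat (functor_comp T Q) \<zeta> \<tau>"
      using * exact_functor_to_Fcat[OF _ im] nat_iso_Fcat[of "mod_prod n" "functor_comp T Q" \<zeta> \<tau>] \<zeta>_F by blast
  qed
  then show ?thesis by (simp add: framed_functors_def)
qed

lemma df_equiv_Fcat:
  fixes A :: "('k, 'a, 'b) lin_cat"
  assumes "(A, Q) \<in> df_tilde n"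
  shows "df_equiv n (A, Q) (Fcat, \<zeta>) = ncdef_equiv n C \<zeta> (A, Q)"
proof -
  have iff: "(\<exists>\<psi>. nat_trans A Fcat T T' \<psi> \<and> (\<forall>M \<in> Ob (mod_prod n). \<tau>' M \<cdot> \<psi> (on_ob Q M) = \<tau> M)) \<longleftrightarrow>
      (\<exists>\<psi>. nat_iso A C T T' \<psi> \<and> (\<forall>M \<in> Ob (mod_prod n). \<tau>' M \<cdot> \<psi> (on_ob Q M) = \<tau> M))"
    if "(T, \<tau>) \<in> framed_functors n (A, Q) C \<zeta>" "(T', \<tau>') \<in> framed_functors n (A, Q) C \<zeta>" for T \<tau> T' \<tau>'
  proof -
    have h: "exact_functor A C T" "nat_iso (mod_prod n) C (functor_comp T Q) \<zeta> \<tau>"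
      "exact_functor A C T'" "nat_iso (mod_prod n) C (functor_comp T' Q) \<zeta> \<tau>'"
      using that by (simp_all add: framed_functors_def)
    have nt: "nat_trans A Fcat T T' \<psi> \<longleftrightarrow> nat_trans A C T T' \<psi>" for \<psi>
      by (rule nat_trans_Fcat[OF framed_functor_image[OF assms h(1,2)] framed_functor_image[OF assms h(3,4)]])
    have "nat_iso A C T T' \<psi>" if "nat_trans A C T T' \<psi>" "\<forall>M \<in> Ob (mod_prod n). \<tau>' M \<cdot> \<psi> (on_ob Q M) = \<tau> M" for \<psi>
      unfolding nat_iso_def using framed_transformation_iso[OF assms abelian_category_axioms h that(1)] that by blast
    then show ?thesis unfolding nt by (auto simp: nat_iso_def)
  qed
  have mem: "((T, \<tau>), (T', \<tau>')) \<in> df_equiv n (A, Q) (Fcat, \<zeta>) \<longleftrightarrow> ((T, \<tau>), (T', \<tau>')) \<in> ncdef_equiv n C \<zeta> (A, Q)" for T \<tau> T' \<tau>'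
    unfolding df_equiv_def ncdef_equiv_def prod.case mem_Collect_eq framed_functors_Fcat[OF assms] full_subcat_sel
    using iff[of T \<tau> T' \<tau>'] by (simp only: cong: conj_cong)
  show ?thesis
  proof (rule Set.set_eqI)
    fix x :: "(('a, 'b, 'o, 'm) functr \<times> ('k pmod \<Rightarrow> 'm)) \<times> (('a, 'b, 'o, 'm) functr \<times> ('k pmod \<Rightarrow> 'm))"
    obtain T \<tau> T' \<tau>' where "x = ((T, \<tau>), (T', \<tau>'))" by (metis surj_pair)
    then show "x \<in> df_equiv n (A, Q) (Fcat, \<zeta>) \<longleftrightarrow> x \<in> ncdef_equiv n C \<zeta> (A, Q)" by (simp only: mem)
  qed
qed

text \<open>An exact framed functor to the ambient category takes values in the extension closure, so the
  two presheaves coincide and the identity is the required isomorphism.\<close>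

lemma Fcat_ind_represents:
  assumes "(Fcat, \<zeta>) \<in> df_tilde n"
  shows "ind_represents n (Fcat, \<zeta>) (ncDef n C \<zeta> ::
    ('k, 'a, 'b, (('a, 'b, 'o, 'm) functr \<times> ('k pmod \<Rightarrow> 'm)) set) df_presheaf)"
proof -
  have eqs: "framed_functors n X Fcat \<zeta> = framed_functors n X C \<zeta>" "df_equiv n X (Fcat, \<zeta>) = ncdef_equiv n C \<zeta> X"
    if X: "X \<in> df n" for X :: "('k, 'a, 'b) df"
  proof -
    obtain A Q where AQ: "X = (A, Q)" by (cases X)
    have AQ': "(A, Q) \<in> df_tilde n" using X unfolding AQ df_def by simp
    show "framed_functors n X Fcat \<zeta> = framed_functors n X C \<zeta>" "df_equiv n X (Fcat, \<zeta>) = ncdef_equiv n C \<zeta> X"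
      unfolding AQ by (rule framed_functors_Fcat[OF AQ'], rule df_equiv_Fcat[OF AQ'])
  qed
  have "presheaf_iso n (hom_presheaf n (Fcat, \<zeta>)) (ncDef n C \<zeta> ::
    ('k, 'a, 'b, (('a, 'b, 'o, 'm) functr \<times> ('k pmod \<Rightarrow> 'm)) set) df_presheaf) (\<lambda>X h. h)"
    unfolding presheaf_iso_def
  proof (intro conjI ballI)
    fix X :: "('k, 'a, 'b) df" assume X: "X \<in> df n"
    show "bij_betw (\<lambda>h. h) (value_at (hom_presheaf n (Fcat, \<zeta>)) X) (value_at (ncDef n C \<zeta>) X)"
      using eqs[OF X] by (simp add: hom_presheaf_def ncDef_def df_hom_def bij_betw_def)
    fix Y :: "('k, 'a, 'b) df" and f h assume "Y \<in> df n"
    show "restrict_along (hom_presheaf n (Fcat, \<zeta>)) X Y f h = restrict_along (ncDef n C \<zeta>) X Y f h"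
      using eqs(2)[OF X] by (simp add: hom_presheaf_def ncDef_def df_comp_def framed_comp_full_subcat)
  qed
  then show ?thesis unfolding ind_represents_def using assms by blast
qed

end

end

theorem theoremA:
  fixes Z :: "('k::alg_closed_field, 'p, 'q) lin_cat"
    and n :: nat and Zs :: "nat \<Rightarrow> 'p" and W :: 'p
  assumes "abelian_category Z"
    and "simple_collection n Z Zs"
    and "is_direct_sum Z n Zs W"
    and "finite_dim (Ext1 Z W W)"
  shows "(\<exists>\<zeta>. sends_simples_to n (filt_cat n Z Zs) Zs \<zeta>) \<and>
    (\<forall>\<zeta>. sends_simples_to n (filt_cat n Z Zs) Zs \<zeta> \<longrightarrow>
       (filt_cat n Z Zs, \<zeta>) \<in> df_tilde n \<and>
       ind_represents n (filt_cat n Z Zs, \<zeta>)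
         (ncDef n Z \<zeta> :: ('k, 'o, 'm, (('o, 'm, 'p, 'q) functr \<times> ('k pmod \<Rightarrow> 'q)) set) df_presheaf))"
proof -
  interpret simple_coll Z n Zs
    by (rule simple_coll.intro[OF assms(1)]) (rule simple_coll_axioms.intro[OF assms(2)])
  show ?thesis
    unfolding filt_cat_eq
    using structure_functor_exists F_df_tilde[OF _ assms(3,4)] Fcat_ind_represents by blast
qed

end
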